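(* Let $\lambda$ be a deformation of a Courant pair $(A,L)$ with base a finite dimensional local algebra $(R,\mathcal{M}_R)$, let $M$ be a finite dimensional $R$-module with $\mathcal{M}_R M=0$, and let $S$ be an extension of the $\mathbb{K}$-algebra $R$ by $M$, $$0\to M\xrightarrow{i}S\xrightarrow{p}R\to0,$$ corresponding to a class $[\psi]\in H^2_{Harr}(R,M)$. Then a deformation $\lambda'$ of $(A,L)$ with base $(S,\mathcal{M}_S)$ satisfying $p_*\lambda'=\lambda$ exists if and only if $\Theta_\lambda([\psi])=0$, where $\Theta_\lambda:H^2_{Harr}(R,M)\to M\otimes H^3_{CP}(A,L)$ is the obstruction map.
   Context: $\mathbb{K}$ is a field of characteristic $0$; all maps are $\mathbb{K}$-linear unless stated otherwise. A (left) Leibniz algebra is a vector space $L$ with a bilinear bracket satisfying $[x,[y,z]]=[[x,y],z]+[y,[x,z]]$. A Courant pair $(A,L)$ consists of an associative algebra $A$, a Leibniz algebra $L$ and a Leibniz algebra homomorphism $\mu:L\to \mathrm{Der}_{\mathbb K}(A)$ (derivations with commutator bracket). The same notion is used over a commutative unital $\mathbb{K}$-algebra $R$, with all structure maps $R$-(bi)linear. A homomorphism of Courant pairs $(A,L)\to(A_1,L_1)$ is a pair $(f,g)$, with $f:A\to A_1$ an algebra homomorphism and $g:L\to L_1$ a Leibniz homomorphism, such that $f(\mu(x)(a))=\mu_1(g(x))(f(a))$. Cohomology of $(A,L)$. Put $C^{0,q}=\mathrm{Hom}(L^{\otimes q},L)$ and, for $p>0$, $C^{p,q}=\mathrm{Hom}(L^{\otimes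 q},\mathrm{Hom}(A^{\otimes p},A))\cong \mathrm{Hom}(L^{\otimes q}\otimes A^{\otimes p},A)$, $q\ge 0$. Vertical maps $C^{p,q}\to C^{p+1,q}$, all denoted $\delta_H$: for $p>0$, apply to the values in $\mathrm{Hom}(A^{\otimes p},A)$ the Hochschild coboundary $\delta_Hf(a_1,\dots,a_{p+1})=a_1f(a_2,\dots,a_{p+1})+\sum_{i=1}^{p}(-1)^if(a_1,\dots,a_ia_{i+1},\dots,a_{p+1})+(-1)^{p+1}f(a_1,\dots,a_p)a_{p+1}$; for $p=0$, $(\delta_H f)(x_1,\dots,x_q)(a)=\mu(f(x_1,\dots,x_q))(a)$. Horizontal maps $\delta_L:C^{p,q}\to C^{p,q+1}$: the Leibniz coboundary $$(\delta_L\psi)(x_1,\dots,x_{q+1})=(-1)^{q+1}\Big(\sum_{i=1}^{q}(-1)^{i-1}[x_i,\psi(x_1,\dots,\hat{x_i},\dots,x_{q+1})]+(-1)^{q+1}[\psi(x_1,\dots,x_q),x_{q+1}]+\sum_{1\le i<j\le q+1}(-1)^i\psi(x_1,\dots,\hat{x_i},\dots,x_{j-1},[x_i,x_j],x_{j+1},\dots,x_{q+1})\Big),$$ where for $p=0$ the brackets with values are those of $L$, and for $p>0$, $[x,f](a_1,\dots,a_p)=\mu(x)(f(a_1,\dots,a_p))-\sum_i f(a_1,\dots,\mu(x)(a_i),\dots,a_p)$ and $[f,x]=-[x,f]$. Put $C^n_{tot}(A,L)=\bigoplus_{p+q=n}C^{p,q}$, with $\delta_{tot}$ equal to $\delta_H+(-1)^p\delta_L$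 on $C^{p,q}$; its cohomology is $H^*_{CP}(A,L)$. In particular $C^2_{tot}=\mathrm{Hom}(A^{\otimes 2},A)\oplus\mathrm{Hom}(L\otimes A,A)\oplus\mathrm{Hom}(L^{\otimes 2},L)$ and $C^3_{tot}=\mathrm{Hom}(A^{\otimes 3},A)\oplus\mathrm{Hom}(L\otimes A^{\otimes 2},A)\oplus\mathrm{Hom}(L^{\otimes 2}\otimes A,A)\oplus\mathrm{Hom}(L^{\otimes 3},L)$. Deformations. Let $R$ be a commutative unital $\mathbb{K}$-algebra with an augmentation $\epsilon:R\to\mathbb{K}$ (an algebra homomorphism, $\epsilon(1)=1$) and $\mathcal{M}=\ker\epsilon$. A deformation $\lambda$ of $(A,L)$ with base $(R,\mathcal{M})$ is a Courant pair structure over $R$ on $(R\otimes A,R\otimes L)$, given by a triplet $(\cdot_\lambda,\mu_\lambda,[-,-]_\lambda)$ of an $R$-bilinear associative product, an $R$-Leibniz homomorphism $\mu_\lambda:R\otimes L\to\mathrm{Der}_R(R\otimes A)$, and an $R$-bilinear Leibniz bracket, such that $(\epsilon\otimes\mathrm{id}_A,\epsilon\otimes\mathrm{id}_L):(R\otimes A,R\otimes L)\to(A,L)$ is a homomorphism of Courant pairs. If $R$ is local, $\mathcal{M}=\mathcal{M}_R$ is its maximal ideal. For a unital algebra homomorphism $\phi:R\to R_1$ compatible with augmentations, the push-out $\phi_*\lambda$ is the deformation with base $R_1$ obtained from $\lambda$ by extension of scalars along $\phi$ (using $R_1\otimes A=R_1\otimes_R(R\otimes A)$, $R_1\otimes L=R_1\otimes_R(R\otimes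 L)$). Extensions. An extension of $R$ by an $R$-module $M$ is an exact sequence $0\to M\xrightarrow{i}S\xrightarrow{p}R\to0$ with $S$ a commutative unital $\mathbb{K}$-algebra, $p$ an algebra homomorphism and $s\cdot i(m)=i(p(s)m)$. Equivalence classes of such extensions correspond bijectively to the second Harrison cohomology $H^2_{Harr}(R,M)$: choosing a linear section $q$ of $p$, write $(r,m)_q=q(r)+i(m)$; the product of $S$ is $(r_1,m_1)_q(r_2,m_2)_q=(r_1r_2,r_1m_2+r_2m_1+\psi(r_1,r_2))_q$ with $\psi$ a Harrison 2-cocycle. When $\mathcal{M}_RM=0$, $S$ is local with maximal ideal $\mathcal{M}_S=p^{-1}(\mathcal{M}_R)$ and augmentation $\epsilon\circ p$. Obstruction map. Let $\lambda$ be a deformation with finite dimensional local base $(R,\mathcal{M}_R)$, $\{m_i\}_{1\le i\le n}$ a basis of $\mathcal{M}_R$, and write $(1\otimes a)\cdot_\lambda(1\otimes b)=1\otimes ab+\sum_{i=1}^n m_i\otimes\psi^1_i(a,b)$, $\mu_\lambda(1\otimes x)(1\otimes a)=1\otimes\mu(x)(a)+\sum_{i=1}^n m_i\otimes\psi^2_i(x,a)$, $[1\otimes x,1\otimes y]_\lambda=1\otimes[x,y]+\sum_{i=1}^n m_i\otimes\psi^3_i(x,y)$. Let $\{e_j\}_{1\le j\le d}$ be a basis of $M$, $n_i=(m_i,0)_q$ for $1\le i\le n$, $n_{n+j}=i(e_j)$ for $1\le j\le d$: a basis of $\mathcal{M}_S$. Choose any cochains $(\psi^1_{n+j},\psi^2_{n+j},\psi^3_{n+j})\in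 C^2_{tot}(A,L)$, $1\le j\le d$, and define $S$-bilinear maps by $(s_1\otimes a)\cdot_s(s_2\otimes b)=s_1s_2\otimes ab+\sum_{i=1}^{n+d}s_1s_2n_i\otimes\psi^1_i(a,b)$, $\mu_s(s_1\otimes x)(s_2\otimes a)=s_1s_2\otimes\mu(x)(a)+\sum_{i=1}^{n+d}s_1s_2n_i\otimes\psi^2_i(x,a)$, $[s_1\otimes x,s_2\otimes y]_s=s_1s_2\otimes[x,y]+\sum_{i=1}^{n+d}s_1s_2n_i\otimes\psi^3_i(x,y)$. Identify $a\in A$, $x\in L$ with $1\otimes a$, $1\otimes x$, and $i(M)$ with $M$. The maps $\theta_A(a,b,c)=a\cdot_s(b\cdot_sc)-(a\cdot_sb)\cdot_sc$, $\theta_1(x,a,b)=-\big(\mu_s(x)(a\cdot_sb)-\mu_s(x)(a)\cdot_sb-a\cdot_s\mu_s(x)(b)\big)$, $\theta_2(x,y,a)=\mu_s([x,y]_s)(a)-\mu_s(x)(\mu_s(y)(a))+\mu_s(y)(\mu_s(x)(a))$, $\theta_L(x,y,z)=-\big([x,[y,z]_s]_s-[[x,y]_s,z]_s-[y,[x,z]_s]_s\big)$ take values in $M\otimes A$, $M\otimes A$, $M\otimes A$, $M\otimes L$ respectively. The cochain $\Theta_M=(\theta_A,\theta_1,\theta_2,\theta_L)\in M\otimes C^3_{tot}(A,L)$ is a cocycle whose class does not depend on the choices, and $\Theta_\lambda([\psi]):=[\Theta_M]\in M\otimes H^3_{CP}(A,L)$. *)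

theory Defs
  imports "HOL-Algebra.Module" "HOL-Algebra.Ideal"
begin

text \<open>
  Algebras over a commutative ring \<open>R\<close> are records of type \<open>('r, 'a) module\<close>. As in the library
  locale \<^locale>\<open>algebra\<close>, the field \<open>mult\<close> carries the bilinear operation: the product of an
  associative algebra, or the bracket of a Leibniz algebra. Where no unit (or no product) is
  required, the field \<open>one\<close> (and \<open>mult\<close>) is never used. Commutative unital algebras are
  instances of \<^locale>\<open>algebra\<close>.
\<close>

section \<open>Linear algebra over a commutative ring\<close>

definition linear_map ::
  "('r, 'z) ring_scheme \<Rightarrow> ('r, 'v) module \<Rightarrow> ('r, 'w) module \<Rightarrow> ('v \<Rightarrow> 'w) \<Rightarrow> bool" where
  "linear_map R V W f \<longleftrightarrow>
     f \<in> carrier V \<rightarrow> carrier W \<and>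
     (\<forall>x\<in>carrier V. \<forall>y\<in>carrier V. f (x \<oplus>\<^bsub>V\<^esub> y) = f x \<oplus>\<^bsub>W\<^esub> f y) \<and>
     (\<forall>c\<in>carrier R. \<forall>x\<in>carrier V. f (c \<odot>\<^bsub>V\<^esub> x) = c \<odot>\<^bsub>W\<^esub> f x)"

definition bilinear_map ::
  "('r, 'z) ring_scheme \<Rightarrow> ('r, 'u) module \<Rightarrow> ('r, 'v) module \<Rightarrow> ('r, 'w) module
    \<Rightarrow> ('u \<Rightarrow> 'v \<Rightarrow> 'w) \<Rightarrow> bool" where
  "bilinear_map R U V W f \<longleftrightarrow>
     (\<forall>u\<in>carrier U. linear_map R V W (f u)) \<and>
     (\<forall>v\<in>carrier V. linear_map R U W (\<lambda>u. f u v))"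

definition is_basis :: "('k, 'z) ring_scheme \<Rightarrow> ('k, 'v) module \<Rightarrow> nat \<Rightarrow> (nat \<Rightarrow> 'v) \<Rightarrow> bool" where
  "is_basis K V n b \<longleftrightarrow>
     b \<in> {1..n} \<rightarrow> carrier V \<and>
     (\<forall>v\<in>carrier V. \<exists>!c. c \<in> {1..n} \<rightarrow>\<^sub>E carrier K \<and>
        v = (\<Oplus>\<^bsub>V\<^esub>i\<in>{1..n}. c i \<odot>\<^bsub>V\<^esub> b i))"

definition finite_dim :: "('k, 'z) ring_scheme \<Rightarrow> ('k, 'v) module \<Rightarrow> bool" where
  "finite_dim K V \<longleftrightarrow> (\<exists>n b. is_basis K V n b)"

definition free_module :: "('k, 'z) ring_scheme \<Rightarrow> 'x set \<Rightarrow> ('k, 'x \<Rightarrow> 'k) module" where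
  "free_module K X =
     \<lparr>carrier = {f \<in> X \<rightarrow>\<^sub>E carrier K. finite {x \<in> X. f x \<noteq> \<zero>\<^bsub>K\<^esub>}},
      mult = undefined, one = undefined,
      zero = (\<lambda>x\<in>X. \<zero>\<^bsub>K\<^esub>),
      add = (\<lambda>f g. \<lambda>x\<in>X. f x \<oplus>\<^bsub>K\<^esub> g x),
      smult = (\<lambda>c f. \<lambda>x\<in>X. c \<otimes>\<^bsub>K\<^esub> f x)\<rparr>"

definition free_gen :: "('k, 'z) ring_scheme \<Rightarrow> 'x set \<Rightarrow> 'x \<Rightarrow> 'x \<Rightarrow> 'k" where
  "free_gen K X x = (\<lambda>y\<in>X. if y = x then \<one>\<^bsub>K\<^esub> else \<zero>\<^bsub>K\<^esub>)"

definition quot_module :: "('k, 'v) module \<Rightarrow> 'v set \<Rightarrow> ('k, 'v set) module" where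
  "quot_module V N =
     \<lparr>carrier = a_rcosets\<^bsub>V\<^esub> N,
      mult = undefined, one = undefined,
      zero = N,
      add = set_add V,
      smult = (\<lambda>c X. \<Union>x\<in>X. N +>\<^bsub>V\<^esub> (c \<odot>\<^bsub>V\<^esub> x))\<rparr>"


section \<open>Tensor products\<close>

definition tensor_relators ::
  "('k, 'z) ring_scheme \<Rightarrow> ('k, 'v) module \<Rightarrow> ('k, 'w) module \<Rightarrow> ('v \<times> 'w \<Rightarrow> 'k) set" where
  "tensor_relators K V W =
     (let F = free_module K (carrier V \<times> carrier W);
          g = (\<lambda>v w. free_gen K (carrier V \<times> carrier W) (v, w))
      in {g (v \<oplus>\<^bsub>V\<^esub> v') w \<ominus>\<^bsub>F\<^esub> (g v w \<oplus>\<^bsub>F\<^esub> g v' w) | v v' w.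
            v \<in> carrier V \<and> v' \<in> carrier V \<and> w \<in> carrier W} \<union>
         {g v (w \<oplus>\<^bsub>W\<^esub> w') \<ominus>\<^bsub>F\<^esub> (g v w \<oplus>\<^bsub>F\<^esub> g v w') | v w w'.
            v \<in> carrier V \<and> w \<in> carrier W \<and> w' \<in> carrier W} \<union>
         {g (c \<odot>\<^bsub>V\<^esub> v) w \<ominus>\<^bsub>F\<^esub> c \<odot>\<^bsub>F\<^esub> g v w | c v w.
            c \<in> carrier K \<and> v \<in> carrier V \<and> w \<in> carrier W} \<union>
         {g v (c \<odot>\<^bsub>W\<^esub> w) \<ominus>\<^bsub>F\<^esub> c \<odot>\<^bsub>F\<^esub> g v w | c v w.
            c \<in> carrier K \<and> v \<in> carrier V \<and> w \<in> carrier W})"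

definition tensor_rel ::
  "('k, 'z) ring_scheme \<Rightarrow> ('k, 'v) module \<Rightarrow> ('k, 'w) module \<Rightarrow> ('v \<times> 'w \<Rightarrow> 'k) set" where
  "tensor_rel K V W =
     \<Inter>{N. submodule N K (free_module K (carrier V \<times> carrier W)) \<and> tensor_relators K V W \<subseteq> N}"

definition tensor ::
  "('k, 'z) ring_scheme \<Rightarrow> ('k, 'v) module \<Rightarrow> ('k, 'w) module
    \<Rightarrow> ('k, ('v \<times> 'w \<Rightarrow> 'k) set) module" where
  "tensor K V W = quot_module (free_module K (carrier V \<times> carrier W)) (tensor_rel K V W)"

definition tens ::
  "('k, 'z) ring_scheme \<Rightarrow> ('k, 'v) module \<Rightarrow> ('k, 'w) module \<Rightarrow> 'v \<Rightarrow> 'w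
    \<Rightarrow> ('v \<times> 'w \<Rightarrow> 'k) set" where
  "tens K V W v w =
     tensor_rel K V W +>\<^bsub>free_module K (carrier V \<times> carrier W)\<^esub>
       free_gen K (carrier V \<times> carrier W) (v, w)"

text \<open>
  For bilinear \<open>f\<close>, the map \<open>tensor_lift K V W U f\<close> is the induced linear map on \<open>V \<otimes> W\<close>: the sum
  below has the same value for all representatives of the class \<open>X\<close>.
\<close>
definition tensor_lift ::
  "('k, 'z) ring_scheme \<Rightarrow> ('k, 'v) module \<Rightarrow> ('k, 'w) module \<Rightarrow> ('k, 'u) module
    \<Rightarrow> ('v \<Rightarrow> 'w \<Rightarrow> 'u) \<Rightarrow> ('v \<times> 'w \<Rightarrow> 'k) set \<Rightarrow> 'u" where
  "tensor_lift K V W U f X =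
     the_elem ((\<lambda>x. \<Oplus>\<^bsub>U\<^esub>z\<in>{z \<in> carrier V \<times> carrier W. x z \<noteq> \<zero>\<^bsub>K\<^esub>}.
                      x z \<odot>\<^bsub>U\<^esub> f (fst z) (snd z)) ` X)"

definition tensor_map ::
  "('k, 'z) ring_scheme \<Rightarrow> ('k, 'v) module \<Rightarrow> ('k, 'w) module \<Rightarrow> ('k, 'v1) module
    \<Rightarrow> ('k, 'w1) module \<Rightarrow> ('v \<Rightarrow> 'v1) \<Rightarrow> ('w \<Rightarrow> 'w1)
    \<Rightarrow> ('v \<times> 'w \<Rightarrow> 'k) set \<Rightarrow> ('v1 \<times> 'w1 \<Rightarrow> 'k) set" where
  "tensor_map K V W V1 W1 f g =
     tensor_lift K V W (tensor K V1 W1) (\<lambda>v w. tens K V1 W1 (f v) (g w))"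

text \<open>\<open>R \<otimes> V\<close> as an \<open>R\<close>-module, for a \<open>K\<close>-algebra \<open>R\<close>; its additive group is that of
  \<open>tensor K R V\<close>.\<close>
definition extend_scalars ::
  "('k, 'z) ring_scheme \<Rightarrow> ('k, 'r) module \<Rightarrow> ('k, 'v) module
    \<Rightarrow> ('r, ('r \<times> 'v \<Rightarrow> 'k) set) module" where
  "extend_scalars K R V =
     \<lparr>carrier = carrier (tensor K R V),
      mult = undefined, one = undefined,
      zero = zero (tensor K R V),
      add = add (tensor K R V),
      smult = (\<lambda>r. tensor_map K R V R V (\<lambda>r'. r \<otimes>\<^bsub>R\<^esub> r') (\<lambda>v. v))\<rparr>"

text \<open>An \<open>R\<close>-module as a \<open>K\<close>-module, for a \<open>K\<close>-algebra \<open>R\<close>.\<close>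
definition restrict_scalars :: "('k, 'r) module \<Rightarrow> ('r, 'm) module \<Rightarrow> ('k, 'm) module" where
  "restrict_scalars R M =
     \<lparr>carrier = carrier M, mult = mult M, one = one M, zero = zero M, add = add M,
      smult = (\<lambda>k m. (k \<odot>\<^bsub>R\<^esub> \<one>\<^bsub>R\<^esub>) \<odot>\<^bsub>M\<^esub> m)\<rparr>"


section \<open>Courant pairs\<close>

definition assoc_algebra :: "('r, 'z) ring_scheme \<Rightarrow> ('r, 'a) module \<Rightarrow> bool" where
  "assoc_algebra R A \<longleftrightarrow>
     module R A \<and> bilinear_map R A A A (mult A) \<and>
     (\<forall>a\<in>carrier A. \<forall>b\<in>carrier A. \<forall>c\<in>carrier A.
        (a \<otimes>\<^bsub>A\<^esub> b) \<otimes>\<^bsub>A\<^esub> c = a \<otimes>\<^bsub>A\<^esub> (b \<otimes>\<^bsub>A\<^esub> c))"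

definition leibniz_algebra :: "('r, 'z) ring_scheme \<Rightarrow> ('r, 'l) module \<Rightarrow> bool" where
  "leibniz_algebra R L \<longleftrightarrow>
     module R L \<and> bilinear_map R L L L (mult L) \<and>
     (\<forall>x\<in>carrier L. \<forall>y\<in>carrier L. \<forall>z\<in>carrier L.
        x \<otimes>\<^bsub>L\<^esub> (y \<otimes>\<^bsub>L\<^esub> z) = (x \<otimes>\<^bsub>L\<^esub> y) \<otimes>\<^bsub>L\<^esub> z \<oplus>\<^bsub>L\<^esub> y \<otimes>\<^bsub>L\<^esub> (x \<otimes>\<^bsub>L\<^esub> z))"

definition derivation :: "('r, 'z) ring_scheme \<Rightarrow> ('r, 'a) module \<Rightarrow> ('a \<Rightarrow> 'a) \<Rightarrow> bool" where
  "derivation R A D \<longleftrightarrow>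
     linear_map R A A D \<and>
     (\<forall>a\<in>carrier A. \<forall>b\<in>carrier A. D (a \<otimes>\<^bsub>A\<^esub> b) = D a \<otimes>\<^bsub>A\<^esub> b \<oplus>\<^bsub>A\<^esub> a \<otimes>\<^bsub>A\<^esub> D b)"

definition courant_pair ::
  "('r, 'z) ring_scheme \<Rightarrow> ('r, 'a) module \<Rightarrow> ('r, 'l) module \<Rightarrow> ('l \<Rightarrow> 'a \<Rightarrow> 'a) \<Rightarrow> bool" where
  "courant_pair R A L \<mu> \<longleftrightarrow>
     assoc_algebra R A \<and> leibniz_algebra R L \<and>
     (\<forall>x\<in>carrier L. derivation R A (\<mu> x)) \<and>
     bilinear_map R L A A \<mu> \<and>
     (\<forall>x\<in>carrier L. \<forall>y\<in>carrier L. \<forall>a\<in>carrier A.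
        \<mu> (x \<otimes>\<^bsub>L\<^esub> y) a = \<mu> x (\<mu> y a) \<ominus>\<^bsub>A\<^esub> \<mu> y (\<mu> x a))"

definition courant_hom ::
  "('r, 'z) ring_scheme \<Rightarrow> ('r, 'a) module \<Rightarrow> ('r, 'l) module \<Rightarrow> ('l \<Rightarrow> 'a \<Rightarrow> 'a)
    \<Rightarrow> ('r, 'a1) module \<Rightarrow> ('r, 'l1) module \<Rightarrow> ('l1 \<Rightarrow> 'a1 \<Rightarrow> 'a1)
    \<Rightarrow> ('a \<Rightarrow> 'a1) \<Rightarrow> ('l \<Rightarrow> 'l1) \<Rightarrow> bool" where
  "courant_hom R A L \<mu> A1 L1 \<mu>1 f g \<longleftrightarrow>
     linear_map R A A1 f \<and>
     (\<forall>a\<in>carrier A. \<forall>b\<in>carrier A. f (a \<otimes>\<^bsub>A\<^esub> b) = f a \<otimes>\<^bsub>A1\<^esub> f b) \<and>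
     linear_map R L L1 g \<and>
     (\<forall>x\<in>carrier L. \<forall>y\<in>carrier L. g (x \<otimes>\<^bsub>L\<^esub> y) = g x \<otimes>\<^bsub>L1\<^esub> g y) \<and>
     (\<forall>x\<in>carrier L. \<forall>a\<in>carrier A. f (\<mu> x a) = \<mu>1 (g x) (f a))"


section \<open>Cohomology of a Courant pair\<close>

text \<open>
  A cochain of total degree \<open>n\<close> is a pair \<open>(f, g)\<close>. The map \<open>f\<close>, on lists of length \<open>n\<close> over \<open>L\<close>,
  is the component in \<open>Hom(L^n, L)\<close>. The map \<open>g\<close> is defined on pairs of lists \<open>(xs, as)\<close> over \<open>L\<close>
  and \<open>A\<close> with \<open>as\<close> nonempty and \<open>length xs + length as = n\<close>; its restriction to
  \<open>length as = p\<close>, \<open>length xs = q\<close> is the component in \<open>Hom(L^q \<otimes> A^p, A)\<close>.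
\<close>
type_synonym ('a, 'l) cochain = "('l list \<Rightarrow> 'l) \<times> ('l list \<times> 'a list \<Rightarrow> 'a)"

definition args0 :: "('k, 'l) module \<Rightarrow> nat \<Rightarrow> 'l list set" where
  "args0 L n = {xs. set xs \<subseteq> carrier L \<and> length xs = n}"

definition args1 :: "('k, 'a) module \<Rightarrow> ('k, 'l) module \<Rightarrow> nat \<Rightarrow> ('l list \<times> 'a list) set" where
  "args1 A L n =
     {(xs, as). set xs \<subseteq> carrier L \<and> set as \<subseteq> carrier A \<and> as \<noteq> [] \<and>
                length xs + length as = n}"

definition cochains ::
  "('k, 'z) ring_scheme \<Rightarrow> ('k, 'a) module \<Rightarrow> ('k, 'l) module \<Rightarrow> nat
    \<Rightarrow> ('k, ('a, 'l) cochain) module" where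
  "cochains K A L n =
     \<lparr>carrier = {(f, g).
        f \<in> args0 L n \<rightarrow>\<^sub>E carrier L \<and>
        (\<forall>xs\<in>args0 L n. \<forall>i<n. linear_map K L L (\<lambda>x. f (xs[i := x]))) \<and>
        g \<in> args1 A L n \<rightarrow>\<^sub>E carrier A \<and>
        (\<forall>(xs, as)\<in>args1 A L n.
           (\<forall>i<length xs. linear_map K L A (\<lambda>x. g (xs[i := x], as))) \<and>
           (\<forall>i<length as. linear_map K A A (\<lambda>a. g (xs, as[i := a]))))},
      mult = undefined, one = undefined,
      zero = ((\<lambda>xs\<in>args0 L n. \<zero>\<^bsub>L\<^esub>), (\<lambda>z\<in>args1 A L n. \<zero>\<^bsub>A\<^esub>)),
      add = (\<lambda>(f, g) (f', g').
        ((\<lambda>xs\<in>args0 L n. f xs \<oplus>\<^bsub>L\<^esub> f' xs), (\<lambda>z\<in>args1 A L n. g z \<oplus>\<^bsub>A\<^esub> g' z))),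
      smult = (\<lambda>c (f, g).
        ((\<lambda>xs\<in>args0 L n. c \<odot>\<^bsub>L\<^esub> f xs), (\<lambda>z\<in>args1 A L n. c \<odot>\<^bsub>A\<^esub> g z)))\<rparr>"

text \<open>\<open>signed V n v\<close> is \<open>(-1)^n v\<close>.\<close>
definition signed :: "('v, 'z) ring_scheme \<Rightarrow> nat \<Rightarrow> 'v \<Rightarrow> 'v" where
  "signed V n v = (if even n then v else \<ominus>\<^bsub>V\<^esub> v)"

definition hochschild_cobdry :: "('k, 'a) module \<Rightarrow> ('a list \<Rightarrow> 'a) \<Rightarrow> 'a list \<Rightarrow> 'a" where
  "hochschild_cobdry A f as =
     (let p = length as - 1 in
        hd as \<otimes>\<^bsub>A\<^esub> f (tl as)
        \<oplus>\<^bsub>A\<^esub> (\<Oplus>\<^bsub>A\<^esub>i\<in>{1..p}. signed A i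
               (f (take (i - 1) as @ [as ! (i - 1) \<otimes>\<^bsub>A\<^esub> as ! i] @ drop (i + 1) as)))
        \<oplus>\<^bsub>A\<^esub> signed A (p + 1) (f (butlast as) \<otimes>\<^bsub>A\<^esub> last as))"

text \<open>Removal of the entry \<open>x\<^sub>i\<close> of a list \<open>x\<^sub>1, x\<^sub>2, \<dots>\<close> (numbered from 1).\<close>
definition omit :: "nat \<Rightarrow> 'x list \<Rightarrow> 'x list" where
  "omit i xs = take (i - 1) xs @ drop i xs"

text \<open>
  The arguments \<open>l\<close> and \<open>r\<close> stand for the brackets with values of \<open>\<psi>\<close>: \<open>l x ys\<close> is
  \<open>[x, \<psi>(ys)]\<close> and \<open>r ys x\<close> is \<open>[\<psi>(ys), x]\<close>; \<open>W\<close> is the module of values of \<open>\<psi>\<close>.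
\<close>
definition leibniz_cobdry ::
  "('k, 'l) module \<Rightarrow> ('k, 'w) module \<Rightarrow> ('l \<Rightarrow> 'l list \<Rightarrow> 'w) \<Rightarrow> ('l list \<Rightarrow> 'l \<Rightarrow> 'w)
    \<Rightarrow> ('l list \<Rightarrow> 'w) \<Rightarrow> 'l list \<Rightarrow> 'w" where
  "leibniz_cobdry L W l r \<psi> xs =
     (let q = length xs - 1 in
        signed W (q + 1)
          ((\<Oplus>\<^bsub>W\<^esub>i\<in>{1..q}. signed W (i - 1) (l (xs ! (i - 1)) (omit i xs)))
           \<oplus>\<^bsub>W\<^esub> signed W (q + 1) (r (butlast xs) (last xs))
           \<oplus>\<^bsub>W\<^esub> (\<Oplus>\<^bsub>W\<^esub>ij\<in>{(i, j). 1 \<le> i \<and> i < j \<and> j \<le> q + 1}. case ij of (i, j) \<Rightarrow>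
                  signed W i
                    (\<psi> (omit i (xs[j - 1 := xs ! (i - 1) \<otimes>\<^bsub>L\<^esub> xs ! (j - 1)]))))))"

text \<open>The action \<open>[x, f]\<close> of \<open>L\<close> on \<open>Hom(A^p, A)\<close>.\<close>
definition hom_action ::
  "('k, 'a) module \<Rightarrow> ('l \<Rightarrow> 'a \<Rightarrow> 'a) \<Rightarrow> 'l \<Rightarrow> ('a list \<Rightarrow> 'a) \<Rightarrow> 'a list \<Rightarrow> 'a" where
  "hom_action A \<mu> x f as =
     \<mu> x (f as) \<ominus>\<^bsub>A\<^esub> (\<Oplus>\<^bsub>A\<^esub>i\<in>{1..length as}. f (as[i - 1 := \<mu> x (as ! (i - 1))]))"

text \<open>
  The component of \<open>\<delta>\<^sub>t\<^sub>o\<^sub>t\<close> at \<open>(xs, as)\<close>, with \<open>p = length as > 0\<close> and \<open>q = length xs\<close>, is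
  \<open>\<delta>\<^sub>H : C^(p-1,q) \<rightarrow> C^(p,q)\<close> plus \<open>(-1)^p \<delta>\<^sub>L : C^(p,q-1) \<rightarrow> C^(p,q)\<close>, the latter only if \<open>q > 0\<close>.
\<close>
definition total_cobdry ::
  "('k, 'a) module \<Rightarrow> ('k, 'l) module \<Rightarrow> ('l \<Rightarrow> 'a \<Rightarrow> 'a) \<Rightarrow> nat
    \<Rightarrow> ('a, 'l) cochain \<Rightarrow> ('a, 'l) cochain" where
  "total_cobdry A L \<mu> n = (\<lambda>(f, g).
     ((\<lambda>xs\<in>args0 L (n + 1).
         leibniz_cobdry L L (\<lambda>x ys. x \<otimes>\<^bsub>L\<^esub> f ys) (\<lambda>ys x. f ys \<otimes>\<^bsub>L\<^esub> x) f xs),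
      (\<lambda>(xs, as)\<in>args1 A L (n + 1).
         (if length as = 1 then \<mu> (f xs) (hd as)
          else hochschild_cobdry A (\<lambda>bs. g (xs, bs)) as)
         \<oplus>\<^bsub>A\<^esub>
         (if xs = [] then \<zero>\<^bsub>A\<^esub>
          else signed A (length as)
                 (leibniz_cobdry L A
                    (\<lambda>x ys. hom_action A \<mu> x (\<lambda>bs. g (ys, bs)) as)
                    (\<lambda>ys x. \<ominus>\<^bsub>A\<^esub> hom_action A \<mu> x (\<lambda>bs. g (ys, bs)) as)
                    (\<lambda>ys. g (ys, as)) xs)))))"

definition cocycles ::
  "('k, 'z) ring_scheme \<Rightarrow> ('k, 'a) module \<Rightarrow> ('k, 'l) module \<Rightarrow> ('l \<Rightarrow> 'a \<Rightarrow> 'a) \<Rightarrow> nat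
    \<Rightarrow> ('k, ('a, 'l) cochain) module" where
  "cocycles K A L \<mu> n =
     (cochains K A L n)\<lparr>carrier := {c \<in> carrier (cochains K A L n).
        total_cobdry A L \<mu> n c = \<zero>\<^bsub>cochains K A L (n + 1)\<^esub>}\<rparr>"

definition coboundaries ::
  "('k, 'z) ring_scheme \<Rightarrow> ('k, 'a) module \<Rightarrow> ('k, 'l) module \<Rightarrow> ('l \<Rightarrow> 'a \<Rightarrow> 'a) \<Rightarrow> nat
    \<Rightarrow> ('a, 'l) cochain set" where
  "coboundaries K A L \<mu> n =
     (if n = 0 then {\<zero>\<^bsub>cochains K A L 0\<^esub>}
      else total_cobdry A L \<mu> (n - 1) ` carrier (cochains K A L (n - 1)))"

definition cohomology ::
  "('k, 'z) ring_scheme \<Rightarrow> ('k, 'a) module \<Rightarrow> ('k, 'l) module \<Rightarrow> ('l \<Rightarrow> 'a \<Rightarrow> 'a) \<Rightarrow> nat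
    \<Rightarrow> ('k, ('a, 'l) cochain set) module" where
  "cohomology K A L \<mu> n = quot_module (cocycles K A L \<mu> n) (coboundaries K A L \<mu> n)"

definition cohomology_class ::
  "('k, 'z) ring_scheme \<Rightarrow> ('k, 'a) module \<Rightarrow> ('k, 'l) module \<Rightarrow> ('l \<Rightarrow> 'a \<Rightarrow> 'a) \<Rightarrow> nat
    \<Rightarrow> ('a, 'l) cochain \<Rightarrow> ('a, 'l) cochain set" where
  "cohomology_class K A L \<mu> n c =
     coboundaries K A L \<mu> n +>\<^bsub>cocycles K A L \<mu> n\<^esub> c"


section \<open>Deformations\<close>

definition augmentation :: "('k, 'z) ring_scheme \<Rightarrow> ('k, 'r) module \<Rightarrow> ('r \<Rightarrow> 'k) \<Rightarrow> bool" where
  "augmentation K R \<epsilon> \<longleftrightarrow>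
     \<epsilon> \<in> ring_hom R K \<and>
     (\<forall>c\<in>carrier K. \<forall>r\<in>carrier R. \<epsilon> (c \<odot>\<^bsub>R\<^esub> r) = c \<otimes>\<^bsub>K\<^esub> \<epsilon> r)"

definition local_algebra :: "('k, 'z) ring_scheme \<Rightarrow> ('k, 'r) module \<Rightarrow> ('r \<Rightarrow> 'k) \<Rightarrow> bool" where
  "local_algebra K R \<epsilon> \<longleftrightarrow>
     algebra K R \<and> augmentation K R \<epsilon> \<and> {I. maximalideal I R} = {a_kernel R K \<epsilon>}"

type_synonym ('k, 'r, 'a, 'l) deformation =
  "(('r \<times> 'a \<Rightarrow> 'k) set \<Rightarrow> ('r \<times> 'a \<Rightarrow> 'k) set \<Rightarrow> ('r \<times> 'a \<Rightarrow> 'k) set) \<times>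
   (('r \<times> 'l \<Rightarrow> 'k) set \<Rightarrow> ('r \<times> 'a \<Rightarrow> 'k) set \<Rightarrow> ('r \<times> 'a \<Rightarrow> 'k) set) \<times>
   (('r \<times> 'l \<Rightarrow> 'k) set \<Rightarrow> ('r \<times> 'l \<Rightarrow> 'k) set \<Rightarrow> ('r \<times> 'l \<Rightarrow> 'k) set)"

definition aug_map ::
  "('k, 'z) ring_scheme \<Rightarrow> ('k, 'r) module \<Rightarrow> ('r \<Rightarrow> 'k) \<Rightarrow> ('k, 'v) module
    \<Rightarrow> ('r \<times> 'v \<Rightarrow> 'k) set \<Rightarrow> 'v" where
  "aug_map K R \<epsilon> V = tensor_lift K R V V (\<lambda>r v. \<epsilon> r \<odot>\<^bsub>V\<^esub> v)"

text \<open>The base \<open>(R, ker \<epsilon>)\<close> is given by the augmentation \<open>\<epsilon>\<close>.\<close>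
definition deformation ::
  "('k, 'z) ring_scheme \<Rightarrow> ('k, 'r) module \<Rightarrow> ('r \<Rightarrow> 'k) \<Rightarrow> ('k, 'a) module \<Rightarrow> ('k, 'l) module
    \<Rightarrow> ('l \<Rightarrow> 'a \<Rightarrow> 'a) \<Rightarrow> ('k, 'r, 'a, 'l) deformation \<Rightarrow> bool" where
  "deformation K R \<epsilon> A L \<mu> = (\<lambda>(m, \<nu>, b).
     courant_pair R ((extend_scalars K R A)\<lparr>mult := m\<rparr>) ((extend_scalars K R L)\<lparr>mult := b\<rparr>) \<nu> \<and>
     courant_hom K ((tensor K R A)\<lparr>mult := m\<rparr>) ((tensor K R L)\<lparr>mult := b\<rparr>) \<nu> A L \<mu>
       (aug_map K R \<epsilon> A) (aug_map K R \<epsilon> L))"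

text \<open>
  \<open>\<lambda>1 = \<phi>\<^sub>* \<lambda>\<close>. Under the identification of \<open>R1 \<otimes>\<^sub>R (R \<otimes> V)\<close> with \<open>R1 \<otimes> V\<close>, the element
  \<open>r1 \<otimes>\<^sub>R u\<close> becomes \<open>r1 (\<phi> \<otimes> id)(u)\<close>, so the equations below are the defining equations
  \<open>(r1 \<otimes> u) (r2 \<otimes> v) = r1 r2 \<otimes> u v\<close> of the extension of scalars. As these elements span
  \<open>R1 \<otimes> V\<close>, they determine \<open>\<lambda>1\<close>.
\<close>
definition is_push_out ::
  "('k, 'z) ring_scheme \<Rightarrow> ('k, 'r) module \<Rightarrow> ('k, 'r1) module \<Rightarrow> ('r \<Rightarrow> 'r1)
    \<Rightarrow> ('k, 'a) module \<Rightarrow> ('k, 'l) module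
    \<Rightarrow> ('k, 'r, 'a, 'l) deformation \<Rightarrow> ('k, 'r1, 'a, 'l) deformation \<Rightarrow> bool" where
  "is_push_out K R R1 \<phi> A L = (\<lambda>(m, \<nu>, b) (m1, \<nu>1, b1).
     (let A1 = extend_scalars K R1 A; L1 = extend_scalars K R1 L;
          \<phi>A = tensor_map K R A R1 A \<phi> (\<lambda>a. a);
          \<phi>L = tensor_map K R L R1 L \<phi> (\<lambda>x. x)
      in \<forall>r\<in>carrier R1. \<forall>s\<in>carrier R1.
           (\<forall>u\<in>carrier (tensor K R A). \<forall>v\<in>carrier (tensor K R A).
              m1 (r \<odot>\<^bsub>A1\<^esub> \<phi>A u) (s \<odot>\<^bsub>A1\<^esub> \<phi>A v) = (r \<otimes>\<^bsub>R1\<^esub> s) \<odot>\<^bsub>A1\<^esub> \<phi>A (m u v)) \<and>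
           (\<forall>x\<in>carrier (tensor K R L). \<forall>u\<in>carrier (tensor K R A).
              \<nu>1 (r \<odot>\<^bsub>L1\<^esub> \<phi>L x) (s \<odot>\<^bsub>A1\<^esub> \<phi>A u) = (r \<otimes>\<^bsub>R1\<^esub> s) \<odot>\<^bsub>A1\<^esub> \<phi>A (\<nu> x u)) \<and>
           (\<forall>x\<in>carrier (tensor K R L). \<forall>y\<in>carrier (tensor K R L).
              b1 (r \<odot>\<^bsub>L1\<^esub> \<phi>L x) (s \<odot>\<^bsub>L1\<^esub> \<phi>L y) = (r \<otimes>\<^bsub>R1\<^esub> s) \<odot>\<^bsub>L1\<^esub> \<phi>L (b x y))))"


section \<open>Extensions and Harrison cohomology\<close>

definition algebra_hom ::
  "('k, 'z) ring_scheme \<Rightarrow> ('k, 's) module \<Rightarrow> ('k, 'r) module \<Rightarrow> ('s \<Rightarrow> 'r) \<Rightarrow> bool" where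
  "algebra_hom K S R p \<longleftrightarrow> p \<in> ring_hom S R \<and> linear_map K S R p"

definition algebra_extension ::
  "('k, 'z) ring_scheme \<Rightarrow> ('k, 'r) module \<Rightarrow> ('r, 'm) module \<Rightarrow> ('k, 's) module
    \<Rightarrow> ('m \<Rightarrow> 's) \<Rightarrow> ('s \<Rightarrow> 'r) \<Rightarrow> bool" where
  "algebra_extension K R M S i p \<longleftrightarrow>
     algebra K S \<and> algebra_hom K S R p \<and>
     linear_map K (restrict_scalars R M) S i \<and>
     inj_on i (carrier M) \<and> i ` carrier M = a_kernel S R p \<and> p ` carrier S = carrier R \<and>
     (\<forall>s\<in>carrier S. \<forall>m\<in>carrier M. s \<otimes>\<^bsub>S\<^esub> i m = i (p s \<odot>\<^bsub>M\<^esub> m))"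

text \<open>Harrison 2-cocycles are the symmetric Hochschild 2-cocycles; maps of two arguments are
  written on pairs.\<close>
definition harrison_cocycles ::
  "('k, 'z) ring_scheme \<Rightarrow> ('k, 'r) module \<Rightarrow> ('r, 'm) module
    \<Rightarrow> ('k, 'r \<times> 'r \<Rightarrow> 'm) module" where
  "harrison_cocycles K R M =
     \<lparr>carrier = {\<psi> \<in> carrier R \<times> carrier R \<rightarrow>\<^sub>E carrier M.
        bilinear_map K R R (restrict_scalars R M) (\<lambda>r s. \<psi> (r, s)) \<and>
        (\<forall>r\<in>carrier R. \<forall>s\<in>carrier R. \<psi> (r, s) = \<psi> (s, r)) \<and>
        (\<forall>r\<in>carrier R. \<forall>s\<in>carrier R. \<forall>t\<in>carrier R.
           r \<odot>\<^bsub>M\<^esub> \<psi> (s, t) \<ominus>\<^bsub>M\<^esub> \<psi> (r \<otimes>\<^bsub>R\<^esub> s, t) \<oplus>\<^bsub>M\<^esub> \<psi> (r, s \<otimes>\<^bsub>R\<^esub> t)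
             \<ominus>\<^bsub>M\<^esub> t \<odot>\<^bsub>M\<^esub> \<psi> (r, s) = \<zero>\<^bsub>M\<^esub>)},
      mult = undefined, one = undefined,
      zero = (\<lambda>z\<in>carrier R \<times> carrier R. \<zero>\<^bsub>M\<^esub>),
      add = (\<lambda>\<psi> \<psi>'. \<lambda>z\<in>carrier R \<times> carrier R. \<psi> z \<oplus>\<^bsub>M\<^esub> \<psi>' z),
      smult = (\<lambda>c \<psi>. \<lambda>z\<in>carrier R \<times> carrier R. c \<odot>\<^bsub>restrict_scalars R M\<^esub> \<psi> z)\<rparr>"

definition harrison_coboundaries ::
  "('k, 'z) ring_scheme \<Rightarrow> ('k, 'r) module \<Rightarrow> ('r, 'm) module \<Rightarrow> ('r \<times> 'r \<Rightarrow> 'm) set" where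
  "harrison_coboundaries K R M =
     {(\<lambda>(r, s)\<in>carrier R \<times> carrier R. r \<odot>\<^bsub>M\<^esub> g s \<ominus>\<^bsub>M\<^esub> g (r \<otimes>\<^bsub>R\<^esub> s) \<oplus>\<^bsub>M\<^esub> s \<odot>\<^bsub>M\<^esub> g r) | g.
        linear_map K R (restrict_scalars R M) g}"

definition harrison_H2 ::
  "('k, 'z) ring_scheme \<Rightarrow> ('k, 'r) module \<Rightarrow> ('r, 'm) module
    \<Rightarrow> ('k, ('r \<times> 'r \<Rightarrow> 'm) set) module" where
  "harrison_H2 K R M = quot_module (harrison_cocycles K R M) (harrison_coboundaries K R M)"

definition harrison_class ::
  "('k, 'z) ring_scheme \<Rightarrow> ('k, 'r) module \<Rightarrow> ('r, 'm) module
    \<Rightarrow> ('r \<times> 'r \<Rightarrow> 'm) \<Rightarrow> ('r \<times> 'r \<Rightarrow> 'm) set" where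
  "harrison_class K R M \<psi> = harrison_coboundaries K R M +>\<^bsub>harrison_cocycles K R M\<^esub> \<psi>"

text \<open>The extension \<open>(S, i, p)\<close> corresponds to the class of \<open>\<psi>\<close>: for some linear section \<open>q\<close>, the
  cocycle \<open>\<psi>\<close> describes the product of \<open>S\<close> in the decomposition \<open>q(r) + i(m)\<close>.\<close>
definition corresponds_to ::
  "('k, 'z) ring_scheme \<Rightarrow> ('k, 'r) module \<Rightarrow> ('r, 'm) module \<Rightarrow> ('k, 's) module
    \<Rightarrow> ('m \<Rightarrow> 's) \<Rightarrow> ('s \<Rightarrow> 'r) \<Rightarrow> ('r \<times> 'r \<Rightarrow> 'm) set \<Rightarrow> bool" where
  "corresponds_to K R M S i p c \<longleftrightarrow>
     (\<exists>q \<psi>. linear_map K R S q \<and> (\<forall>r\<in>carrier R. p (q r) = r) \<and>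
        \<psi> \<in> carrier (harrison_cocycles K R M) \<and> c = harrison_class K R M \<psi> \<and>
        (\<forall>r\<in>carrier R. \<forall>s\<in>carrier R.
           q r \<otimes>\<^bsub>S\<^esub> q s = q (r \<otimes>\<^bsub>R\<^esub> s) \<oplus>\<^bsub>S\<^esub> i (\<psi> (r, s))))"

text \<open>
  The extension on \<open>R \<times> M\<close> with cocycle \<open>\<psi>\<close>. Cocycles need not be normalized, hence the
  correction term in the unit.
\<close>
definition std_extension ::
  "('k, 'r) module \<Rightarrow> ('r, 'm) module \<Rightarrow> ('r \<times> 'r \<Rightarrow> 'm) \<Rightarrow> ('k, 'r \<times> 'm) module" where
  "std_extension R M \<psi> =
     \<lparr>carrier = carrier R \<times> carrier M,
      mult = (\<lambda>(r, m) (s, n).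
        (r \<otimes>\<^bsub>R\<^esub> s, r \<odot>\<^bsub>M\<^esub> n \<oplus>\<^bsub>M\<^esub> s \<odot>\<^bsub>M\<^esub> m \<oplus>\<^bsub>M\<^esub> \<psi> (r, s))),
      one = (\<one>\<^bsub>R\<^esub>, \<ominus>\<^bsub>M\<^esub> \<psi> (\<one>\<^bsub>R\<^esub>, \<one>\<^bsub>R\<^esub>)),
      zero = (\<zero>\<^bsub>R\<^esub>, \<zero>\<^bsub>M\<^esub>),
      add = (\<lambda>(r, m) (s, n). (r \<oplus>\<^bsub>R\<^esub> s, m \<oplus>\<^bsub>M\<^esub> n)),
      smult = (\<lambda>c (r, m). (c \<odot>\<^bsub>R\<^esub> r, c \<odot>\<^bsub>restrict_scalars R M\<^esub> m))\<rparr>"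


section \<open>The obstruction map\<close>

definition comp_A2 :: "('a, 'l) cochain \<Rightarrow> 'a \<Rightarrow> 'a \<Rightarrow> 'a" where
  "comp_A2 c a b = snd c ([], [a, b])"

definition comp_LA :: "('a, 'l) cochain \<Rightarrow> 'l \<Rightarrow> 'a \<Rightarrow> 'a" where
  "comp_LA c x a = snd c ([x], [a])"

definition comp_L2 :: "('a, 'l) cochain \<Rightarrow> 'l \<Rightarrow> 'l \<Rightarrow> 'l" where
  "comp_L2 c x y = fst c [x, y]"

text \<open>
  The unique map on \<open>(S \<otimes> U) \<times> (S \<otimes> V)\<close> that is given on \<open>(s\<^sub>1 \<otimes> u, s\<^sub>2 \<otimes> v)\<close> by
  \<open>s\<^sub>1s\<^sub>2 \<otimes> \<beta>\<^sub>0(u, v) + \<Sum> s\<^sub>1s\<^sub>2n\<^sub>j \<otimes> \<beta>\<^sub>j(u, v)\<close>, where \<open>j = 1, \<dots>, N\<close>.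
\<close>
definition perturbed_map ::
  "('k, 'z) ring_scheme \<Rightarrow> ('k, 's) module \<Rightarrow> ('k, 'u) module \<Rightarrow> ('k, 'v) module
    \<Rightarrow> ('k, 'w) module \<Rightarrow> nat \<Rightarrow> (nat \<Rightarrow> 's) \<Rightarrow> ('u \<Rightarrow> 'v \<Rightarrow> 'w) \<Rightarrow> (nat \<Rightarrow> 'u \<Rightarrow> 'v \<Rightarrow> 'w)
    \<Rightarrow> ('s \<times> 'u \<Rightarrow> 'k) set \<Rightarrow> ('s \<times> 'v \<Rightarrow> 'k) set \<Rightarrow> ('s \<times> 'w \<Rightarrow> 'k) set" where
  "perturbed_map K S U V W N n \<beta>0 \<beta> X Y =
     tensor_lift K S U (tensor K S W)
       (\<lambda>s1 u. tensor_lift K S V (tensor K S W)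
          (\<lambda>s2 v. tens K S W (s1 \<otimes>\<^bsub>S\<^esub> s2) (\<beta>0 u v) \<oplus>\<^bsub>tensor K S W\<^esub>
             (\<Oplus>\<^bsub>tensor K S W\<^esub>j\<in>{1..N}. tens K S W (s1 \<otimes>\<^bsub>S\<^esub> s2 \<otimes>\<^bsub>S\<^esub> n j) (\<beta> j u v))) Y) X"

text \<open>\<open>\<Psi> 1, \<dots>, \<Psi> n\<close> are the components \<open>(\<psi>\<^sub>i\<^sup>1, \<psi>\<^sub>i\<^sup>2, \<psi>\<^sub>i\<^sup>3)\<close> of a deformation with respect to
  the basis \<open>m\<^sub>1, \<dots>, m\<^sub>n\<close> of the maximal ideal.\<close>
definition deformation_components ::
  "('k, 'z) ring_scheme \<Rightarrow> ('k, 'r) module \<Rightarrow> ('k, 'a) module \<Rightarrow> ('k, 'l) module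
    \<Rightarrow> ('l \<Rightarrow> 'a \<Rightarrow> 'a) \<Rightarrow> ('k, 'r, 'a, 'l) deformation \<Rightarrow> nat \<Rightarrow> (nat \<Rightarrow> 'r)
    \<Rightarrow> (nat \<Rightarrow> ('a, 'l) cochain) \<Rightarrow> bool" where
  "deformation_components K R A L \<mu> = (\<lambda>(m, \<nu>, b) n mb \<Psi>.
     (let RA = tensor K R A; RL = tensor K R L;
          ta = tens K R A; tl = tens K R L; e = \<one>\<^bsub>R\<^esub>
      in (\<forall>a\<in>carrier A. \<forall>a'\<in>carrier A.
            m (ta e a) (ta e a') = ta e (a \<otimes>\<^bsub>A\<^esub> a') \<oplus>\<^bsub>RA\<^esub>
              (\<Oplus>\<^bsub>RA\<^esub>i\<in>{1..n}. ta (mb i) (comp_A2 (\<Psi> i) a a'))) \<and>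
         (\<forall>x\<in>carrier L. \<forall>a\<in>carrier A.
            \<nu> (tl e x) (ta e a) = ta e (\<mu> x a) \<oplus>\<^bsub>RA\<^esub>
              (\<Oplus>\<^bsub>RA\<^esub>i\<in>{1..n}. ta (mb i) (comp_LA (\<Psi> i) x a))) \<and>
         (\<forall>x\<in>carrier L. \<forall>y\<in>carrier L.
            b (tl e x) (tl e y) = tl e (x \<otimes>\<^bsub>L\<^esub> y) \<oplus>\<^bsub>RL\<^esub>
              (\<Oplus>\<^bsub>RL\<^esub>i\<in>{1..n}. tl (mb i) (comp_L2 (\<Psi> i) x y)))))"

text \<open>
  The element \<open>\<Theta>\<close> of \<open>M \<otimes> Z\<^sup>3\<close>, with \<open>Z\<^sup>3\<close> the cocycles in \<open>C\<^sup>3\<close>, represents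
  \<open>(\<theta>\<^sub>A, \<theta>\<^sub>1, \<theta>\<^sub>2, \<theta>\<^sub>L)\<close>: evaluating the cochain factor of \<open>\<Theta>\<close> at arguments and applying \<open>i\<close> to
  the factor in \<open>M\<close> gives the values of the \<open>\<theta>\<close>s, which lie in \<open>S \<otimes> A\<close> and \<open>S \<otimes> L\<close>.
\<close>
definition represents_obstruction ::
  "('k, 'z) ring_scheme \<Rightarrow> ('k, 'a) module \<Rightarrow> ('k, 'l) module \<Rightarrow> ('l \<Rightarrow> 'a \<Rightarrow> 'a)
    \<Rightarrow> ('k, 'm) module \<Rightarrow> ('k, 's) module \<Rightarrow> ('m \<Rightarrow> 's) \<Rightarrow> ('k, 's, 'a, 'l) deformation
    \<Rightarrow> ('m \<times> ('a, 'l) cochain \<Rightarrow> 'k) set \<Rightarrow> bool" where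
  "represents_obstruction K A L \<mu> M S i = (\<lambda>(m, \<nu>, b) \<Theta>.
     (let Z = cocycles K A L \<mu> 3;
          SA = tensor K S A; SL = tensor K S L;
          ta = tens K S A \<one>\<^bsub>S\<^esub>; tl = tens K S L \<one>\<^bsub>S\<^esub>;
          evA = (\<lambda>xs as. tensor_map K M Z S A i (\<lambda>c. snd c (xs, as)) \<Theta>);
          evL = (\<lambda>xs. tensor_map K M Z S L i (\<lambda>c. fst c xs) \<Theta>)
      in \<Theta> \<in> carrier (tensor K M Z) \<and>
         (\<forall>a1\<in>carrier A. \<forall>a2\<in>carrier A. \<forall>a3\<in>carrier A.
            evA [] [a1, a2, a3] =
              m (ta a1) (m (ta a2) (ta a3)) \<ominus>\<^bsub>SA\<^esub> m (m (ta a1) (ta a2)) (ta a3)) \<and>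
         (\<forall>x\<in>carrier L. \<forall>a1\<in>carrier A. \<forall>a2\<in>carrier A.
            evA [x] [a1, a2] =
              \<ominus>\<^bsub>SA\<^esub> (\<nu> (tl x) (m (ta a1) (ta a2))
                  \<ominus>\<^bsub>SA\<^esub> m (\<nu> (tl x) (ta a1)) (ta a2)
                  \<ominus>\<^bsub>SA\<^esub> m (ta a1) (\<nu> (tl x) (ta a2)))) \<and>
         (\<forall>x\<in>carrier L. \<forall>y\<in>carrier L. \<forall>a\<in>carrier A.
            evA [x, y] [a] =
              \<nu> (b (tl x) (tl y)) (ta a)
                \<ominus>\<^bsub>SA\<^esub> \<nu> (tl x) (\<nu> (tl y) (ta a))
                \<oplus>\<^bsub>SA\<^esub> \<nu> (tl y) (\<nu> (tl x) (ta a))) \<and>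
         (\<forall>x\<in>carrier L. \<forall>y\<in>carrier L. \<forall>z\<in>carrier L.
            evL [x, y, z] =
              \<ominus>\<^bsub>SL\<^esub> (b (tl x) (b (tl y) (tl z))
                  \<ominus>\<^bsub>SL\<^esub> b (b (tl x) (tl y)) (tl z)
                  \<ominus>\<^bsub>SL\<^esub> b (tl y) (b (tl x) (tl z))))))"

text \<open>
  \<open>t\<close> is the class \<open>[\<Theta>\<^sub>M]\<close> obtained from an extension \<open>(S, i, p)\<close> with linear section \<open>q\<close>, for some
  choice of bases and of the cochains \<open>\<Psi> j\<close> with \<open>n < j \<le> n + d\<close>.
\<close>
definition obstruction_class ::
  "('k, 'z) ring_scheme \<Rightarrow> ('k, 'a) module \<Rightarrow> ('k, 'l) module \<Rightarrow> ('l \<Rightarrow> 'a \<Rightarrow> 'a)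
    \<Rightarrow> ('k, 'r) module \<Rightarrow> ('r \<Rightarrow> 'k) \<Rightarrow> ('k, 'r, 'a, 'l) deformation \<Rightarrow> ('r, 'm) module
    \<Rightarrow> ('k, 's) module \<Rightarrow> ('m \<Rightarrow> 's) \<Rightarrow> ('r \<Rightarrow> 's)
    \<Rightarrow> ('m \<times> ('a, 'l) cochain set \<Rightarrow> 'k) set \<Rightarrow> bool" where
  "obstruction_class K A L \<mu> R \<epsilon> \<Lambda> M S i q t \<longleftrightarrow>
     (\<exists>n mb d eb \<Psi> \<Theta>.
        is_basis K (R\<lparr>carrier := a_kernel R K \<epsilon>\<rparr>) n mb \<and>
        is_basis K (restrict_scalars R M) d eb \<and>
        (\<forall>j\<in>{1..n + d}. \<Psi> j \<in> carrier (cochains K A L 2)) \<and>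
        deformation_components K R A L \<mu> \<Lambda> n mb \<Psi> \<and>
        (let nb = (\<lambda>j. if j \<le> n then q (mb j) else i (eb (j - n)));
             ms = perturbed_map K S A A A (n + d) nb (mult A) (\<lambda>j. comp_A2 (\<Psi> j));
             \<nu>s = perturbed_map K S L A A (n + d) nb \<mu> (\<lambda>j. comp_LA (\<Psi> j));
             bs = perturbed_map K S L L L (n + d) nb (mult L) (\<lambda>j. comp_L2 (\<Psi> j))
         in represents_obstruction K A L \<mu> (restrict_scalars R M) S i (ms, \<nu>s, bs) \<Theta>) \<and>
        t = tensor_map K (restrict_scalars R M) (cocycles K A L \<mu> 3)
              (restrict_scalars R M) (cohomology K A L \<mu> 3)
              (\<lambda>m. m) (cohomology_class K A L \<mu> 3) \<Theta>)"

text \<open>\<open>\<Theta>\<^sub>\<lambda>\<close> as a map on \<open>H\<^sup>2\<close> of Harrison, computed from the extensions \<open>std_extension R M \<psi>\<close>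
  with section \<open>r \<mapsto> (r, 0)\<close>, where \<open>\<psi>\<close> is a representative of the class \<open>c\<close>.\<close>
definition obstruction_map ::
  "('k, 'z) ring_scheme \<Rightarrow> ('k, 'a) module \<Rightarrow> ('k, 'l) module \<Rightarrow> ('l \<Rightarrow> 'a \<Rightarrow> 'a)
    \<Rightarrow> ('k, 'r) module \<Rightarrow> ('r \<Rightarrow> 'k) \<Rightarrow> ('k, 'r, 'a, 'l) deformation \<Rightarrow> ('r, 'm) module
    \<Rightarrow> ('r \<times> 'r \<Rightarrow> 'm) set \<Rightarrow> ('m \<times> ('a, 'l) cochain set \<Rightarrow> 'k) set" where
  "obstruction_map K A L \<mu> R \<epsilon> \<Lambda> M c =
     (THE t. \<exists>\<psi>\<in>c. obstruction_class K A L \<mu> R \<epsilon> \<Lambda> M (std_extension R M \<psi>)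
                     (\<lambda>m. (\<zero>\<^bsub>R\<^esub>, m)) (\<lambda>r. (r, \<zero>\<^bsub>M\<^esub>)) t)"

end

theory Submission
  imports Defs
begin

text \<open>
  Choose \<open>S\<close>-bilinear operations on \<open>S \<otimes> A\<close> and \<open>S \<otimes> L\<close> that reduce over \<open>R\<close> to those of \<open>\<lambda>\<close>. Such a
  \<^emph>\<open>lift\<close> always exists; it is a deformation with push-out \<open>\<lambda>\<close> exactly if it satisfies the axioms of a
  Courant pair, and the obstruction measures by how much these fail. The \<^emph>\<open>defects\<close> of a lift, the
  differences of the two sides of the axioms, vanish over \<open>R\<close>, so they lie in the kernel of
  \<open>S \<otimes> A \<rightarrow> R \<otimes> A\<close>, which is a copy of \<open>M \<otimes> A\<close> (\<open>kernel_proj\<close>), or in its analogue for \<open>L\<close>. As the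
  maximal ideal of \<open>S\<close> annihilates this kernel, the defects only depend on the reductions of their
  arguments (\<open>kernel_trilinear_reduce\<close>): they form an element of \<open>M \<otimes> C\<^sup>3\<close>.

  This element is a cocycle because the defects of arbitrary bilinear operations satisfy identities
  of Bianchi type, whose outer operations act on the kernel as those of \<open>(A, L)\<close> do
  (\<open>theta_cocycle\<close>). Two lifts differ by an element \<open>c\<close> of \<open>M \<otimes> C\<^sup>2\<close>, their defects differ by the
  coboundary of \<open>c\<close> (\<open>theta_difference\<close>), and every \<open>c\<close> occurs (\<open>lift_change\<close>). Hence the class in
  \<open>M \<otimes> H\<^sup>3\<close> does not depend on the lift, and it vanishes iff some lift has no defects
  (\<open>obstruction_class_zero_iff_liftable\<close>).

  Since \<open>M\<close> is finite dimensional, all this can be read off in coordinates: a functional \<open>f\<close> on \<open>M\<close>,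
  extended to \<open>S\<close> by a linear section, contracts the defects to cochains with values in \<open>A\<close> and \<open>L\<close>.
  The arguments about cocycles and coboundaries only use a few properties of such contractions, which
  are collected in the locale \<open>first_order_lift\<close>. Operations over the dual numbers have these
  properties as well, and their defects are the coboundaries of 2-cochains. So the same argument
  yields \<open>\<delta>\<delta> = 0\<close> on \<open>C\<^sup>2\<close> (\<open>d2_cocycle\<close>), which makes \<open>H\<^sup>3\<close> a module.

  The obstruction map is computed from the extensions \<open>R \<times> M\<close> given by the cocycles in a Harrison
  class. Every cocycle in the class of \<open>S\<close> comes from a linear section of \<open>S\<close> (\<open>section_of_cocycle\<close>),
  which gives an isomorphism of \<open>R \<times> M\<close> with \<open>S\<close>, and obstruction classes are transported along
  homomorphisms of extensions (\<open>obstruction_class_transport\<close>). Thus all representatives lead to the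
  one class that is attached to the lifts over \<open>S\<close>.
\<close>

section \<open>Linear algebra\<close>

context abelian_group
begin

lemma add_minus_out: "\<lbrakk>x \<in> carrier G; y \<in> carrier G; z \<in> carrier G\<rbrakk> \<Longrightarrow> x \<oplus> (y \<ominus> z) = (x \<oplus> y) \<ominus> z"
  by (simp add: a_minus_def a_ac)
lemma minus_add_out: "\<lbrakk>x \<in> carrier G; y \<in> carrier G; z \<in> carrier G\<rbrakk> \<Longrightarrow> (x \<ominus> y) \<oplus> z = (x \<oplus> z) \<ominus> y"
  by (simp add: a_minus_def a_ac)
lemma minus_minus_out1: "\<lbrakk>x \<in> carrier G; y \<in> carrier G; z \<in> carrier G\<rbrakk> \<Longrightarrow> x \<ominus> (y \<ominus> z) = (x \<oplus> z) \<ominus> y"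
  by (simp add: a_minus_def a_ac minus_add)
lemma minus_minus_out2: "\<lbrakk>x \<in> carrier G; y \<in> carrier G; z \<in> carrier G\<rbrakk> \<Longrightarrow> (x \<ominus> y) \<ominus> z = x \<ominus> (y \<oplus> z)"
  by (simp add: a_minus_def a_ac minus_add)
lemma inv_minus_out: "x \<in> carrier G \<Longrightarrow> \<ominus> x = \<zero> \<ominus> x"
  by (simp add: a_minus_def)
lemma minus_eq_iff: "\<lbrakk>x \<in> carrier G; y \<in> carrier G; z \<in> carrier G\<rbrakk> \<Longrightarrow> x \<ominus> y = z \<longleftrightarrow> x = z \<oplus> y"
  by (metis a_minus_def add.inv_closed add.m_closed add.inv_solve_right')
lemma eq_minus_iff: "\<lbrakk>x \<in> carrier G; y \<in> carrier G; z \<in> carrier G\<rbrakk> \<Longrightarrow> z = x \<ominus> y \<longleftrightarrow> z \<oplus> y = x"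
  using minus_eq_iff by metis

text \<open>
  These rules decide identities between signed sums: they turn each side into a difference of two
  sums without signs and move all subtracted terms to the other side, where associativity and
  commutativity suffice.
\<close>
lemmas signed_sum_simps = add_minus_out minus_add_out minus_minus_out1 minus_minus_out2
  inv_minus_out minus_eq_iff eq_minus_iff a_ac

end

lemma module_abelian_group: "module K V \<Longrightarrow> abelian_group V"
  by (rule module.axioms(2))

lemma linear_mapI:
  assumes "\<And>x. x \<in> carrier V \<Longrightarrow> f x \<in> carrier W"
    and "\<And>x y. \<lbrakk>x \<in> carrier V; y \<in> carrier V\<rbrakk> \<Longrightarrow> f (x \<oplus>\<^bsub>V\<^esub> y) = f x \<oplus>\<^bsub>W\<^esub> f y"
    and "\<And>c x. \<lbrakk>c \<in> carrier K; x \<in> carrier V\<rbrakk> \<Longrightarrow> f (c \<odot>\<^bsub>V\<^esub> x) = c \<odot>\<^bsub>W\<^esub> f x"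
  shows "linear_map K V W f"
  using assms by (auto simp: linear_map_def)

lemma linear_map_closed: "\<lbrakk>linear_map K V W f; x \<in> carrier V\<rbrakk> \<Longrightarrow> f x \<in> carrier W"
  by (auto simp: linear_map_def)

lemma linear_map_add:
  "\<lbrakk>linear_map K V W f; x \<in> carrier V; y \<in> carrier V\<rbrakk> \<Longrightarrow> f (x \<oplus>\<^bsub>V\<^esub> y) = f x \<oplus>\<^bsub>W\<^esub> f y"
  by (auto simp: linear_map_def)

lemma linear_map_smult:
  "\<lbrakk>linear_map K V W f; c \<in> carrier K; x \<in> carrier V\<rbrakk> \<Longrightarrow> f (c \<odot>\<^bsub>V\<^esub> x) = c \<odot>\<^bsub>W\<^esub> f x"
  by (auto simp: linear_map_def)

lemma linear_map_zero:
  assumes "linear_map K V W f" "module K V" "module K W"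
  shows "f \<zero>\<^bsub>V\<^esub> = \<zero>\<^bsub>W\<^esub>"
proof -
  interpret V: abelian_group V using assms by (simp add: module_abelian_group)
  interpret W: abelian_group W using assms by (simp add: module_abelian_group)
  have "f \<zero>\<^bsub>V\<^esub> \<oplus>\<^bsub>W\<^esub> f \<zero>\<^bsub>V\<^esub> = f \<zero>\<^bsub>V\<^esub>"
    using linear_map_add[OF assms(1), of "\<zero>\<^bsub>V\<^esub>" "\<zero>\<^bsub>V\<^esub>"] by simp
  with linear_map_closed[OF assms(1) V.zero_closed] show ?thesis
    by (simp add: W.add.r_cancel_one')
qed

lemma linear_map_minus:
  assumes "linear_map K V W f" "module K V" "module K W" "x \<in> carrier V"
  shows "f (\<ominus>\<^bsub>V\<^esub> x) = \<ominus>\<^bsub>W\<^esub> f x"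
proof -
  interpret V: abelian_group V using assms by (simp add: module_abelian_group)
  interpret W: abelian_group W using assms by (simp add: module_abelian_group)
  have "f (\<ominus>\<^bsub>V\<^esub> x) \<oplus>\<^bsub>W\<^esub> f x = \<zero>\<^bsub>W\<^esub>"
    using linear_map_add[OF assms(1), of "\<ominus>\<^bsub>V\<^esub> x" x] linear_map_zero[OF assms(1-3)] assms(4)
    by (simp add: V.l_neg)
  then show ?thesis
    using assms(4) linear_map_closed[OF assms(1)] by (simp add: W.minus_equality)
qed

lemma linear_map_diff:
  assumes "linear_map K V W f" "module K V" "module K W" "x \<in> carrier V" "y \<in> carrier V"
  shows "f (x \<ominus>\<^bsub>V\<^esub> y) = f x \<ominus>\<^bsub>W\<^esub> f y"
proof -
  interpret V: abelian_group V using assms by (simp add: module_abelian_group)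
  show ?thesis
    using assms by (simp add: a_minus_def linear_map_add[OF assms(1)] linear_map_minus[OF assms(1-3)])
qed

lemma linear_map_finsum:
  assumes f: "linear_map K V W f" and V: "module K V" and W: "module K W"
    and g: "g \<in> I \<rightarrow> carrier V"
  shows "f (\<Oplus>\<^bsub>V\<^esub>i\<in>I. g i) = (\<Oplus>\<^bsub>W\<^esub>i\<in>I. f (g i))"
proof -
  interpret V: abelian_group V using assms by (simp add: module_abelian_group)
  interpret W: abelian_group W using assms by (simp add: module_abelian_group)
  show ?thesis
  proof (cases "finite I")
    case True
    then show ?thesis using g
    proof induct
      case empty
      then show ?case using linear_map_zero[OF f V W] by simp
    next
      case (insert a I)
      then show ?case using linear_map_closed[OF f] linear_map_add[OF f]
        by (simp add: Pi_def V.finsum_insert W.finsum_insert)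
    qed
  next
    case False
    then show ?thesis using linear_map_zero[OF f V W] by (simp add: V.finsum_infinite W.finsum_infinite)
  qed
qed

lemma linear_map_comp:
  "\<lbrakk>linear_map K U V f; linear_map K V W g\<rbrakk> \<Longrightarrow> linear_map K U W (\<lambda>x. g (f x))"
  by (auto simp: linear_map_def Pi_def)

lemma linear_map_ident: "linear_map K V V (\<lambda>x. x)"
  by (auto simp: linear_map_def)

lemma linear_map_cong:
  "\<lbrakk>linear_map K V W f; module K V; \<And>x. x \<in> carrier V \<Longrightarrow> f x = g x\<rbrakk> \<Longrightarrow> linear_map K V W g"
  unfolding linear_map_def Pi_def
  by (auto simp: module.smult_closed abelian_monoid.a_closed abelian_group.axioms(1) module_abelian_group)

lemma linear_map_plus:
  assumes "linear_map K V W f" "linear_map K V W g" "module K V" "module K W"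
  shows "linear_map K V W (\<lambda>x. f x \<oplus>\<^bsub>W\<^esub> g x)"
proof -
  interpret W: module K W by fact
  show ?thesis
    using assms(1,2) by (auto simp: linear_map_def Pi_def W.smult_r_distr W.a_ac)
qed

lemma linear_map_uminus:
  assumes "linear_map K V W f" "module K V" "module K W"
  shows "linear_map K V W (\<lambda>x. \<ominus>\<^bsub>W\<^esub> f x)"
proof -
  interpret W: module K W by fact
  show ?thesis
    using assms(1) by (auto simp: linear_map_def Pi_def W.smult_r_minus W.minus_add)
qed

lemma linear_map_sub:
  assumes "linear_map K V W f" "linear_map K V W g" "module K V" "module K W"
  shows "linear_map K V W (\<lambda>x. f x \<ominus>\<^bsub>W\<^esub> g x)"
  unfolding a_minus_def using assms by (intro linear_map_plus linear_map_uminus)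

lemma linear_map_scale:
  assumes "linear_map K V W f" "module K V" "module K W" "c \<in> carrier K"
  shows "linear_map K V W (\<lambda>x. c \<odot>\<^bsub>W\<^esub> f x)"
proof -
  interpret W: module K W by fact
  have "c \<odot>\<^bsub>W\<^esub> (d \<odot>\<^bsub>W\<^esub> w) = d \<odot>\<^bsub>W\<^esub> (c \<odot>\<^bsub>W\<^esub> w)" if "d \<in> carrier K" "w \<in> carrier W" for d w
    using that assms(4) by (metis W.R.m_comm W.smult_assoc1)
  then show ?thesis
    using assms(1,4) by (auto simp: linear_map_def Pi_def W.smult_r_distr)
qed

lemma linear_map_fsum:
  assumes V: "module K V" and W: "module K W" and f: "\<And>i. i \<in> I \<Longrightarrow> linear_map K V W (f i)"
  shows "linear_map K V W (\<lambda>x. \<Oplus>\<^bsub>W\<^esub>i\<in>I. f i x)"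
proof -
  interpret W: module K W by fact
  have cl: "f i x \<in> carrier W" if "i \<in> I" "x \<in> carrier V" for i x
    using linear_map_closed[OF f] that by blast
  show ?thesis
  proof (cases "finite I")
    case True
    show ?thesis
    proof (rule linear_mapI)
      fix x y assume xy: "x \<in> carrier V" "y \<in> carrier V"
      have "(\<Oplus>\<^bsub>W\<^esub>i\<in>I. f i (x \<oplus>\<^bsub>V\<^esub> y)) = (\<Oplus>\<^bsub>W\<^esub>i\<in>I. f i x \<oplus>\<^bsub>W\<^esub> f i y)"
        using xy cl linear_map_add[OF f] by (intro W.finsum_cong') auto
      then show "(\<Oplus>\<^bsub>W\<^esub>i\<in>I. f i (x \<oplus>\<^bsub>V\<^esub> y)) = (\<Oplus>\<^bsub>W\<^esub>i\<in>I. f i x) \<oplus>\<^bsub>W\<^esub> (\<Oplus>\<^bsub>W\<^esub>i\<in>I. f i y)"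
        using xy cl by (simp add: W.finsum_addf Pi_def)
    next
      fix c x assume cx: "c \<in> carrier K" "x \<in> carrier V"
      have "(\<Oplus>\<^bsub>W\<^esub>i\<in>I. f i (c \<odot>\<^bsub>V\<^esub> x)) = (\<Oplus>\<^bsub>W\<^esub>i\<in>I. c \<odot>\<^bsub>W\<^esub> f i x)"
        using cx cl linear_map_smult[OF f] by (intro W.finsum_cong') auto
      then show "(\<Oplus>\<^bsub>W\<^esub>i\<in>I. f i (c \<odot>\<^bsub>V\<^esub> x)) = c \<odot>\<^bsub>W\<^esub> (\<Oplus>\<^bsub>W\<^esub>i\<in>I. f i x)"
        using cx cl True by (simp add: W.finsum_smult_ldistr Pi_def)
    qed (use cl in \<open>auto intro!: W.finsum_closed\<close>)
  next
    case False
    then show ?thesis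
      by (auto simp: W.finsum_infinite intro!: linear_mapI)
  qed
qed

lemma bilinear_mapD:
  assumes "bilinear_map K U V W f"
  shows "u \<in> carrier U \<Longrightarrow> linear_map K V W (f u)"
    and "v \<in> carrier V \<Longrightarrow> linear_map K U W (\<lambda>u. f u v)"
  using assms by (auto simp: bilinear_map_def)

lemma bilinear_mapI:
  assumes "\<And>u. u \<in> carrier U \<Longrightarrow> linear_map K V W (f u)"
    and "\<And>v. v \<in> carrier V \<Longrightarrow> linear_map K U W (\<lambda>u. f u v)"
  shows "bilinear_map K U V W f"
  using assms by (auto simp: bilinear_map_def)

lemma bilinear_closed:
  "\<lbrakk>bilinear_map K U V W f; u \<in> carrier U; v \<in> carrier V\<rbrakk> \<Longrightarrow> f u v \<in> carrier W"
  by (auto simp: bilinear_map_def linear_map_def)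

lemma bilinear_add:
  assumes "bilinear_map K U V W f"
  shows "\<lbrakk>u \<in> carrier U; u' \<in> carrier U; v \<in> carrier V\<rbrakk> \<Longrightarrow> f (u \<oplus>\<^bsub>U\<^esub> u') v = f u v \<oplus>\<^bsub>W\<^esub> f u' v"
    and "\<lbrakk>u \<in> carrier U; v \<in> carrier V; v' \<in> carrier V\<rbrakk> \<Longrightarrow> f u (v \<oplus>\<^bsub>V\<^esub> v') = f u v \<oplus>\<^bsub>W\<^esub> f u v'"
  using assms by (auto simp: bilinear_map_def linear_map_def)

lemma bilinear_smult:
  assumes "bilinear_map K U V W f"
  shows "\<lbrakk>c \<in> carrier K; u \<in> carrier U; v \<in> carrier V\<rbrakk> \<Longrightarrow> f (c \<odot>\<^bsub>U\<^esub> u) v = c \<odot>\<^bsub>W\<^esub> f u v"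
    and "\<lbrakk>c \<in> carrier K; u \<in> carrier U; v \<in> carrier V\<rbrakk> \<Longrightarrow> f u (c \<odot>\<^bsub>V\<^esub> v) = c \<odot>\<^bsub>W\<^esub> f u v"
  using assms by (auto simp: bilinear_map_def linear_map_def)

lemma bilinear_minus:
  assumes "bilinear_map K U V W f" "module K U" "module K V" "module K W"
  shows "\<lbrakk>u \<in> carrier U; v \<in> carrier V\<rbrakk> \<Longrightarrow> f (\<ominus>\<^bsub>U\<^esub> u) v = \<ominus>\<^bsub>W\<^esub> f u v"
    and "\<lbrakk>u \<in> carrier U; v \<in> carrier V\<rbrakk> \<Longrightarrow> f u (\<ominus>\<^bsub>V\<^esub> v) = \<ominus>\<^bsub>W\<^esub> f u v"
  using linear_map_minus[OF bilinear_mapD(2)[OF assms(1)] assms(2,4)]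
    linear_map_minus[OF bilinear_mapD(1)[OF assms(1)] assms(3,4)] by simp_all

lemma bilinear_diff:
  assumes "bilinear_map K U V W f" "module K U" "module K V" "module K W"
  shows "\<lbrakk>u \<in> carrier U; u' \<in> carrier U; v \<in> carrier V\<rbrakk> \<Longrightarrow> f (u \<ominus>\<^bsub>U\<^esub> u') v = f u v \<ominus>\<^bsub>W\<^esub> f u' v"
    and "\<lbrakk>u \<in> carrier U; v \<in> carrier V; v' \<in> carrier V\<rbrakk> \<Longrightarrow> f u (v \<ominus>\<^bsub>V\<^esub> v') = f u v \<ominus>\<^bsub>W\<^esub> f u v'"
  using linear_map_diff[OF bilinear_mapD(2)[OF assms(1)] assms(2,4)]
    linear_map_diff[OF bilinear_mapD(1)[OF assms(1)] assms(3,4)] by simp_all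

lemma bilinear_zero:
  assumes "bilinear_map K U V W f" "module K U" "module K V" "module K W"
  shows "v \<in> carrier V \<Longrightarrow> f \<zero>\<^bsub>U\<^esub> v = \<zero>\<^bsub>W\<^esub>" and "u \<in> carrier U \<Longrightarrow> f u \<zero>\<^bsub>V\<^esub> = \<zero>\<^bsub>W\<^esub>"
  using linear_map_zero[OF bilinear_mapD(2)[OF assms(1)] assms(2,4)]
    linear_map_zero[OF bilinear_mapD(1)[OF assms(1)] assms(3,4)] by simp_all

lemma bilinear_comp:
  assumes "bilinear_map K U V W f" "linear_map K U' U g" "linear_map K V' V h" "linear_map K W W' k"
  shows "bilinear_map K U' V' W' (\<lambda>u v. k (f (g u) (h v)))"
  using assms by (auto simp: bilinear_map_def linear_map_def Pi_def)

subsection \<open>Functionals\<close>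

definition functional :: "('k, 'z) ring_scheme \<Rightarrow> ('k, 'v) module \<Rightarrow> ('v \<Rightarrow> 'k) \<Rightarrow> bool" where
  "functional K V f \<longleftrightarrow>
     f \<in> carrier V \<rightarrow> carrier K \<and>
     (\<forall>x\<in>carrier V. \<forall>y\<in>carrier V. f (x \<oplus>\<^bsub>V\<^esub> y) = f x \<oplus>\<^bsub>K\<^esub> f y) \<and>
     (\<forall>c\<in>carrier K. \<forall>x\<in>carrier V. f (c \<odot>\<^bsub>V\<^esub> x) = c \<otimes>\<^bsub>K\<^esub> f x)"

lemma functionalD:
  assumes "functional K V f"
  shows "x \<in> carrier V \<Longrightarrow> f x \<in> carrier K"
    and "\<lbrakk>x \<in> carrier V; y \<in> carrier V\<rbrakk> \<Longrightarrow> f (x \<oplus>\<^bsub>V\<^esub> y) = f x \<oplus>\<^bsub>K\<^esub> f y"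
    and "\<lbrakk>c \<in> carrier K; x \<in> carrier V\<rbrakk> \<Longrightarrow> f (c \<odot>\<^bsub>V\<^esub> x) = c \<otimes>\<^bsub>K\<^esub> f x"
  using assms by (auto simp: functional_def)

lemma functional_comp:
  "\<lbrakk>linear_map K U V g; functional K V f\<rbrakk> \<Longrightarrow> functional K U (\<lambda>x. f (g x))"
  by (auto simp: functional_def linear_map_def Pi_def)

lemma augmentation_functional: "augmentation K R \<epsilon> \<Longrightarrow> functional K R \<epsilon>"
  by (auto simp: augmentation_def functional_def ring_hom_def)

text \<open>Coordinates are unique, hence linear in the vector, and the coordinates of \<open>b k\<close> itself are known.\<close>

lemma basis_dual:
  assumes V: "module K V" and b: "is_basis K V n b"
  obtains \<phi> where "\<And>j. j \<in> {1..n} \<Longrightarrow> functional K V (\<phi> j)"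
    and "\<And>v. v \<in> carrier V \<Longrightarrow> v = (\<Oplus>\<^bsub>V\<^esub>j\<in>{1..n}. \<phi> j v \<odot>\<^bsub>V\<^esub> b j)"
    and "\<And>j k. \<lbrakk>j \<in> {1..n}; k \<in> {1..n}\<rbrakk> \<Longrightarrow> \<phi> j (b k) = (if j = k then \<one>\<^bsub>K\<^esub> else \<zero>\<^bsub>K\<^esub>)"
proof -
  interpret V: module K V by fact
  define is_coord where "is_coord = (\<lambda>v c. c \<in> {1..n} \<rightarrow>\<^sub>E carrier K \<and> v = (\<Oplus>\<^bsub>V\<^esub>i\<in>{1..n}. c i \<odot>\<^bsub>V\<^esub> b i))"
  define co where "co = (\<lambda>v. THE c. is_coord v c)"
  have ex1: "\<exists>!c. is_coord v c" if "v \<in> carrier V" for v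
    using b that by (simp add: is_basis_def is_coord_def)
  have co: "is_coord v (co v)" if "v \<in> carrier V" for v
    unfolding co_def using theI'[OF ex1[OF that]] .
  have coI: "co v = c" if "v \<in> carrier V" "is_coord v c" for v c
    using ex1[OF that(1)] co[OF that(1)] that(2) by blast
  have bc: "b i \<in> carrier V" if "i \<in> {1..n}" for i
    using b that unfolding is_basis_def by blast
  have coc: "co v i \<in> carrier K" if "v \<in> carrier V" "i \<in> {1..n}" for v i
    using co[OF that(1)] that(2) unfolding is_coord_def by (auto simp: PiE_def Pi_def)
  have cosum: "v = (\<Oplus>\<^bsub>V\<^esub>i\<in>{1..n}. co v i \<odot>\<^bsub>V\<^esub> b i)" if "v \<in> carrier V" for v
    using co[OF that(1)] unfolding is_coord_def by blast
  have add: "co (v \<oplus>\<^bsub>V\<^esub> w) = (\<lambda>i\<in>{1..n}. co v i \<oplus>\<^bsub>K\<^esub> co w i)" if "v \<in> carrier V" "w \<in> carrier V" for v w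
  proof (rule coI)
    have "(\<Oplus>\<^bsub>V\<^esub>i\<in>{1..n}. (\<lambda>i\<in>{1..n}. co v i \<oplus>\<^bsub>K\<^esub> co w i) i \<odot>\<^bsub>V\<^esub> b i)
      = (\<Oplus>\<^bsub>V\<^esub>i\<in>{1..n}. co v i \<odot>\<^bsub>V\<^esub> b i \<oplus>\<^bsub>V\<^esub> co w i \<odot>\<^bsub>V\<^esub> b i)"
      by (rule V.finsum_cong') (use that coc bc in \<open>auto simp: Pi_def V.smult_l_distr\<close>)
    also have "\<dots> = v \<oplus>\<^bsub>V\<^esub> w"
      using that coc bc cosum by (subst V.finsum_addf) (auto simp: Pi_def)
    finally show "is_coord (v \<oplus>\<^bsub>V\<^esub> w) (\<lambda>i\<in>{1..n}. co v i \<oplus>\<^bsub>K\<^esub> co w i)"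
      unfolding is_coord_def using that coc by (auto simp del: atLeastAtMost_iff)
  qed (use that in simp)
  have smult: "co (c \<odot>\<^bsub>V\<^esub> v) = (\<lambda>i\<in>{1..n}. c \<otimes>\<^bsub>K\<^esub> co v i)" if "c \<in> carrier K" "v \<in> carrier V" for c v
  proof (rule coI)
    have "(\<Oplus>\<^bsub>V\<^esub>i\<in>{1..n}. (\<lambda>i\<in>{1..n}. c \<otimes>\<^bsub>K\<^esub> co v i) i \<odot>\<^bsub>V\<^esub> b i)
      = (\<Oplus>\<^bsub>V\<^esub>i\<in>{1..n}. c \<odot>\<^bsub>V\<^esub> (co v i \<odot>\<^bsub>V\<^esub> b i))"
      by (rule V.finsum_cong') (use that coc bc in \<open>auto simp: Pi_def V.smult_assoc1\<close>)
    also have "\<dots> = c \<odot>\<^bsub>V\<^esub> v"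
      using that coc bc cosum by (subst V.finsum_smult_ldistr[symmetric]) (auto simp: Pi_def)
    finally show "is_coord (c \<odot>\<^bsub>V\<^esub> v) (\<lambda>i\<in>{1..n}. c \<otimes>\<^bsub>K\<^esub> co v i)"
      unfolding is_coord_def using that coc by (auto simp del: atLeastAtMost_iff)
  qed (use that in simp)
  have unit: "co (b k) = (\<lambda>i\<in>{1..n}. if i = k then \<one>\<^bsub>K\<^esub> else \<zero>\<^bsub>K\<^esub>)" if "k \<in> {1..n}" for k
  proof (rule coI)
    have "(\<Oplus>\<^bsub>V\<^esub>i\<in>{1..n}. (\<lambda>i\<in>{1..n}. if i = k then \<one>\<^bsub>K\<^esub> else \<zero>\<^bsub>K\<^esub>) i \<odot>\<^bsub>V\<^esub> b i)
      = (\<Oplus>\<^bsub>V\<^esub>i\<in>{1..n}. if k = i then b i else \<zero>\<^bsub>V\<^esub>)"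
      by (rule V.finsum_cong') (use bc in \<open>auto simp: Pi_def\<close>)
    also have "\<dots> = b k"
      using V.finsum_singleton[of k "{1..n}" b] that bc by (simp add: Pi_def)
    finally show "is_coord (b k) (\<lambda>i\<in>{1..n}. if i = k then \<one>\<^bsub>K\<^esub> else \<zero>\<^bsub>K\<^esub>)"
      unfolding is_coord_def using that by auto
  qed (use that bc in simp)
  show thesis
  proof (rule that[of "\<lambda>j v. co v j"])
    fix j assume j: "j \<in> {1..n}"
    show "functional K V (\<lambda>v. co v j)"
      unfolding functional_def using add smult coc j by auto
  qed (use cosum unit in auto)
qed

subsection \<open>Quotient modules\<close>

lemma submodule_abelian_subgroup:
  assumes "module K V" "submodule N K V"
  shows "abelian_subgroup N V"
  using assms by (intro abelian_subgroupI3 additive_subgroup.intro)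
    (auto simp: module_abelian_group submodule_def)

lemma quot_class_eq_iff:
  assumes "module K V" "submodule N K V" "x \<in> carrier V" "y \<in> carrier V"
  shows "N +>\<^bsub>V\<^esub> x = N +>\<^bsub>V\<^esub> y \<longleftrightarrow> x \<ominus>\<^bsub>V\<^esub> y \<in> N"
proof -
  interpret N: abelian_subgroup N V using assms by (intro submodule_abelian_subgroup)
  have "x \<in> N +>\<^bsub>V\<^esub> y \<longleftrightarrow> x \<ominus>\<^bsub>V\<^esub> y \<in> N"
    using N.a_rcos_module[of y x] assms(3,4) by (simp add: a_minus_def)
  then show ?thesis
    by (metis N.a_rcos_self N.a_repr_independence' assms(3,4))
qed

lemma quot_class_zero_iff:
  assumes "module K V" "submodule N K V" "x \<in> carrier V"
  shows "N +>\<^bsub>V\<^esub> x = N \<longleftrightarrow> x \<in> N"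
proof -
  interpret N: abelian_subgroup N V using assms by (intro submodule_abelian_subgroup)
  show ?thesis
    using N.a_coset_join1 N.a_coset_join2 N.a_subgroup assms(3) N.a_rcos_self by metis
qed

text \<open>The scalar multiple of a class is a union over its members; as \<open>N\<close> is a submodule, all of them
  contribute the same class.\<close>

lemma quot_module_smult_class:
  assumes V: "module K V" and N: "submodule N K V" and c: "c \<in> carrier K" and x: "x \<in> carrier V"
  shows "c \<odot>\<^bsub>quot_module V N\<^esub> (N +>\<^bsub>V\<^esub> x) = N +>\<^bsub>V\<^esub> (c \<odot>\<^bsub>V\<^esub> x)"
proof -
  interpret V: module K V by fact
  interpret N: abelian_subgroup N V using V N by (intro submodule_abelian_subgroup)
  have "N +>\<^bsub>V\<^esub> (c \<odot>\<^bsub>V\<^esub> y) = N +>\<^bsub>V\<^esub> (c \<odot>\<^bsub>V\<^esub> x)" if y: "y \<in> N +>\<^bsub>V\<^esub> x" for y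
  proof -
    have yc: "y \<in> carrier V" using N.a_elemrcos_carrier[OF x y] .
    have "y \<ominus>\<^bsub>V\<^esub> x \<in> N" using N.a_rcos_module[of x y] x yc y by (simp add: a_minus_def)
    then have "c \<odot>\<^bsub>V\<^esub> (y \<ominus>\<^bsub>V\<^esub> x) \<in> N" using submodule.smult_closed[OF N c] by blast
    then have "c \<odot>\<^bsub>V\<^esub> y \<ominus>\<^bsub>V\<^esub> c \<odot>\<^bsub>V\<^esub> x \<in> N"
      using c x yc by (simp add: a_minus_def V.smult_r_distr V.smult_r_minus)
    then show ?thesis using quot_class_eq_iff[OF V N] c x yc by simp
  qed
  then have "(\<lambda>y. N +>\<^bsub>V\<^esub> (c \<odot>\<^bsub>V\<^esub> y)) ` (N +>\<^bsub>V\<^esub> x) = {N +>\<^bsub>V\<^esub> (c \<odot>\<^bsub>V\<^esub> x)}"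
    using N.a_rcos_self[OF x] by blast
  then show ?thesis by (simp add: quot_module_def)
qed

lemma quot_module_add_class:
  assumes V: "module K V" and N: "submodule N K V" and x: "x \<in> carrier V" and y: "y \<in> carrier V"
  shows "(N +>\<^bsub>V\<^esub> x) \<oplus>\<^bsub>quot_module V N\<^esub> (N +>\<^bsub>V\<^esub> y) = N +>\<^bsub>V\<^esub> (x \<oplus>\<^bsub>V\<^esub> y)"
proof -
  interpret N: abelian_subgroup N V using V N by (intro submodule_abelian_subgroup)
  show ?thesis using N.a_rcos_sum x y by (simp add: quot_module_def)
qed

lemma quot_module_carrier: "carrier (quot_module V N) = (\<lambda>x. N +>\<^bsub>V\<^esub> x) ` carrier V"
  by (auto simp: quot_module_def A_RCOSETS_def')

lemma quot_module_zero: "\<zero>\<^bsub>quot_module V N\<^esub> = N"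
  by (simp add: quot_module_def)

lemma quot_module_module:
  assumes V: "module K V" and N: "submodule N K V"
  shows "module K (quot_module V N)"
proof -
  interpret V: module K V by fact
  interpret N: abelian_subgroup N V using V N by (intro submodule_abelian_subgroup)
  note [simp] = quot_module_smult_class[OF V N] quot_module_add_class[OF V N]
  have z: "\<zero>\<^bsub>quot_module V N\<^esub> = N +>\<^bsub>V\<^esub> \<zero>\<^bsub>V\<^esub>"
    using quot_class_zero_iff[OF V N, of "\<zero>\<^bsub>V\<^esub>"] by (simp add: quot_module_zero)
  show ?thesis
  proof (rule moduleI)
    show "cring K" using V by (simp add: module_def)
    show "abelian_group (quot_module V N)"
    proof (rule abelian_groupI)
      fix x assume "x \<in> carrier (quot_module V N)"
      then obtain x' where x': "x' \<in> carrier V" "x = N +>\<^bsub>V\<^esub> x'" by (auto simp: quot_module_carrier)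
      then have "(N +>\<^bsub>V\<^esub> (\<ominus>\<^bsub>V\<^esub> x')) \<oplus>\<^bsub>quot_module V N\<^esub> x = \<zero>\<^bsub>quot_module V N\<^esub>"
        by (simp add: z V.l_neg)
      then show "\<exists>y\<in>carrier (quot_module V N). y \<oplus>\<^bsub>quot_module V N\<^esub> x = \<zero>\<^bsub>quot_module V N\<^esub>"
        using x' by (auto simp: quot_module_carrier)
    qed (auto simp: quot_module_carrier z V.a_ac)
  qed (auto simp: quot_module_carrier V.smult_l_distr V.smult_r_distr V.smult_assoc1)
qed

lemma quot_class_linear:
  assumes "module K V" "submodule N K V"
  shows "linear_map K V (quot_module V N) (\<lambda>x. N +>\<^bsub>V\<^esub> x)"
  using assms
  by (intro linear_mapI) (auto simp: quot_module_carrier quot_module_smult_class quot_module_add_class)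

section \<open>Tensor products\<close>

lemma free_module_simps:
  "carrier (free_module K X) = {f \<in> X \<rightarrow>\<^sub>E carrier K. finite {x \<in> X. f x \<noteq> \<zero>\<^bsub>K\<^esub>}}"
  "\<zero>\<^bsub>free_module K X\<^esub> = (\<lambda>x\<in>X. \<zero>\<^bsub>K\<^esub>)"
  "f \<oplus>\<^bsub>free_module K X\<^esub> g = (\<lambda>x\<in>X. f x \<oplus>\<^bsub>K\<^esub> g x)"
  "c \<odot>\<^bsub>free_module K X\<^esub> f = (\<lambda>x\<in>X. c \<otimes>\<^bsub>K\<^esub> f x)"
  by (simp_all add: free_module_def)

lemma free_module_module:
  assumes "cring K"
  shows "module K (free_module K X)"
proof -
  interpret K: cring K by fact
  let ?F = "free_module K X"
  let ?s = "\<lambda>f. {x \<in> X. f x \<noteq> \<zero>\<^bsub>K\<^esub>}"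
  have val: "f x \<in> carrier K" if "f \<in> carrier ?F" "x \<in> X" for f x
    using that by (auto simp: free_module_simps PiE_def Pi_def)
  have add: "f \<oplus>\<^bsub>?F\<^esub> g \<in> carrier ?F" if "f \<in> carrier ?F" "g \<in> carrier ?F" for f g
  proof -
    have "?s (f \<oplus>\<^bsub>?F\<^esub> g) \<subseteq> ?s f \<union> ?s g" by (auto simp: free_module_simps)
    moreover have "finite (?s f \<union> ?s g)" using that by (simp add: free_module_simps)
    ultimately have "finite (?s (f \<oplus>\<^bsub>?F\<^esub> g))" by (rule finite_subset)
    then show ?thesis unfolding free_module_simps(1) using that val by (simp add: free_module_simps(3))
  qed
  have smult: "c \<odot>\<^bsub>?F\<^esub> f \<in> carrier ?F" if "c \<in> carrier K" "f \<in> carrier ?F" for c f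
  proof -
    have "?s (c \<odot>\<^bsub>?F\<^esub> f) \<subseteq> ?s f" using that by (auto simp: free_module_simps)
    moreover have "finite (?s f)" using that by (simp add: free_module_simps)
    ultimately have "finite (?s (c \<odot>\<^bsub>?F\<^esub> f))" by (rule finite_subset)
    then show ?thesis unfolding free_module_simps(1) using that val by (simp add: free_module_simps(4))
  qed
  have eqI: "f = g" if "f \<in> carrier ?F" "g \<in> carrier ?F" "\<And>x. x \<in> X \<Longrightarrow> f x = g x" for f g
    using that by (intro PiE_ext[of f X "\<lambda>_. carrier K" g]) (auto simp: free_module_simps)
  have zero: "\<zero>\<^bsub>?F\<^esub> \<in> carrier ?F" by (auto simp: free_module_simps)
  have ev: "(f \<oplus>\<^bsub>?F\<^esub> g) x = f x \<oplus>\<^bsub>K\<^esub> g x" "(c \<odot>\<^bsub>?F\<^esub> f) x = c \<otimes>\<^bsub>K\<^esub> f x" "\<zero>\<^bsub>?F\<^esub> x = \<zero>\<^bsub>K\<^esub>"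
    if "x \<in> X" for c f g x
    using that by (simp_all add: free_module_simps)
  show ?thesis
  proof (rule moduleI)
    show "cring K" by fact
    show "abelian_group ?F"
    proof (rule abelian_groupI)
      fix f assume f: "f \<in> carrier ?F"
      let ?m = "(\<ominus>\<^bsub>K\<^esub> \<one>\<^bsub>K\<^esub>) \<odot>\<^bsub>?F\<^esub> f"
      have "?m \<in> carrier ?F" using smult f by simp
      moreover have "?m \<oplus>\<^bsub>?F\<^esub> f = \<zero>\<^bsub>?F\<^esub>"
        using f \<open>?m \<in> carrier ?F\<close> by (intro eqI add zero) (auto simp: ev val K.l_minus K.l_neg)
      ultimately show "\<exists>y\<in>carrier ?F. y \<oplus>\<^bsub>?F\<^esub> f = \<zero>\<^bsub>?F\<^esub>" by blast
    qed (intro eqI add zero; auto simp: ev val add zero K.a_ac)+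
  qed (use smult in \<open>(intro eqI add smult; simp add: ev val add smult K.l_distr K.r_distr K.m_assoc)+\<close>)
qed

lemma free_gen_closed:
  assumes "cring K" "x \<in> X"
  shows "free_gen K X x \<in> carrier (free_module K X)"
proof -
  interpret K: cring K by fact
  have "finite {y \<in> X. free_gen K X x y \<noteq> \<zero>\<^bsub>K\<^esub>}"
    by (rule finite_subset[of _ "{x}"]) (auto simp: free_gen_def)
  then show ?thesis by (auto simp: free_module_simps free_gen_def)
qed

lemma tensor_relators_closed:
  assumes "module K V" "module K W"
  shows "tensor_relators K V W \<subseteq> carrier (free_module K (carrier V \<times> carrier W))"
proof -
  interpret V: module K V by fact
  interpret W: module K W by fact
  have K: "cring K" using assms by (simp add: module_def)
  interpret F: module K "free_module K (carrier V \<times> carrier W)" by (rule free_module_module[OF K])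
  show ?thesis
    unfolding tensor_relators_def Let_def by (auto intro!: F.minus_closed F.a_closed F.smult_closed free_gen_closed[OF K])
qed

lemma tensor_rel_least:
  assumes "submodule N K (free_module K (carrier V \<times> carrier W))" "tensor_relators K V W \<subseteq> N"
  shows "tensor_rel K V W \<subseteq> N"
  using assms by (auto simp: tensor_rel_def)

lemma tensor_relators_subset: "tensor_relators K V W \<subseteq> tensor_rel K V W"
  by (auto simp: tensor_rel_def)

lemma tensor_rel_submodule:
  assumes "module K V" "module K W"
  shows "submodule (tensor_rel K V W) K (free_module K (carrier V \<times> carrier W))"
proof -
  have K: "cring K" using assms by (simp add: module_def)
  interpret F: module K "free_module K (carrier V \<times> carrier W)" by (rule free_module_module[OF K])
  have *: "tensor_rel K V W \<subseteq> carrier (free_module K (carrier V \<times> carrier W))"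
    using tensor_rel_least[OF F.carrier_is_submodule tensor_relators_closed[OF assms]] .
  show ?thesis
    by (rule F.submoduleI)
      (use * in \<open>auto simp: tensor_rel_def F.submoduleE(3,4,5) intro: subgroup.one_closed[of _ "add_monoid _", simplified] submodule.axioms(1)\<close>)
qed

lemma tensor_module [simp]:
  "\<lbrakk>module K V; module K W\<rbrakk> \<Longrightarrow> module K (tensor K V W)"
  unfolding tensor_def
  by (intro quot_module_module free_module_module tensor_rel_submodule) (simp_all add: module_def)

lemma tens_closed [simp]:
  assumes "module K V" "module K W" "v \<in> carrier V" "w \<in> carrier W"
  shows "tens K V W v w \<in> carrier (tensor K V W)"
  using assms free_gen_closed[of K "(v, w)" "carrier V \<times> carrier W"]
  by (auto simp: tensor_def tens_def quot_module_carrier module_def)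

lemma tens_bilinear:
  assumes V: "module K V" and W: "module K W"
  shows "bilinear_map K V W (tensor K V W) (tens K V W)"
proof -
  interpret V: module K V by fact
  interpret W: module K W by fact
  have K: "cring K" using assms by (simp add: module_def)
  let ?X = "carrier V \<times> carrier W"
  let ?F = "free_module K ?X" and ?N = "tensor_rel K V W"
  interpret F: module K ?F by (rule free_module_module[OF K])
  note F = F.module_axioms and N = tensor_rel_submodule[OF V W]
  note g = free_gen_closed[OF K, of _ ?X]
  have rel: "r \<in> tensor_relators K V W \<Longrightarrow> r \<in> ?N" for r using tensor_relators_subset by auto
  have cl: "tens K V W v w \<in> carrier (tensor K V W)" if "v \<in> carrier V" "w \<in> carrier W" for v w
    using V W that by simp
  have eq: "?N +>\<^bsub>?F\<^esub> x = ?N +>\<^bsub>?F\<^esub> y" if "x \<in> carrier ?F" "y \<in> carrier ?F" "x \<ominus>\<^bsub>?F\<^esub> y \<in> tensor_relators K V W" for x y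
    using quot_class_eq_iff[OF F N] that rel by blast
  show ?thesis
  proof (intro bilinear_mapI linear_mapI)
    fix v v' w assume *: "v \<in> carrier V" "v' \<in> carrier V" "w \<in> carrier W"
    then show "tens K V W (v \<oplus>\<^bsub>V\<^esub> v') w = tens K V W v w \<oplus>\<^bsub>tensor K V W\<^esub> tens K V W v' w"
      unfolding tens_def tensor_def
      by (subst quot_module_add_class[OF F N]; (intro eq F.a_closed g)?)
        (auto simp: tensor_relators_def Let_def)
  next
    fix v w w' assume *: "v \<in> carrier V" "w \<in> carrier W" "w' \<in> carrier W"
    then show "tens K V W v (w \<oplus>\<^bsub>W\<^esub> w') = tens K V W v w \<oplus>\<^bsub>tensor K V W\<^esub> tens K V W v w'"
      unfolding tens_def tensor_def
      by (subst quot_module_add_class[OF F N]; (intro eq F.a_closed g)?)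
        (auto simp: tensor_relators_def Let_def)
  next
    fix c v w assume *: "c \<in> carrier K" "v \<in> carrier V" "w \<in> carrier W"
    show "tens K V W (c \<odot>\<^bsub>V\<^esub> v) w = c \<odot>\<^bsub>tensor K V W\<^esub> tens K V W v w"
      unfolding tens_def tensor_def using *
      by (subst quot_module_smult_class[OF F N]; (intro eq F.smult_closed g)?)
        (auto simp: tensor_relators_def Let_def)
    show "tens K V W v (c \<odot>\<^bsub>W\<^esub> w) = c \<odot>\<^bsub>tensor K V W\<^esub> tens K V W v w"
      unfolding tens_def tensor_def using *
      by (subst quot_module_smult_class[OF F N]; (intro eq F.smult_closed g)?)
        (auto simp: tensor_relators_def Let_def)
  qed (use cl in auto)
qed


text \<open>An element of the free module is a finite sum of multiples of generators, and a multiple of a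
  pure tensor is pure, since the scalar moves into the left factor.\<close>

lemma tensor_induct [consumes 3, case_names tens add]:
  assumes V: "module K V" and W: "module K W" and X: "X \<in> carrier (tensor K V W)"
    and tens: "\<And>v w. \<lbrakk>v \<in> carrier V; w \<in> carrier W\<rbrakk> \<Longrightarrow> P (tens K V W v w)"
    and add: "\<And>X Y. \<lbrakk>X \<in> carrier (tensor K V W); Y \<in> carrier (tensor K V W); P X; P Y\<rbrakk>
                \<Longrightarrow> P (X \<oplus>\<^bsub>tensor K V W\<^esub> Y)"
  shows "P X"
proof -
  interpret V: module K V by fact
  interpret W: module K W by fact
  have K: "cring K" using assms by (simp add: module_def)
  let ?X = "carrier V \<times> carrier W"
  let ?F = "free_module K ?X" and ?N = "tensor_rel K V W"
  interpret F: module K ?F by (rule free_module_module[OF K])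
  note F = F.module_axioms and N = tensor_rel_submodule[OF V W]
  have "P (?N +>\<^bsub>?F\<^esub> x)" if "finite T" "x \<in> carrier ?F" "{z \<in> ?X. x z \<noteq> \<zero>\<^bsub>K\<^esub>} \<subseteq> T" "T \<subseteq> ?X" for T x
    using that
  proof (induction T arbitrary: x)
    case empty
    then have "x = \<zero>\<^bsub>?F\<^esub>"
      by (intro PiE_ext[of _ ?X "\<lambda>_. carrier K"]) (auto simp: free_module_simps)
    then have "?N +>\<^bsub>?F\<^esub> x = \<zero>\<^bsub>tensor K V W\<^esub>"
      using quot_class_zero_iff[OF F N, of x] F.submoduleE(1)[OF N] subgroup.one_closed[OF submodule.axioms(1)[OF N]]
      by (simp add: tensor_def quot_module_zero)
    also have "\<dots> = tens K V W \<zero>\<^bsub>V\<^esub> \<zero>\<^bsub>W\<^esub>"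
      using bilinear_zero(1)[OF tens_bilinear[OF V W] V W tensor_module[OF V W]] by simp
    finally show ?case using tens by simp
  next
    case (insert z T)
    define y where "y = (\<lambda>u\<in>?X. if u = z then \<zero>\<^bsub>K\<^esub> else x u)"
    have z: "z \<in> ?X" and xz: "x z \<in> carrier K" using insert.prems by (auto simp: free_module_simps PiE_def Pi_def)
    have ysupp: "{u \<in> ?X. y u \<noteq> \<zero>\<^bsub>K\<^esub>} \<subseteq> {u \<in> ?X. x u \<noteq> \<zero>\<^bsub>K\<^esub>}" by (auto simp: y_def)
    have y: "y \<in> carrier ?F"
      using insert.prems(1) finite_subset[OF ysupp] by (auto simp: free_module_simps y_def PiE_def Pi_def)
    have g: "free_gen K ?X z \<in> carrier ?F" using free_gen_closed[OF K z] .
    have x: "x = y \<oplus>\<^bsub>?F\<^esub> x z \<odot>\<^bsub>?F\<^esub> free_gen K ?X z"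
      using insert.prems(1) xz z
      by (intro PiE_ext[of x ?X "\<lambda>_. carrier K"])
        (auto simp: free_module_simps y_def free_gen_def PiE_def Pi_def)
    have "?N +>\<^bsub>?F\<^esub> x = (?N +>\<^bsub>?F\<^esub> y) \<oplus>\<^bsub>tensor K V W\<^esub> (?N +>\<^bsub>?F\<^esub> (x z \<odot>\<^bsub>?F\<^esub> free_gen K ?X z))"
      using quot_module_add_class[OF F N y, of "x z \<odot>\<^bsub>?F\<^esub> free_gen K ?X z"] x F.smult_closed[OF xz g]
      by (simp add: tensor_def)
    also have "?N +>\<^bsub>?F\<^esub> (x z \<odot>\<^bsub>?F\<^esub> free_gen K ?X z) = x z \<odot>\<^bsub>tensor K V W\<^esub> tens K V W (fst z) (snd z)"
      using quot_module_smult_class[OF F N xz g] by (simp add: tens_def tensor_def)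
    also have "\<dots> = tens K V W (x z \<odot>\<^bsub>V\<^esub> fst z) (snd z)"
      using bilinear_smult(1)[OF tens_bilinear[OF V W]] z xz by auto
    finally have eq: "?N +>\<^bsub>?F\<^esub> x = (?N +>\<^bsub>?F\<^esub> y) \<oplus>\<^bsub>tensor K V W\<^esub> tens K V W (x z \<odot>\<^bsub>V\<^esub> fst z) (snd z)" .
    have "{u \<in> ?X. y u \<noteq> \<zero>\<^bsub>K\<^esub>} \<subseteq> T" using insert.prems(2) by (auto simp: y_def)
    then have "P (?N +>\<^bsub>?F\<^esub> y)" using insert.prems(3) y by (intro insert.IH) simp_all
    moreover have "?N +>\<^bsub>?F\<^esub> y \<in> carrier (tensor K V W)"
      using y by (auto simp: tensor_def quot_module_carrier)
    ultimately show ?case unfolding eq using V W z xz by (intro add tens) auto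
  qed
  moreover obtain x where "x \<in> carrier ?F" "X = ?N +>\<^bsub>?F\<^esub> x"
    using X by (auto simp: tensor_def quot_module_carrier)
  ultimately show ?thesis by (auto simp: free_module_simps)
qed

text \<open>The universal property: the linear extension of \<open>f\<close> to the free module vanishes on the relators.
  Its linearity is seen by enlarging the supports of both arguments to a common finite set.\<close>

lemma tensor_lift:
  assumes V: "module K V" and W: "module K W" and U: "module K U" and f: "bilinear_map K V W U f"
  shows tensor_lift_linear: "linear_map K (tensor K V W) U (tensor_lift K V W U f)"
    and tensor_lift_tens: "\<lbrakk>v \<in> carrier V; w \<in> carrier W\<rbrakk> \<Longrightarrow> tensor_lift K V W U f (tens K V W v w) = f v w"
proof -
  interpret V: module K V by fact
  interpret W: module K W by fact
  interpret U: module K U by fact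
  have K: "cring K" using assms by (simp add: module_def)
  let ?X = "carrier V \<times> carrier W"
  let ?F = "free_module K ?X" and ?N = "tensor_rel K V W"
  interpret F: module K ?F by (rule free_module_module[OF K])
  note F = F.module_axioms and N = tensor_rel_submodule[OF V W]
  interpret N: abelian_subgroup ?N ?F using F N by (rule submodule_abelian_subgroup)
  define S where "S = (\<lambda>x T. \<Oplus>\<^bsub>U\<^esub>z\<in>T. x z \<odot>\<^bsub>U\<^esub> f (fst z) (snd z))"
  define G where "G = (\<lambda>x. S x {z \<in> ?X. x z \<noteq> \<zero>\<^bsub>K\<^esub>})"
  have val: "x z \<in> carrier K" if "x \<in> carrier ?F" "z \<in> ?X" for x z
    using that by (auto simp: free_module_simps PiE_def Pi_def)
  have fc: "f (fst z) (snd z) \<in> carrier U" if "z \<in> ?X" for z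
    using bilinear_closed[OF f] that by auto
  have GS: "G x = S x T" if "x \<in> carrier ?F" "finite T" "{z \<in> ?X. x z \<noteq> \<zero>\<^bsub>K\<^esub>} \<subseteq> T" "T \<subseteq> ?X" for x T
    unfolding G_def S_def
  proof (rule U.add.finprod_mono_neutral_cong_left)
    fix z assume "z \<in> T - {z \<in> ?X. x z \<noteq> \<zero>\<^bsub>K\<^esub>}"
    then have "z \<in> ?X" "x z = \<zero>\<^bsub>K\<^esub>" using that(4) by blast+
    then show "x z \<odot>\<^bsub>U\<^esub> f (fst z) (snd z) = \<zero>\<^bsub>U\<^esub>" using fc[of z] by simp
  next
    show "(\<lambda>z. x z \<odot>\<^bsub>U\<^esub> f (fst z) (snd z)) \<in> T \<rightarrow> carrier U"
      using that(4) val[OF that(1)] fc by (intro Pi_I U.smult_closed) blast+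
  qed (use that in simp_all)
  have fin: "finite {z \<in> ?X. x z \<noteq> \<zero>\<^bsub>K\<^esub>}" if "x \<in> carrier ?F" for x
    using that by (simp add: free_module_simps(1))
  have Glin: "linear_map K ?F U G"
  proof (rule linear_mapI)
    fix x assume "x \<in> carrier ?F"
    then show "G x \<in> carrier U" unfolding G_def S_def by (intro U.finsum_closed) (auto simp: val fc)
  next
    fix x y assume x: "x \<in> carrier ?F" and y: "y \<in> carrier ?F"
    let ?T = "{z \<in> ?X. x z \<noteq> \<zero>\<^bsub>K\<^esub>} \<union> {z \<in> ?X. y z \<noteq> \<zero>\<^bsub>K\<^esub>}"
    have "G (x \<oplus>\<^bsub>?F\<^esub> y) = S (x \<oplus>\<^bsub>?F\<^esub> y) ?T"
      by (rule GS[OF F.a_closed[OF x y]]) (use fin[OF x] fin[OF y] in \<open>auto simp: free_module_simps(3)\<close>)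
    also have "\<dots> = (\<Oplus>\<^bsub>U\<^esub>z\<in>?T. x z \<odot>\<^bsub>U\<^esub> f (fst z) (snd z) \<oplus>\<^bsub>U\<^esub> y z \<odot>\<^bsub>U\<^esub> f (fst z) (snd z))"
      unfolding S_def using x y
      by (intro U.finsum_cong') (auto simp: free_module_simps(3) val fc U.smult_l_distr)
    also have "\<dots> = S x ?T \<oplus>\<^bsub>U\<^esub> S y ?T"
      unfolding S_def using x y by (intro U.finsum_addf) (auto simp: val fc)
    also have "\<dots> = G x \<oplus>\<^bsub>U\<^esub> G y"
      using GS[of x ?T] GS[of y ?T] x y fin by auto
    finally show "G (x \<oplus>\<^bsub>?F\<^esub> y) = G x \<oplus>\<^bsub>U\<^esub> G y" .
  next
    fix c x assume c: "c \<in> carrier K" and x: "x \<in> carrier ?F"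
    let ?T = "{z \<in> ?X. x z \<noteq> \<zero>\<^bsub>K\<^esub>}"
    have "G (c \<odot>\<^bsub>?F\<^esub> x) = S (c \<odot>\<^bsub>?F\<^esub> x) ?T"
      by (rule GS[OF F.smult_closed[OF c x]]) (use c fin[OF x] in \<open>auto simp: free_module_simps(4)\<close>)
    also have "\<dots> = (\<Oplus>\<^bsub>U\<^esub>z\<in>?T. c \<odot>\<^bsub>U\<^esub> (x z \<odot>\<^bsub>U\<^esub> f (fst z) (snd z)))"
      unfolding S_def using x c
      by (intro U.finsum_cong') (auto simp: free_module_simps(4) val fc U.smult_assoc1)
    also have "\<dots> = c \<odot>\<^bsub>U\<^esub> G x"
      unfolding S_def G_def using x c fin by (subst U.finsum_smult_ldistr) (auto simp: val fc)
    finally show "G (c \<odot>\<^bsub>?F\<^esub> x) = c \<odot>\<^bsub>U\<^esub> G x" .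
  qed
  have Ggen: "G (free_gen K ?X (v, w)) = f v w" if "v \<in> carrier V" "w \<in> carrier W" for v w
  proof -
    have "G (free_gen K ?X (v, w)) = S (free_gen K ?X (v, w)) {(v, w)}"
      by (rule GS[OF free_gen_closed[OF K]]) (use that in \<open>auto simp: free_gen_def\<close>)
    also have "\<dots> = f v w"
      using that fc[of "(v, w)"] unfolding S_def by (subst U.finsum_insert) (auto simp: free_gen_def)
    finally show ?thesis .
  qed
  note Gadd = linear_map_add[OF Glin] and Gsm = linear_map_smult[OF Glin]
    and Gdiff = linear_map_diff[OF Glin F U] and gcl = free_gen_closed[OF K, of _ ?X]
  let ?ker = "{x \<in> carrier ?F. G x = \<zero>\<^bsub>U\<^esub>}"
  have "tensor_rel K V W \<subseteq> ?ker"
  proof (rule tensor_rel_least)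
    show "submodule ?ker K ?F"
      by (rule F.submoduleI)
        (use linear_map_zero[OF Glin F U] linear_map_minus[OF Glin F U] in \<open>auto simp: Gadd Gsm\<close>)
    have fU: "f v w \<in> carrier U" if "v \<in> carrier V" "w \<in> carrier W" for v w
      using bilinear_closed[OF f] that by simp
    show "tensor_relators K V W \<subseteq> ?ker"
      using tensor_relators_closed[OF V W]
      by (auto simp: tensor_relators_def Let_def Gdiff Gadd Gsm Ggen gcl fU
          bilinear_add[OF f] bilinear_smult[OF f] U.r_neg a_minus_def[of U])
  qed
  then have kern: "G x = \<zero>\<^bsub>U\<^esub>" if "x \<in> ?N" for x using that by auto
  have lift: "tensor_lift K V W U f (?N +>\<^bsub>?F\<^esub> x) = G x" if x: "x \<in> carrier ?F" for x
  proof -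
    have "G y = G x" if "y \<in> ?N +>\<^bsub>?F\<^esub> x" for y
    proof -
      have y: "y \<in> carrier ?F" using N.a_elemrcos_carrier[OF x that] .
      have "y \<ominus>\<^bsub>?F\<^esub> x \<in> ?N" using N.a_rcos_module[of x y] x y that by (simp add: a_minus_def)
      then have "G y \<ominus>\<^bsub>U\<^esub> G x = \<zero>\<^bsub>U\<^esub>" using kern Gdiff[OF y x] by simp
      then show ?thesis
        using linear_map_closed[OF Glin] x y by (simp add: U.minus_eq_iff)
    qed
    then have "G ` (?N +>\<^bsub>?F\<^esub> x) = {G x}" using N.a_rcos_self[OF x] by blast
    then show ?thesis unfolding tensor_lift_def G_def S_def by simp
  qed
  show "linear_map K (tensor K V W) U (tensor_lift K V W U f)"
    unfolding tensor_def
    by (rule linear_mapI)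
      (auto simp: quot_module_carrier quot_module_add_class[OF F N] quot_module_smult_class[OF F N]
        lift Gadd Gsm linear_map_closed[OF Glin])
  show "tensor_lift K V W U f (tens K V W v w) = f v w" if "v \<in> carrier V" "w \<in> carrier W"
    using that unfolding tens_def by (simp add: lift gcl Ggen)
qed

lemma linear_map_tensor_eqI:
  assumes "module K V" "module K W" "linear_map K (tensor K V W) U f" "linear_map K (tensor K V W) U g"
    and "\<And>v w. \<lbrakk>v \<in> carrier V; w \<in> carrier W\<rbrakk> \<Longrightarrow> f (tens K V W v w) = g (tens K V W v w)"
    and "X \<in> carrier (tensor K V W)"
  shows "f X = g X"
  using assms(1,2,6)
  by (induct rule: tensor_induct)
    (simp_all add: assms(5) linear_map_add[OF assms(3)] linear_map_add[OF assms(4)])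

lemma tensor_map:
  assumes V: "module K V" and W: "module K W" and V1: "module K V1" and W1: "module K W1"
    and f: "linear_map K V V1 f" and g: "linear_map K W W1 g"
  shows tensor_map_linear: "linear_map K (tensor K V W) (tensor K V1 W1) (tensor_map K V W V1 W1 f g)"
    and tensor_map_tens: "\<lbrakk>v \<in> carrier V; w \<in> carrier W\<rbrakk>
      \<Longrightarrow> tensor_map K V W V1 W1 f g (tens K V W v w) = tens K V1 W1 (f v) (g w)"
proof -
  have "bilinear_map K V W (tensor K V1 W1) (\<lambda>v w. tens K V1 W1 (f v) (g w))"
    using bilinear_comp[OF tens_bilinear[OF V1 W1] f g linear_map_ident] .
  note * = tensor_lift[OF V W tensor_module[OF V1 W1] this]
  show "linear_map K (tensor K V W) (tensor K V1 W1) (tensor_map K V W V1 W1 f g)"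
    unfolding tensor_map_def by (rule *(1))
  show "tensor_map K V W V1 W1 f g (tens K V W v w) = tens K V1 W1 (f v) (g w)"
    if "v \<in> carrier V" "w \<in> carrier W"
    unfolding tensor_map_def by (rule *(2)[OF that])
qed

subsection \<open>Contraction with a functional\<close>

text \<open>The map \<open>f \<otimes> id : S \<otimes> V \<rightarrow> V\<close> of a functional \<open>f\<close> on \<open>S\<close> is \<^const>\<open>aug_map\<close> for \<open>f\<close>
  in place of an augmentation.\<close>

lemma contraction:
  assumes S: "module K S" and V: "module K V" and f: "functional K S f"
  shows contraction_linear: "linear_map K (tensor K S V) V (aug_map K S f V)"
    and contraction_tens: "\<lbrakk>s \<in> carrier S; v \<in> carrier V\<rbrakk> \<Longrightarrow> aug_map K S f V (tens K S V s v) = f s \<odot>\<^bsub>V\<^esub> v"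
proof -
  interpret V: module K V by fact
  have "bilinear_map K S V V (\<lambda>s v. f s \<odot>\<^bsub>V\<^esub> v)"
  proof (intro bilinear_mapI linear_mapI)
    fix s c v assume *: "s \<in> carrier S" "c \<in> carrier K" "v \<in> carrier V"
    then show "f s \<odot>\<^bsub>V\<^esub> (c \<odot>\<^bsub>V\<^esub> v) = c \<odot>\<^bsub>V\<^esub> (f s \<odot>\<^bsub>V\<^esub> v)"
      using functionalD(1)[OF f] by (metis V.R.m_comm V.smult_assoc1)
  qed (use functionalD[OF f] in \<open>auto simp: V.smult_l_distr V.smult_r_distr V.smult_assoc1\<close>)
  note * = tensor_lift[OF S V V this]
  show "linear_map K (tensor K S V) V (aug_map K S f V)" unfolding aug_map_def by (rule *(1))
  show "aug_map K S f V (tens K S V s v) = f s \<odot>\<^bsub>V\<^esub> v" if "s \<in> carrier S" "v \<in> carrier V"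
    unfolding aug_map_def by (rule *(2)[OF that])
qed

text \<open>On a pure tensor \<open>s \<otimes> v\<close>, the coefficients \<open>f j s\<close> move from the left factor to \<open>v\<close>, where they give
  the contractions.\<close>

lemma tensor_map_expansion:
  assumes S: "module K S" and T: "module K T" and V: "module K V"
    and g: "linear_map K S T g" and J: "finite J"
    and u: "\<And>j. j \<in> J \<Longrightarrow> u j \<in> carrier T" and f: "\<And>j. j \<in> J \<Longrightarrow> functional K S (f j)"
    and exp: "\<And>s. s \<in> carrier S \<Longrightarrow> g s = (\<Oplus>\<^bsub>T\<^esub>j\<in>J. f j s \<odot>\<^bsub>T\<^esub> u j)"
    and X: "X \<in> carrier (tensor K S V)"
  shows "tensor_map K S V T V g (\<lambda>v. v) X = (\<Oplus>\<^bsub>tensor K T V\<^esub>j\<in>J. tens K T V (u j) (aug_map K S (f j) V X))"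
proof (rule linear_map_tensor_eqI[OF S V _ _ _ X])
  interpret T: module K T by fact
  interpret TV: module K "tensor K T V" using T V by simp
  note b = tens_bilinear[OF T V]
  show "linear_map K (tensor K S V) (tensor K T V) (tensor_map K S V T V g (\<lambda>v. v))"
    by (rule tensor_map_linear[OF S V T V g linear_map_ident])
  show "linear_map K (tensor K S V) (tensor K T V)
     (\<lambda>X. \<Oplus>\<^bsub>tensor K T V\<^esub>j\<in>J. tens K T V (u j) (aug_map K S (f j) V X))"
    using S T V
    by (intro linear_map_fsum tensor_module linear_map_comp[OF contraction_linear[OF S V f] bilinear_mapD(1)[OF b u]])
  fix s v assume s: "s \<in> carrier S" and v: "v \<in> carrier V"
  have fs: "f j s \<in> carrier K" if "j \<in> J" for j using functionalD(1)[OF f[OF that] s] .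
  have "tensor_map K S V T V g (\<lambda>v. v) (tens K S V s v) = tens K T V (\<Oplus>\<^bsub>T\<^esub>j\<in>J. f j s \<odot>\<^bsub>T\<^esub> u j) v"
    using tensor_map_tens[OF S V T V g linear_map_ident s v] exp[OF s] by simp
  also have "\<dots> = (\<Oplus>\<^bsub>tensor K T V\<^esub>j\<in>J. tens K T V (f j s \<odot>\<^bsub>T\<^esub> u j) v)"
    by (rule linear_map_finsum[OF bilinear_mapD(2)[OF b v] T tensor_module[OF T V]]) (use u fs in auto)
  also have "\<dots> = (\<Oplus>\<^bsub>tensor K T V\<^esub>j\<in>J. tens K T V (u j) (aug_map K S (f j) V (tens K S V s v)))"
    using u fs v T V
    by (intro TV.finsum_cong')
      (auto simp: contraction_tens[OF S V f s v] bilinear_smult[OF b] intro!: bilinear_closed[OF b] module.smult_closed[OF V])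
  finally show "tensor_map K S V T V g (\<lambda>v. v) (tens K S V s v) = \<dots>" .
qed

subsection \<open>Extension of scalars\<close>

lemma extend_scalars_simps [simp]:
  "carrier (extend_scalars K R V) = carrier (tensor K R V)"
  "\<zero>\<^bsub>extend_scalars K R V\<^esub> = \<zero>\<^bsub>tensor K R V\<^esub>"
  "add (extend_scalars K R V) = add (tensor K R V)"
  by (simp_all add: extend_scalars_def)

lemma extend_scalars_ops [simp]:
  "a_inv (extend_scalars K R V) = a_inv (tensor K R V)"
  "a_minus (extend_scalars K R V) = a_minus (tensor K R V)"
  "finsum (extend_scalars K R V) = finsum (tensor K R V)"
  by (simp_all add: fun_eq_iff a_inv_def a_minus_def m_inv_def finsum_def finprod_def)

lemma algebra_moduleD: "algebra K R \<Longrightarrow> module K R"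
  by (rule algebra.axioms(1))

lemma algebra_mult_bilinear:
  assumes "algebra K R"
  shows "bilinear_map K R R R (mult R)"
proof -
  interpret algebra K R by fact
  have "x \<otimes>\<^bsub>R\<^esub> (c \<odot>\<^bsub>R\<^esub> y) = c \<odot>\<^bsub>R\<^esub> (x \<otimes>\<^bsub>R\<^esub> y)" if "c \<in> carrier K" "x \<in> carrier R" "y \<in> carrier R" for c x y
    using that smult_assoc2[of c y x] by (simp add: m_comm)
  then show ?thesis
    by (intro bilinear_mapI linear_mapI) (auto simp: l_distr r_distr smult_assoc2)
qed

lemma extend_scalars_smult:
  assumes R: "algebra K R" and V: "module K V" and r: "r \<in> carrier R"
  shows extend_scalars_smult_linear:
      "linear_map K (tensor K R V) (tensor K R V) (\<lambda>X. r \<odot>\<^bsub>extend_scalars K R V\<^esub> X)"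
    and extend_scalars_smult_tens: "\<lbrakk>s \<in> carrier R; v \<in> carrier V\<rbrakk>
      \<Longrightarrow> r \<odot>\<^bsub>extend_scalars K R V\<^esub> tens K R V s v = tens K R V (r \<otimes>\<^bsub>R\<^esub> s) v"
proof -
  have R': "module K R" using R by (rule algebra_moduleD)
  note * = tensor_map[OF R' V R' V bilinear_mapD(1)[OF algebra_mult_bilinear[OF R] r] linear_map_ident]
  show "linear_map K (tensor K R V) (tensor K R V) (\<lambda>X. r \<odot>\<^bsub>extend_scalars K R V\<^esub> X)"
    using *(1) by (simp add: extend_scalars_def)
  show "r \<odot>\<^bsub>extend_scalars K R V\<^esub> tens K R V s v = tens K R V (r \<otimes>\<^bsub>R\<^esub> s) v"
    if "s \<in> carrier R" "v \<in> carrier V"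
    using *(2) that by (simp add: extend_scalars_def)
qed

text \<open>On pure tensors this is the multiplicativity of \<open>\<Phi>\<close>.\<close>

lemma tensor_map_smult:
  assumes S1: "algebra K S1" and S2: "algebra K S2" and \<Phi>: "linear_map K S1 S2 \<Phi>"
    and mult: "\<And>s t. \<lbrakk>s \<in> carrier S1; t \<in> carrier S1\<rbrakk> \<Longrightarrow> \<Phi> (s \<otimes>\<^bsub>S1\<^esub> t) = \<Phi> s \<otimes>\<^bsub>S2\<^esub> \<Phi> t"
    and V: "module K V" and s: "s \<in> carrier S1" and X: "X \<in> carrier (tensor K S1 V)"
  shows "tensor_map K S1 V S2 V \<Phi> (\<lambda>v. v) (s \<odot>\<^bsub>extend_scalars K S1 V\<^esub> X) =
    \<Phi> s \<odot>\<^bsub>extend_scalars K S2 V\<^esub> tensor_map K S1 V S2 V \<Phi> (\<lambda>v. v) X"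
proof -
  interpret S1: algebra K S1 by fact
  note m = algebra_moduleD[OF S1] algebra_moduleD[OF S2]
  note l = tensor_map_linear[OF m(1) V m(2) V \<Phi> linear_map_ident]
    and t = tensor_map_tens[OF m(1) V m(2) V \<Phi> linear_map_ident]
  note c = linear_map_closed[OF \<Phi>]
  show ?thesis
    by (rule linear_map_tensor_eqI[OF m(1) V linear_map_comp[OF extend_scalars_smult_linear[OF S1 V s] l]
          linear_map_comp[OF l extend_scalars_smult_linear[OF S2 V c[OF s]]] _ X])
      (simp add: s c t mult extend_scalars_smult_tens[OF S1 V] extend_scalars_smult_tens[OF S2 V])
qed

lemma extend_scalars_module:
  assumes R: "algebra K R" and V: "module K V"
  shows "module R (extend_scalars K R V)"
proof -
  interpret R: algebra K R by fact
  have R': "module K R" using R by (rule algebra_moduleD)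
  interpret T: module K "tensor K R V" using R' V by simp
  let ?E = "extend_scalars K R V" and ?T = "tensor K R V"
  note cl = linear_map_closed[OF extend_scalars_smult_linear[OF R V]]
    and add = linear_map_add[OF extend_scalars_smult_linear[OF R V]]
    and tens = extend_scalars_smult_tens[OF R V] and b = tens_bilinear[OF R' V]
  show ?thesis
  proof (rule moduleI)
    show "cring R" by (rule R.M_cring)
    show "abelian_group ?E"
      by (rule abelian_groupI) (auto simp: T.a_ac intro: T.add.inv_closed T.l_neg)
    show "r \<odot>\<^bsub>?E\<^esub> X \<in> carrier ?E" if "r \<in> carrier R" "X \<in> carrier ?E" for r X
      using cl that by simp
    show "r \<odot>\<^bsub>?E\<^esub> (X \<oplus>\<^bsub>?E\<^esub> Y) = r \<odot>\<^bsub>?E\<^esub> X \<oplus>\<^bsub>?E\<^esub> r \<odot>\<^bsub>?E\<^esub> Y"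
      if "r \<in> carrier R" "X \<in> carrier ?E" "Y \<in> carrier ?E" for r X Y
      using add that by simp
    show "\<one>\<^bsub>R\<^esub> \<odot>\<^bsub>?E\<^esub> X = X" if "X \<in> carrier ?E" for X
      using R' V that[simplified]
      by (induct rule: tensor_induct) (simp_all add: tens add)
    show "(r \<otimes>\<^bsub>R\<^esub> s) \<odot>\<^bsub>?E\<^esub> X = r \<odot>\<^bsub>?E\<^esub> (s \<odot>\<^bsub>?E\<^esub> X)"
      if "r \<in> carrier R" "s \<in> carrier R" "X \<in> carrier ?E" for r s X
      using R' V that(3)[simplified]
      by (induct rule: tensor_induct) (simp_all add: tens add that cl R.m_assoc)
    show "(r \<oplus>\<^bsub>R\<^esub> s) \<odot>\<^bsub>?E\<^esub> X = r \<odot>\<^bsub>?E\<^esub> X \<oplus>\<^bsub>?E\<^esub> s \<odot>\<^bsub>?E\<^esub> X"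
      if "r \<in> carrier R" "s \<in> carrier R" "X \<in> carrier ?E" for r s X
      using R' V that(3)[simplified]
      by (induct rule: tensor_induct)
        (simp_all add: tens add that cl R.l_distr bilinear_add[OF b] T.a_ac)
  qed
qed

section \<open>Cochains\<close>

lemma args0_update: "\<lbrakk>xs \<in> args0 L n; x \<in> carrier L\<rbrakk> \<Longrightarrow> xs[i := x] \<in> args0 L n"
  using set_update_subset_insert by (fastforce simp: args0_def)

lemma args1_update:
  "\<lbrakk>(xs, as) \<in> args1 A L n; x \<in> carrier L\<rbrakk> \<Longrightarrow> (xs[i := x], as) \<in> args1 A L n"
  "\<lbrakk>(xs, as) \<in> args1 A L n; a \<in> carrier A\<rbrakk> \<Longrightarrow> (xs, as[i := a]) \<in> args1 A L n"
  using set_update_subset_insert by (fastforce simp: args1_def)+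

lemma cochains_simps:
  "\<zero>\<^bsub>cochains K A L n\<^esub> = ((\<lambda>xs\<in>args0 L n. \<zero>\<^bsub>L\<^esub>), (\<lambda>z\<in>args1 A L n. \<zero>\<^bsub>A\<^esub>))"
  "c \<oplus>\<^bsub>cochains K A L n\<^esub> c' =
     ((\<lambda>xs\<in>args0 L n. fst c xs \<oplus>\<^bsub>L\<^esub> fst c' xs), (\<lambda>z\<in>args1 A L n. snd c z \<oplus>\<^bsub>A\<^esub> snd c' z))"
  "k \<odot>\<^bsub>cochains K A L n\<^esub> c =
     ((\<lambda>xs\<in>args0 L n. k \<odot>\<^bsub>L\<^esub> fst c xs), (\<lambda>z\<in>args1 A L n. k \<odot>\<^bsub>A\<^esub> snd c z))"
  by (simp_all add: cochains_def case_prod_beta)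

lemma cochains_carrier_iff:
  "c \<in> carrier (cochains K A L n) \<longleftrightarrow>
     fst c \<in> args0 L n \<rightarrow>\<^sub>E carrier L \<and>
     (\<forall>xs\<in>args0 L n. \<forall>i<n. linear_map K L L (\<lambda>x. fst c (xs[i := x]))) \<and>
     snd c \<in> args1 A L n \<rightarrow>\<^sub>E carrier A \<and>
     (\<forall>(xs, as)\<in>args1 A L n.
        (\<forall>i<length xs. linear_map K L A (\<lambda>x. snd c (xs[i := x], as))) \<and>
        (\<forall>i<length as. linear_map K A A (\<lambda>a. snd c (xs, as[i := a]))))"
  by (simp add: cochains_def case_prod_beta)

lemma cochain_closed:
  assumes "c \<in> carrier (cochains K A L n)"
  shows "xs \<in> args0 L n \<Longrightarrow> fst c xs \<in> carrier L" and "z \<in> args1 A L n \<Longrightarrow> snd c z \<in> carrier A"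
  using assms by (auto simp: cochains_carrier_iff)

lemma cochain_eqI:
  assumes "c \<in> carrier (cochains K A L n)" "c' \<in> carrier (cochains K A L n)"
    and "\<And>xs. xs \<in> args0 L n \<Longrightarrow> fst c xs = fst c' xs"
    and "\<And>z. z \<in> args1 A L n \<Longrightarrow> snd c z = snd c' z"
  shows "c = c'"
proof (rule prod_eqI)
  show "fst c = fst c'"
    using assms by (intro PiE_ext[of _ "args0 L n" "\<lambda>_. carrier L"]) (simp_all add: cochains_carrier_iff)
  show "snd c = snd c'"
    using assms by (intro PiE_ext[of _ "args1 A L n" "\<lambda>_. carrier A"]) (simp_all add: cochains_carrier_iff)
qed

lemma cochains_module:
  assumes A: "module K A" and L: "module K L"
  shows "module K (cochains K A L n)"
proof -
  interpret A: module K A by fact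
  interpret L: module K L by fact
  let ?C = "cochains K A L n"
  have lin0: "linear_map K L L (\<lambda>x. fst c (xs[i := x]))"
    if "c \<in> carrier ?C" "xs \<in> args0 L n" "i < n" for c xs i
    using that by (simp add: cochains_carrier_iff)
  have lin1: "linear_map K L A (\<lambda>x. snd c (xs[i := x], as))"
    if "c \<in> carrier ?C" "(xs, as) \<in> args1 A L n" "i < length xs" for c xs as i
    using that by (force simp: cochains_carrier_iff)
  have lin2: "linear_map K A A (\<lambda>a. snd c (xs, as[i := a]))"
    if "c \<in> carrier ?C" "(xs, as) \<in> args1 A L n" "i < length as" for c xs as i
    using that by (force simp: cochains_carrier_iff)
  note cl = cochain_closed
  have zero: "\<zero>\<^bsub>?C\<^esub> \<in> carrier ?C"
    unfolding cochains_carrier_iff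
    by (auto simp: cochains_simps args0_update args1_update intro!: linear_mapI)
  have add: "c \<oplus>\<^bsub>?C\<^esub> d \<in> carrier ?C" if c: "c \<in> carrier ?C" and d: "d \<in> carrier ?C" for c d
    unfolding cochains_carrier_iff
  proof (safe)
    fix xs i assume *: "xs \<in> args0 L n" "i < n"
    show "linear_map K L L (\<lambda>x. fst (c \<oplus>\<^bsub>?C\<^esub> d) (xs[i := x]))"
      by (rule linear_map_cong[OF linear_map_plus[OF lin0[OF c *] lin0[OF d *] L L] L])
        (simp add: cochains_simps args0_update *)
  next
    fix xs as i assume *: "(xs, as) \<in> args1 A L n" "i < length xs"
    show "linear_map K L A (\<lambda>x. snd (c \<oplus>\<^bsub>?C\<^esub> d) (xs[i := x], as))"
      by (rule linear_map_cong[OF linear_map_plus[OF lin1[OF c *] lin1[OF d *] L A] L])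
        (simp add: cochains_simps args1_update *)
  next
    fix xs as i assume *: "(xs, as) \<in> args1 A L n" "i < length as"
    show "linear_map K A A (\<lambda>a. snd (c \<oplus>\<^bsub>?C\<^esub> d) (xs, as[i := a]))"
      by (rule linear_map_cong[OF linear_map_plus[OF lin2[OF c *] lin2[OF d *] A A] A])
        (simp add: cochains_simps args1_update *)
  qed (auto simp: cochains_simps cl[OF c] cl[OF d])
  have smult: "k \<odot>\<^bsub>?C\<^esub> c \<in> carrier ?C" if k: "k \<in> carrier K" and c: "c \<in> carrier ?C" for k c
    unfolding cochains_carrier_iff
  proof (safe)
    fix xs i assume *: "xs \<in> args0 L n" "i < n"
    show "linear_map K L L (\<lambda>x. fst (k \<odot>\<^bsub>?C\<^esub> c) (xs[i := x]))"
      by (rule linear_map_cong[OF linear_map_scale[OF lin0[OF c *] L L k] L])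
        (simp add: cochains_simps args0_update *)
  next
    fix xs as i assume *: "(xs, as) \<in> args1 A L n" "i < length xs"
    show "linear_map K L A (\<lambda>x. snd (k \<odot>\<^bsub>?C\<^esub> c) (xs[i := x], as))"
      by (rule linear_map_cong[OF linear_map_scale[OF lin1[OF c *] L A k] L])
        (simp add: cochains_simps args1_update *)
  next
    fix xs as i assume *: "(xs, as) \<in> args1 A L n" "i < length as"
    show "linear_map K A A (\<lambda>a. snd (k \<odot>\<^bsub>?C\<^esub> c) (xs, as[i := a]))"
      by (rule linear_map_cong[OF linear_map_scale[OF lin2[OF c *] A A k] A])
        (simp add: cochains_simps args1_update *)
  qed (auto simp: cochains_simps cl[OF c] k)
  have ev: "fst (c \<oplus>\<^bsub>?C\<^esub> d) xs = fst c xs \<oplus>\<^bsub>L\<^esub> fst d xs" "fst (k \<odot>\<^bsub>?C\<^esub> c) xs = k \<odot>\<^bsub>L\<^esub> fst c xs"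
      "fst \<zero>\<^bsub>?C\<^esub> xs = \<zero>\<^bsub>L\<^esub>" if "xs \<in> args0 L n" for c d k xs
    using that by (simp_all add: cochains_simps)
  have ev1: "snd (c \<oplus>\<^bsub>?C\<^esub> d) z = snd c z \<oplus>\<^bsub>A\<^esub> snd d z" "snd (k \<odot>\<^bsub>?C\<^esub> c) z = k \<odot>\<^bsub>A\<^esub> snd c z"
      "snd \<zero>\<^bsub>?C\<^esub> z = \<zero>\<^bsub>A\<^esub>" if "z \<in> args1 A L n" for c d k z
    using that by (simp_all add: cochains_simps)
  show ?thesis
  proof (rule moduleI)
    show "cring K" using A by (simp add: module_def)
    show "abelian_group ?C"
    proof (rule abelian_groupI)
      fix c assume c: "c \<in> carrier ?C"
      let ?m = "(\<ominus>\<^bsub>K\<^esub> \<one>\<^bsub>K\<^esub>) \<odot>\<^bsub>?C\<^esub> c"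
      have m: "?m \<in> carrier ?C" using smult c by simp
      have "?m \<oplus>\<^bsub>?C\<^esub> c = \<zero>\<^bsub>?C\<^esub>"
        using c m by (intro cochain_eqI[of _ K A L n] add zero)
          (simp_all add: ev ev1 cl[OF c] L.smult_l_minus A.smult_l_minus L.l_neg A.l_neg)
      then show "\<exists>y\<in>carrier ?C. y \<oplus>\<^bsub>?C\<^esub> c = \<zero>\<^bsub>?C\<^esub>" using m by blast
    qed (intro add zero cochain_eqI[of _ K A L n]; simp add: ev ev1 cl add zero L.a_ac A.a_ac)+
  qed (use smult in \<open>(intro add smult cochain_eqI[of _ K A L n]; simp add: ev ev1 cl add smult
      L.smult_l_distr L.smult_r_distr L.smult_assoc1 A.smult_l_distr A.smult_r_distr A.smult_assoc1)+\<close>)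
qed

lemma cochains_eval:
  "xs \<in> args0 L n \<Longrightarrow> fst (c \<oplus>\<^bsub>cochains K A L n\<^esub> d) xs = fst c xs \<oplus>\<^bsub>L\<^esub> fst d xs"
  "z \<in> args1 A L n \<Longrightarrow> snd (c \<oplus>\<^bsub>cochains K A L n\<^esub> d) z = snd c z \<oplus>\<^bsub>A\<^esub> snd d z"
  "xs \<in> args0 L n \<Longrightarrow> fst (k \<odot>\<^bsub>cochains K A L n\<^esub> c) xs = k \<odot>\<^bsub>L\<^esub> fst c xs"
  "z \<in> args1 A L n \<Longrightarrow> snd (k \<odot>\<^bsub>cochains K A L n\<^esub> c) z = k \<odot>\<^bsub>A\<^esub> snd c z"
  "xs \<in> args0 L n \<Longrightarrow> fst \<zero>\<^bsub>cochains K A L n\<^esub> xs = \<zero>\<^bsub>L\<^esub>"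
  "z \<in> args1 A L n \<Longrightarrow> snd \<zero>\<^bsub>cochains K A L n\<^esub> z = \<zero>\<^bsub>A\<^esub>"
  by (simp_all add: cochains_simps)

lemma cochains_extensional:
  "fst (c \<oplus>\<^bsub>cochains K A L n\<^esub> d) \<in> extensional (args0 L n)"
  "snd (c \<oplus>\<^bsub>cochains K A L n\<^esub> d) \<in> extensional (args1 A L n)"
  "fst (k \<odot>\<^bsub>cochains K A L n\<^esub> c) \<in> extensional (args0 L n)"
  "snd (k \<odot>\<^bsub>cochains K A L n\<^esub> c) \<in> extensional (args1 A L n)"
  "fst \<zero>\<^bsub>cochains K A L n\<^esub> \<in> extensional (args0 L n)"
  "snd \<zero>\<^bsub>cochains K A L n\<^esub> \<in> extensional (args1 A L n)"
  by (simp_all add: cochains_simps)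

subsection \<open>The coboundary operators on short lists\<close>

lemma atLeast1_upto:
  "{1..0::nat} = {}" "{1..1::nat} = {1}" "{1..2::nat} = {1, 2}" "{1..3::nat} = {1, 2, 3}"
  by auto

lemma pairs_upto:
  "{(i, j). (1::nat) \<le> i \<and> i < j \<and> j \<le> 0 + 1} = {}"
  "{(i, j). (1::nat) \<le> i \<and> i < j \<and> j \<le> 1 + 1} = {(1, 2)}"
  "{(i, j). (1::nat) \<le> i \<and> i < j \<and> j \<le> 2 + 1} = {(1, 2), (1, 3), (2, 3)}"
  "{(i, j). (1::nat) \<le> i \<and> i < j \<and> j \<le> 3 + 1} = {(1, 2), (1, 3), (1, 4), (2, 3), (2, 4), (3, 4)}"
  by auto

lemma length_minus_one:
  "length [x] - 1 = 0" "length [x, y] - 1 = 1" "length [x, y, z] - 1 = 2" "length [x, y, z, w] - 1 = 3"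
  by simp_all

lemma signed_simps:
  "signed V 0 v = v" "signed V (Suc 0) v = \<ominus>\<^bsub>V\<^esub> v" "signed V (Suc (Suc n)) v = signed V n v"
  by (simp_all add: signed_def)

text \<open>Only the coboundaries \<open>C\<^sup>2 \<rightarrow> C\<^sup>3\<close> and \<open>C\<^sup>3 \<rightarrow> C\<^sup>4\<close> enter the argument, so the sums over
  indices are expanded once and for all for lists of at most four entries.\<close>

lemma hochschild_cobdry_short:
  fixes A :: "('k, 'a) module"
  assumes A: "abelian_group A"
    and "\<And>u v. \<lbrakk>u \<in> carrier A; v \<in> carrier A\<rbrakk> \<Longrightarrow> u \<otimes>\<^bsub>A\<^esub> v \<in> carrier A"
    and "\<And>as. set as \<subseteq> carrier A \<Longrightarrow> length as = n \<Longrightarrow> f as \<in> carrier A"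
    and "a \<in> carrier A" "b \<in> carrier A" "c \<in> carrier A" "d \<in> carrier A"
  shows "n = 1 \<Longrightarrow> hochschild_cobdry A f [a, b] = a \<otimes>\<^bsub>A\<^esub> f [b] \<ominus>\<^bsub>A\<^esub> f [a \<otimes>\<^bsub>A\<^esub> b] \<oplus>\<^bsub>A\<^esub> f [a] \<otimes>\<^bsub>A\<^esub> b"
    and "n = 2 \<Longrightarrow> hochschild_cobdry A f [a, b, c] =
      a \<otimes>\<^bsub>A\<^esub> f [b, c] \<ominus>\<^bsub>A\<^esub> f [a \<otimes>\<^bsub>A\<^esub> b, c] \<oplus>\<^bsub>A\<^esub> f [a, b \<otimes>\<^bsub>A\<^esub> c] \<ominus>\<^bsub>A\<^esub> f [a, b] \<otimes>\<^bsub>A\<^esub> c"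
    and "n = 3 \<Longrightarrow> hochschild_cobdry A f [a, b, c, d] =
      a \<otimes>\<^bsub>A\<^esub> f [b, c, d] \<ominus>\<^bsub>A\<^esub> f [a \<otimes>\<^bsub>A\<^esub> b, c, d] \<oplus>\<^bsub>A\<^esub> f [a, b \<otimes>\<^bsub>A\<^esub> c, d]
        \<ominus>\<^bsub>A\<^esub> f [a, b, c \<otimes>\<^bsub>A\<^esub> d] \<oplus>\<^bsub>A\<^esub> f [a, b, c] \<otimes>\<^bsub>A\<^esub> d"
proof -
  interpret A: abelian_group A by fact
  note [simp] = assms(2-)
  show "hochschild_cobdry A f [a, b] = a \<otimes>\<^bsub>A\<^esub> f [b] \<ominus>\<^bsub>A\<^esub> f [a \<otimes>\<^bsub>A\<^esub> b] \<oplus>\<^bsub>A\<^esub> f [a] \<otimes>\<^bsub>A\<^esub> b"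
    if n: "n = 1"
    unfolding hochschild_cobdry_def Let_def length_minus_one atLeast1_upto
    by (simp add: n signed_def A.signed_sum_simps)
  show "hochschild_cobdry A f [a, b, c] =
      a \<otimes>\<^bsub>A\<^esub> f [b, c] \<ominus>\<^bsub>A\<^esub> f [a \<otimes>\<^bsub>A\<^esub> b, c] \<oplus>\<^bsub>A\<^esub> f [a, b \<otimes>\<^bsub>A\<^esub> c] \<ominus>\<^bsub>A\<^esub> f [a, b] \<otimes>\<^bsub>A\<^esub> c"
    if n: "n = 2"
    unfolding hochschild_cobdry_def Let_def length_minus_one atLeast1_upto
    by (simp add: n signed_def A.signed_sum_simps)
  show "hochschild_cobdry A f [a, b, c, d] =
      a \<otimes>\<^bsub>A\<^esub> f [b, c, d] \<ominus>\<^bsub>A\<^esub> f [a \<otimes>\<^bsub>A\<^esub> b, c, d] \<oplus>\<^bsub>A\<^esub> f [a, b \<otimes>\<^bsub>A\<^esub> c, d]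
        \<ominus>\<^bsub>A\<^esub> f [a, b, c \<otimes>\<^bsub>A\<^esub> d] \<oplus>\<^bsub>A\<^esub> f [a, b, c] \<otimes>\<^bsub>A\<^esub> d"
    if n: "n = 3"
    unfolding hochschild_cobdry_def Let_def length_minus_one atLeast1_upto
    by (simp add: n signed_def A.signed_sum_simps)
qed

lemma leibniz_cobdry_short:
  fixes L :: "('k, 'l) module" and W :: "('k, 'w) module"
  assumes W: "abelian_group W"
    and "\<And>u v. \<lbrakk>u \<in> carrier L; v \<in> carrier L\<rbrakk> \<Longrightarrow> u \<otimes>\<^bsub>L\<^esub> v \<in> carrier L"
    and "\<And>x ys. x \<in> carrier L \<Longrightarrow> set ys \<subseteq> carrier L \<Longrightarrow> length ys = n \<Longrightarrow> l x ys \<in> carrier W"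
    and "\<And>x ys. x \<in> carrier L \<Longrightarrow> set ys \<subseteq> carrier L \<Longrightarrow> length ys = n \<Longrightarrow> r ys x \<in> carrier W"
    and "\<And>ys. set ys \<subseteq> carrier L \<Longrightarrow> length ys = n \<Longrightarrow> f ys \<in> carrier W"
    and "x \<in> carrier L" "y \<in> carrier L" "z \<in> carrier L" "w \<in> carrier L"
  shows "n = 0 \<Longrightarrow> leibniz_cobdry L W l r f [x] = r [] x"
    and "n = 1 \<Longrightarrow> leibniz_cobdry L W l r f [x, y] = l x [y] \<oplus>\<^bsub>W\<^esub> r [x] y \<ominus>\<^bsub>W\<^esub> f [x \<otimes>\<^bsub>L\<^esub> y]"
    and "n = 2 \<Longrightarrow> leibniz_cobdry L W l r f [x, y, z] =
      l y [x, z] \<ominus>\<^bsub>W\<^esub> l x [y, z] \<oplus>\<^bsub>W\<^esub> r [x, y] z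
        \<oplus>\<^bsub>W\<^esub> f [x \<otimes>\<^bsub>L\<^esub> y, z] \<oplus>\<^bsub>W\<^esub> f [y, x \<otimes>\<^bsub>L\<^esub> z] \<ominus>\<^bsub>W\<^esub> f [x, y \<otimes>\<^bsub>L\<^esub> z]"
    and "n = 3 \<Longrightarrow> leibniz_cobdry L W l r f [x, y, z, w] =
      l x [y, z, w] \<ominus>\<^bsub>W\<^esub> l y [x, z, w] \<oplus>\<^bsub>W\<^esub> l z [x, y, w] \<oplus>\<^bsub>W\<^esub> r [x, y, z] w
        \<ominus>\<^bsub>W\<^esub> f [x \<otimes>\<^bsub>L\<^esub> y, z, w] \<ominus>\<^bsub>W\<^esub> f [y, x \<otimes>\<^bsub>L\<^esub> z, w] \<ominus>\<^bsub>W\<^esub> f [y, z, x \<otimes>\<^bsub>L\<^esub> w]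
        \<oplus>\<^bsub>W\<^esub> f [x, y \<otimes>\<^bsub>L\<^esub> z, w] \<oplus>\<^bsub>W\<^esub> f [x, z, y \<otimes>\<^bsub>L\<^esub> w] \<ominus>\<^bsub>W\<^esub> f [x, y, z \<otimes>\<^bsub>L\<^esub> w]"
proof -
  interpret W: abelian_group W by fact
  note [simp] = assms(2-)
  show "leibniz_cobdry L W l r f [x] = r [] x" if n: "n = 0"
    unfolding leibniz_cobdry_def Let_def length_minus_one atLeast1_upto pairs_upto
    by (simp add: n signed_def)
  show "leibniz_cobdry L W l r f [x, y] = l x [y] \<oplus>\<^bsub>W\<^esub> r [x] y \<ominus>\<^bsub>W\<^esub> f [x \<otimes>\<^bsub>L\<^esub> y]" if n: "n = 1"
    unfolding leibniz_cobdry_def Let_def length_minus_one atLeast1_upto pairs_upto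
    by (simp add: n signed_def omit_def W.signed_sum_simps)
  show "leibniz_cobdry L W l r f [x, y, z] =
      l y [x, z] \<ominus>\<^bsub>W\<^esub> l x [y, z] \<oplus>\<^bsub>W\<^esub> r [x, y] z
        \<oplus>\<^bsub>W\<^esub> f [x \<otimes>\<^bsub>L\<^esub> y, z] \<oplus>\<^bsub>W\<^esub> f [y, x \<otimes>\<^bsub>L\<^esub> z] \<ominus>\<^bsub>W\<^esub> f [x, y \<otimes>\<^bsub>L\<^esub> z]" if n: "n = 2"
    unfolding leibniz_cobdry_def Let_def length_minus_one atLeast1_upto pairs_upto
    by (simp add: n signed_simps omit_def eval_nat_numeral W.signed_sum_simps)
  show "leibniz_cobdry L W l r f [x, y, z, w] =
      l x [y, z, w] \<ominus>\<^bsub>W\<^esub> l y [x, z, w] \<oplus>\<^bsub>W\<^esub> l z [x, y, w] \<oplus>\<^bsub>W\<^esub> r [x, y, z] w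
        \<ominus>\<^bsub>W\<^esub> f [x \<otimes>\<^bsub>L\<^esub> y, z, w] \<ominus>\<^bsub>W\<^esub> f [y, x \<otimes>\<^bsub>L\<^esub> z, w] \<ominus>\<^bsub>W\<^esub> f [y, z, x \<otimes>\<^bsub>L\<^esub> w]
        \<oplus>\<^bsub>W\<^esub> f [x, y \<otimes>\<^bsub>L\<^esub> z, w] \<oplus>\<^bsub>W\<^esub> f [x, z, y \<otimes>\<^bsub>L\<^esub> w] \<ominus>\<^bsub>W\<^esub> f [x, y, z \<otimes>\<^bsub>L\<^esub> w]" if n: "n = 3"
    unfolding leibniz_cobdry_def Let_def length_minus_one atLeast1_upto pairs_upto
    by (simp add: n signed_simps omit_def eval_nat_numeral W.signed_sum_simps)
qed

lemma hom_action_short: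
  fixes A :: "('k, 'a) module"
  assumes A: "abelian_group A"
    and "\<And>u. u \<in> carrier A \<Longrightarrow> \<mu> x u \<in> carrier A"
    and "\<And>as. set as \<subseteq> carrier A \<Longrightarrow> length as = n \<Longrightarrow> f as \<in> carrier A"
    and "a \<in> carrier A" "b \<in> carrier A" "c \<in> carrier A"
  shows "n = 1 \<Longrightarrow> hom_action A \<mu> x f [a] = \<mu> x (f [a]) \<ominus>\<^bsub>A\<^esub> f [\<mu> x a]"
    and "n = 2 \<Longrightarrow> hom_action A \<mu> x f [a, b] = \<mu> x (f [a, b]) \<ominus>\<^bsub>A\<^esub> f [\<mu> x a, b] \<ominus>\<^bsub>A\<^esub> f [a, \<mu> x b]"
    and "n = 3 \<Longrightarrow> hom_action A \<mu> x f [a, b, c] =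
      \<mu> x (f [a, b, c]) \<ominus>\<^bsub>A\<^esub> f [\<mu> x a, b, c] \<ominus>\<^bsub>A\<^esub> f [a, \<mu> x b, c] \<ominus>\<^bsub>A\<^esub> f [a, b, \<mu> x c]"
proof -
  interpret A: abelian_group A by fact
  note [simp] = assms(2-)
  have len: "length [a] = 1" "length [a, b] = 2" "length [a, b, c] = 3" by simp_all
  show "hom_action A \<mu> x f [a] = \<mu> x (f [a]) \<ominus>\<^bsub>A\<^esub> f [\<mu> x a]" if n: "n = 1"
    unfolding hom_action_def len atLeast1_upto by (simp add: n)
  show "hom_action A \<mu> x f [a, b] = \<mu> x (f [a, b]) \<ominus>\<^bsub>A\<^esub> f [\<mu> x a, b] \<ominus>\<^bsub>A\<^esub> f [a, \<mu> x b]" if n: "n = 2"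
    unfolding hom_action_def len atLeast1_upto by (simp add: n A.signed_sum_simps)
  show "hom_action A \<mu> x f [a, b, c] =
      \<mu> x (f [a, b, c]) \<ominus>\<^bsub>A\<^esub> f [\<mu> x a, b, c] \<ominus>\<^bsub>A\<^esub> f [a, \<mu> x b, c] \<ominus>\<^bsub>A\<^esub> f [a, b, \<mu> x c]" if n: "n = 3"
    unfolding hom_action_def len atLeast1_upto
    by (simp add: n numeral_2_eq_2 numeral_3_eq_3 A.signed_sum_simps)
qed

section \<open>Cochains of degree 2 and 3\<close>

definition trilinear_map ::
  "('k, 'z) ring_scheme \<Rightarrow> ('k, 'u) module \<Rightarrow> ('k, 'v) module \<Rightarrow> ('k, 'w) module \<Rightarrow> ('k, 'x) module
    \<Rightarrow> ('u \<Rightarrow> 'v \<Rightarrow> 'w \<Rightarrow> 'x) \<Rightarrow> bool" where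
  "trilinear_map K U V W X f \<longleftrightarrow>
     (\<forall>v\<in>carrier V. \<forall>w\<in>carrier W. linear_map K U X (\<lambda>u. f u v w)) \<and>
     (\<forall>u\<in>carrier U. \<forall>w\<in>carrier W. linear_map K V X (\<lambda>v. f u v w)) \<and>
     (\<forall>u\<in>carrier U. \<forall>v\<in>carrier V. linear_map K W X (f u v))"

lemma trilinear_closed:
  "\<lbrakk>trilinear_map K U V W X f; u \<in> carrier U; v \<in> carrier V; w \<in> carrier W\<rbrakk> \<Longrightarrow> f u v w \<in> carrier X"
  unfolding trilinear_map_def by (blast intro: linear_map_closed)

lemma trilinear_mapD:
  assumes "trilinear_map K U V W X f"
  shows "\<lbrakk>v \<in> carrier V; w \<in> carrier W\<rbrakk> \<Longrightarrow> linear_map K U X (\<lambda>u. f u v w)"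
    and "\<lbrakk>u \<in> carrier U; w \<in> carrier W\<rbrakk> \<Longrightarrow> linear_map K V X (\<lambda>v. f u v w)"
    and "\<lbrakk>u \<in> carrier U; v \<in> carrier V\<rbrakk> \<Longrightarrow> linear_map K W X (f u v)"
  using assms by (simp_all add: trilinear_map_def)

lemma trilinear_comp:
  assumes "trilinear_map K U V W X f" "linear_map K U' U g" "linear_map K V' V h"
    "linear_map K W' W l" "linear_map K X X' k"
  shows "trilinear_map K U' V' W' X' (\<lambda>u v w. k (f (g u) (h v) (l w)))"
  using assms by (auto simp: trilinear_map_def linear_map_def Pi_def)

lemma args_short_cases:
  "xs \<in> args0 L 2 \<longleftrightarrow> (\<exists>x y. xs = [x, y] \<and> x \<in> carrier L \<and> y \<in> carrier L)" (is ?P1)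
  "xs \<in> args0 L 3 \<longleftrightarrow> (\<exists>x y z. xs = [x, y, z] \<and> x \<in> carrier L \<and> y \<in> carrier L \<and> z \<in> carrier L)" (is ?P2)
  "xs \<in> args0 L 4 \<longleftrightarrow> (\<exists>x y z w. xs = [x, y, z, w] \<and>
     x \<in> carrier L \<and> y \<in> carrier L \<and> z \<in> carrier L \<and> w \<in> carrier L)" (is ?P3)
  "(xs, as) \<in> args1 A L 2 \<longleftrightarrow>
     (\<exists>a b. xs = [] \<and> as = [a, b] \<and> a \<in> carrier A \<and> b \<in> carrier A) \<or>
     (\<exists>x a. xs = [x] \<and> as = [a] \<and> x \<in> carrier L \<and> a \<in> carrier A)" (is ?P4)
  "(xs, as) \<in> args1 A L 3 \<longleftrightarrow>
     (\<exists>a b c. xs = [] \<and> as = [a, b, c] \<and> a \<in> carrier A \<and> b \<in> carrier A \<and> c \<in> carrier A) \<or>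
     (\<exists>x a b. xs = [x] \<and> as = [a, b] \<and> x \<in> carrier L \<and> a \<in> carrier A \<and> b \<in> carrier A) \<or>
     (\<exists>x y a. xs = [x, y] \<and> as = [a] \<and> x \<in> carrier L \<and> y \<in> carrier L \<and> a \<in> carrier A)" (is ?P5)
  "(xs, as) \<in> args1 A L 4 \<longleftrightarrow>
     (\<exists>a b c d. xs = [] \<and> as = [a, b, c, d] \<and>
        a \<in> carrier A \<and> b \<in> carrier A \<and> c \<in> carrier A \<and> d \<in> carrier A) \<or>
     (\<exists>x a b c. xs = [x] \<and> as = [a, b, c] \<and>
        x \<in> carrier L \<and> a \<in> carrier A \<and> b \<in> carrier A \<and> c \<in> carrier A) \<or>
     (\<exists>x y a b. xs = [x, y] \<and> as = [a, b] \<and>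
        x \<in> carrier L \<and> y \<in> carrier L \<and> a \<in> carrier A \<and> b \<in> carrier A) \<or>
     (\<exists>x y z a. xs = [x, y, z] \<and> as = [a] \<and>
        x \<in> carrier L \<and> y \<in> carrier L \<and> z \<in> carrier L \<and> a \<in> carrier A)" (is ?P6)
proof -
  have split: "length xs + length as = 2 \<and> as \<noteq> [] \<longleftrightarrow>
      length xs = 0 \<and> length as = 2 \<or> length xs = 1 \<and> length as = 1"
    "length xs + length as = 3 \<and> as \<noteq> [] \<longleftrightarrow>
      length xs = 0 \<and> length as = 3 \<or> length xs = 1 \<and> length as = 2 \<or> length xs = 2 \<and> length as = 1"
    "length xs + length as = 4 \<and> as \<noteq> [] \<longleftrightarrow>
      length xs = 0 \<and> length as = 4 \<or> length xs = 1 \<and> length as = 3 \<or>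
      length xs = 2 \<and> length as = 2 \<or> length xs = 3 \<and> length as = 1"
    unfolding length_greater_0_conv[symmetric] by arith+
  have mem: "(xs, as) \<in> args1 A L n \<longleftrightarrow>
      set xs \<subseteq> carrier L \<and> set as \<subseteq> carrier A \<and> length xs + length as = n \<and> as \<noteq> []" for n
    by (auto simp: args1_def)
  show ?P1 ?P2 ?P3 by (auto simp: args0_def eval_nat_numeral length_Suc_conv)
  show ?P4 ?P5 ?P6 unfolding mem split by (auto simp: eval_nat_numeral length_Suc_conv)
qed

definition cochain2 ::
  "('k, 'a) module \<Rightarrow> ('k, 'l) module \<Rightarrow> ('a \<Rightarrow> 'a \<Rightarrow> 'a) \<Rightarrow> ('l \<Rightarrow> 'a \<Rightarrow> 'a) \<Rightarrow> ('l \<Rightarrow> 'l \<Rightarrow> 'l)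
    \<Rightarrow> ('a, 'l) cochain" where
  "cochain2 A L \<alpha> \<beta> \<gamma> =
     ((\<lambda>xs\<in>args0 L 2. \<gamma> (xs ! 0) (xs ! 1)),
      (\<lambda>(xs, as)\<in>args1 A L 2. if xs = [] then \<alpha> (as ! 0) (as ! 1) else \<beta> (xs ! 0) (as ! 0)))"

definition cochain3 ::
  "('k, 'a) module \<Rightarrow> ('k, 'l) module \<Rightarrow> ('a \<Rightarrow> 'a \<Rightarrow> 'a \<Rightarrow> 'a) \<Rightarrow> ('l \<Rightarrow> 'a \<Rightarrow> 'a \<Rightarrow> 'a)
    \<Rightarrow> ('l \<Rightarrow> 'l \<Rightarrow> 'a \<Rightarrow> 'a) \<Rightarrow> ('l \<Rightarrow> 'l \<Rightarrow> 'l \<Rightarrow> 'l) \<Rightarrow> ('a, 'l) cochain" where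
  "cochain3 A L tA t1 t2 tL =
     ((\<lambda>xs\<in>args0 L 3. tL (xs ! 0) (xs ! 1) (xs ! 2)),
      (\<lambda>(xs, as)\<in>args1 A L 3.
         if length xs = 0 then tA (as ! 0) (as ! 1) (as ! 2)
         else if length xs = 1 then t1 (xs ! 0) (as ! 0) (as ! 1)
         else t2 (xs ! 0) (xs ! 1) (as ! 0)))"

lemma cochain2_values:
  "\<lbrakk>a \<in> carrier A; b \<in> carrier A\<rbrakk> \<Longrightarrow> snd (cochain2 A L \<alpha> \<beta> \<gamma>) ([], [a, b]) = \<alpha> a b"
  "\<lbrakk>x \<in> carrier L; a \<in> carrier A\<rbrakk> \<Longrightarrow> snd (cochain2 A L \<alpha> \<beta> \<gamma>) ([x], [a]) = \<beta> x a"
  "\<lbrakk>x \<in> carrier L; y \<in> carrier L\<rbrakk> \<Longrightarrow> fst (cochain2 A L \<alpha> \<beta> \<gamma>) [x, y] = \<gamma> x y"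
  by (simp_all add: cochain2_def args0_def args1_def)

lemma cochain3_values:
  "\<lbrakk>a \<in> carrier A; b \<in> carrier A; c \<in> carrier A\<rbrakk>
     \<Longrightarrow> snd (cochain3 A L tA t1 t2 tL) ([], [a, b, c]) = tA a b c"
  "\<lbrakk>x \<in> carrier L; a \<in> carrier A; b \<in> carrier A\<rbrakk>
     \<Longrightarrow> snd (cochain3 A L tA t1 t2 tL) ([x], [a, b]) = t1 x a b"
  "\<lbrakk>x \<in> carrier L; y \<in> carrier L; a \<in> carrier A\<rbrakk>
     \<Longrightarrow> snd (cochain3 A L tA t1 t2 tL) ([x, y], [a]) = t2 x y a"
  "\<lbrakk>x \<in> carrier L; y \<in> carrier L; z \<in> carrier L\<rbrakk>
     \<Longrightarrow> fst (cochain3 A L tA t1 t2 tL) [x, y, z] = tL x y z"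
  by (simp_all add: cochain3_def args0_def args1_def numeral_2_eq_2)

lemma all_less_short:
  "(\<forall>i<Suc 0. P i) \<longleftrightarrow> P 0" "(\<forall>i<2. P i) \<longleftrightarrow> P 0 \<and> P (1::nat)"
  "(\<forall>i<3. P i) \<longleftrightarrow> P 0 \<and> P (1::nat) \<and> P 2"
  by (auto simp: eval_nat_numeral less_Suc_eq)

lemma cochain2_closed:
  assumes A: "module K A" and L: "module K L"
    and a: "bilinear_map K A A A \<alpha>" and b: "bilinear_map K L A A \<beta>" and g: "bilinear_map K L L L \<gamma>"
  shows "cochain2 A L \<alpha> \<beta> \<gamma> \<in> carrier (cochains K A L 2)"
  unfolding cochains_carrier_iff
proof (intro conjI ballI)
  show "fst (cochain2 A L \<alpha> \<beta> \<gamma>) \<in> args0 L 2 \<rightarrow>\<^sub>E carrier L"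
    by (auto simp: cochain2_def args_short_cases bilinear_closed[OF g])
  show "snd (cochain2 A L \<alpha> \<beta> \<gamma>) \<in> args1 A L 2 \<rightarrow>\<^sub>E carrier A"
    by (auto simp: cochain2_def args_short_cases bilinear_closed[OF a] bilinear_closed[OF b])
next
  fix xs assume "xs \<in> args0 L 2"
  then obtain x y where *: "xs = [x, y]" "x \<in> carrier L" "y \<in> carrier L"
    by (auto simp: args_short_cases)
  show "\<forall>i<2. linear_map K L L (\<lambda>x. fst (cochain2 A L \<alpha> \<beta> \<gamma>) (xs[i := x]))"
    unfolding all_less_short * using *
    by (auto intro: linear_map_cong[OF bilinear_mapD(1)[OF g] L] linear_map_cong[OF bilinear_mapD(2)[OF g] L]
        simp: cochain2_values)
next
  fix z assume "z \<in> args1 A L 2"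
  then consider a b where "z = ([], [a, b])" "a \<in> carrier A" "b \<in> carrier A"
    | x a where "z = ([x], [a])" "x \<in> carrier L" "a \<in> carrier A"
    by (cases z) (auto simp: args_short_cases)
  then show "case z of (xs, as) \<Rightarrow>
    (\<forall>i<length xs. linear_map K L A (\<lambda>x. snd (cochain2 A L \<alpha> \<beta> \<gamma>) (xs[i := x], as))) \<and>
    (\<forall>i<length as. linear_map K A A (\<lambda>a. snd (cochain2 A L \<alpha> \<beta> \<gamma>) (xs, as[i := a])))"
  proof cases
    case (1 a b)
    then show ?thesis
      by (auto simp: less_Suc_eq cochain2_values
          intro: linear_map_cong[OF bilinear_mapD(1)[OF a] A] linear_map_cong[OF bilinear_mapD(2)[OF a] A])
  next
    case (2 x a)
    then show ?thesis
      by (auto simp: less_Suc_eq cochain2_values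
          intro: linear_map_cong[OF bilinear_mapD(1)[OF b] A] linear_map_cong[OF bilinear_mapD(2)[OF b] L])
  qed
qed

lemma cochain3_closed:
  assumes A: "module K A" and L: "module K L"
    and tA: "trilinear_map K A A A A tA" and t1: "trilinear_map K L A A A t1"
    and t2: "trilinear_map K L L A A t2" and tL: "trilinear_map K L L L L tL"
  shows "cochain3 A L tA t1 t2 tL \<in> carrier (cochains K A L 3)" (is "?c \<in> _")
  unfolding cochains_carrier_iff
proof (intro conjI ballI)
  note cl = trilinear_closed[OF tA] trilinear_closed[OF t1] trilinear_closed[OF t2] trilinear_closed[OF tL]
  show "fst ?c \<in> args0 L 3 \<rightarrow>\<^sub>E carrier L"
    by (auto simp: cochain3_def args_short_cases cl)
  show "snd ?c \<in> args1 A L 3 \<rightarrow>\<^sub>E carrier A"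
    by (auto simp: cochain3_def args_short_cases cl)
  show "\<forall>i<3. linear_map K L L (\<lambda>x. fst ?c (xs[i := x]))" if xs: "xs \<in> args0 L 3" for xs
  proof -
    obtain x y z where *: "xs = [x, y, z]" "x \<in> carrier L" "y \<in> carrier L" "z \<in> carrier L"
      using xs by (auto simp: args_short_cases)
    note [simp] = *(2-)
    have "linear_map K L L (\<lambda>u. fst ?c [u, y, z])"
      by (rule linear_map_cong[OF trilinear_mapD(1)[OF tL, of y z] L]; simp add: cochain3_values)
    moreover have "linear_map K L L (\<lambda>u. fst ?c [x, u, z])"
      by (rule linear_map_cong[OF trilinear_mapD(2)[OF tL, of x z] L]; simp add: cochain3_values)
    moreover have "linear_map K L L (\<lambda>u. fst ?c [x, y, u])"
      by (rule linear_map_cong[OF trilinear_mapD(3)[OF tL, of x y] L]; simp add: cochain3_values)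
    ultimately show ?thesis unfolding all_less_short *(1) by (simp add: numeral_2_eq_2)
  qed
  show "case z of (xs, as) \<Rightarrow>
    (\<forall>i<length xs. linear_map K L A (\<lambda>x. snd ?c (xs[i := x], as))) \<and>
    (\<forall>i<length as. linear_map K A A (\<lambda>a. snd ?c (xs, as[i := a])))" if z: "z \<in> args1 A L 3" for z
  proof -
    consider a b c where "z = ([], [a, b, c])" "a \<in> carrier A" "b \<in> carrier A" "c \<in> carrier A"
      | x a b where "z = ([x], [a, b])" "x \<in> carrier L" "a \<in> carrier A" "b \<in> carrier A"
      | x y a where "z = ([x, y], [a])" "x \<in> carrier L" "y \<in> carrier L" "a \<in> carrier A"
      using z by (cases z) (auto simp: args_short_cases)
    then show ?thesis
    proof cases
      case (1 a b c)
      note [simp] = 1(2-)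
      have "linear_map K A A (\<lambda>u. snd ?c ([], [u, b, c]))"
        by (rule linear_map_cong[OF trilinear_mapD(1)[OF tA, of b c] A]; simp add: cochain3_values)
      moreover have "linear_map K A A (\<lambda>u. snd ?c ([], [a, u, c]))"
        by (rule linear_map_cong[OF trilinear_mapD(2)[OF tA, of a c] A]; simp add: cochain3_values)
      moreover have "linear_map K A A (\<lambda>u. snd ?c ([], [a, b, u]))"
        by (rule linear_map_cong[OF trilinear_mapD(3)[OF tA, of a b] A]; simp add: cochain3_values)
      ultimately show ?thesis unfolding 1(1) by (simp add: All_less_Suc2)
    next
      case (2 x a b)
      note [simp] = 2(2-)
      have "linear_map K L A (\<lambda>u. snd ?c ([u], [a, b]))"
        by (rule linear_map_cong[OF trilinear_mapD(1)[OF t1, of a b] L]; simp add: cochain3_values)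
      moreover have "linear_map K A A (\<lambda>u. snd ?c ([x], [u, b]))"
        by (rule linear_map_cong[OF trilinear_mapD(2)[OF t1, of x b] A]; simp add: cochain3_values)
      moreover have "linear_map K A A (\<lambda>u. snd ?c ([x], [a, u]))"
        by (rule linear_map_cong[OF trilinear_mapD(3)[OF t1, of x a] A]; simp add: cochain3_values)
      ultimately show ?thesis unfolding 2(1) by (simp add: All_less_Suc2)
    next
      case (3 x y a)
      note [simp] = 3(2-)
      have "linear_map K L A (\<lambda>u. snd ?c ([u, y], [a]))"
        by (rule linear_map_cong[OF trilinear_mapD(1)[OF t2, of y a] L]; simp add: cochain3_values)
      moreover have "linear_map K L A (\<lambda>u. snd ?c ([x, u], [a]))"
        by (rule linear_map_cong[OF trilinear_mapD(2)[OF t2, of x a] L]; simp add: cochain3_values)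
      moreover have "linear_map K A A (\<lambda>u. snd ?c ([x, y], [u]))"
        by (rule linear_map_cong[OF trilinear_mapD(3)[OF t2, of x y] A]; simp add: cochain3_values)
      ultimately show ?thesis unfolding 3(1) by (simp add: All_less_Suc2)
    qed
  qed
qed

lemma cochain2_comp_bilinear:
  assumes A: "module K A" and L: "module K L" and c: "c \<in> carrier (cochains K A L 2)"
  shows "bilinear_map K A A A (comp_A2 c)" "bilinear_map K L A A (comp_LA c)" "bilinear_map K L L L (comp_L2 c)"
proof -
  have lin0: "linear_map K L L (\<lambda>x. fst c (xs[i := x]))"
    if "xs \<in> args0 L 2" "i < 2" for xs i
    using c that by (simp add: cochains_carrier_iff)
  have lin1: "linear_map K L A (\<lambda>x. snd c (xs[i := x], as))"
    if "(xs, as) \<in> args1 A L 2" "i < length xs" for xs as i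
    using c that by (force simp: cochains_carrier_iff)
  have lin2: "linear_map K A A (\<lambda>a. snd c (xs, as[i := a]))"
    if "(xs, as) \<in> args1 A L 2" "i < length as" for xs as i
    using c that by (force simp: cochains_carrier_iff)
  interpret A: module K A by fact
  interpret L: module K L by fact
  show "bilinear_map K A A A (comp_A2 c)"
    using lin2[of "[]" "[_, \<zero>\<^bsub>A\<^esub>]" 1] lin2[of "[]" "[\<zero>\<^bsub>A\<^esub>, _]" 0]
    by (intro bilinear_mapI) (simp_all add: comp_A2_def[abs_def] args1_def)
  show "bilinear_map K L A A (comp_LA c)"
    using lin2[of "[_]" "[\<zero>\<^bsub>A\<^esub>]" 0] lin1[of "[\<zero>\<^bsub>L\<^esub>]" "[_]" 0]
    by (intro bilinear_mapI) (simp_all add: comp_LA_def[abs_def] args1_def)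
  show "bilinear_map K L L L (comp_L2 c)"
    using lin0[of "[_, \<zero>\<^bsub>L\<^esub>]" 1] lin0[of "[\<zero>\<^bsub>L\<^esub>, _]" 0]
    by (intro bilinear_mapI) (simp_all add: comp_L2_def[abs_def] args0_def)
qed

section \<open>The coboundary of a Courant pair in degrees 2 and 3\<close>

locale courant =
  fixes K :: "('k, 'z) ring_scheme" and A :: "('k, 'a) module" and L :: "('k, 'l) module"
    and \<mu> :: "'l \<Rightarrow> 'a \<Rightarrow> 'a"
  assumes pair: "courant_pair K A L \<mu>"
begin

lemma A_module: "module K A" and L_module: "module K L"
  using pair by (auto simp: courant_pair_def assoc_algebra_def leibniz_algebra_def)

sublocale A: module K A by (rule A_module)
sublocale L: module K L by (rule L_module)

lemma mult_bilinear: "bilinear_map K A A A (mult A)"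
  and bracket_bilinear: "bilinear_map K L L L (mult L)"
  and action_bilinear: "bilinear_map K L A A \<mu>"
  using pair by (auto simp: courant_pair_def assoc_algebra_def leibniz_algebra_def)

lemmas mult_rules = bilinear_add[OF mult_bilinear] bilinear_smult[OF mult_bilinear]
    bilinear_minus[OF mult_bilinear A_module A_module A_module]
    bilinear_diff[OF mult_bilinear A_module A_module A_module]
    bilinear_zero[OF mult_bilinear A_module A_module A_module]
  and bracket_rules = bilinear_add[OF bracket_bilinear] bilinear_smult[OF bracket_bilinear]
    bilinear_minus[OF bracket_bilinear L_module L_module L_module]
    bilinear_diff[OF bracket_bilinear L_module L_module L_module]
    bilinear_zero[OF bracket_bilinear L_module L_module L_module]
  and action_rules = bilinear_add[OF action_bilinear] bilinear_smult[OF action_bilinear]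
    bilinear_minus[OF action_bilinear L_module A_module A_module]
    bilinear_diff[OF action_bilinear L_module A_module A_module]
    bilinear_zero[OF action_bilinear L_module A_module A_module]

lemma op_closed [simp]:
  "\<lbrakk>a \<in> carrier A; b \<in> carrier A\<rbrakk> \<Longrightarrow> a \<otimes>\<^bsub>A\<^esub> b \<in> carrier A"
  "\<lbrakk>x \<in> carrier L; y \<in> carrier L\<rbrakk> \<Longrightarrow> x \<otimes>\<^bsub>L\<^esub> y \<in> carrier L"
  "\<lbrakk>x \<in> carrier L; a \<in> carrier A\<rbrakk> \<Longrightarrow> \<mu> x a \<in> carrier A"
  using bilinear_closed[OF mult_bilinear] bilinear_closed[OF bracket_bilinear] bilinear_closed[OF action_bilinear]
  by auto

lemma pair_axioms:
  "\<lbrakk>a \<in> carrier A; b \<in> carrier A; c \<in> carrier A\<rbrakk> \<Longrightarrow> (a \<otimes>\<^bsub>A\<^esub> b) \<otimes>\<^bsub>A\<^esub> c = a \<otimes>\<^bsub>A\<^esub> (b \<otimes>\<^bsub>A\<^esub> c)"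
  "\<lbrakk>x \<in> carrier L; a \<in> carrier A; b \<in> carrier A\<rbrakk>
     \<Longrightarrow> \<mu> x (a \<otimes>\<^bsub>A\<^esub> b) = \<mu> x a \<otimes>\<^bsub>A\<^esub> b \<oplus>\<^bsub>A\<^esub> a \<otimes>\<^bsub>A\<^esub> \<mu> x b"
  "\<lbrakk>x \<in> carrier L; y \<in> carrier L; a \<in> carrier A\<rbrakk>
     \<Longrightarrow> \<mu> (x \<otimes>\<^bsub>L\<^esub> y) a = \<mu> x (\<mu> y a) \<ominus>\<^bsub>A\<^esub> \<mu> y (\<mu> x a)"
  "\<lbrakk>x \<in> carrier L; y \<in> carrier L; z \<in> carrier L\<rbrakk>
     \<Longrightarrow> x \<otimes>\<^bsub>L\<^esub> (y \<otimes>\<^bsub>L\<^esub> z) = (x \<otimes>\<^bsub>L\<^esub> y) \<otimes>\<^bsub>L\<^esub> z \<oplus>\<^bsub>L\<^esub> y \<otimes>\<^bsub>L\<^esub> (x \<otimes>\<^bsub>L\<^esub> z)"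
  using pair unfolding courant_pair_def assoc_algebra_def leibniz_algebra_def derivation_def by blast+

text \<open>All signs are resolved here: at \<open>(xs, as)\<close> with \<open>q = length xs\<close> and \<open>p = length as\<close>, the summand of
  \<open>\<delta>\<^sub>L\<close> carries the sign \<open>(-1)\<^sup>p\<close> of the total complex and the sign \<open>(-1)\<^sup>q\<close> of the Leibniz
  coboundary.\<close>

lemma d2_values:
  assumes c: "c \<in> carrier (cochains K A L 2)"
  defines "f \<equiv> fst c" and "g \<equiv> snd c" and "D \<equiv> total_cobdry A L \<mu> 2 c"
  shows "\<lbrakk>a \<in> carrier A; b \<in> carrier A; d \<in> carrier A\<rbrakk> \<Longrightarrow> snd D ([], [a, b, d]) =
      a \<otimes>\<^bsub>A\<^esub> g ([], [b, d]) \<ominus>\<^bsub>A\<^esub> g ([], [a \<otimes>\<^bsub>A\<^esub> b, d]) \<oplus>\<^bsub>A\<^esub> g ([], [a, b \<otimes>\<^bsub>A\<^esub> d]) \<ominus>\<^bsub>A\<^esub> g ([], [a, b]) \<otimes>\<^bsub>A\<^esub> d"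
      (is "\<lbrakk>?a1; ?b1; ?c1\<rbrakk> \<Longrightarrow> ?P1")
    and "\<lbrakk>x \<in> carrier L; a \<in> carrier A; b \<in> carrier A\<rbrakk> \<Longrightarrow> snd D ([x], [a, b]) =
      a \<otimes>\<^bsub>A\<^esub> g ([x], [b]) \<ominus>\<^bsub>A\<^esub> g ([x], [a \<otimes>\<^bsub>A\<^esub> b]) \<oplus>\<^bsub>A\<^esub> g ([x], [a]) \<otimes>\<^bsub>A\<^esub> b
      \<ominus>\<^bsub>A\<^esub> (\<mu> x (g ([], [a, b])) \<ominus>\<^bsub>A\<^esub> g ([], [\<mu> x a, b]) \<ominus>\<^bsub>A\<^esub> g ([], [a, \<mu> x b]))"
      (is "\<lbrakk>?a2; ?b2; ?c2\<rbrakk> \<Longrightarrow> ?P2")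
    and "\<lbrakk>x \<in> carrier L; y \<in> carrier L; a \<in> carrier A\<rbrakk> \<Longrightarrow> snd D ([x, y], [a]) =
      \<mu> (f [x, y]) a \<ominus>\<^bsub>A\<^esub> (\<mu> x (g ([y], [a])) \<ominus>\<^bsub>A\<^esub> g ([y], [\<mu> x a]))
      \<oplus>\<^bsub>A\<^esub> (\<mu> y (g ([x], [a])) \<ominus>\<^bsub>A\<^esub> g ([x], [\<mu> y a])) \<oplus>\<^bsub>A\<^esub> g ([x \<otimes>\<^bsub>L\<^esub> y], [a])"
      (is "\<lbrakk>?a3; ?b3; ?c3\<rbrakk> \<Longrightarrow> ?P3")
    and "\<lbrakk>x \<in> carrier L; y \<in> carrier L; z \<in> carrier L\<rbrakk> \<Longrightarrow> fst D [x, y, z] =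
      y \<otimes>\<^bsub>L\<^esub> f [x, z] \<ominus>\<^bsub>L\<^esub> x \<otimes>\<^bsub>L\<^esub> f [y, z] \<oplus>\<^bsub>L\<^esub> f [x, y] \<otimes>\<^bsub>L\<^esub> z
      \<oplus>\<^bsub>L\<^esub> f [x \<otimes>\<^bsub>L\<^esub> y, z] \<oplus>\<^bsub>L\<^esub> f [y, x \<otimes>\<^bsub>L\<^esub> z] \<ominus>\<^bsub>L\<^esub> f [x, y \<otimes>\<^bsub>L\<^esub> z]"
      (is "\<lbrakk>?a4; ?b4; ?c4\<rbrakk> \<Longrightarrow> ?P4")
proof -
  note gA = A.abelian_group_axioms and gL = L.abelian_group_axioms
  have fc: "f ys \<in> carrier L" if "set ys \<subseteq> carrier L" "length ys = 2" for ys
    using cochain_closed(1)[OF c] that by (simp add: f_def args0_def)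
  have gc: "g (ys, as) \<in> carrier A"
    if "set ys \<subseteq> carrier L" "set as \<subseteq> carrier A" "length as > 0" "length ys + length as = 2" for ys as
    using cochain_closed(2)[OF c] that by (auto simp: g_def args1_def)
  have D: "D = total_cobdry A L \<mu> 2 (f, g)" by (simp add: D_def f_def g_def)
  show ?P1 if ?a1 ?b1 ?c1
    using that hochschild_cobdry_short(2)[OF gA, where f = "\<lambda>bs. g ([], bs)" and n = 2 and d = a]
    by (simp add: D total_cobdry_def args1_def gc)
  show ?P2 if ?a2 ?b2 ?c2
  proof -
    have h: "hom_action A \<mu> y (\<lambda>bs. g ([], bs)) [a, b] =
        \<mu> y (g ([], [a, b])) \<ominus>\<^bsub>A\<^esub> g ([], [\<mu> y a, b]) \<ominus>\<^bsub>A\<^esub> g ([], [a, \<mu> y b])" if "y \<in> carrier L" for y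
      using hom_action_short(2)[OF gA, where \<mu> = \<mu> and x = y and f = "\<lambda>bs. g ([], bs)" and n = 2 and c = a]
        \<open>a \<in> carrier A\<close> \<open>b \<in> carrier A\<close> \<open>y \<in> carrier L\<close> by (simp add: gc)
    have "leibniz_cobdry L A (\<lambda>x ys. hom_action A \<mu> x (\<lambda>bs. g (ys, bs)) [a, b])
        (\<lambda>ys x. \<ominus>\<^bsub>A\<^esub> hom_action A \<mu> x (\<lambda>bs. g (ys, bs)) [a, b]) (\<lambda>ys. g (ys, [a, b])) [x]
      = \<ominus>\<^bsub>A\<^esub> (\<mu> x (g ([], [a, b])) \<ominus>\<^bsub>A\<^esub> g ([], [\<mu> x a, b]) \<ominus>\<^bsub>A\<^esub> g ([], [a, \<mu> x b]))"
      by (subst leibniz_cobdry_short(1)[OF gA, where n = 0 and y = x and z = x and w = x])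
        (use that in \<open>simp_all add: h gc\<close>)
    then show ?thesis
      using that hochschild_cobdry_short(1)[OF gA, where f = "\<lambda>bs. g ([x], bs)" and n = 1 and c = a and d = a]
      by (simp add: D total_cobdry_def args1_def gc signed_simps a_minus_def)
  qed
  show ?P3 if ?a3 ?b3 ?c3
  proof -
    have h: "hom_action A \<mu> y (\<lambda>bs. g (ys, bs)) [a] = \<mu> y (g (ys, [a])) \<ominus>\<^bsub>A\<^esub> g (ys, [\<mu> y a])"
      if "y \<in> carrier L" "set ys \<subseteq> carrier L" "length ys = 1" for y ys
      using hom_action_short(1)[OF gA, where \<mu> = \<mu> and x = y and f = "\<lambda>bs. g (ys, bs)" and n = 1 and b = a and c = a]
        \<open>a \<in> carrier A\<close> that by (simp add: gc)
    have "leibniz_cobdry L A (\<lambda>x ys. hom_action A \<mu> x (\<lambda>bs. g (ys, bs)) [a])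
        (\<lambda>ys x. \<ominus>\<^bsub>A\<^esub> hom_action A \<mu> x (\<lambda>bs. g (ys, bs)) [a]) (\<lambda>ys. g (ys, [a])) [x, y]
      = (\<mu> x (g ([y], [a])) \<ominus>\<^bsub>A\<^esub> g ([y], [\<mu> x a])) \<oplus>\<^bsub>A\<^esub> \<ominus>\<^bsub>A\<^esub> (\<mu> y (g ([x], [a])) \<ominus>\<^bsub>A\<^esub> g ([x], [\<mu> y a]))
         \<ominus>\<^bsub>A\<^esub> g ([x \<otimes>\<^bsub>L\<^esub> y], [a])"
      by (subst leibniz_cobdry_short(2)[OF gA, where n = 1 and z = x and w = x])
        (use that in \<open>simp_all add: h gc\<close>)
    then show ?thesis
      using that by (simp add: D total_cobdry_def args1_def gc fc signed_simps A.signed_sum_simps)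
  qed
  show ?P4 if ?a4 ?b4 ?c4
    using that leibniz_cobdry_short(3)[OF gL, where L = L and l = "\<lambda>x ys. x \<otimes>\<^bsub>L\<^esub> f ys" and r = "\<lambda>ys x. f ys \<otimes>\<^bsub>L\<^esub> x"
        and f = f and n = 2 and w = x]
    by (simp add: D total_cobdry_def args0_def fc)
qed

lemma d3_values:
  assumes c: "c \<in> carrier (cochains K A L 3)"
  defines "f \<equiv> fst c" and "g \<equiv> snd c" and "D \<equiv> total_cobdry A L \<mu> 3 c"
  shows "\<lbrakk>a \<in> carrier A; b \<in> carrier A; d \<in> carrier A; e \<in> carrier A\<rbrakk> \<Longrightarrow> snd D ([], [a, b, d, e]) =
      a \<otimes>\<^bsub>A\<^esub> g ([], [b, d, e]) \<ominus>\<^bsub>A\<^esub> g ([], [a \<otimes>\<^bsub>A\<^esub> b, d, e]) \<oplus>\<^bsub>A\<^esub> g ([], [a, b \<otimes>\<^bsub>A\<^esub> d, e])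
      \<ominus>\<^bsub>A\<^esub> g ([], [a, b, d \<otimes>\<^bsub>A\<^esub> e]) \<oplus>\<^bsub>A\<^esub> g ([], [a, b, d]) \<otimes>\<^bsub>A\<^esub> e"
      (is "\<lbrakk>?a1; ?b1; ?c1; ?d1\<rbrakk> \<Longrightarrow> ?P1")
    and "\<lbrakk>x \<in> carrier L; a \<in> carrier A; b \<in> carrier A; d \<in> carrier A\<rbrakk> \<Longrightarrow> snd D ([x], [a, b, d]) =
      a \<otimes>\<^bsub>A\<^esub> g ([x], [b, d]) \<ominus>\<^bsub>A\<^esub> g ([x], [a \<otimes>\<^bsub>A\<^esub> b, d]) \<oplus>\<^bsub>A\<^esub> g ([x], [a, b \<otimes>\<^bsub>A\<^esub> d]) \<ominus>\<^bsub>A\<^esub> g ([x], [a, b]) \<otimes>\<^bsub>A\<^esub> d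
      \<oplus>\<^bsub>A\<^esub> (\<mu> x (g ([], [a, b, d])) \<ominus>\<^bsub>A\<^esub> g ([], [\<mu> x a, b, d]) \<ominus>\<^bsub>A\<^esub> g ([], [a, \<mu> x b, d]) \<ominus>\<^bsub>A\<^esub> g ([], [a, b, \<mu> x d]))"
      (is "\<lbrakk>?a2; ?b2; ?c2; ?d2\<rbrakk> \<Longrightarrow> ?P2")
    and "\<lbrakk>x \<in> carrier L; y \<in> carrier L; a \<in> carrier A; b \<in> carrier A\<rbrakk> \<Longrightarrow> snd D ([x, y], [a, b]) =
      a \<otimes>\<^bsub>A\<^esub> g ([x, y], [b]) \<ominus>\<^bsub>A\<^esub> g ([x, y], [a \<otimes>\<^bsub>A\<^esub> b]) \<oplus>\<^bsub>A\<^esub> g ([x, y], [a]) \<otimes>\<^bsub>A\<^esub> b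
      \<oplus>\<^bsub>A\<^esub> (\<mu> x (g ([y], [a, b])) \<ominus>\<^bsub>A\<^esub> g ([y], [\<mu> x a, b]) \<ominus>\<^bsub>A\<^esub> g ([y], [a, \<mu> x b]))
      \<ominus>\<^bsub>A\<^esub> (\<mu> y (g ([x], [a, b])) \<ominus>\<^bsub>A\<^esub> g ([x], [\<mu> y a, b]) \<ominus>\<^bsub>A\<^esub> g ([x], [a, \<mu> y b]))
      \<ominus>\<^bsub>A\<^esub> g ([x \<otimes>\<^bsub>L\<^esub> y], [a, b])"
      (is "\<lbrakk>?a3; ?b3; ?c3; ?d3\<rbrakk> \<Longrightarrow> ?P3")
    and "\<lbrakk>x \<in> carrier L; y \<in> carrier L; z \<in> carrier L; a \<in> carrier A\<rbrakk> \<Longrightarrow> snd D ([x, y, z], [a]) =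
      \<mu> (f [x, y, z]) a
      \<oplus>\<^bsub>A\<^esub> (\<mu> x (g ([y, z], [a])) \<ominus>\<^bsub>A\<^esub> g ([y, z], [\<mu> x a]))
      \<ominus>\<^bsub>A\<^esub> (\<mu> y (g ([x, z], [a])) \<ominus>\<^bsub>A\<^esub> g ([x, z], [\<mu> y a]))
      \<oplus>\<^bsub>A\<^esub> (\<mu> z (g ([x, y], [a])) \<ominus>\<^bsub>A\<^esub> g ([x, y], [\<mu> z a]))
      \<ominus>\<^bsub>A\<^esub> g ([x \<otimes>\<^bsub>L\<^esub> y, z], [a]) \<ominus>\<^bsub>A\<^esub> g ([y, x \<otimes>\<^bsub>L\<^esub> z], [a]) \<oplus>\<^bsub>A\<^esub> g ([x, y \<otimes>\<^bsub>L\<^esub> z], [a])"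
      (is "\<lbrakk>?a4; ?b4; ?c4; ?d4\<rbrakk> \<Longrightarrow> ?P4")
    and "\<lbrakk>x \<in> carrier L; y \<in> carrier L; z \<in> carrier L; w \<in> carrier L\<rbrakk> \<Longrightarrow> fst D [x, y, z, w] =
      x \<otimes>\<^bsub>L\<^esub> f [y, z, w] \<ominus>\<^bsub>L\<^esub> y \<otimes>\<^bsub>L\<^esub> f [x, z, w] \<oplus>\<^bsub>L\<^esub> z \<otimes>\<^bsub>L\<^esub> f [x, y, w] \<oplus>\<^bsub>L\<^esub> f [x, y, z] \<otimes>\<^bsub>L\<^esub> w
        \<ominus>\<^bsub>L\<^esub> f [x \<otimes>\<^bsub>L\<^esub> y, z, w] \<ominus>\<^bsub>L\<^esub> f [y, x \<otimes>\<^bsub>L\<^esub> z, w] \<ominus>\<^bsub>L\<^esub> f [y, z, x \<otimes>\<^bsub>L\<^esub> w]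
        \<oplus>\<^bsub>L\<^esub> f [x, y \<otimes>\<^bsub>L\<^esub> z, w] \<oplus>\<^bsub>L\<^esub> f [x, z, y \<otimes>\<^bsub>L\<^esub> w] \<ominus>\<^bsub>L\<^esub> f [x, y, z \<otimes>\<^bsub>L\<^esub> w]"
      (is "\<lbrakk>?a5; ?b5; ?c5; ?d5\<rbrakk> \<Longrightarrow> ?P5")
proof -
  note gA = A.abelian_group_axioms and gL = L.abelian_group_axioms
  have fc: "f ys \<in> carrier L" if "set ys \<subseteq> carrier L" "length ys = 3" for ys
    using cochain_closed(1)[OF c] that by (simp add: f_def args0_def)
  have gc: "g (ys, as) \<in> carrier A"
    if "set ys \<subseteq> carrier L" "set as \<subseteq> carrier A" "length as > 0" "length ys + length as = 3" for ys as
    using cochain_closed(2)[OF c] that by (auto simp: g_def args1_def)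
  have D: "D = total_cobdry A L \<mu> 3 (f, g)" by (simp add: D_def f_def g_def)
  show ?P1 if ?a1 ?b1 ?c1 ?d1
    using that hochschild_cobdry_short(3)[OF gA, where f = "\<lambda>bs. g ([], bs)" and n = 3]
    by (simp add: D total_cobdry_def args1_def gc)
  show ?P2 if ?a2 ?b2 ?c2 ?d2
  proof -
    have h: "hom_action A \<mu> y (\<lambda>bs. g ([], bs)) [a, b, d] =
        \<mu> y (g ([], [a, b, d])) \<ominus>\<^bsub>A\<^esub> g ([], [\<mu> y a, b, d]) \<ominus>\<^bsub>A\<^esub> g ([], [a, \<mu> y b, d]) \<ominus>\<^bsub>A\<^esub> g ([], [a, b, \<mu> y d])"
      if "y \<in> carrier L" for y
      using hom_action_short(3)[OF gA, where \<mu> = \<mu> and x = y and f = "\<lambda>bs. g ([], bs)" and n = 3]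
        \<open>a \<in> carrier A\<close> \<open>b \<in> carrier A\<close> \<open>d \<in> carrier A\<close> \<open>y \<in> carrier L\<close> by (simp add: gc)
    have "leibniz_cobdry L A (\<lambda>x ys. hom_action A \<mu> x (\<lambda>bs. g (ys, bs)) [a, b, d])
        (\<lambda>ys x. \<ominus>\<^bsub>A\<^esub> hom_action A \<mu> x (\<lambda>bs. g (ys, bs)) [a, b, d]) (\<lambda>ys. g (ys, [a, b, d])) [x]
      = \<ominus>\<^bsub>A\<^esub> (\<mu> x (g ([], [a, b, d])) \<ominus>\<^bsub>A\<^esub> g ([], [\<mu> x a, b, d]) \<ominus>\<^bsub>A\<^esub> g ([], [a, \<mu> x b, d]) \<ominus>\<^bsub>A\<^esub> g ([], [a, b, \<mu> x d]))"
      by (subst leibniz_cobdry_short(1)[OF gA, where n = 0 and y = x and z = x and w = x])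
        (use that in \<open>simp_all add: h gc\<close>)
    then show ?thesis
      using that hochschild_cobdry_short(2)[OF gA, where f = "\<lambda>bs. g ([x], bs)" and n = 2 and d = a]
      by (simp add: D total_cobdry_def args1_def gc signed_simps)
  qed
  show ?P3 if ?a3 ?b3 ?c3 ?d3
  proof -
    have h: "hom_action A \<mu> y (\<lambda>bs. g (ys, bs)) [a, b] =
        \<mu> y (g (ys, [a, b])) \<ominus>\<^bsub>A\<^esub> g (ys, [\<mu> y a, b]) \<ominus>\<^bsub>A\<^esub> g (ys, [a, \<mu> y b])"
      if "y \<in> carrier L" "set ys \<subseteq> carrier L" "length ys = 1" for y ys
      using hom_action_short(2)[OF gA, where \<mu> = \<mu> and x = y and f = "\<lambda>bs. g (ys, bs)" and n = 2 and c = a]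
        \<open>a \<in> carrier A\<close> \<open>b \<in> carrier A\<close> that by (simp add: gc)
    have "leibniz_cobdry L A (\<lambda>x ys. hom_action A \<mu> x (\<lambda>bs. g (ys, bs)) [a, b])
        (\<lambda>ys x. \<ominus>\<^bsub>A\<^esub> hom_action A \<mu> x (\<lambda>bs. g (ys, bs)) [a, b]) (\<lambda>ys. g (ys, [a, b])) [x, y]
      = (\<mu> x (g ([y], [a, b])) \<ominus>\<^bsub>A\<^esub> g ([y], [\<mu> x a, b]) \<ominus>\<^bsub>A\<^esub> g ([y], [a, \<mu> x b]))
        \<oplus>\<^bsub>A\<^esub> \<ominus>\<^bsub>A\<^esub> (\<mu> y (g ([x], [a, b])) \<ominus>\<^bsub>A\<^esub> g ([x], [\<mu> y a, b]) \<ominus>\<^bsub>A\<^esub> g ([x], [a, \<mu> y b]))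
        \<ominus>\<^bsub>A\<^esub> g ([x \<otimes>\<^bsub>L\<^esub> y], [a, b])"
      by (subst leibniz_cobdry_short(2)[OF gA, where n = 1 and z = x and w = x])
        (use that in \<open>simp_all add: h gc\<close>)
    then show ?thesis
      using that hochschild_cobdry_short(1)[OF gA, where f = "\<lambda>bs. g ([x, y], bs)" and n = 1 and c = a and d = a]
      by (simp add: D total_cobdry_def args1_def gc signed_simps A.signed_sum_simps)
  qed
  show ?P4 if ?a4 ?b4 ?c4 ?d4
  proof -
    have h: "hom_action A \<mu> y (\<lambda>bs. g (ys, bs)) [a] = \<mu> y (g (ys, [a])) \<ominus>\<^bsub>A\<^esub> g (ys, [\<mu> y a])"
      if "y \<in> carrier L" "set ys \<subseteq> carrier L" "length ys = 2" for y ys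
      using hom_action_short(1)[OF gA, where \<mu> = \<mu> and x = y and f = "\<lambda>bs. g (ys, bs)" and n = 1 and b = a and c = a]
        \<open>a \<in> carrier A\<close> that by (simp add: gc)
    have "leibniz_cobdry L A (\<lambda>x ys. hom_action A \<mu> x (\<lambda>bs. g (ys, bs)) [a])
        (\<lambda>ys x. \<ominus>\<^bsub>A\<^esub> hom_action A \<mu> x (\<lambda>bs. g (ys, bs)) [a]) (\<lambda>ys. g (ys, [a])) [x, y, z]
      = (\<mu> y (g ([x, z], [a])) \<ominus>\<^bsub>A\<^esub> g ([x, z], [\<mu> y a])) \<ominus>\<^bsub>A\<^esub> (\<mu> x (g ([y, z], [a])) \<ominus>\<^bsub>A\<^esub> g ([y, z], [\<mu> x a]))
        \<oplus>\<^bsub>A\<^esub> \<ominus>\<^bsub>A\<^esub> (\<mu> z (g ([x, y], [a])) \<ominus>\<^bsub>A\<^esub> g ([x, y], [\<mu> z a]))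
        \<oplus>\<^bsub>A\<^esub> g ([x \<otimes>\<^bsub>L\<^esub> y, z], [a]) \<oplus>\<^bsub>A\<^esub> g ([y, x \<otimes>\<^bsub>L\<^esub> z], [a]) \<ominus>\<^bsub>A\<^esub> g ([x, y \<otimes>\<^bsub>L\<^esub> z], [a])"
      by (subst leibniz_cobdry_short(3)[OF gA, where n = 2 and w = x])
        (use that in \<open>simp_all add: h gc\<close>)
    then show ?thesis
      using that by (simp add: D total_cobdry_def args1_def gc fc signed_simps A.signed_sum_simps)
  qed
  show ?P5 if ?a5 ?b5 ?c5 ?d5
    using that leibniz_cobdry_short(4)[OF gL, where L = L and l = "\<lambda>x ys. x \<otimes>\<^bsub>L\<^esub> f ys" and r = "\<lambda>ys x. f ys \<otimes>\<^bsub>L\<^esub> x"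
        and f = f and n = 3]
    by (simp add: D total_cobdry_def args0_def fc)
qed

end

section \<open>Defects of a triple of operations\<close>

lemma (in module) smult_r_diff:
  "\<lbrakk>c \<in> carrier R; x \<in> carrier M; y \<in> carrier M\<rbrakk> \<Longrightarrow> c \<odot>\<^bsub>M\<^esub> (x \<ominus>\<^bsub>M\<^esub> y) = c \<odot>\<^bsub>M\<^esub> x \<ominus>\<^bsub>M\<^esub> c \<odot>\<^bsub>M\<^esub> y"
  by (simp add: a_minus_def smult_r_distr smult_r_minus)

text \<open>The failure of the four axioms of a Courant pair. The signs are those for which the identities
  below become the cocycle condition of the total complex.\<close>

definition assoc_defect :: "('k, 'x) module \<Rightarrow> ('x \<Rightarrow> 'x \<Rightarrow> 'x) \<Rightarrow> 'x \<Rightarrow> 'x \<Rightarrow> 'x \<Rightarrow> 'x" where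
  "assoc_defect X m u v w = m u (m v w) \<ominus>\<^bsub>X\<^esub> m (m u v) w"

definition derivation_defect ::
  "('k, 'x) module \<Rightarrow> ('x \<Rightarrow> 'x \<Rightarrow> 'x) \<Rightarrow> ('y \<Rightarrow> 'x \<Rightarrow> 'x) \<Rightarrow> 'y \<Rightarrow> 'x \<Rightarrow> 'x \<Rightarrow> 'x" where
  "derivation_defect X m \<nu> y u v = \<ominus>\<^bsub>X\<^esub> (\<nu> y (m u v) \<ominus>\<^bsub>X\<^esub> m (\<nu> y u) v \<ominus>\<^bsub>X\<^esub> m u (\<nu> y v))"

definition action_defect ::
  "('k, 'x) module \<Rightarrow> ('y \<Rightarrow> 'x \<Rightarrow> 'x) \<Rightarrow> ('y \<Rightarrow> 'y \<Rightarrow> 'y) \<Rightarrow> 'y \<Rightarrow> 'y \<Rightarrow> 'x \<Rightarrow> 'x" where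
  "action_defect X \<nu> b y z u = \<nu> (b y z) u \<ominus>\<^bsub>X\<^esub> \<nu> y (\<nu> z u) \<oplus>\<^bsub>X\<^esub> \<nu> z (\<nu> y u)"

definition leibniz_defect :: "('k, 'y) module \<Rightarrow> ('y \<Rightarrow> 'y \<Rightarrow> 'y) \<Rightarrow> 'y \<Rightarrow> 'y \<Rightarrow> 'y \<Rightarrow> 'y" where
  "leibniz_defect Y b x y z = \<ominus>\<^bsub>Y\<^esub> (b x (b y z) \<ominus>\<^bsub>Y\<^esub> b (b x y) z \<ominus>\<^bsub>Y\<^esub> b y (b x z))"

lemmas defect_defs = assoc_defect_def derivation_defect_def action_defect_def leibniz_defect_def

locale operation_triple =
  fixes K :: "('k, 'z) ring_scheme" and X :: "('k, 'x) module" and Y :: "('k, 'y) module"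
    and m :: "'x \<Rightarrow> 'x \<Rightarrow> 'x" and \<nu> :: "'y \<Rightarrow> 'x \<Rightarrow> 'x" and b :: "'y \<Rightarrow> 'y \<Rightarrow> 'y"
  assumes X_module: "module K X" and Y_module: "module K Y"
    and m: "bilinear_map K X X X m" and \<nu>: "bilinear_map K Y X X \<nu>" and b: "bilinear_map K Y Y Y b"
begin

sublocale X: module K X by (rule X_module)
sublocale Y: module K Y by (rule Y_module)

lemmas triple_rules =
    bilinear_add[OF m] bilinear_minus[OF m X_module X_module X_module] bilinear_diff[OF m X_module X_module X_module]
    bilinear_add[OF \<nu>] bilinear_minus[OF \<nu> Y_module X_module X_module] bilinear_diff[OF \<nu> Y_module X_module X_module]
    bilinear_add[OF b] bilinear_minus[OF b Y_module Y_module Y_module] bilinear_diff[OF b Y_module Y_module Y_module]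

lemmas triple_smult = bilinear_smult[OF m] bilinear_smult[OF \<nu>] bilinear_smult[OF b]

lemma triple_closed [simp]:
  "\<lbrakk>u \<in> carrier X; v \<in> carrier X\<rbrakk> \<Longrightarrow> m u v \<in> carrier X"
  "\<lbrakk>y \<in> carrier Y; v \<in> carrier X\<rbrakk> \<Longrightarrow> \<nu> y v \<in> carrier X"
  "\<lbrakk>y \<in> carrier Y; z \<in> carrier Y\<rbrakk> \<Longrightarrow> b y z \<in> carrier Y"
  using bilinear_closed[OF m] bilinear_closed[OF \<nu>] bilinear_closed[OF b] by auto

lemma defect_trilinear:
  "trilinear_map K X X X X (assoc_defect X m)"
  "trilinear_map K Y X X X (derivation_defect X m \<nu>)"
  "trilinear_map K Y Y X X (action_defect X \<nu> b)"
  "trilinear_map K Y Y Y Y (leibniz_defect Y b)"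
proof -
  note rules = defect_defs triple_rules triple_smult X.signed_sum_simps Y.signed_sum_simps
    X.smult_r_distr Y.smult_r_distr X.smult_r_diff Y.smult_r_diff
  show "trilinear_map K X X X X (assoc_defect X m)"
    unfolding trilinear_map_def by (intro conjI ballI linear_mapI) (simp_all add: rules)
  show "trilinear_map K Y X X X (derivation_defect X m \<nu>)"
    unfolding trilinear_map_def by (intro conjI ballI linear_mapI) (simp_all add: rules)
  show "trilinear_map K Y Y X X (action_defect X \<nu> b)"
    unfolding trilinear_map_def by (intro conjI ballI linear_mapI) (simp_all add: rules)
  show "trilinear_map K Y Y Y Y (leibniz_defect Y b)"
    unfolding trilinear_map_def by (intro conjI ballI linear_mapI) (simp_all add: rules)
qed

lemma defect_closed [simp]:
  "\<lbrakk>u \<in> carrier X; v \<in> carrier X; w \<in> carrier X\<rbrakk> \<Longrightarrow> assoc_defect X m u v w \<in> carrier X"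
  "\<lbrakk>y \<in> carrier Y; u \<in> carrier X; v \<in> carrier X\<rbrakk> \<Longrightarrow> derivation_defect X m \<nu> y u v \<in> carrier X"
  "\<lbrakk>y \<in> carrier Y; z \<in> carrier Y; u \<in> carrier X\<rbrakk> \<Longrightarrow> action_defect X \<nu> b y z u \<in> carrier X"
  "\<lbrakk>x \<in> carrier Y; y \<in> carrier Y; z \<in> carrier Y\<rbrakk> \<Longrightarrow> leibniz_defect Y b x y z \<in> carrier Y"
  using defect_trilinear by (simp_all add: trilinear_closed)

text \<open>After expanding the defects, every composite of three operations occurs twice, with opposite signs,
  so these identities hold for operations without any axioms. They have the form of the cocycle
  condition for the defects, with the operations themselves in the place of those of a Courant
  pair. The digits in the names count the arguments in \<open>X\<close> and in \<open>Y\<close>.\<close>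

lemma bianchi_40:
  assumes "u \<in> carrier X" "v \<in> carrier X" "w \<in> carrier X" "t \<in> carrier X"
  shows "m u (assoc_defect X m v w t) \<ominus>\<^bsub>X\<^esub> assoc_defect X m (m u v) w t \<oplus>\<^bsub>X\<^esub> assoc_defect X m u (m v w) t
     \<ominus>\<^bsub>X\<^esub> assoc_defect X m u v (m w t) \<oplus>\<^bsub>X\<^esub> m (assoc_defect X m u v w) t = \<zero>\<^bsub>X\<^esub>"
  using assms by (simp add: defect_defs triple_rules X.signed_sum_simps)

lemma bianchi_31:
  assumes "y \<in> carrier Y" "u \<in> carrier X" "v \<in> carrier X" "w \<in> carrier X"
  shows "m u (derivation_defect X m \<nu> y v w) \<ominus>\<^bsub>X\<^esub> derivation_defect X m \<nu> y (m u v) w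
     \<oplus>\<^bsub>X\<^esub> derivation_defect X m \<nu> y u (m v w) \<ominus>\<^bsub>X\<^esub> m (derivation_defect X m \<nu> y u v) w
     \<oplus>\<^bsub>X\<^esub> (\<nu> y (assoc_defect X m u v w) \<ominus>\<^bsub>X\<^esub> assoc_defect X m (\<nu> y u) v w
       \<ominus>\<^bsub>X\<^esub> assoc_defect X m u (\<nu> y v) w \<ominus>\<^bsub>X\<^esub> assoc_defect X m u v (\<nu> y w)) = \<zero>\<^bsub>X\<^esub>"
  using assms by (simp add: defect_defs triple_rules X.signed_sum_simps)

lemma bianchi_22:
  assumes "y \<in> carrier Y" "z \<in> carrier Y" "u \<in> carrier X" "v \<in> carrier X"
  shows "m u (action_defect X \<nu> b y z v) \<ominus>\<^bsub>X\<^esub> action_defect X \<nu> b y z (m u v)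
     \<oplus>\<^bsub>X\<^esub> m (action_defect X \<nu> b y z u) v
     \<oplus>\<^bsub>X\<^esub> (\<nu> y (derivation_defect X m \<nu> z u v) \<ominus>\<^bsub>X\<^esub> derivation_defect X m \<nu> z (\<nu> y u) v
       \<ominus>\<^bsub>X\<^esub> derivation_defect X m \<nu> z u (\<nu> y v))
     \<ominus>\<^bsub>X\<^esub> (\<nu> z (derivation_defect X m \<nu> y u v) \<ominus>\<^bsub>X\<^esub> derivation_defect X m \<nu> y (\<nu> z u) v
       \<ominus>\<^bsub>X\<^esub> derivation_defect X m \<nu> y u (\<nu> z v))
     \<ominus>\<^bsub>X\<^esub> derivation_defect X m \<nu> (b y z) u v = \<zero>\<^bsub>X\<^esub>"
  using assms by (simp add: defect_defs triple_rules X.signed_sum_simps)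

lemma bianchi_13:
  assumes "x \<in> carrier Y" "y \<in> carrier Y" "z \<in> carrier Y" "u \<in> carrier X"
  shows "\<nu> (leibniz_defect Y b x y z) u
     \<oplus>\<^bsub>X\<^esub> (\<nu> x (action_defect X \<nu> b y z u) \<ominus>\<^bsub>X\<^esub> action_defect X \<nu> b y z (\<nu> x u))
     \<ominus>\<^bsub>X\<^esub> (\<nu> y (action_defect X \<nu> b x z u) \<ominus>\<^bsub>X\<^esub> action_defect X \<nu> b x z (\<nu> y u))
     \<oplus>\<^bsub>X\<^esub> (\<nu> z (action_defect X \<nu> b x y u) \<ominus>\<^bsub>X\<^esub> action_defect X \<nu> b x y (\<nu> z u))
     \<ominus>\<^bsub>X\<^esub> action_defect X \<nu> b (b x y) z u \<ominus>\<^bsub>X\<^esub> action_defect X \<nu> b y (b x z) u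
     \<oplus>\<^bsub>X\<^esub> action_defect X \<nu> b x (b y z) u = \<zero>\<^bsub>X\<^esub>"
  using assms by (simp add: defect_defs triple_rules X.signed_sum_simps)

lemma bianchi_04:
  assumes "x \<in> carrier Y" "y \<in> carrier Y" "z \<in> carrier Y" "w \<in> carrier Y"
  shows "b x (leibniz_defect Y b y z w) \<ominus>\<^bsub>Y\<^esub> b y (leibniz_defect Y b x z w)
     \<oplus>\<^bsub>Y\<^esub> b z (leibniz_defect Y b x y w) \<oplus>\<^bsub>Y\<^esub> b (leibniz_defect Y b x y z) w
     \<ominus>\<^bsub>Y\<^esub> leibniz_defect Y b (b x y) z w \<ominus>\<^bsub>Y\<^esub> leibniz_defect Y b y (b x z) w
     \<ominus>\<^bsub>Y\<^esub> leibniz_defect Y b y z (b x w) \<oplus>\<^bsub>Y\<^esub> leibniz_defect Y b x (b y z) w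
     \<oplus>\<^bsub>Y\<^esub> leibniz_defect Y b x z (b y w) \<ominus>\<^bsub>Y\<^esub> leibniz_defect Y b x y (b z w) = \<zero>\<^bsub>Y\<^esub>"
  using assms by (simp add: defect_defs triple_rules Y.signed_sum_simps)

end

section \<open>First-order lifts of a Courant pair\<close>

lemma extensional_pair_eqI:
  assumes "fst c \<in> extensional (args0 L n)" "snd c \<in> extensional (args1 A L n)"
    and "fst c' \<in> extensional (args0 L n)" "snd c' \<in> extensional (args1 A L n)"
    and "\<And>xs. xs \<in> args0 L n \<Longrightarrow> fst c xs = fst c' xs"
    and "\<And>xs as. (xs, as) \<in> args1 A L n \<Longrightarrow> snd c (xs, as) = snd c' (xs, as)"
  shows "c = c'"
proof (rule prod_eqI)
  show "fst c = fst c'" using assms by (intro extensionalityI[of _ "args0 L n"]) auto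
  show "snd c = snd c'" using assms by (intro extensionalityI[of _ "args1 A L n"]) auto
qed

lemma total_cobdry_extensional:
  "fst (total_cobdry A L \<mu> n c) \<in> extensional (args0 L (n + 1))"
  "snd (total_cobdry A L \<mu> n c) \<in> extensional (args1 A L (n + 1))"
  by (simp_all add: total_cobdry_def case_prod_beta)

lemma bilinear_map_sub:
  assumes "bilinear_map K U V W h" "bilinear_map K U V W h'" "module K U" "module K V" "module K W"
  shows "bilinear_map K U V W (\<lambda>u v. h u v \<ominus>\<^bsub>W\<^esub> h' u v)"
  using assms by (intro bilinear_mapI linear_map_sub bilinear_mapD[OF assms(1)] bilinear_mapD[OF assms(2)])

text \<open>The maps \<open>jA\<close>, \<open>jL\<close> embed the arguments as constants, and \<open>fA\<close>, \<open>fL\<close> read off one coordinate of a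
  defect.\<close>

definition defect_cochain ::
  "('k, 'a) module \<Rightarrow> ('k, 'l) module \<Rightarrow> ('k, 'x) module \<Rightarrow> ('k, 'y) module
    \<Rightarrow> ('x \<Rightarrow> 'a) \<Rightarrow> ('y \<Rightarrow> 'l) \<Rightarrow> ('a \<Rightarrow> 'x) \<Rightarrow> ('l \<Rightarrow> 'y)
    \<Rightarrow> ('x \<Rightarrow> 'x \<Rightarrow> 'x) \<Rightarrow> ('y \<Rightarrow> 'x \<Rightarrow> 'x) \<Rightarrow> ('y \<Rightarrow> 'y \<Rightarrow> 'y) \<Rightarrow> ('a, 'l) cochain" where
  "defect_cochain A L X Y fA fL jA jL m \<nu> b =
     cochain3 A L
       (\<lambda>a1 a2 a3. fA (assoc_defect X m (jA a1) (jA a2) (jA a3)))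
       (\<lambda>x a1 a2. fA (derivation_defect X m \<nu> (jL x) (jA a1) (jA a2)))
       (\<lambda>x y a. fA (action_defect X \<nu> b (jL x) (jL y) (jA a)))
       (\<lambda>x y z. fL (leibniz_defect Y b (jL x) (jL y) (jL z)))"

lemma defect_cochain_values:
  "\<lbrakk>a \<in> carrier A; a' \<in> carrier A; a'' \<in> carrier A\<rbrakk> \<Longrightarrow> snd (defect_cochain A L X Y fA fL jA jL m \<nu> b) ([], [a, a', a'']) =
     fA (assoc_defect X m (jA a) (jA a') (jA a''))"
  "\<lbrakk>x \<in> carrier L; a' \<in> carrier A; a'' \<in> carrier A\<rbrakk> \<Longrightarrow> snd (defect_cochain A L X Y fA fL jA jL m \<nu> b) ([x], [a', a'']) =
     fA (derivation_defect X m \<nu> (jL x) (jA a') (jA a''))"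
  "\<lbrakk>x \<in> carrier L; y \<in> carrier L; a'' \<in> carrier A\<rbrakk> \<Longrightarrow> snd (defect_cochain A L X Y fA fL jA jL m \<nu> b) ([x, y], [a'']) =
     fA (action_defect X \<nu> b (jL x) (jL y) (jA a''))"
  "\<lbrakk>x \<in> carrier L; y \<in> carrier L; z \<in> carrier L\<rbrakk> \<Longrightarrow> fst (defect_cochain A L X Y fA fL jA jL m \<nu> b) [x, y, z] =
     fL (leibniz_defect Y b (jL x) (jL y) (jL z))"
  by (simp_all add: defect_cochain_def cochain3_values)

definition difference_cochain ::
  "('k, 'a) module \<Rightarrow> ('k, 'l) module \<Rightarrow> ('k, 'x) module \<Rightarrow> ('k, 'y) module
    \<Rightarrow> ('x \<Rightarrow> 'a) \<Rightarrow> ('y \<Rightarrow> 'l) \<Rightarrow> ('a \<Rightarrow> 'x) \<Rightarrow> ('l \<Rightarrow> 'y)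
    \<Rightarrow> ('x \<Rightarrow> 'x \<Rightarrow> 'x) \<Rightarrow> ('y \<Rightarrow> 'x \<Rightarrow> 'x) \<Rightarrow> ('y \<Rightarrow> 'y \<Rightarrow> 'y)
    \<Rightarrow> ('x \<Rightarrow> 'x \<Rightarrow> 'x) \<Rightarrow> ('y \<Rightarrow> 'x \<Rightarrow> 'x) \<Rightarrow> ('y \<Rightarrow> 'y \<Rightarrow> 'y) \<Rightarrow> ('a, 'l) cochain" where
  "difference_cochain A L X Y fA fL jA jL m \<nu> b m' \<nu>' b' =
     cochain2 A L
       (\<lambda>a1 a2. fA (m (jA a1) (jA a2) \<ominus>\<^bsub>X\<^esub> m' (jA a1) (jA a2)))
       (\<lambda>x a. fA (\<nu> (jL x) (jA a) \<ominus>\<^bsub>X\<^esub> \<nu>' (jL x) (jA a)))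
       (\<lambda>x y. fL (b (jL x) (jL y) \<ominus>\<^bsub>Y\<^esub> b' (jL x) (jL y)))"

text \<open>The model is \<open>X = S \<otimes> A\<close>, \<open>Y = S \<otimes> L\<close> for an extension \<open>S\<close> of \<open>R\<close> by \<open>M\<close>: there \<open>e\<close> is the
  augmentation, \<open>j\<close> sends \<open>v\<close> to \<open>1 \<otimes> v\<close>, \<open>IA\<close> and \<open>IL\<close> are the copies of \<open>M \<otimes> A\<close> and \<open>M \<otimes> L\<close>, and \<open>f\<close> is
  the contraction with a functional on \<open>M\<close>. The dual numbers are a second instance.\<close>

locale first_order_frame = courant K A L \<mu>
  for K :: "('k, 'z) ring_scheme" and A :: "('k, 'a) module" and L :: "('k, 'l) module" and \<mu> +
  fixes X :: "('k, 'x) module" and Y :: "('k, 'y) module"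
    and eA :: "'x \<Rightarrow> 'a" and eL :: "'y \<Rightarrow> 'l" and fA :: "'x \<Rightarrow> 'a" and fL :: "'y \<Rightarrow> 'l"
    and jA :: "'a \<Rightarrow> 'x" and jL :: "'l \<Rightarrow> 'y" and IA :: "'x set" and IL :: "'y set"
  assumes X_mod: "module K X" and Y_mod: "module K Y"
    and eA: "linear_map K X A eA" and eL: "linear_map K Y L eL"
    and fA: "linear_map K X A fA" and fL: "linear_map K Y L fL"
    and jA: "linear_map K A X jA" and jL: "linear_map K L Y jL"
    and eA_jA [simp]: "\<And>a. a \<in> carrier A \<Longrightarrow> eA (jA a) = a"
    and eL_jL [simp]: "\<And>x. x \<in> carrier L \<Longrightarrow> eL (jL x) = x"
    and IA: "IA \<subseteq> carrier X" and IL: "IL \<subseteq> carrier Y"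
begin

lemma frame_closed [simp]:
  "u \<in> carrier X \<Longrightarrow> eA u \<in> carrier A" "u \<in> carrier X \<Longrightarrow> fA u \<in> carrier A"
  "y \<in> carrier Y \<Longrightarrow> eL y \<in> carrier L" "y \<in> carrier Y \<Longrightarrow> fL y \<in> carrier L"
  "a \<in> carrier A \<Longrightarrow> jA a \<in> carrier X" "x \<in> carrier L \<Longrightarrow> jL x \<in> carrier Y"
  using eA eL fA fL jA jL by (simp_all add: linear_map_closed)

lemmas f_rules = linear_map_add[OF fA] linear_map_minus[OF fA X_mod A_module] linear_map_diff[OF fA X_mod A_module]
  linear_map_add[OF fL] linear_map_minus[OF fL Y_mod L_module] linear_map_diff[OF fL Y_mod L_module]

end

text \<open>What a lift to an extension of \<open>R\<close> by \<open>M\<close> becomes after contraction with a functional on \<open>M\<close>. That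
  \<open>f\<close> turns operations on \<open>IA\<close> and \<open>IL\<close> into those of the Courant pair holds as the maximal ideal
  annihilates \<open>M\<close>; the defects lie in \<open>IA\<close> and \<open>IL\<close> because they vanish over \<open>R\<close>, and only depend on
  the reductions of their arguments because they are \<open>S\<close>-trilinear.\<close>

locale first_order_lift = first_order_frame K A L \<mu> X Y eA eL fA fL jA jL IA IL
    + operation_triple K X Y m \<nu> b
  for K :: "('k, 'z) ring_scheme" and A :: "('k, 'a) module" and L :: "('k, 'l) module" and \<mu>
    and X :: "('k, 'x) module" and Y :: "('k, 'y) module"
    and eA eL fA fL jA jL IA IL m \<nu> b +
  assumes e_ops: "\<lbrakk>u \<in> carrier X; v \<in> carrier X\<rbrakk> \<Longrightarrow> eA (m u v) = eA u \<otimes>\<^bsub>A\<^esub> eA v"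
      "\<lbrakk>y \<in> carrier Y; v \<in> carrier X\<rbrakk> \<Longrightarrow> eA (\<nu> y v) = \<mu> (eL y) (eA v)"
      "\<lbrakk>y \<in> carrier Y; z \<in> carrier Y\<rbrakk> \<Longrightarrow> eL (b y z) = eL y \<otimes>\<^bsub>L\<^esub> eL z"
    and f_ops: "\<lbrakk>u \<in> carrier X; v \<in> IA\<rbrakk> \<Longrightarrow> fA (m u v) = eA u \<otimes>\<^bsub>A\<^esub> fA v"
      "\<lbrakk>u \<in> IA; v \<in> carrier X\<rbrakk> \<Longrightarrow> fA (m u v) = fA u \<otimes>\<^bsub>A\<^esub> eA v"
      "\<lbrakk>y \<in> carrier Y; v \<in> IA\<rbrakk> \<Longrightarrow> fA (\<nu> y v) = \<mu> (eL y) (fA v)"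
      "\<lbrakk>y \<in> IL; v \<in> carrier X\<rbrakk> \<Longrightarrow> fA (\<nu> y v) = \<mu> (fL y) (eA v)"
      "\<lbrakk>y \<in> carrier Y; z \<in> IL\<rbrakk> \<Longrightarrow> fL (b y z) = eL y \<otimes>\<^bsub>L\<^esub> fL z"
      "\<lbrakk>y \<in> IL; z \<in> carrier Y\<rbrakk> \<Longrightarrow> fL (b y z) = fL y \<otimes>\<^bsub>L\<^esub> eL z"
    and defects_in: "\<lbrakk>u \<in> carrier X; v \<in> carrier X; w \<in> carrier X\<rbrakk> \<Longrightarrow> assoc_defect X m u v w \<in> IA"
      "\<lbrakk>y \<in> carrier Y; u \<in> carrier X; v \<in> carrier X\<rbrakk> \<Longrightarrow> derivation_defect X m \<nu> y u v \<in> IA"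
      "\<lbrakk>y \<in> carrier Y; z \<in> carrier Y; u \<in> carrier X\<rbrakk> \<Longrightarrow> action_defect X \<nu> b y z u \<in> IA"
      "\<lbrakk>x \<in> carrier Y; y \<in> carrier Y; z \<in> carrier Y\<rbrakk> \<Longrightarrow> leibniz_defect Y b x y z \<in> IL"
    and defects_reduce: "\<lbrakk>u \<in> carrier X; v \<in> carrier X; w \<in> carrier X\<rbrakk>
        \<Longrightarrow> fA (assoc_defect X m u v w) = fA (assoc_defect X m (jA (eA u)) (jA (eA v)) (jA (eA w)))"
      "\<lbrakk>y \<in> carrier Y; u \<in> carrier X; v \<in> carrier X\<rbrakk>
        \<Longrightarrow> fA (derivation_defect X m \<nu> y u v) = fA (derivation_defect X m \<nu> (jL (eL y)) (jA (eA u)) (jA (eA v)))"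
      "\<lbrakk>y \<in> carrier Y; z \<in> carrier Y; u \<in> carrier X\<rbrakk>
        \<Longrightarrow> fA (action_defect X \<nu> b y z u) = fA (action_defect X \<nu> b (jL (eL y)) (jL (eL z)) (jA (eA u)))"
      "\<lbrakk>x \<in> carrier Y; y \<in> carrier Y; z \<in> carrier Y\<rbrakk>
        \<Longrightarrow> fL (leibniz_defect Y b x y z) = fL (leibniz_defect Y b (jL (eL x)) (jL (eL y)) (jL (eL z)))"
begin

abbreviation "theta \<equiv> defect_cochain A L X Y fA fL jA jL m \<nu> b"

lemma theta_closed: "theta \<in> carrier (cochains K A L 3)"
  unfolding defect_cochain_def
  by (intro cochain3_closed A_module L_module trilinear_comp[OF defect_trilinear(1) jA jA jA fA]
      trilinear_comp[OF defect_trilinear(2) jL jA jA fA] trilinear_comp[OF defect_trilinear(3) jL jL jA fA]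
      trilinear_comp[OF defect_trilinear(4) jL jL jL fL])

text \<open>After \<open>f\<close> the defects only see reductions, so arguments in the image of \<open>e\<close> may be replaced by any
  preimages. This is the form in which the Bianchi identities apply.\<close>

lemma theta_values:
  "\<lbrakk>u \<in> carrier X; v \<in> carrier X; w \<in> carrier X\<rbrakk>
     \<Longrightarrow> snd theta ([], [eA u, eA v, eA w]) = fA (assoc_defect X m u v w)"
  "\<lbrakk>y \<in> carrier Y; u \<in> carrier X; v \<in> carrier X\<rbrakk>
     \<Longrightarrow> snd theta ([eL y], [eA u, eA v]) = fA (derivation_defect X m \<nu> y u v)"
  "\<lbrakk>y \<in> carrier Y; z \<in> carrier Y; u \<in> carrier X\<rbrakk>
     \<Longrightarrow> snd theta ([eL y, eL z], [eA u]) = fA (action_defect X \<nu> b y z u)"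
  "\<lbrakk>x \<in> carrier Y; y \<in> carrier Y; z \<in> carrier Y\<rbrakk>
     \<Longrightarrow> fst theta [eL x, eL y, eL z] = fL (leibniz_defect Y b x y z)"
  unfolding defect_cochain_def by (simp_all add: cochain3_values defects_reduce[symmetric])

text \<open>When \<open>f\<close> is applied to a Bianchi identity, each outer operation turns into that of the Courant pair,
  because the defects lie in \<open>IA\<close> and \<open>IL\<close>; the result is the cocycle condition.\<close>

lemma theta_cocycle: "theta \<in> carrier (cocycles K A L \<mu> 3)"
proof -
  have e: "\<And>a. a \<in> carrier A \<Longrightarrow> \<exists>u\<in>carrier X. a = eA u" "\<And>x. x \<in> carrier L \<Longrightarrow> \<exists>y\<in>carrier Y. x = eL y"
    using eA_jA eL_jL frame_closed(5,6) by metis+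
  note rules = e_ops[symmetric] theta_values f_ops[symmetric] defects_in f_rules[symmetric]
    linear_map_zero[OF fA X_mod A_module] linear_map_zero[OF fL Y_mod L_module]
    bianchi_40 bianchi_31 bianchi_22 bianchi_13 bianchi_04
  let ?D = "total_cobdry A L \<mu> 3 theta"
  have "snd ?D (xs, as) = \<zero>\<^bsub>A\<^esub>" if z: "(xs, as) \<in> args1 A L 4" for xs as
  proof -
    consider a b c d where "xs = []" "as = [a, b, c, d]" "a \<in> carrier A" "b \<in> carrier A" "c \<in> carrier A" "d \<in> carrier A"
      | x a b c where "xs = [x]" "as = [a, b, c]" "x \<in> carrier L" "a \<in> carrier A" "b \<in> carrier A" "c \<in> carrier A"
      | x y a b where "xs = [x, y]" "as = [a, b]" "x \<in> carrier L" "y \<in> carrier L" "a \<in> carrier A" "b \<in> carrier A"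
      | x y z a where "xs = [x, y, z]" "as = [a]" "x \<in> carrier L" "y \<in> carrier L" "z \<in> carrier L" "a \<in> carrier A"
      using z by (auto simp: args_short_cases)
    then show ?thesis
    proof cases
      case (1 a b c d)
      then obtain u1 u2 u3 u4 where "u1 \<in> carrier X" "u2 \<in> carrier X" "u3 \<in> carrier X" "u4 \<in> carrier X"
        "a = eA u1" "b = eA u2" "c = eA u3" "d = eA u4" using e by meson
      with 1(1,2) show ?thesis by (simp add: d3_values[OF theta_closed] rules)
    next
      case (2 x a b c)
      then obtain y1 u1 u2 u3 where "y1 \<in> carrier Y" "u1 \<in> carrier X" "u2 \<in> carrier X" "u3 \<in> carrier X"
        "x = eL y1" "a = eA u1" "b = eA u2" "c = eA u3" using e by meson
      with 2(1,2) show ?thesis by (simp add: d3_values[OF theta_closed] rules)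
    next
      case (3 x y a b)
      then obtain y1 y2 u1 u2 where "y1 \<in> carrier Y" "y2 \<in> carrier Y" "u1 \<in> carrier X" "u2 \<in> carrier X"
        "x = eL y1" "y = eL y2" "a = eA u1" "b = eA u2" using e by meson
      with 3(1,2) show ?thesis by (simp add: d3_values[OF theta_closed] rules)
    next
      case (4 x y z a)
      then obtain y1 y2 y3 u1 where "y1 \<in> carrier Y" "y2 \<in> carrier Y" "y3 \<in> carrier Y" "u1 \<in> carrier X"
        "x = eL y1" "y = eL y2" "z = eL y3" "a = eA u1" using e by meson
      with 4(1,2) show ?thesis by (simp add: d3_values[OF theta_closed] rules)
    qed
  qed
  moreover have "fst ?D xs = \<zero>\<^bsub>L\<^esub>" if "xs \<in> args0 L 4" for xs
  proof -
    from that obtain x y z w where x: "xs = [x, y, z, w]" "x \<in> carrier L" "y \<in> carrier L" "z \<in> carrier L" "w \<in> carrier L"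
      by (auto simp: args_short_cases)
    then obtain y1 y2 y3 y4 where "y1 \<in> carrier Y" "y2 \<in> carrier Y" "y3 \<in> carrier Y" "y4 \<in> carrier Y"
      "x = eL y1" "y = eL y2" "z = eL y3" "w = eL y4" using e by meson
    with x(1) show ?thesis by (simp add: d3_values[OF theta_closed] rules)
  qed
  ultimately have "?D = \<zero>\<^bsub>cochains K A L (3 + 1)\<^esub>"
    by (intro extensional_pair_eqI[OF total_cobdry_extensional]) (auto simp: cochains_simps)
  then show ?thesis using theta_closed by (simp add: cocycles_def)
qed

end

text \<open>In the model these are two lifts of the same deformation over \<open>R\<close>. Their differences vanish over \<open>R\<close>
  and are \<open>S\<close>-bilinear, so what was said about the defects applies to them as well.\<close>

locale first_order_lifts =
  first_order_lift K A L \<mu> X Y eA eL fA fL jA jL IA IL m \<nu> b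
    + l': first_order_lift K A L \<mu> X Y eA eL fA fL jA jL IA IL m' \<nu>' b'
  for K :: "('k, 'z) ring_scheme" and A :: "('k, 'a) module" and L :: "('k, 'l) module" and \<mu>
    and X :: "('k, 'x) module" and Y :: "('k, 'y) module"
    and eA eL fA fL jA jL IA IL m \<nu> b m' \<nu>' b' +
  assumes differences_in: "\<lbrakk>u \<in> carrier X; v \<in> carrier X\<rbrakk> \<Longrightarrow> m u v \<ominus>\<^bsub>X\<^esub> m' u v \<in> IA"
      "\<lbrakk>y \<in> carrier Y; v \<in> carrier X\<rbrakk> \<Longrightarrow> \<nu> y v \<ominus>\<^bsub>X\<^esub> \<nu>' y v \<in> IA"
      "\<lbrakk>y \<in> carrier Y; z \<in> carrier Y\<rbrakk> \<Longrightarrow> b y z \<ominus>\<^bsub>Y\<^esub> b' y z \<in> IL"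
    and differences_reduce: "\<lbrakk>u \<in> carrier X; v \<in> carrier X\<rbrakk>
        \<Longrightarrow> fA (m u v \<ominus>\<^bsub>X\<^esub> m' u v) = fA (m (jA (eA u)) (jA (eA v)) \<ominus>\<^bsub>X\<^esub> m' (jA (eA u)) (jA (eA v)))"
      "\<lbrakk>y \<in> carrier Y; v \<in> carrier X\<rbrakk>
        \<Longrightarrow> fA (\<nu> y v \<ominus>\<^bsub>X\<^esub> \<nu>' y v) = fA (\<nu> (jL (eL y)) (jA (eA v)) \<ominus>\<^bsub>X\<^esub> \<nu>' (jL (eL y)) (jA (eA v)))"
      "\<lbrakk>y \<in> carrier Y; z \<in> carrier Y\<rbrakk>
        \<Longrightarrow> fL (b y z \<ominus>\<^bsub>Y\<^esub> b' y z) = fL (b (jL (eL y)) (jL (eL z)) \<ominus>\<^bsub>Y\<^esub> b' (jL (eL y)) (jL (eL z)))"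
begin

abbreviation "difference \<equiv> difference_cochain A L X Y fA fL jA jL m \<nu> b m' \<nu>' b'"

lemma difference_closed: "difference \<in> carrier (cochains K A L 2)"
  unfolding difference_cochain_def
proof (intro cochain2_closed A_module L_module)
  show "bilinear_map K A A A (\<lambda>a1 a2. fA (m (jA a1) (jA a2) \<ominus>\<^bsub>X\<^esub> m' (jA a1) (jA a2)))"
    by (rule bilinear_comp[OF bilinear_map_sub[OF m l'.m X_mod X_mod X_mod] jA jA fA])
  show "bilinear_map K L A A (\<lambda>x a. fA (\<nu> (jL x) (jA a) \<ominus>\<^bsub>X\<^esub> \<nu>' (jL x) (jA a)))"
    by (rule bilinear_comp[OF bilinear_map_sub[OF \<nu> l'.\<nu> Y_mod X_mod X_mod] jL jA fA])
  show "bilinear_map K L L L (\<lambda>x y. fL (b (jL x) (jL y) \<ominus>\<^bsub>Y\<^esub> b' (jL x) (jL y)))"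
    by (rule bilinear_comp[OF bilinear_map_sub[OF b l'.b Y_mod Y_mod Y_mod] jL jL fL])
qed

lemma difference_values:
  "\<lbrakk>u \<in> carrier X; v \<in> carrier X\<rbrakk>
     \<Longrightarrow> snd difference ([], [eA u, eA v]) = fA (m u v \<ominus>\<^bsub>X\<^esub> m' u v)"
  "\<lbrakk>y \<in> carrier Y; u \<in> carrier X\<rbrakk>
     \<Longrightarrow> snd difference ([eL y], [eA u]) = fA (\<nu> y u \<ominus>\<^bsub>X\<^esub> \<nu>' y u)"
  "\<lbrakk>y \<in> carrier Y; z \<in> carrier Y\<rbrakk>
     \<Longrightarrow> fst difference [eL y, eL z] = fL (b y z \<ominus>\<^bsub>Y\<^esub> b' y z)"
  unfolding difference_cochain_def by (simp_all add: cochain2_values differences_reduce[symmetric])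

text \<open>Telescoping: in each composite of two operations one of them is exchanged at a time.\<close>

lemma defect_differences:
  "\<lbrakk>u \<in> carrier X; v \<in> carrier X; w \<in> carrier X\<rbrakk> \<Longrightarrow>
     assoc_defect X m u v w = assoc_defect X m' u v w \<oplus>\<^bsub>X\<^esub>
       (m' u (m v w \<ominus>\<^bsub>X\<^esub> m' v w) \<ominus>\<^bsub>X\<^esub> (m (m u v) w \<ominus>\<^bsub>X\<^esub> m' (m u v) w)
        \<oplus>\<^bsub>X\<^esub> (m u (m v w) \<ominus>\<^bsub>X\<^esub> m' u (m v w)) \<ominus>\<^bsub>X\<^esub> m' (m u v \<ominus>\<^bsub>X\<^esub> m' u v) w)"
  "\<lbrakk>y \<in> carrier Y; u \<in> carrier X; v \<in> carrier X\<rbrakk> \<Longrightarrow>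
     derivation_defect X m \<nu> y u v = derivation_defect X m' \<nu>' y u v \<oplus>\<^bsub>X\<^esub>
       (m' u (\<nu> y v \<ominus>\<^bsub>X\<^esub> \<nu>' y v) \<ominus>\<^bsub>X\<^esub> (\<nu> y (m u v) \<ominus>\<^bsub>X\<^esub> \<nu>' y (m u v)) \<oplus>\<^bsub>X\<^esub> m' (\<nu> y u \<ominus>\<^bsub>X\<^esub> \<nu>' y u) v
        \<ominus>\<^bsub>X\<^esub> (\<nu>' y (m u v \<ominus>\<^bsub>X\<^esub> m' u v) \<ominus>\<^bsub>X\<^esub> (m (\<nu> y u) v \<ominus>\<^bsub>X\<^esub> m' (\<nu> y u) v)
          \<ominus>\<^bsub>X\<^esub> (m u (\<nu> y v) \<ominus>\<^bsub>X\<^esub> m' u (\<nu> y v))))"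
  "\<lbrakk>y \<in> carrier Y; z \<in> carrier Y; u \<in> carrier X\<rbrakk> \<Longrightarrow>
     action_defect X \<nu> b y z u = action_defect X \<nu>' b' y z u \<oplus>\<^bsub>X\<^esub>
       (\<nu>' (b y z \<ominus>\<^bsub>Y\<^esub> b' y z) u \<ominus>\<^bsub>X\<^esub> (\<nu>' y (\<nu> z u \<ominus>\<^bsub>X\<^esub> \<nu>' z u) \<ominus>\<^bsub>X\<^esub> (\<nu> z (\<nu> y u) \<ominus>\<^bsub>X\<^esub> \<nu>' z (\<nu> y u)))
        \<oplus>\<^bsub>X\<^esub> (\<nu>' z (\<nu> y u \<ominus>\<^bsub>X\<^esub> \<nu>' y u) \<ominus>\<^bsub>X\<^esub> (\<nu> y (\<nu> z u) \<ominus>\<^bsub>X\<^esub> \<nu>' y (\<nu> z u)))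
        \<oplus>\<^bsub>X\<^esub> (\<nu> (b y z) u \<ominus>\<^bsub>X\<^esub> \<nu>' (b y z) u))"
  "\<lbrakk>x \<in> carrier Y; y \<in> carrier Y; z \<in> carrier Y\<rbrakk> \<Longrightarrow>
     leibniz_defect Y b x y z = leibniz_defect Y b' x y z \<oplus>\<^bsub>Y\<^esub>
       (b' y (b x z \<ominus>\<^bsub>Y\<^esub> b' x z) \<ominus>\<^bsub>Y\<^esub> b' x (b y z \<ominus>\<^bsub>Y\<^esub> b' y z) \<oplus>\<^bsub>Y\<^esub> b' (b x y \<ominus>\<^bsub>Y\<^esub> b' x y) z
        \<oplus>\<^bsub>Y\<^esub> (b (b x y) z \<ominus>\<^bsub>Y\<^esub> b' (b x y) z) \<oplus>\<^bsub>Y\<^esub> (b y (b x z) \<ominus>\<^bsub>Y\<^esub> b' y (b x z))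
        \<ominus>\<^bsub>Y\<^esub> (b x (b y z) \<ominus>\<^bsub>Y\<^esub> b' x (b y z)))"
  by (simp_all add: defect_defs l'.triple_rules X.signed_sum_simps Y.signed_sum_simps)

text \<open>In the telescoped differences of the defects, every outer operation is applied to an element of \<open>IA\<close>
  or \<open>IL\<close>, where \<open>f\<close> turns it into that of the Courant pair. What results is the coboundary formula.\<close>

lemma theta_difference: "theta = l'.theta \<oplus>\<^bsub>cochains K A L 3\<^esub> total_cobdry A L \<mu> 2 difference"
proof -
  have e: "\<And>a. a \<in> carrier A \<Longrightarrow> \<exists>u\<in>carrier X. a = eA u" "\<And>x. x \<in> carrier L \<Longrightarrow> \<exists>y\<in>carrier Y. x = eL y"
    using eA_jA eL_jL frame_closed(5,6) by metis+
  note rules = e_ops[symmetric] theta_values l'.theta_values difference_values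
  note rules2 = l'.f_ops[symmetric] differences_in f_rules[symmetric]
  let ?D = "total_cobdry A L \<mu> 2 difference"
  have "snd theta (xs, as) = snd l'.theta (xs, as) \<oplus>\<^bsub>A\<^esub> snd ?D (xs, as)" if z: "(xs, as) \<in> args1 A L 3" for xs as
  proof -
    consider a b c where "xs = []" "as = [a, b, c]" "a \<in> carrier A" "b \<in> carrier A" "c \<in> carrier A"
      | x a b where "xs = [x]" "as = [a, b]" "x \<in> carrier L" "a \<in> carrier A" "b \<in> carrier A"
      | x y a where "xs = [x, y]" "as = [a]" "x \<in> carrier L" "y \<in> carrier L" "a \<in> carrier A"
      using z by (auto simp: args_short_cases)
    then show ?thesis
    proof cases
      case (1 a b c)
      then obtain u1 u2 u3 where "u1 \<in> carrier X" "u2 \<in> carrier X" "u3 \<in> carrier X"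
        "a = eA u1" "b = eA u2" "c = eA u3" using e by meson
      with 1(1,2) show ?thesis
        by (simp add: d2_values[OF difference_closed] rules defect_differences(1))
          (simp add: rules2)
    next
      case (2 x a b)
      then obtain y1 u1 u2 where "y1 \<in> carrier Y" "u1 \<in> carrier X" "u2 \<in> carrier X"
        "x = eL y1" "a = eA u1" "b = eA u2" using e by meson
      with 2(1,2) show ?thesis
        by (simp add: d2_values[OF difference_closed] rules defect_differences(2))
          (simp add: rules2)
    next
      case (3 x y a)
      then obtain y1 y2 u1 where "y1 \<in> carrier Y" "y2 \<in> carrier Y" "u1 \<in> carrier X"
        "x = eL y1" "y = eL y2" "a = eA u1" using e by meson
      with 3(1,2) show ?thesis
        by (simp add: d2_values[OF difference_closed] rules defect_differences(3))
          (simp add: rules2)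
    qed
  qed
  moreover have "fst theta xs = fst l'.theta xs \<oplus>\<^bsub>L\<^esub> fst ?D xs" if "xs \<in> args0 L 3" for xs
  proof -
    from that obtain x y z where x: "xs = [x, y, z]" "x \<in> carrier L" "y \<in> carrier L" "z \<in> carrier L"
      by (auto simp: args_short_cases)
    then obtain y1 y2 y3 where "y1 \<in> carrier Y" "y2 \<in> carrier Y" "y3 \<in> carrier Y"
      "x = eL y1" "y = eL y2" "z = eL y3" using e by meson
    with x(1) show ?thesis
      by (simp add: d2_values[OF difference_closed] rules defect_differences(4))
        (simp add: rules2)
  qed
  ultimately show ?thesis
    using theta_closed by (intro extensional_pair_eqI) (auto simp: cochains_simps cochains_carrier_iff PiE_def)
qed

end

section \<open>Cohomology in degree 3\<close>

context courant
begin

lemma short_args_mem: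
  "\<lbrakk>a \<in> carrier A; b \<in> carrier A\<rbrakk> \<Longrightarrow> ([], [a, b]) \<in> args1 A L 2"
  "\<lbrakk>x \<in> carrier L; a \<in> carrier A\<rbrakk> \<Longrightarrow> ([x], [a]) \<in> args1 A L 2"
  "\<lbrakk>x \<in> carrier L; y \<in> carrier L\<rbrakk> \<Longrightarrow> [x, y] \<in> args0 L 2"
  "\<lbrakk>a \<in> carrier A; b \<in> carrier A; c \<in> carrier A\<rbrakk> \<Longrightarrow> ([], [a, b, c]) \<in> args1 A L 3"
  "\<lbrakk>x \<in> carrier L; a \<in> carrier A; b \<in> carrier A\<rbrakk> \<Longrightarrow> ([x], [a, b]) \<in> args1 A L 3"
  "\<lbrakk>x \<in> carrier L; y \<in> carrier L; a \<in> carrier A\<rbrakk> \<Longrightarrow> ([x, y], [a]) \<in> args1 A L 3"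
  "\<lbrakk>x \<in> carrier L; y \<in> carrier L; z \<in> carrier L\<rbrakk> \<Longrightarrow> [x, y, z] \<in> args0 L 3"
  by (simp_all add: args_short_cases)

lemma d2_linear:
  assumes c: "c \<in> carrier (cochains K A L 2)" and c': "c' \<in> carrier (cochains K A L 2)" and k: "k \<in> carrier K"
  shows "total_cobdry A L \<mu> 2 (c \<oplus>\<^bsub>cochains K A L 2\<^esub> c') =
      total_cobdry A L \<mu> 2 c \<oplus>\<^bsub>cochains K A L 3\<^esub> total_cobdry A L \<mu> 2 c'" (is "?l1 = ?r1")
    and "total_cobdry A L \<mu> 2 (k \<odot>\<^bsub>cochains K A L 2\<^esub> c) = k \<odot>\<^bsub>cochains K A L 3\<^esub> total_cobdry A L \<mu> 2 c" (is "?l2 = ?r2")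
proof -
  interpret C: module K "cochains K A L 2" by (rule cochains_module[OF A_module L_module])
  note vals = d2_values[OF c] d2_values[OF c'] d2_values[OF C.a_closed[OF c c']] d2_values[OF C.smult_closed[OF k c]]
  note simps = vals cochains_eval short_args_mem mult_rules bracket_rules action_rules
    cochain_closed[OF c] cochain_closed[OF c'] A.signed_sum_simps L.signed_sum_simps
    A.smult_r_distr L.smult_r_distr A.smult_r_diff L.smult_r_diff k
  show "?l1 = ?r1"
  proof (rule extensional_pair_eqI)
    fix xs as assume "(xs, as) \<in> args1 A L 3"
    then show "snd ?l1 (xs, as) = snd ?r1 (xs, as)"
      unfolding args_short_cases by (elim disjE exE conjE) (simp_all add: simps)
  next
    fix xs assume "xs \<in> args0 L 3"
    then show "fst ?l1 xs = fst ?r1 xs"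
      unfolding args_short_cases by (elim exE conjE) (simp add: simps)
  qed (use total_cobdry_extensional[of A L \<mu> 2] in \<open>simp_all add: cochains_extensional\<close>)
  show "?l2 = ?r2"
  proof (rule extensional_pair_eqI)
    fix xs as assume "(xs, as) \<in> args1 A L 3"
    then show "snd ?l2 (xs, as) = snd ?r2 (xs, as)"
      unfolding args_short_cases by (elim disjE exE conjE) (simp_all add: simps)
  next
    fix xs assume "xs \<in> args0 L 3"
    then show "fst ?l2 xs = fst ?r2 xs"
      unfolding args_short_cases by (elim exE conjE) (simp add: simps)
  qed (use total_cobdry_extensional[of A L \<mu> 2] in \<open>simp_all add: cochains_extensional\<close>)
qed

lemma d3_linear:
  assumes c: "c \<in> carrier (cochains K A L 3)" and c': "c' \<in> carrier (cochains K A L 3)" and k: "k \<in> carrier K"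
  shows "total_cobdry A L \<mu> 3 (c \<oplus>\<^bsub>cochains K A L 3\<^esub> c') =
      total_cobdry A L \<mu> 3 c \<oplus>\<^bsub>cochains K A L 4\<^esub> total_cobdry A L \<mu> 3 c'" (is "?l1 = ?r1")
    and "total_cobdry A L \<mu> 3 (k \<odot>\<^bsub>cochains K A L 3\<^esub> c) = k \<odot>\<^bsub>cochains K A L 4\<^esub> total_cobdry A L \<mu> 3 c" (is "?l2 = ?r2")
proof -
  interpret C: module K "cochains K A L 3" by (rule cochains_module[OF A_module L_module])
  note vals = d3_values[OF c] d3_values[OF c'] d3_values[OF C.a_closed[OF c c']] d3_values[OF C.smult_closed[OF k c]]
  note simps = vals cochains_eval short_args_mem mult_rules bracket_rules action_rules
    cochain_closed[OF c] cochain_closed[OF c'] A.signed_sum_simps L.signed_sum_simps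
    A.smult_r_distr L.smult_r_distr A.smult_r_diff L.smult_r_diff k
  show "?l1 = ?r1"
  proof (rule extensional_pair_eqI)
    fix xs as assume m: "(xs, as) \<in> args1 A L 4"
    then show "snd ?l1 (xs, as) = snd ?r1 (xs, as)"
      unfolding cochains_eval(2)[OF m]
      unfolding args_short_cases by (elim disjE exE conjE) (simp_all add: simps)
  next
    fix xs assume m: "xs \<in> args0 L 4"
    then show "fst ?l1 xs = fst ?r1 xs"
      unfolding cochains_eval(1)[OF m]
      unfolding args_short_cases by (elim exE conjE) (simp add: simps)
  qed (use total_cobdry_extensional[of A L \<mu> 3] in \<open>simp_all add: cochains_extensional\<close>)
  show "?l2 = ?r2"
  proof (rule extensional_pair_eqI)
    fix xs as assume m: "(xs, as) \<in> args1 A L 4"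
    then show "snd ?l2 (xs, as) = snd ?r2 (xs, as)"
      unfolding cochains_eval(4)[OF m]
      unfolding args_short_cases by (elim disjE exE conjE) (simp_all add: simps)
  next
    fix xs assume m: "xs \<in> args0 L 4"
    then show "fst ?l2 xs = fst ?r2 xs"
      unfolding cochains_eval(3)[OF m]
      unfolding args_short_cases by (elim exE conjE) (simp add: simps)
  qed (use total_cobdry_extensional[of A L \<mu> 3] in \<open>simp_all add: cochains_extensional\<close>)
qed

lemma cocycles_submodule: "submodule (carrier (cocycles K A L \<mu> 3)) K (cochains K A L 3)"
proof -
  interpret C: module K "cochains K A L 3" by (rule cochains_module[OF A_module L_module])
  interpret C4: module K "cochains K A L 4" by (rule cochains_module[OF A_module L_module])
  let ?Z = "carrier (cocycles K A L \<mu> 3)"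
  have mem: "c \<in> ?Z \<longleftrightarrow> c \<in> carrier (cochains K A L 3) \<and> total_cobdry A L \<mu> 3 c = \<zero>\<^bsub>cochains K A L 4\<^esub>" for c
    by (simp add: cocycles_def)
  have smult: "k \<odot>\<^bsub>cochains K A L 3\<^esub> c \<in> ?Z" if "k \<in> carrier K" "c \<in> ?Z" for k c
    using that d3_linear(2)[of c c k] by (simp add: mem)
  have add: "c \<oplus>\<^bsub>cochains K A L 3\<^esub> d \<in> ?Z" if "c \<in> ?Z" "d \<in> ?Z" for c d
    using that d3_linear(1)[of c d "\<zero>\<^bsub>K\<^esub>"] by (simp add: mem)
  have zero: "\<zero>\<^bsub>cochains K A L 3\<^esub> \<in> ?Z"
  proof -
    note simps = d3_values[OF C.zero_closed] cochains_eval short_args_mem mult_rules bracket_rules action_rules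
      A.signed_sum_simps L.signed_sum_simps
    have "total_cobdry A L \<mu> 3 \<zero>\<^bsub>cochains K A L 3\<^esub> = \<zero>\<^bsub>cochains K A L 4\<^esub>"
    proof (rule extensional_pair_eqI)
      fix xs as assume m: "(xs, as) \<in> args1 A L 4"
      then show "snd (total_cobdry A L \<mu> 3 \<zero>\<^bsub>cochains K A L 3\<^esub>) (xs, as) = snd \<zero>\<^bsub>cochains K A L 4\<^esub> (xs, as)"
        unfolding cochains_eval(6)[OF m]
        unfolding args_short_cases by (elim disjE exE conjE) (simp_all add: simps)
    next
      fix xs assume m: "xs \<in> args0 L 4"
      then show "fst (total_cobdry A L \<mu> 3 \<zero>\<^bsub>cochains K A L 3\<^esub>) xs = fst \<zero>\<^bsub>cochains K A L 4\<^esub> xs"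
        unfolding cochains_eval(5)[OF m]
        unfolding args_short_cases by (elim exE conjE) (simp add: simps)
    qed (use total_cobdry_extensional[of A L \<mu> 3] in \<open>simp_all add: cochains_extensional\<close>)
    then show ?thesis by (simp add: mem)
  qed
  show ?thesis
  proof (rule C.submoduleI)
    show "\<ominus>\<^bsub>cochains K A L 3\<^esub> c \<in> ?Z" if "c \<in> ?Z" for c
      using smult[of "\<ominus>\<^bsub>K\<^esub> \<one>\<^bsub>K\<^esub>" c] that by (simp add: C.smult_l_minus mem)
  qed (use add smult zero mem in auto)
qed

lemma cocycles_module: "module K (cocycles K A L \<mu> 3)"
  using submodule.submodule_is_module[OF cocycles_submodule cochains_module[OF A_module L_module]]
  by (simp add: cocycles_def)

end

subsection \<open>Dual numbers\<close>

definition dual_module :: "('k, 'v) module \<Rightarrow> ('k, 'v \<times> 'v) module" where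
  "dual_module V =
     \<lparr>carrier = carrier V \<times> carrier V, mult = undefined, one = undefined,
      zero = (\<zero>\<^bsub>V\<^esub>, \<zero>\<^bsub>V\<^esub>),
      add = (\<lambda>u v. (fst u \<oplus>\<^bsub>V\<^esub> fst v, snd u \<oplus>\<^bsub>V\<^esub> snd v)),
      smult = (\<lambda>c u. (c \<odot>\<^bsub>V\<^esub> fst u, c \<odot>\<^bsub>V\<^esub> snd u))\<rparr>"

text \<open>The pair \<open>(u\<^sub>0, u\<^sub>1)\<close> stands for \<open>u\<^sub>0 + t u\<^sub>1\<close> with \<open>t\<^sup>2 = 0\<close>, and the operation is the bilinear
  extension of \<open>f + t \<phi>\<close> over the dual numbers.\<close>

definition dual_op ::
  "('k, 'w) module \<Rightarrow> ('u \<Rightarrow> 'v \<Rightarrow> 'w) \<Rightarrow> ('u \<Rightarrow> 'v \<Rightarrow> 'w) \<Rightarrow> 'u \<times> 'u \<Rightarrow> 'v \<times> 'v \<Rightarrow> 'w \<times> 'w" where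
  "dual_op W f \<phi> u v =
     (f (fst u) (fst v), f (fst u) (snd v) \<oplus>\<^bsub>W\<^esub> f (snd u) (fst v) \<oplus>\<^bsub>W\<^esub> \<phi> (fst u) (fst v))"

lemma dual_module_module:
  assumes "module K V"
  shows "module K (dual_module V)"
proof -
  interpret V: module K V by fact
  show ?thesis
  proof (rule moduleI)
    show "cring K" using assms by (simp add: module_def)
    show "abelian_group (dual_module V)"
    proof (rule abelian_groupI)
      fix u assume "u \<in> carrier (dual_module V)"
      then show "\<exists>v\<in>carrier (dual_module V). v \<oplus>\<^bsub>dual_module V\<^esub> u = \<zero>\<^bsub>dual_module V\<^esub>"
        by (intro bexI[of _ "(\<ominus>\<^bsub>V\<^esub> fst u, \<ominus>\<^bsub>V\<^esub> snd u)"]) (auto simp: dual_module_def V.l_neg)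
    qed (auto simp: dual_module_def V.a_ac)
  qed (auto simp: dual_module_def V.smult_l_distr V.smult_r_distr V.smult_assoc1)
qed

lemma dual_module_linear:
  assumes "module K V"
  shows "linear_map K (dual_module V) V fst" "linear_map K (dual_module V) V snd"
    "linear_map K V (dual_module V) (\<lambda>v. (v, \<zero>\<^bsub>V\<^esub>))"
proof -
  interpret V: module K V by fact
  show "linear_map K (dual_module V) V fst" "linear_map K (dual_module V) V snd"
    "linear_map K V (dual_module V) (\<lambda>v. (v, \<zero>\<^bsub>V\<^esub>))"
    by (auto simp: linear_map_def dual_module_def)
qed

lemma dual_op_bilinear:
  assumes f: "bilinear_map K U V W f" and g: "bilinear_map K U V W g"
    and U: "module K U" and V: "module K V" and W: "module K W"
  shows "bilinear_map K (dual_module U) (dual_module V) (dual_module W) (dual_op W f g)"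
proof -
  interpret W: module K W by fact
  show ?thesis
    by (intro bilinear_mapI linear_mapI)
      (auto simp: dual_module_def dual_op_def bilinear_closed[OF f] bilinear_closed[OF g]
        bilinear_add[OF f] bilinear_add[OF g] bilinear_smult[OF f] bilinear_smult[OF g] W.a_ac W.smult_r_distr)
qed

lemma dual_module_simps:
  "carrier (dual_module V) = carrier V \<times> carrier V"
  "u \<oplus>\<^bsub>dual_module V\<^esub> v = (fst u \<oplus>\<^bsub>V\<^esub> fst v, snd u \<oplus>\<^bsub>V\<^esub> snd v)"
  by (simp_all add: dual_module_def)

lemma dual_module_minus:
  assumes V: "module K V" and u: "u \<in> carrier (dual_module V)"
  shows "\<ominus>\<^bsub>dual_module V\<^esub> u = (\<ominus>\<^bsub>V\<^esub> fst u, \<ominus>\<^bsub>V\<^esub> snd u)"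
    and "v \<in> carrier (dual_module V) \<Longrightarrow> u \<ominus>\<^bsub>dual_module V\<^esub> v = (fst u \<ominus>\<^bsub>V\<^esub> fst v, snd u \<ominus>\<^bsub>V\<^esub> snd v)"
proof -
  note l = dual_module_linear(1,2)[OF V] and D = dual_module_module[OF V]
  show "\<ominus>\<^bsub>dual_module V\<^esub> u = (\<ominus>\<^bsub>V\<^esub> fst u, \<ominus>\<^bsub>V\<^esub> snd u)"
    using linear_map_minus[OF l(1) D V u] linear_map_minus[OF l(2) D V u] by (metis prod.collapse)
  show "u \<ominus>\<^bsub>dual_module V\<^esub> v = (fst u \<ominus>\<^bsub>V\<^esub> fst v, snd u \<ominus>\<^bsub>V\<^esub> snd v)" if "v \<in> carrier (dual_module V)"
    using linear_map_diff[OF l(1) D V u that] linear_map_diff[OF l(2) D V u that] by (metis prod.collapse)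
qed

context courant
begin

lemma dual_numbers_triple:
  assumes \<alpha>: "bilinear_map K A A A \<alpha>" and \<beta>: "bilinear_map K L A A \<beta>" and \<gamma>: "bilinear_map K L L L \<gamma>"
  shows "operation_triple K (dual_module A) (dual_module L)
    (dual_op A (mult A) \<alpha>) (dual_op A \<mu> \<beta>) (dual_op L (mult L) \<gamma>)"
  by (intro operation_triple.intro dual_module_module dual_op_bilinear mult_bilinear action_bilinear
      bracket_bilinear \<alpha> \<beta> \<gamma> A_module L_module)

text \<open>At \<open>t = 0\<close> the operations are those of the Courant pair, so their defects are multiples of \<open>t\<close>. The
  coefficient of \<open>t\<close> is the coboundary formula for \<open>(\<alpha>, \<beta>, \<gamma>)\<close>.\<close>

lemma dual_numbers_defects:
  assumes \<alpha>: "bilinear_map K A A A \<alpha>" and \<beta>: "bilinear_map K L A A \<beta>" and \<gamma>: "bilinear_map K L L L \<gamma>"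
  shows "\<lbrakk>u \<in> carrier (dual_module A); v \<in> carrier (dual_module A); w \<in> carrier (dual_module A)\<rbrakk> \<Longrightarrow>
      assoc_defect (dual_module A) (dual_op A (mult A) \<alpha>) u v w =
      (\<zero>\<^bsub>A\<^esub>, fst u \<otimes>\<^bsub>A\<^esub> \<alpha> (fst v) (fst w) \<ominus>\<^bsub>A\<^esub> \<alpha> (fst u \<otimes>\<^bsub>A\<^esub> fst v) (fst w)
         \<oplus>\<^bsub>A\<^esub> \<alpha> (fst u) (fst v \<otimes>\<^bsub>A\<^esub> fst w) \<ominus>\<^bsub>A\<^esub> \<alpha> (fst u) (fst v) \<otimes>\<^bsub>A\<^esub> fst w)"
      (is "\<lbrakk>?a1; ?b1; ?c1\<rbrakk> \<Longrightarrow> ?P1")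
    and "\<lbrakk>y \<in> carrier (dual_module L); u \<in> carrier (dual_module A); v \<in> carrier (dual_module A)\<rbrakk> \<Longrightarrow>
      derivation_defect (dual_module A) (dual_op A (mult A) \<alpha>) (dual_op A \<mu> \<beta>) y u v =
      (\<zero>\<^bsub>A\<^esub>, fst u \<otimes>\<^bsub>A\<^esub> \<beta> (fst y) (fst v) \<ominus>\<^bsub>A\<^esub> \<beta> (fst y) (fst u \<otimes>\<^bsub>A\<^esub> fst v) \<oplus>\<^bsub>A\<^esub> \<beta> (fst y) (fst u) \<otimes>\<^bsub>A\<^esub> fst v
         \<ominus>\<^bsub>A\<^esub> (\<mu> (fst y) (\<alpha> (fst u) (fst v)) \<ominus>\<^bsub>A\<^esub> \<alpha> (\<mu> (fst y) (fst u)) (fst v) \<ominus>\<^bsub>A\<^esub> \<alpha> (fst u) (\<mu> (fst y) (fst v))))"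
      (is "\<lbrakk>?a2; ?b2; ?c2\<rbrakk> \<Longrightarrow> ?P2")
    and "\<lbrakk>y \<in> carrier (dual_module L); z \<in> carrier (dual_module L); u \<in> carrier (dual_module A)\<rbrakk> \<Longrightarrow>
      action_defect (dual_module A) (dual_op A \<mu> \<beta>) (dual_op L (mult L) \<gamma>) y z u =
      (\<zero>\<^bsub>A\<^esub>, \<mu> (\<gamma> (fst y) (fst z)) (fst u) \<ominus>\<^bsub>A\<^esub> (\<mu> (fst y) (\<beta> (fst z) (fst u)) \<ominus>\<^bsub>A\<^esub> \<beta> (fst z) (\<mu> (fst y) (fst u)))
         \<oplus>\<^bsub>A\<^esub> (\<mu> (fst z) (\<beta> (fst y) (fst u)) \<ominus>\<^bsub>A\<^esub> \<beta> (fst y) (\<mu> (fst z) (fst u))) \<oplus>\<^bsub>A\<^esub> \<beta> (fst y \<otimes>\<^bsub>L\<^esub> fst z) (fst u))"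
      (is "\<lbrakk>?a3; ?b3; ?c3\<rbrakk> \<Longrightarrow> ?P3")
    and "\<lbrakk>x \<in> carrier (dual_module L); y \<in> carrier (dual_module L); z \<in> carrier (dual_module L)\<rbrakk> \<Longrightarrow>
      leibniz_defect (dual_module L) (dual_op L (mult L) \<gamma>) x y z =
      (\<zero>\<^bsub>L\<^esub>, fst y \<otimes>\<^bsub>L\<^esub> \<gamma> (fst x) (fst z) \<ominus>\<^bsub>L\<^esub> fst x \<otimes>\<^bsub>L\<^esub> \<gamma> (fst y) (fst z) \<oplus>\<^bsub>L\<^esub> \<gamma> (fst x) (fst y) \<otimes>\<^bsub>L\<^esub> fst z
         \<oplus>\<^bsub>L\<^esub> \<gamma> (fst x \<otimes>\<^bsub>L\<^esub> fst y) (fst z) \<oplus>\<^bsub>L\<^esub> \<gamma> (fst y) (fst x \<otimes>\<^bsub>L\<^esub> fst z) \<ominus>\<^bsub>L\<^esub> \<gamma> (fst x) (fst y \<otimes>\<^bsub>L\<^esub> fst z))"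
      (is "\<lbrakk>?a4; ?b4; ?c4\<rbrakk> \<Longrightarrow> ?P4")
proof -
  interpret operation_triple K "dual_module A" "dual_module L" "dual_op A (mult A) \<alpha>" "dual_op A \<mu> \<beta>" "dual_op L (mult L) \<gamma>"
    by (rule dual_numbers_triple[OF \<alpha> \<beta> \<gamma>])
  note cls = bilinear_closed[OF \<alpha>] bilinear_closed[OF \<beta>] bilinear_closed[OF \<gamma>]
  note zeros = bilinear_zero[OF \<alpha> A_module A_module A_module] bilinear_zero[OF \<beta> L_module A_module A_module]
    bilinear_zero[OF \<gamma> L_module L_module L_module]
  have jac: "(x \<otimes>\<^bsub>L\<^esub> y) \<otimes>\<^bsub>L\<^esub> z = x \<otimes>\<^bsub>L\<^esub> (y \<otimes>\<^bsub>L\<^esub> z) \<ominus>\<^bsub>L\<^esub> y \<otimes>\<^bsub>L\<^esub> (x \<otimes>\<^bsub>L\<^esub> z)"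
    if "x \<in> carrier L" "y \<in> carrier L" "z \<in> carrier L" for x y z
    using pair_axioms(4)[OF that] that by (simp add: L.eq_minus_iff)
  note rules = dual_op_def defect_defs dual_module_simps dual_module_minus[OF A_module] dual_module_minus[OF L_module]
    cls zeros mult_rules action_rules bracket_rules pair_axioms(1-3) jac A.signed_sum_simps L.signed_sum_simps
  show ?P1 if ?a1 ?b1 ?c1 using that by (cases u; cases v; cases w) (simp add: rules)
  show ?P2 if ?a2 ?b2 ?c2 using that by (cases u; cases v; cases y) (simp add: rules)
  show ?P3 if ?a3 ?b3 ?c3 using that by (cases u; cases z; cases y) (simp add: rules)
  show ?P4 if ?a4 ?b4 ?c4 using that by (cases x; cases y; cases z) (simp add: rules)
qed

text \<open>A multiple of \<open>t\<close> only sees the other factors at \<open>t = 0\<close>, where the operations are those of the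
  Courant pair.\<close>

lemma dual_numbers_lift:
  assumes \<alpha>: "bilinear_map K A A A \<alpha>" and \<beta>: "bilinear_map K L A A \<beta>" and \<gamma>: "bilinear_map K L L L \<gamma>"
  shows "first_order_lift K A L \<mu> (dual_module A) (dual_module L) fst fst snd snd
    (\<lambda>a. (a, \<zero>\<^bsub>A\<^esub>)) (\<lambda>x. (x, \<zero>\<^bsub>L\<^esub>)) ({\<zero>\<^bsub>A\<^esub>} \<times> carrier A) ({\<zero>\<^bsub>L\<^esub>} \<times> carrier L)
    (dual_op A (mult A) \<alpha>) (dual_op A \<mu> \<beta>) (dual_op L (mult L) \<gamma>)"
proof -
  interpret operation_triple K "dual_module A" "dual_module L" "dual_op A (mult A) \<alpha>" "dual_op A \<mu> \<beta>" "dual_op L (mult L) \<gamma>"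
    by (rule dual_numbers_triple[OF \<alpha> \<beta> \<gamma>])
  note cls = bilinear_closed[OF \<alpha>] bilinear_closed[OF \<beta>] bilinear_closed[OF \<gamma>]
  note zeros = bilinear_zero[OF \<alpha> A_module A_module A_module] bilinear_zero[OF \<beta> L_module A_module A_module]
    bilinear_zero[OF \<gamma> L_module L_module L_module]
  show ?thesis
  proof (unfold_locales)
    show "linear_map K (dual_module A) A fst" "linear_map K (dual_module A) A snd"
      "linear_map K A (dual_module A) (\<lambda>a. (a, \<zero>\<^bsub>A\<^esub>))" "linear_map K (dual_module L) L fst"
      "linear_map K (dual_module L) L snd" "linear_map K L (dual_module L) (\<lambda>a. (a, \<zero>\<^bsub>L\<^esub>))"
      using dual_module_linear[OF A_module] dual_module_linear[OF L_module] by simp_all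
  qed (auto simp: dual_numbers_defects[OF \<alpha> \<beta> \<gamma>] dual_module_simps dual_op_def cls zeros
      mult_rules action_rules bracket_rules)
qed

text \<open>Perturbing the operations by \<open>t c\<close> gives a lift over the dual numbers whose defect cochain is the
  coboundary of \<open>c\<close>. So \<open>\<delta>\<delta>c = 0\<close> is the cocycle property of defects.\<close>

lemma d2_cocycle:
  assumes c: "c \<in> carrier (cochains K A L 2)"
  shows "total_cobdry A L \<mu> 2 c \<in> carrier (cocycles K A L \<mu> 3)"
proof -
  note comps = cochain2_comp_bilinear[OF A_module L_module c]
  interpret first_order_lift K A L \<mu> "dual_module A" "dual_module L" fst fst snd snd
    "\<lambda>a. (a, \<zero>\<^bsub>A\<^esub>)" "\<lambda>x. (x, \<zero>\<^bsub>L\<^esub>)" "{\<zero>\<^bsub>A\<^esub>} \<times> carrier A" "{\<zero>\<^bsub>L\<^esub>} \<times> carrier L"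
    "dual_op A (mult A) (comp_A2 c)" "dual_op A \<mu> (comp_LA c)" "dual_op L (mult L) (comp_L2 c)"
    by (rule dual_numbers_lift[OF comps])
  note rules = defect_cochain_values dual_numbers_defects[OF comps] dual_module_simps d2_values[OF c]
    comp_A2_def comp_LA_def comp_L2_def
  have "theta = total_cobdry A L \<mu> 2 c"
  proof (rule extensional_pair_eqI)
    fix xs as assume "(xs, as) \<in> args1 A L 3"
    then show "snd theta (xs, as) = snd (total_cobdry A L \<mu> 2 c) (xs, as)"
      unfolding args_short_cases by (elim disjE exE conjE) (simp_all add: rules)
  next
    fix xs assume "xs \<in> args0 L 3"
    then show "fst theta xs = fst (total_cobdry A L \<mu> 2 c) xs"
      unfolding args_short_cases by (elim exE conjE) (simp add: rules)
  qed (use total_cobdry_extensional[of A L \<mu> 2] theta_closed in \<open>auto simp: cochains_carrier_iff PiE_def\<close>)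
  then show ?thesis using theta_cocycle by simp
qed

lemma coboundaries_submodule: "submodule (coboundaries K A L \<mu> 3) K (cocycles K A L \<mu> 3)"
proof -
  interpret C: module K "cochains K A L 2" by (rule cochains_module[OF A_module L_module])
  interpret Z: module K "cocycles K A L \<mu> 3" by (rule cocycles_module)
  have lin: "linear_map K (cochains K A L 2) (cocycles K A L \<mu> 3) (total_cobdry A L \<mu> 2)"
  proof (rule linear_mapI)
    fix c d assume "c \<in> carrier (cochains K A L 2)" "d \<in> carrier (cochains K A L 2)"
    then show "total_cobdry A L \<mu> 2 (c \<oplus>\<^bsub>cochains K A L 2\<^esub> d) =
      total_cobdry A L \<mu> 2 c \<oplus>\<^bsub>cocycles K A L \<mu> 3\<^esub> total_cobdry A L \<mu> 2 d"
      using d2_linear(1)[of c d "\<zero>\<^bsub>K\<^esub>"] by (simp add: cocycles_def)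
  next
    fix k c assume "k \<in> carrier K" "c \<in> carrier (cochains K A L 2)"
    then show "total_cobdry A L \<mu> 2 (k \<odot>\<^bsub>cochains K A L 2\<^esub> c) = k \<odot>\<^bsub>cocycles K A L \<mu> 3\<^esub> total_cobdry A L \<mu> 2 c"
      using d2_linear(2)[of c c k] by (simp add: cocycles_def)
  qed (rule d2_cocycle)
  have B: "coboundaries K A L \<mu> 3 = total_cobdry A L \<mu> 2 ` carrier (cochains K A L 2)"
    by (simp add: coboundaries_def)
  show ?thesis
  proof (rule Z.submoduleI)
    show "\<zero>\<^bsub>cocycles K A L \<mu> 3\<^esub> \<in> coboundaries K A L \<mu> 3"
      unfolding B using linear_map_zero[OF lin C.module_axioms Z.module_axioms] C.zero_closed by (metis imageI)
    fix a assume "a \<in> coboundaries K A L \<mu> 3"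
    then obtain c where c: "c \<in> carrier (cochains K A L 2)" "a = total_cobdry A L \<mu> 2 c" by (auto simp: B)
    show "\<ominus>\<^bsub>cocycles K A L \<mu> 3\<^esub> a \<in> coboundaries K A L \<mu> 3"
      unfolding B c(2) linear_map_minus[OF lin C.module_axioms Z.module_axioms c(1), symmetric] using c(1) by blast
    show "k \<odot>\<^bsub>cocycles K A L \<mu> 3\<^esub> a \<in> coboundaries K A L \<mu> 3" if k: "k \<in> carrier K" for k
      unfolding B c(2) linear_map_smult[OF lin k c(1), symmetric] using c(1) k by blast
    fix a' assume "a' \<in> coboundaries K A L \<mu> 3"
    then obtain c' where c': "c' \<in> carrier (cochains K A L 2)" "a' = total_cobdry A L \<mu> 2 c'" by (auto simp: B)
    show "a \<oplus>\<^bsub>cocycles K A L \<mu> 3\<^esub> a' \<in> coboundaries K A L \<mu> 3"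
      unfolding B c(2) c'(2) linear_map_add[OF lin c(1) c'(1), symmetric] using c(1) c'(1) by blast
  qed (use d2_cocycle in \<open>auto simp: B\<close>)
qed

lemma cohomology_module: "module K (cohomology K A L \<mu> 3)"
  unfolding cohomology_def by (rule quot_module_module[OF cocycles_module coboundaries_submodule])

lemma cohomology_class_linear:
  "linear_map K (cocycles K A L \<mu> 3) (cohomology K A L \<mu> 3) (cohomology_class K A L \<mu> 3)"
  unfolding cohomology_def cohomology_class_def[abs_def]
  by (rule quot_class_linear[OF cocycles_module coboundaries_submodule])

lemma cohomology_class_zero_iff:
  "c \<in> carrier (cocycles K A L \<mu> 3) \<Longrightarrow>
     cohomology_class K A L \<mu> 3 c = \<zero>\<^bsub>cohomology K A L \<mu> 3\<^esub> \<longleftrightarrow> c \<in> coboundaries K A L \<mu> 3"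
  unfolding cohomology_def cohomology_class_def quot_module_zero
  by (rule quot_class_zero_iff[OF cocycles_module coboundaries_submodule])

end

section \<open>Square-zero extensions and tensor products\<close>

lemma restrict_scalars_simps [simp]:
  "carrier (restrict_scalars R M) = carrier M" "\<zero>\<^bsub>restrict_scalars R M\<^esub> = \<zero>\<^bsub>M\<^esub>"
  "add (restrict_scalars R M) = add M"
  "k \<odot>\<^bsub>restrict_scalars R M\<^esub> x = (k \<odot>\<^bsub>R\<^esub> \<one>\<^bsub>R\<^esub>) \<odot>\<^bsub>M\<^esub> x"
  by (simp_all add: restrict_scalars_def)

lemma restrict_scalars_module:
  assumes R: "algebra K R" and M: "module R M"
  shows "module K (restrict_scalars R M)"
proof -
  interpret R: algebra K R by fact
  interpret M: module R M by fact
  have one: "(j \<otimes>\<^bsub>K\<^esub> k) \<odot>\<^bsub>R\<^esub> \<one>\<^bsub>R\<^esub> = (j \<odot>\<^bsub>R\<^esub> \<one>\<^bsub>R\<^esub>) \<otimes>\<^bsub>R\<^esub> (k \<odot>\<^bsub>R\<^esub> \<one>\<^bsub>R\<^esub>)" if "j \<in> carrier K" "k \<in> carrier K" for j k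
    using that by (simp add: R.smult_assoc2 R.smult_assoc1)
  show ?thesis
  proof (rule moduleI)
    show "cring K" using algebra_moduleD[OF R] by (simp add: module_def)
    show "abelian_group (restrict_scalars R M)"
      by (rule abelian_groupI) (auto simp: M.a_ac intro: M.add.inv_closed M.l_neg)
  qed (simp_all add: M.smult_l_distr M.smult_r_distr M.smult_assoc1 one R.smult_l_distr)
qed

lemma smult_one_tensor:
  assumes S: "algebra K S" and V: "module K V" and c: "c \<in> carrier K" and X: "X \<in> carrier (tensor K S V)"
  shows "(c \<odot>\<^bsub>S\<^esub> \<one>\<^bsub>S\<^esub>) \<odot>\<^bsub>extend_scalars K S V\<^esub> X = c \<odot>\<^bsub>tensor K S V\<^esub> X"
proof -
  interpret S: algebra K S by fact
  have S': "module K S" using S by (rule algebra_moduleD)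
  interpret T: module K "tensor K S V" using S' V by simp
  have c1: "c \<odot>\<^bsub>S\<^esub> \<one>\<^bsub>S\<^esub> \<in> carrier S" using c by simp
  show ?thesis
    using S' V X
    by (induct rule: tensor_induct)
      (simp_all add: extend_scalars_smult_tens[OF S V c1] S.smult_assoc2 c bilinear_smult[OF tens_bilinear[OF S' V]]
        linear_map_add[OF extend_scalars_smult_linear[OF S V c1]] T.smult_r_distr)
qed

lemma extend_linear_restrict:
  assumes S: "algebra K S" and V: "module K V" and W: "module K W"
    and T: "linear_map S (extend_scalars K S V) (extend_scalars K S W) T"
  shows "linear_map K (tensor K S V) (tensor K S W) T"
proof (rule linear_mapI)
  interpret S: algebra K S by fact
  fix c X assume c: "c \<in> carrier K" and X: "X \<in> carrier (tensor K S V)"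
  have "T X \<in> carrier (tensor K S W)" using linear_map_closed[OF T] X by simp
  then show "T (c \<odot>\<^bsub>tensor K S V\<^esub> X) = c \<odot>\<^bsub>tensor K S W\<^esub> T X"
    using linear_map_smult[OF T, of "c \<odot>\<^bsub>S\<^esub> \<one>\<^bsub>S\<^esub>" X] c X
    by (simp add: smult_one_tensor[OF S V] smult_one_tensor[OF S W])
qed (use linear_map_closed[OF T] linear_map_add[OF T] in auto)

lemma extend_bilinear_restrict:
  assumes S: "algebra K S" and U: "module K U" and V: "module K V" and W: "module K W"
    and f: "bilinear_map S (extend_scalars K S U) (extend_scalars K S V) (extend_scalars K S W) f"
  shows "bilinear_map K (tensor K S U) (tensor K S V) (tensor K S W) f"
  using extend_linear_restrict[OF S U W bilinear_mapD(2)[OF f]] extend_linear_restrict[OF S V W bilinear_mapD(1)[OF f]]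
  by (intro bilinear_mapI) simp_all

text \<open>Since \<open>\<M>\<^sub>R M = 0\<close>, the ideal \<open>i(M)\<close> of \<open>S\<close> has square zero and is even annihilated by the maximal
  ideal of \<open>S\<close>. The linear section \<open>q\<close> serves to extend functionals from \<open>M\<close> to \<open>S\<close>.\<close>

locale square_zero_extension =
  fixes K :: "('k, 'z) ring_scheme" and R :: "('k, 'r) module" and \<epsilon> :: "'r \<Rightarrow> 'k"
    and M :: "('r, 'm) module" and S :: "('k, 's) module" and i :: "'m \<Rightarrow> 's" and p :: "'s \<Rightarrow> 'r"
    and q :: "'r \<Rightarrow> 's"
  assumes R_alg: "algebra K R" and aug: "augmentation K R \<epsilon>" and M_mod: "module R M"
    and kill: "\<And>r m. \<lbrakk>r \<in> a_kernel R K \<epsilon>; m \<in> carrier M\<rbrakk> \<Longrightarrow> r \<odot>\<^bsub>M\<^esub> m = \<zero>\<^bsub>M\<^esub>"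
    and ext: "algebra_extension K R M S i p"
    and q: "linear_map K R S q" and pq: "\<And>r. r \<in> carrier R \<Longrightarrow> p (q r) = r"
begin

abbreviation "MK \<equiv> restrict_scalars R M"
abbreviation "\<epsilon>S \<equiv> \<epsilon> \<circ> p"

lemma S_alg: "algebra K S" and p: "linear_map K S R p" and i: "linear_map K MK S i"
  and p_mult: "\<lbrakk>s \<in> carrier S; t \<in> carrier S\<rbrakk> \<Longrightarrow> p (s \<otimes>\<^bsub>S\<^esub> t) = p s \<otimes>\<^bsub>R\<^esub> p t" and p_one: "p \<one>\<^bsub>S\<^esub> = \<one>\<^bsub>R\<^esub>"
  and i_inj: "inj_on i (carrier M)" and i_image: "i ` carrier M = a_kernel S R p"
  and mult_i: "\<lbrakk>s \<in> carrier S; x \<in> carrier M\<rbrakk> \<Longrightarrow> s \<otimes>\<^bsub>S\<^esub> i x = i (p s \<odot>\<^bsub>M\<^esub> x)"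
  using ext by (auto simp: algebra_extension_def algebra_hom_def ring_hom_def)

sublocale R: algebra K R by (rule R_alg)
sublocale S: algebra K S by (rule S_alg)
sublocale M: module R M by (rule M_mod)

lemma R_mod: "module K R" and S_mod: "module K S" and MK_mod: "module K MK"
  using R_alg S_alg M_mod by (simp_all add: algebra_moduleD restrict_scalars_module)

lemma \<epsilon>_fun: "functional K R \<epsilon>" using aug by (rule augmentation_functional)

lemma \<epsilon>S_fun: "functional K S \<epsilon>S"
  using functional_comp[OF p \<epsilon>_fun] by (simp add: comp_def)

lemma map_closed [simp]:
  "s \<in> carrier S \<Longrightarrow> p s \<in> carrier R" "x \<in> carrier M \<Longrightarrow> i x \<in> carrier S" "r \<in> carrier R \<Longrightarrow> q r \<in> carrier S"
  "r \<in> carrier R \<Longrightarrow> \<epsilon> r \<in> carrier K"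
  using linear_map_closed[OF p] linear_map_closed[OF i] linear_map_closed[OF q] functionalD(1)[OF \<epsilon>_fun] by auto

lemma p_i [simp]: "x \<in> carrier M \<Longrightarrow> p (i x) = \<zero>\<^bsub>R\<^esub>"
  using i_image by (auto simp: a_kernel_def')

lemma \<epsilon>_one: "\<epsilon> \<one>\<^bsub>R\<^esub> = \<one>\<^bsub>K\<^esub>"
  using aug by (auto simp: augmentation_def ring_hom_def)

text \<open>The difference \<open>r - \<epsilon>(r) 1\<close> lies in the augmentation ideal, which annihilates \<open>M\<close>.\<close>

lemma act_M:
  assumes r: "r \<in> carrier R" and x: "x \<in> carrier M"
  shows "r \<odot>\<^bsub>M\<^esub> x = \<epsilon> r \<odot>\<^bsub>MK\<^esub> x"
proof -
  let ?k = "\<epsilon> r \<odot>\<^bsub>R\<^esub> \<one>\<^bsub>R\<^esub>"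
  have er: "\<epsilon> r \<in> carrier K" using r by simp
  have k: "?k \<in> carrier R" using r by simp
  have "\<epsilon> (r \<ominus>\<^bsub>R\<^esub> ?k) \<oplus>\<^bsub>K\<^esub> \<epsilon> ?k = \<epsilon> r"
    using functionalD(2)[OF \<epsilon>_fun, of "r \<ominus>\<^bsub>R\<^esub> ?k" ?k] r k by (simp add: a_minus_def R.a_assoc R.l_neg)
  moreover have "\<epsilon> ?k = \<epsilon> r" using functionalD(3)[OF \<epsilon>_fun er R.one_closed] er by (simp add: \<epsilon>_one)
  ultimately have "\<epsilon> (r \<ominus>\<^bsub>R\<^esub> ?k) = \<zero>\<^bsub>K\<^esub>"
    using er r k R.R.add.r_cancel_one' by (metis map_closed(4) R.minus_closed)
  then have "r \<ominus>\<^bsub>R\<^esub> ?k \<in> a_kernel R K \<epsilon>" using r k by (simp add: a_kernel_def')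
  then have "(r \<ominus>\<^bsub>R\<^esub> ?k) \<odot>\<^bsub>M\<^esub> x = \<zero>\<^bsub>M\<^esub>" using x by (rule kill)
  then have "r \<odot>\<^bsub>M\<^esub> x \<ominus>\<^bsub>M\<^esub> ?k \<odot>\<^bsub>M\<^esub> x = \<zero>\<^bsub>M\<^esub>"
    using r k x by (simp add: a_minus_def M.smult_l_distr M.smult_l_minus)
  then show ?thesis using r k x by (simp add: M.minus_eq_iff)
qed

text \<open>The projection of \<open>S\<close> onto \<open>M\<close> along the image of the section.\<close>

definition \<rho> :: "'s \<Rightarrow> 'm" where
  "\<rho> s = inv_into (carrier M) i (s \<ominus>\<^bsub>S\<^esub> q (p s))"

lemma \<rho>_closed [simp]: "s \<in> carrier S \<Longrightarrow> \<rho> s \<in> carrier M"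
  and i_\<rho>: "s \<in> carrier S \<Longrightarrow> i (\<rho> s) = s \<ominus>\<^bsub>S\<^esub> q (p s)"
proof -
  assume s: "s \<in> carrier S"
  have "p (s \<ominus>\<^bsub>S\<^esub> q (p s)) = \<zero>\<^bsub>R\<^esub>"
    using s by (simp add: linear_map_diff[OF p S_mod R_mod] pq R.minus_eq_iff)
  then have "s \<ominus>\<^bsub>S\<^esub> q (p s) \<in> i ` carrier M" using s by (simp add: i_image a_kernel_def')
  then show "\<rho> s \<in> carrier M" "i (\<rho> s) = s \<ominus>\<^bsub>S\<^esub> q (p s)"
    unfolding \<rho>_def by (auto intro: inv_into_into f_inv_into_f)
qed

lemma \<rho>_i: "x \<in> carrier M \<Longrightarrow> \<rho> (i x) = x"
  using i_\<rho>[of "i x"] linear_map_zero[OF q R_mod S_mod] inj_onD[OF i_inj, of "\<rho> (i x)" x]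
  by (simp add: S.minus_eq_iff)

lemma \<rho>_linear: "linear_map K S MK \<rho>"
proof (rule linear_mapI)
  note rules = i_\<rho> linear_map_add[OF i] linear_map_smult[OF i] linear_map_add[OF p] linear_map_smult[OF p]
    linear_map_add[OF q] linear_map_smult[OF q] S.signed_sum_simps S.smult_r_diff
  interpret MK: module K MK by (rule MK_mod)
  show "\<rho> (s \<oplus>\<^bsub>S\<^esub> t) = \<rho> s \<oplus>\<^bsub>MK\<^esub> \<rho> t" if "s \<in> carrier S" "t \<in> carrier S" for s t
    using that linear_map_add[OF i, of "\<rho> s" "\<rho> t"]
    by (intro inj_onD[OF i_inj]) (simp_all add: rules del: restrict_scalars_simps(4))
  show "\<rho> (c \<odot>\<^bsub>S\<^esub> s) = c \<odot>\<^bsub>MK\<^esub> \<rho> s" if "c \<in> carrier K" "s \<in> carrier S" for c s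
    using that linear_map_smult[OF i, of c "\<rho> s"] MK.smult_closed[of c "\<rho> s"]
    by (intro inj_onD[OF i_inj]) (simp_all add: rules del: restrict_scalars_simps(4))
qed simp

lemma functional_\<rho>: "functional K MK f \<Longrightarrow> functional K S (f \<circ> \<rho>)"
  using functional_comp[OF \<rho>_linear] by (simp add: comp_def)

end

locale extension_tensor = square_zero_extension +
  fixes V :: "('a, 'v) module"
  assumes V_mod: "module K V"
begin

abbreviation "TS \<equiv> tensor K S V"
abbreviation "TR \<equiv> tensor K R V"
abbreviation "ES \<equiv> extend_scalars K S V"
abbreviation "proj \<equiv> tensor_map K S V R V p (\<lambda>v. v)"
abbreviation "incl \<equiv> tensor_map K MK V S V i (\<lambda>v. v)"

sublocale V: module K V by (rule V_mod)
lemma TS_mod: "module K TS" and TR_mod: "module K TR" and ES_mod: "module S ES" and TM_mod: "module K (tensor K MK V)"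
  using S_mod R_mod V_mod MK_mod extend_scalars_module[OF S_alg V_mod] by simp_all
sublocale TS: module K TS by (rule TS_mod)
sublocale TR: module K TR by (rule TR_mod)
sublocale TM: module K "tensor K MK V" by (rule TM_mod)
sublocale ES: module S ES by (rule ES_mod)

lemmas proj_lin = tensor_map_linear[OF S_mod V_mod R_mod V_mod p linear_map_ident]
  and proj_tens = tensor_map_tens[OF S_mod V_mod R_mod V_mod p linear_map_ident]
  and incl_lin = tensor_map_linear[OF MK_mod V_mod S_mod V_mod i linear_map_ident]
  and incl_tens = tensor_map_tens[OF MK_mod V_mod S_mod V_mod i linear_map_ident]
  and augS_lin = contraction_linear[OF S_mod V_mod \<epsilon>S_fun]
  and augS_tens = contraction_tens[OF S_mod V_mod \<epsilon>S_fun]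
  and augR_lin = contraction_linear[OF R_mod V_mod \<epsilon>_fun]
  and augR_tens = contraction_tens[OF R_mod V_mod \<epsilon>_fun]
  and tensS = tens_bilinear[OF S_mod V_mod]
  and tensR = tens_bilinear[OF R_mod V_mod]
  and smult_tens = extend_scalars_smult_tens[OF S_alg V_mod]
  and smult_lin = extend_scalars_smult_linear[OF S_alg V_mod]

lemma T_closed [simp]:
  "X \<in> carrier TS \<Longrightarrow> proj X \<in> carrier TR" "Y \<in> carrier (tensor K MK V) \<Longrightarrow> incl Y \<in> carrier TS"
  "X \<in> carrier TS \<Longrightarrow> aug_map K S \<epsilon>S V X \<in> carrier V" "Z \<in> carrier TR \<Longrightarrow> aug_map K R \<epsilon> V Z \<in> carrier V"
  "\<lbrakk>s \<in> carrier S; X \<in> carrier TS\<rbrakk> \<Longrightarrow> s \<odot>\<^bsub>ES\<^esub> X \<in> carrier TS"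
  "\<lbrakk>s \<in> carrier S; v \<in> carrier V\<rbrakk> \<Longrightarrow> tens K S V s v \<in> carrier TS"
  "\<lbrakk>r \<in> carrier R; v \<in> carrier V\<rbrakk> \<Longrightarrow> tens K R V r v \<in> carrier TR"
  "\<lbrakk>x \<in> carrier M; v \<in> carrier V\<rbrakk> \<Longrightarrow> tens K MK V x v \<in> carrier (tensor K MK V)"
  using linear_map_closed[OF proj_lin] linear_map_closed[OF incl_lin] linear_map_closed[OF augS_lin]
    linear_map_closed[OF augR_lin] linear_map_closed[OF smult_lin] S_mod R_mod V_mod MK_mod by simp_all

lemma augR_proj: "X \<in> carrier TS \<Longrightarrow> aug_map K R \<epsilon> V (proj X) = aug_map K S \<epsilon>S V X"
  by (rule linear_map_tensor_eqI[OF S_mod V_mod linear_map_comp[OF proj_lin augR_lin] augS_lin])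
    (simp_all add: proj_tens augR_tens augS_tens)

lemma proj_smult:
  assumes s: "s \<in> carrier S" and X: "X \<in> carrier TS"
  shows "proj (s \<odot>\<^bsub>ES\<^esub> X) = p s \<odot>\<^bsub>extend_scalars K R V\<^esub> proj X"
  by (rule tensor_map_smult[OF S_alg R_alg p p_mult V_mod s X])

text \<open>As \<open>R\<close> acts on \<open>M\<close> through the augmentation, \<open>i(x) s = \<epsilon>(p(s)) i(x)\<close>.\<close>

lemma smult_i:
  assumes x: "x \<in> carrier M" and X: "X \<in> carrier TS"
  shows "i x \<odot>\<^bsub>ES\<^esub> X = tens K S V (i x) (aug_map K S \<epsilon>S V X)"
proof (rule linear_map_tensor_eqI[OF S_mod V_mod smult_lin linear_map_comp[OF augS_lin bilinear_mapD(1)[OF tensS]] _ X])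
  fix s v assume s: "s \<in> carrier S" and v: "v \<in> carrier V"
  interpret MK: module K MK by (rule MK_mod)
  have "i x \<otimes>\<^bsub>S\<^esub> s = \<epsilon> (p s) \<odot>\<^bsub>S\<^esub> i x"
    using s x mult_i[OF s x] act_M[of "p s" x] linear_map_smult[OF i, of "\<epsilon> (p s)" x]
    by (simp add: S.m_comm del: restrict_scalars_simps(4))
  then show "i x \<odot>\<^bsub>ES\<^esub> tens K S V s v = tens K S V (i x) (aug_map K S \<epsilon>S V (tens K S V s v))"
    using s v x by (simp add: smult_tens augS_tens bilinear_smult[OF tensS])
qed (simp_all add: x)

lemma smult_incl:
  assumes s: "s \<in> carrier S" and Y: "Y \<in> carrier (tensor K MK V)"
  shows "s \<odot>\<^bsub>ES\<^esub> incl Y = \<epsilon>S s \<odot>\<^bsub>TS\<^esub> incl Y"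
proof (rule linear_map_tensor_eqI[OF MK_mod V_mod linear_map_comp[OF incl_lin smult_lin[OF s]]
      linear_map_scale[OF incl_lin TM_mod TS_mod] _ Y])
  show "\<epsilon>S s \<in> carrier K" using s by simp
  fix x v assume x: "x \<in> carrier MK" and v: "v \<in> carrier V"
  have "s \<otimes>\<^bsub>S\<^esub> i x = \<epsilon> (p s) \<odot>\<^bsub>S\<^esub> i x"
    using s x mult_i[OF s] act_M[of "p s" x] linear_map_smult[OF i, of "\<epsilon> (p s)" x]
    by (simp del: restrict_scalars_simps(4))
  then show "s \<odot>\<^bsub>ES\<^esub> incl (tens K MK V x v) = \<epsilon>S s \<odot>\<^bsub>TS\<^esub> incl (tens K MK V x v)"
    using s x v by (simp add: incl_tens smult_tens bilinear_smult[OF tensS])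
qed

text \<open>Exactness of \<open>M \<otimes> V \<rightarrow> S \<otimes> V \<rightarrow> R \<otimes> V\<close>: the decomposition \<open>s = i(\<rho>(s)) + q(p(s))\<close> carries over to
  tensors and shows that an element of the kernel equals its component in \<open>M \<otimes> V\<close>.\<close>

lemma kernel_proj:
  assumes X: "X \<in> carrier TS" and z: "proj X = \<zero>\<^bsub>TR\<^esub>"
  obtains Y where "Y \<in> carrier (tensor K MK V)" "X = incl Y"
proof -
  let ?r = "tensor_map K S V MK V \<rho> (\<lambda>v. v)" and ?q = "tensor_map K R V S V q (\<lambda>v. v)"
  note r = tensor_map_linear[OF S_mod V_mod MK_mod V_mod \<rho>_linear linear_map_ident]
    tensor_map_tens[OF S_mod V_mod MK_mod V_mod \<rho>_linear linear_map_ident]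
  note q = tensor_map_linear[OF R_mod V_mod S_mod V_mod q linear_map_ident]
    tensor_map_tens[OF R_mod V_mod S_mod V_mod q linear_map_ident]
  have "X = incl (?r X) \<oplus>\<^bsub>TS\<^esub> ?q (proj X)"
  proof (rule linear_map_tensor_eqI[OF S_mod V_mod linear_map_ident
        linear_map_plus[OF linear_map_comp[OF r(1) incl_lin] linear_map_comp[OF proj_lin q(1)] TS_mod TS_mod] _ X])
    fix s v assume s: "s \<in> carrier S" and v: "v \<in> carrier V"
    have "s = i (\<rho> s) \<oplus>\<^bsub>S\<^esub> q (p s)" using s by (simp add: i_\<rho> S.signed_sum_simps)
    then have "tens K S V s v = tens K S V (i (\<rho> s)) v \<oplus>\<^bsub>TS\<^esub> tens K S V (q (p s)) v"
      using s v bilinear_add(1)[OF tensS, of "i (\<rho> s)" "q (p s)" v] by simp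
    moreover have "incl (?r (tens K S V s v)) = tens K S V (i (\<rho> s)) v"
      using s v by (simp add: r(2) incl_tens)
    moreover have "?q (proj (tens K S V s v)) = tens K S V (q (p s)) v"
      using s v by (simp add: q(2) proj_tens)
    ultimately show "tens K S V s v = incl (?r (tens K S V s v)) \<oplus>\<^bsub>TS\<^esub> ?q (proj (tens K S V s v))"
      by simp
  qed
  then have "X = incl (?r X)"
    using z linear_map_zero[OF q(1) TR_mod TS_mod] linear_map_closed[OF r(1) X] by simp
  then show ?thesis using that linear_map_closed[OF r(1) X] by blast
qed

lemma contraction_incl:
  assumes f: "functional K MK f" and Y: "Y \<in> carrier (tensor K MK V)"
  shows "aug_map K S (f \<circ> \<rho>) V (incl Y) = aug_map K MK f V Y"
  by (rule linear_map_tensor_eqI[OF MK_mod V_mod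
        linear_map_comp[OF incl_lin contraction_linear[OF S_mod V_mod functional_\<rho>[OF f]]]
        contraction_linear[OF MK_mod V_mod f] _ Y])
    (simp_all add: incl_tens contraction_tens[OF S_mod V_mod functional_\<rho>[OF f]] contraction_tens[OF MK_mod V_mod f] \<rho>_i)

text \<open>Expanding the factor in \<open>M\<close> along a family of vectors gives coordinates of the kernel with values
  in \<open>V\<close>.\<close>

lemma kernel_expansion:
  assumes J: "finite J" and eb: "\<And>j. j \<in> J \<Longrightarrow> eb j \<in> carrier M" and \<phi>: "\<And>j. j \<in> J \<Longrightarrow> functional K MK (\<phi> j)"
    and exp: "\<And>x. x \<in> carrier M \<Longrightarrow> x = (\<Oplus>\<^bsub>MK\<^esub>j\<in>J. \<phi> j x \<odot>\<^bsub>MK\<^esub> eb j)"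
    and X: "X \<in> carrier TS" and z: "proj X = \<zero>\<^bsub>TR\<^esub>"
  shows "X = (\<Oplus>\<^bsub>TS\<^esub>j\<in>J. tens K S V (i (eb j)) (aug_map K S (\<phi> j \<circ> \<rho>) V X))"
proof -
  interpret MK: module K MK by (rule MK_mod)
  obtain Y where Y: "Y \<in> carrier (tensor K MK V)" "X = incl Y" using kernel_proj[OF X z] .
  have "incl Y = (\<Oplus>\<^bsub>TS\<^esub>j\<in>J. tens K S V (i (eb j)) (aug_map K MK (\<phi> j) V Y))"
  proof (rule tensor_map_expansion[OF MK_mod S_mod V_mod i J _ _ _ Y(1)])
    fix x assume x: "x \<in> carrier MK"
    have px: "\<phi> j x \<in> carrier K" if "j \<in> J" for j using functionalD(1)[OF \<phi>[OF that] x] .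
    have cl: "\<phi> j x \<odot>\<^bsub>MK\<^esub> eb j \<in> carrier MK" if "j \<in> J" for j
      using px[OF that] eb[OF that] by (intro MK.smult_closed) simp_all
    have "i x = i (\<Oplus>\<^bsub>MK\<^esub>j\<in>J. \<phi> j x \<odot>\<^bsub>MK\<^esub> eb j)" using exp[of x] x by simp
    also have "\<dots> = (\<Oplus>\<^bsub>S\<^esub>j\<in>J. i (\<phi> j x \<odot>\<^bsub>MK\<^esub> eb j))"
      using cl by (intro linear_map_finsum[OF i MK_mod S_mod]) blast
    also have "\<dots> = (\<Oplus>\<^bsub>S\<^esub>j\<in>J. \<phi> j x \<odot>\<^bsub>S\<^esub> i (eb j))"
      using px eb linear_map_smult[OF i] by (intro S.finsum_cong') (auto simp del: restrict_scalars_simps(4))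
    finally show "i x = (\<Oplus>\<^bsub>S\<^esub>j\<in>J. \<phi> j x \<odot>\<^bsub>S\<^esub> i (eb j))" .
  qed (use eb \<phi> in auto)
  also have "\<dots> = (\<Oplus>\<^bsub>TS\<^esub>j\<in>J. tens K S V (i (eb j)) (aug_map K S (\<phi> j \<circ> \<rho>) V X))"
    using eb linear_map_closed[OF contraction_linear[OF MK_mod V_mod \<phi>] Y(1)] Y(1)
    by (intro TS.finsum_cong') (auto simp: Y(2) contraction_incl[OF \<phi>])
  finally show ?thesis using Y by simp
qed

text \<open>We have \<open>T(s \<otimes> u) = s T(1 \<otimes> u)\<close>, and \<open>s\<close> acts on the kernel of \<open>S \<otimes> V \<rightarrow> R \<otimes> V\<close> as the scalar \<open>\<epsilon>(p(s))\<close>.\<close>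

lemma kernel_map_reduce:
  assumes U: "module K U" and T: "linear_map S (extend_scalars K S U) ES T"
    and ker: "\<And>X. X \<in> carrier (tensor K S U) \<Longrightarrow> proj (T X) = \<zero>\<^bsub>TR\<^esub>" and X: "X \<in> carrier (tensor K S U)"
  shows "T X = T (tens K S U \<one>\<^bsub>S\<^esub> (aug_map K S \<epsilon>S U X))"
proof -
  note TK = extend_linear_restrict[OF S_alg U V_mod T]
  note bU = tens_bilinear[OF S_mod U]
  interpret U: module K U by fact
  show ?thesis
  proof (rule linear_map_tensor_eqI[OF S_mod U TK linear_map_comp[OF
          linear_map_comp[OF contraction_linear[OF S_mod U \<epsilon>S_fun] bilinear_mapD(1)[OF bU S.one_closed]] TK] _ X])
    fix s u assume s: "s \<in> carrier S" and u: "u \<in> carrier U"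
    let ?X = "tens K S U \<one>\<^bsub>S\<^esub> u"
    have X: "?X \<in> carrier (tensor K S U)" using u S_mod U by simp
    then have TX: "T ?X \<in> carrier TS" using linear_map_closed[OF TK] by simp
    obtain Y where Y: "Y \<in> carrier (tensor K MK V)" "T ?X = incl Y" using kernel_proj[OF TX ker[OF X]] .
    have "T (tens K S U s u) = T (s \<odot>\<^bsub>extend_scalars K S U\<^esub> ?X)"
      using s u by (simp add: extend_scalars_smult_tens[OF S_alg U s])
    also have "\<dots> = s \<odot>\<^bsub>ES\<^esub> T ?X" using linear_map_smult[OF T, of s ?X] s X by simp
    also have "\<dots> = \<epsilon>S s \<odot>\<^bsub>TS\<^esub> T ?X" unfolding Y(2) using smult_incl[OF s Y(1)] .
    also have "\<dots> = T (\<epsilon>S s \<odot>\<^bsub>tensor K S U\<^esub> ?X)" using linear_map_smult[OF TK _ X] s by simp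
    also have "\<epsilon>S s \<odot>\<^bsub>tensor K S U\<^esub> ?X = tens K S U \<one>\<^bsub>S\<^esub> (aug_map K S \<epsilon>S U (tens K S U s u))"
      using s u by (simp add: contraction_tens[OF S_mod U \<epsilon>S_fun] bilinear_smult[OF bU])
    finally show "T (tens K S U s u) = T (tens K S U \<one>\<^bsub>S\<^esub> (aug_map K S \<epsilon>S U (tens K S U s u)))" .
  qed
qed

end

section \<open>Lifts of a deformation to an extension\<close>

lemma mult_update_simps:
  "carrier (V\<lparr>mult := f\<rparr>) = carrier V" "add (V\<lparr>mult := f\<rparr>) = add V" "zero (V\<lparr>mult := f\<rparr>) = zero V"
  "smult (V\<lparr>mult := f\<rparr>) = smult V" "mult (V\<lparr>mult := f\<rparr>) = f" "a_minus (V\<lparr>mult := f\<rparr>) = a_minus V"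
  for V :: "('k, 'v) module"
  by (simp_all add: fun_eq_iff a_inv_def a_minus_def m_inv_def)

lemma mult_update_linear [simp]:
  "linear_map K (V\<lparr>mult := f\<rparr>) W = linear_map K V W" "linear_map K V (W\<lparr>mult := g\<rparr>) = linear_map K V W"
  by (simp_all add: fun_eq_iff linear_map_def mult_update_simps)

lemma mult_update_bilinear [simp]:
  "bilinear_map K (U\<lparr>mult := f\<rparr>) V W = bilinear_map K U V W"
  "bilinear_map K U (V\<lparr>mult := g\<rparr>) W = bilinear_map K U V W"
  "bilinear_map K U V (W\<lparr>mult := h\<rparr>) = bilinear_map K U V W"
  by (simp_all add: fun_eq_iff bilinear_map_def mult_update_simps)

lemma mult_update_module: "module K (V\<lparr>mult := f\<rparr>) \<longleftrightarrow> module K V"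
  by (simp add: module_def module_axioms_def abelian_group_def abelian_monoid_def abelian_group_axioms_def)

lemma (in operation_triple) defect_zero_iff:
  "\<lbrakk>u \<in> carrier X; v \<in> carrier X; w \<in> carrier X\<rbrakk> \<Longrightarrow>
     assoc_defect X m u v w = \<zero>\<^bsub>X\<^esub> \<longleftrightarrow> m (m u v) w = m u (m v w)"
  "\<lbrakk>y \<in> carrier Y; u \<in> carrier X; v \<in> carrier X\<rbrakk> \<Longrightarrow>
     derivation_defect X m \<nu> y u v = \<zero>\<^bsub>X\<^esub> \<longleftrightarrow> \<nu> y (m u v) = m (\<nu> y u) v \<oplus>\<^bsub>X\<^esub> m u (\<nu> y v)"
  "\<lbrakk>y \<in> carrier Y; z \<in> carrier Y; u \<in> carrier X\<rbrakk> \<Longrightarrow>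
     action_defect X \<nu> b y z u = \<zero>\<^bsub>X\<^esub> \<longleftrightarrow> \<nu> (b y z) u = \<nu> y (\<nu> z u) \<ominus>\<^bsub>X\<^esub> \<nu> z (\<nu> y u)"
  "\<lbrakk>x \<in> carrier Y; y \<in> carrier Y; z \<in> carrier Y\<rbrakk> \<Longrightarrow>
     leibniz_defect Y b x y z = \<zero>\<^bsub>Y\<^esub> \<longleftrightarrow> b x (b y z) = b (b x y) z \<oplus>\<^bsub>Y\<^esub> b y (b x z)"
  by (auto simp: defect_defs X.signed_sum_simps Y.signed_sum_simps)

definition no_defects ::
  "('k, 'x) module \<Rightarrow> ('k, 'y) module
    \<Rightarrow> ('x \<Rightarrow> 'x \<Rightarrow> 'x) \<Rightarrow> ('y \<Rightarrow> 'x \<Rightarrow> 'x) \<Rightarrow> ('y \<Rightarrow> 'y \<Rightarrow> 'y) \<Rightarrow> bool" where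
  "no_defects X Y m \<nu> b \<longleftrightarrow>
     (\<forall>u\<in>carrier X. \<forall>v\<in>carrier X. \<forall>w\<in>carrier X. assoc_defect X m u v w = \<zero>\<^bsub>X\<^esub>) \<and>
     (\<forall>y\<in>carrier Y. \<forall>u\<in>carrier X. \<forall>v\<in>carrier X. derivation_defect X m \<nu> y u v = \<zero>\<^bsub>X\<^esub>) \<and>
     (\<forall>y\<in>carrier Y. \<forall>z\<in>carrier Y. \<forall>u\<in>carrier X. action_defect X \<nu> b y z u = \<zero>\<^bsub>X\<^esub>) \<and>
     (\<forall>x\<in>carrier Y. \<forall>y\<in>carrier Y. \<forall>z\<in>carrier Y. leibniz_defect Y b x y z = \<zero>\<^bsub>Y\<^esub>)"

lemma (in operation_triple) courant_pair_iff_no_defects: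
  "courant_pair K (X\<lparr>mult := m\<rparr>) (Y\<lparr>mult := b\<rparr>) \<nu> \<longleftrightarrow> no_defects X Y m \<nu> b"
proof -
  have "courant_pair K (X\<lparr>mult := m\<rparr>) (Y\<lparr>mult := b\<rparr>) \<nu> \<longleftrightarrow>
     (\<forall>u\<in>carrier X. \<forall>v\<in>carrier X. \<forall>w\<in>carrier X. m (m u v) w = m u (m v w)) \<and>
     (\<forall>y\<in>carrier Y. \<forall>u\<in>carrier X. \<forall>v\<in>carrier X. \<nu> y (m u v) = m (\<nu> y u) v \<oplus>\<^bsub>X\<^esub> m u (\<nu> y v)) \<and>
     (\<forall>y\<in>carrier Y. \<forall>z\<in>carrier Y. \<forall>u\<in>carrier X. \<nu> (b y z) u = \<nu> y (\<nu> z u) \<ominus>\<^bsub>X\<^esub> \<nu> z (\<nu> y u)) \<and>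
     (\<forall>x\<in>carrier Y. \<forall>y\<in>carrier Y. \<forall>z\<in>carrier Y. b x (b y z) = b (b x y) z \<oplus>\<^bsub>Y\<^esub> b y (b x z))"
    unfolding courant_pair_def assoc_algebra_def leibniz_algebra_def derivation_def
    using X_module Y_module m \<nu> b bilinear_mapD(1)[OF \<nu>]
    by (simp add: mult_update_simps mult_update_module) blast
  then show ?thesis unfolding no_defects_def using defect_zero_iff by simp
qed

lemma defect_extend_scalars [simp]:
  "assoc_defect (extend_scalars K S A) = assoc_defect (tensor K S A)"
  "derivation_defect (extend_scalars K S A) = derivation_defect (tensor K S A)"
  "action_defect (extend_scalars K S A) = action_defect (tensor K S A)"
  "leibniz_defect (extend_scalars K S A) = leibniz_defect (tensor K S A)"
  by (simp_all add: fun_eq_iff defect_defs)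

lemma extension_tripleI:
  assumes S: "algebra K S" and A: "module K A" and L: "module K L"
    and m: "bilinear_map S (extend_scalars K S A) (extend_scalars K S A) (extend_scalars K S A) m"
    and \<nu>: "bilinear_map S (extend_scalars K S L) (extend_scalars K S A) (extend_scalars K S A) \<nu>"
    and b: "bilinear_map S (extend_scalars K S L) (extend_scalars K S L) (extend_scalars K S L) b"
  shows "operation_triple S (extend_scalars K S A) (extend_scalars K S L) m \<nu> b"
    and "operation_triple K (tensor K S A) (tensor K S L) m \<nu> b"
  using assms extend_scalars_module[OF S A] extend_scalars_module[OF S L] algebra_moduleD[OF S]
  by (auto intro!: operation_triple.intro extend_bilinear_restrict[OF S])

text \<open>Separates the part of a deformation that every lift shares from the vanishing of its defects.\<close>

lemma (in courant) deformation_iff: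
  assumes S: "algebra K S" and f: "functional K S \<epsilon>"
  shows "deformation K S \<epsilon> A L \<mu> (m, \<nu>, b) \<longleftrightarrow>
    bilinear_map S (extend_scalars K S A) (extend_scalars K S A) (extend_scalars K S A) m \<and>
    bilinear_map S (extend_scalars K S L) (extend_scalars K S A) (extend_scalars K S A) \<nu> \<and>
    bilinear_map S (extend_scalars K S L) (extend_scalars K S L) (extend_scalars K S L) b \<and>
    no_defects (tensor K S A) (tensor K S L) m \<nu> b \<and>
    (\<forall>u\<in>carrier (tensor K S A). \<forall>v\<in>carrier (tensor K S A).
       aug_map K S \<epsilon> A (m u v) = aug_map K S \<epsilon> A u \<otimes>\<^bsub>A\<^esub> aug_map K S \<epsilon> A v) \<and>
    (\<forall>y\<in>carrier (tensor K S L). \<forall>v\<in>carrier (tensor K S A).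
       aug_map K S \<epsilon> A (\<nu> y v) = \<mu> (aug_map K S \<epsilon> L y) (aug_map K S \<epsilon> A v)) \<and>
    (\<forall>y\<in>carrier (tensor K S L). \<forall>z\<in>carrier (tensor K S L).
       aug_map K S \<epsilon> L (b y z) = aug_map K S \<epsilon> L y \<otimes>\<^bsub>L\<^esub> aug_map K S \<epsilon> L z)"
    (is "?l \<longleftrightarrow> ?m \<and> ?n \<and> ?b \<and> ?r")
proof -
  let ?E = "extend_scalars K S A" and ?F = "extend_scalars K S L"
  have bil: "?m \<and> ?n \<and> ?b" if ?l
    using that by (simp add: deformation_def courant_pair_def assoc_algebra_def leibniz_algebra_def mult_update_simps)
  have nd: "no_defects ?E ?F m \<nu> b \<longleftrightarrow> no_defects (tensor K S A) (tensor K S L) m \<nu> b"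
    by (simp add: no_defects_def)
  have "?l \<longleftrightarrow> ?r" if "?m \<and> ?n \<and> ?b"
  proof -
    interpret operation_triple S ?E ?F m \<nu> b
      using that by (intro extension_tripleI S A_module L_module) simp_all
    show ?thesis
      unfolding deformation_def prod.case courant_pair_iff_no_defects courant_hom_def nd
      using contraction_linear[OF algebra_moduleD[OF S] A_module f] contraction_linear[OF algebra_moduleD[OF S] L_module f]
      by (simp add: mult_update_simps conj_ac)
  qed
  with bil show ?thesis by blast
qed

context square_zero_extension
begin

lemma extension_tensorI: "module K V \<Longrightarrow> extension_tensor K R \<epsilon> M S i p q V"
  by (intro extension_tensor.intro extension_tensor_axioms.intro square_zero_extension_axioms)

text \<open>The kernel is spanned by the elements \<open>i(x) (1 \<otimes> v)\<close>. By \<open>S\<close>-bilinearity, \<open>\<beta>(X, i(x) (1 \<otimes> v))\<close> is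
  \<open>i(x) \<beta>(X, 1 \<otimes> v)\<close>, where \<open>i(x)\<close> only sees the reduction of its cofactor.\<close>

lemma bilinear_on_kernel:
  fixes U :: "('k, 'u) module" and V :: "('k, 'v) module" and W :: "('k, 'w) module"
  assumes U: "module K U" and V: "module K V" and W: "module K W"
    and \<beta>: "bilinear_map S (extend_scalars K S U) (extend_scalars K S V) (extend_scalars K S W) \<beta>"
    and \<beta>0: "bilinear_map K U V W \<beta>0"
    and red: "\<And>X Y. \<lbrakk>X \<in> carrier (tensor K S U); Y \<in> carrier (tensor K S V)\<rbrakk>
      \<Longrightarrow> aug_map K S \<epsilon>S W (\<beta> X Y) = \<beta>0 (aug_map K S \<epsilon>S U X) (aug_map K S \<epsilon>S V Y)"
    and f: "functional K MK f"
    and X: "X \<in> carrier (tensor K S U)" and Y: "Y \<in> carrier (tensor K S V)"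
  shows "tensor_map K S V R V p (\<lambda>v. v) Y = \<zero>\<^bsub>tensor K R V\<^esub> \<Longrightarrow>
      aug_map K S (f \<circ> \<rho>) W (\<beta> X Y) = \<beta>0 (aug_map K S \<epsilon>S U X) (aug_map K S (f \<circ> \<rho>) V Y)"
    and "tensor_map K S U R U p (\<lambda>v. v) X = \<zero>\<^bsub>tensor K R U\<^esub> \<Longrightarrow>
      aug_map K S (f \<circ> \<rho>) W (\<beta> X Y) = \<beta>0 (aug_map K S (f \<circ> \<rho>) U X) (aug_map K S \<epsilon>S V Y)"
proof -
  interpret U: extension_tensor K R \<epsilon> M S i p q U by (rule extension_tensorI[OF U])
  interpret V: extension_tensor K R \<epsilon> M S i p q V by (rule extension_tensorI[OF V])
  interpret W: extension_tensor K R \<epsilon> M S i p q W by (rule extension_tensorI[OF W])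
  note \<beta>K = extend_bilinear_restrict[OF S_alg U V W \<beta>]
  note fr = functional_\<rho>[OF f]
  note cU = contraction_linear[OF S_mod U fr] contraction_tens[OF S_mod U fr]
  note cV = contraction_linear[OF S_mod V fr] contraction_tens[OF S_mod V fr]
  note cW = contraction_linear[OF S_mod W fr] contraction_tens[OF S_mod W fr]
  have frc: "f x \<in> carrier K" if "x \<in> carrier M" for x using functionalD(1)[OF f] that by simp
  show "aug_map K S (f \<circ> \<rho>) W (\<beta> X Y) = \<beta>0 (aug_map K S \<epsilon>S U X) (aug_map K S (f \<circ> \<rho>) V Y)"
    if z: "tensor_map K S V R V p (\<lambda>v. v) Y = \<zero>\<^bsub>tensor K R V\<^esub>"
  proof -
    obtain Z where Z: "Z \<in> carrier (tensor K MK V)" "Y = V.incl Z" using V.kernel_proj[OF Y z] .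
    have "aug_map K S (f \<circ> \<rho>) W (\<beta> X (V.incl Z)) = \<beta>0 (aug_map K S \<epsilon>S U X) (aug_map K S (f \<circ> \<rho>) V (V.incl Z))"
    proof (rule linear_map_tensor_eqI[OF MK_mod V
          linear_map_comp[OF linear_map_comp[OF V.incl_lin bilinear_mapD(1)[OF \<beta>K X]] cW(1)]
          linear_map_comp[OF linear_map_comp[OF V.incl_lin cV(1)] bilinear_mapD(1)[OF \<beta>0]] _ Z(1)])
      fix x v assume x: "x \<in> carrier MK" and v: "v \<in> carrier V"
      let ?v = "tens K S V \<one>\<^bsub>S\<^esub> v"
      have "V.incl (tens K MK V x v) = i x \<odot>\<^bsub>extend_scalars K S V\<^esub> ?v"
        using x v by (simp add: V.incl_tens V.smult_tens)
      then have "\<beta> X (V.incl (tens K MK V x v)) = i x \<odot>\<^bsub>extend_scalars K S W\<^esub> \<beta> X ?v"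
        using x v X bilinear_smult(2)[OF \<beta>, of "i x" X ?v] by simp
      also have "\<dots> = tens K S W (i x) (\<beta>0 (aug_map K S \<epsilon>S U X) v)"
        using x v X bilinear_closed[OF \<beta>K X, of ?v]
        by (simp add: W.smult_i red V.augS_tens p_one \<epsilon>_one)
      finally show "aug_map K S (f \<circ> \<rho>) W (\<beta> X (V.incl (tens K MK V x v))) =
          \<beta>0 (aug_map K S \<epsilon>S U X) (aug_map K S (f \<circ> \<rho>) V (V.incl (tens K MK V x v)))"
        using x v X bilinear_closed[OF \<beta>0] frc
        by (simp add: cW(2) V.incl_tens cV(2) \<rho>_i bilinear_smult[OF \<beta>0])
    qed (use X in simp)
    then show ?thesis using Z by simp
  qed
  show "aug_map K S (f \<circ> \<rho>) W (\<beta> X Y) = \<beta>0 (aug_map K S (f \<circ> \<rho>) U X) (aug_map K S \<epsilon>S V Y)"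
    if z: "tensor_map K S U R U p (\<lambda>v. v) X = \<zero>\<^bsub>tensor K R U\<^esub>"
  proof -
    obtain Z where Z: "Z \<in> carrier (tensor K MK U)" "X = U.incl Z" using U.kernel_proj[OF X z] .
    have "aug_map K S (f \<circ> \<rho>) W (\<beta> (U.incl Z) Y) = \<beta>0 (aug_map K S (f \<circ> \<rho>) U (U.incl Z)) (aug_map K S \<epsilon>S V Y)"
    proof (rule linear_map_tensor_eqI[OF MK_mod U
          linear_map_comp[OF linear_map_comp[OF U.incl_lin bilinear_mapD(2)[OF \<beta>K Y]] cW(1)]
          linear_map_comp[OF linear_map_comp[OF U.incl_lin cU(1)] bilinear_mapD(2)[OF \<beta>0]] _ Z(1)])
      fix x u assume x: "x \<in> carrier MK" and u: "u \<in> carrier U"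
      let ?u = "tens K S U \<one>\<^bsub>S\<^esub> u"
      have "U.incl (tens K MK U x u) = i x \<odot>\<^bsub>extend_scalars K S U\<^esub> ?u"
        using x u by (simp add: U.incl_tens U.smult_tens)
      then have "\<beta> (U.incl (tens K MK U x u)) Y = i x \<odot>\<^bsub>extend_scalars K S W\<^esub> \<beta> ?u Y"
        using x u Y bilinear_smult(1)[OF \<beta>, of "i x" ?u Y] by simp
      also have "\<dots> = tens K S W (i x) (\<beta>0 u (aug_map K S \<epsilon>S V Y))"
        using x u Y bilinear_closed[OF \<beta>K _ Y, of ?u]
        by (simp add: W.smult_i red U.augS_tens p_one \<epsilon>_one)
      finally show "aug_map K S (f \<circ> \<rho>) W (\<beta> (U.incl (tens K MK U x u)) Y) =
          \<beta>0 (aug_map K S (f \<circ> \<rho>) U (U.incl (tens K MK U x u))) (aug_map K S \<epsilon>S V Y)"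
        using x u Y bilinear_closed[OF \<beta>0] frc
        by (simp add: cW(2) U.incl_tens cU(2) \<rho>_i bilinear_smult[OF \<beta>0])
    qed (use Y in simp)
    then show ?thesis using Z by simp
  qed
qed

lemma kernel_bilinear_reduce:
  assumes U: "module K U" and V: "module K V" and W: "module K W"
    and D: "bilinear_map S (extend_scalars K S U) (extend_scalars K S V) (extend_scalars K S W) D"
    and ker: "\<And>X Y. \<lbrakk>X \<in> carrier (tensor K S U); Y \<in> carrier (tensor K S V)\<rbrakk>
      \<Longrightarrow> tensor_map K S W R W p (\<lambda>v. v) (D X Y) = \<zero>\<^bsub>tensor K R W\<^esub>"
    and X: "X \<in> carrier (tensor K S U)" and Y: "Y \<in> carrier (tensor K S V)"
  shows "D X Y = D (tens K S U \<one>\<^bsub>S\<^esub> (aug_map K S \<epsilon>S U X)) (tens K S V \<one>\<^bsub>S\<^esub> (aug_map K S \<epsilon>S V Y))"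
proof -
  interpret U: extension_tensor K R \<epsilon> M S i p q U by (rule extension_tensorI[OF U])
  interpret W: extension_tensor K R \<epsilon> M S i p q W by (rule extension_tensorI[OF W])
  let ?X = "tens K S U \<one>\<^bsub>S\<^esub> (aug_map K S \<epsilon>S U X)"
  have X': "?X \<in> carrier (tensor K S U)" using X by simp
  have "D X Y = D ?X Y"
    using W.kernel_map_reduce[OF U bilinear_mapD(2)[OF D]] ker X Y by simp
  also have "\<dots> = D ?X (tens K S V \<one>\<^bsub>S\<^esub> (aug_map K S \<epsilon>S V Y))"
    using W.kernel_map_reduce[OF V bilinear_mapD(1)[OF D]] ker X' Y by simp
  finally show ?thesis .
qed

lemma kernel_trilinear_reduce:
  assumes U: "module K U" and V: "module K V" and V': "module K V'" and W: "module K W"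
    and D: "trilinear_map S (extend_scalars K S U) (extend_scalars K S V) (extend_scalars K S V') (extend_scalars K S W) D"
    and ker: "\<And>X Y Z. \<lbrakk>X \<in> carrier (tensor K S U); Y \<in> carrier (tensor K S V); Z \<in> carrier (tensor K S V')\<rbrakk>
      \<Longrightarrow> tensor_map K S W R W p (\<lambda>v. v) (D X Y Z) = \<zero>\<^bsub>tensor K R W\<^esub>"
    and X: "X \<in> carrier (tensor K S U)" and Y: "Y \<in> carrier (tensor K S V)" and Z: "Z \<in> carrier (tensor K S V')"
  shows "D X Y Z = D (tens K S U \<one>\<^bsub>S\<^esub> (aug_map K S \<epsilon>S U X)) (tens K S V \<one>\<^bsub>S\<^esub> (aug_map K S \<epsilon>S V Y))
      (tens K S V' \<one>\<^bsub>S\<^esub> (aug_map K S \<epsilon>S V' Z))"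
proof -
  interpret U: extension_tensor K R \<epsilon> M S i p q U by (rule extension_tensorI[OF U])
  interpret V: extension_tensor K R \<epsilon> M S i p q V by (rule extension_tensorI[OF V])
  interpret W: extension_tensor K R \<epsilon> M S i p q W by (rule extension_tensorI[OF W])
  let ?X = "tens K S U \<one>\<^bsub>S\<^esub> (aug_map K S \<epsilon>S U X)" and ?Y = "tens K S V \<one>\<^bsub>S\<^esub> (aug_map K S \<epsilon>S V Y)"
  have X': "?X \<in> carrier (tensor K S U)" and Y': "?Y \<in> carrier (tensor K S V)" using X Y by simp_all
  have "D X Y Z = D ?X Y Z"
    using W.kernel_map_reduce[OF U trilinear_mapD(1)[OF D]] ker X Y Z by simp
  also have "\<dots> = D ?X ?Y Z"
    using W.kernel_map_reduce[OF V trilinear_mapD(2)[OF D]] ker X' Y Z by simp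
  also have "\<dots> = D ?X ?Y (tens K S V' \<one>\<^bsub>S\<^esub> (aug_map K S \<epsilon>S V' Z))"
    using W.kernel_map_reduce[OF V' trilinear_mapD(3)[OF D]] ker X' Y' Z by simp
  finally show ?thesis .
qed

end

section \<open>The obstruction class of an extension\<close>

lemma represents_obstruction_iff:
  "represents_obstruction K A L \<mu> M S i (m, \<nu>, b) \<Theta> \<longleftrightarrow>
     \<Theta> \<in> carrier (tensor K M (cocycles K A L \<mu> 3)) \<and>
     (\<forall>a1\<in>carrier A. \<forall>a2\<in>carrier A. \<forall>a3\<in>carrier A.
        tensor_map K M (cocycles K A L \<mu> 3) S A i (\<lambda>c. snd c ([], [a1, a2, a3])) \<Theta> =
        assoc_defect (tensor K S A) m (tens K S A \<one>\<^bsub>S\<^esub> a1) (tens K S A \<one>\<^bsub>S\<^esub> a2) (tens K S A \<one>\<^bsub>S\<^esub> a3)) \<and>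
     (\<forall>x\<in>carrier L. \<forall>a1\<in>carrier A. \<forall>a2\<in>carrier A.
        tensor_map K M (cocycles K A L \<mu> 3) S A i (\<lambda>c. snd c ([x], [a1, a2])) \<Theta> =
        derivation_defect (tensor K S A) m \<nu> (tens K S L \<one>\<^bsub>S\<^esub> x) (tens K S A \<one>\<^bsub>S\<^esub> a1) (tens K S A \<one>\<^bsub>S\<^esub> a2)) \<and>
     (\<forall>x\<in>carrier L. \<forall>y\<in>carrier L. \<forall>a\<in>carrier A.
        tensor_map K M (cocycles K A L \<mu> 3) S A i (\<lambda>c. snd c ([x, y], [a])) \<Theta> =
        action_defect (tensor K S A) \<nu> b (tens K S L \<one>\<^bsub>S\<^esub> x) (tens K S L \<one>\<^bsub>S\<^esub> y) (tens K S A \<one>\<^bsub>S\<^esub> a)) \<and>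
     (\<forall>x\<in>carrier L. \<forall>y\<in>carrier L. \<forall>z\<in>carrier L.
        tensor_map K M (cocycles K A L \<mu> 3) S L i (\<lambda>c. fst c [x, y, z]) \<Theta> =
        leibniz_defect (tensor K S L) b (tens K S L \<one>\<^bsub>S\<^esub> x) (tens K S L \<one>\<^bsub>S\<^esub> y) (tens K S L \<one>\<^bsub>S\<^esub> z))"
  by (simp add: represents_obstruction_def defect_defs Let_def)

text \<open>The functionals \<open>\<phi> j\<close> are the coordinates of \<open>M\<close> with respect to \<open>eb\<close>; through them, elements of
  \<open>M \<otimes> V\<close> are families of elements of \<open>V\<close>.\<close>

locale lifting_problem = courant K A L \<mu> + square_zero_extension K R \<epsilon> M S i p q
  for K :: "('k, 'z) ring_scheme" and A :: "('k, 'a) module" and L :: "('k, 'l) module" and \<mu>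
    and R :: "('k, 'r) module" and \<epsilon> :: "'r \<Rightarrow> 'k" and M :: "('r, 'm) module" and S :: "('k, 's) module"
    and i :: "'m \<Rightarrow> 's" and p :: "'s \<Rightarrow> 'r" and q :: "'r \<Rightarrow> 's" +
  fixes mR \<nu>R bR and d :: nat and eb :: "nat \<Rightarrow> 'm" and \<phi> :: "nat \<Rightarrow> 'm \<Rightarrow> 'k"
  assumes defR: "deformation K R \<epsilon> A L \<mu> (mR, \<nu>R, bR)"
    and eb: "\<And>j. j \<in> {1..d} \<Longrightarrow> eb j \<in> carrier M"
    and \<phi>: "\<And>j. j \<in> {1..d} \<Longrightarrow> functional K (restrict_scalars R M) (\<phi> j)"
    and expand: "\<And>x. x \<in> carrier M \<Longrightarrow>
      x = (\<Oplus>\<^bsub>restrict_scalars R M\<^esub>j\<in>{1..d}. \<phi> j x \<odot>\<^bsub>restrict_scalars R M\<^esub> eb j)"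
    and \<phi>_eb: "\<And>j k. \<lbrakk>j \<in> {1..d}; k \<in> {1..d}\<rbrakk> \<Longrightarrow> \<phi> j (eb k) = (if j = k then \<one>\<^bsub>K\<^esub> else \<zero>\<^bsub>K\<^esub>)"
begin

sublocale TA: extension_tensor K R \<epsilon> M S i p q A by (rule extension_tensorI[OF A_module])
sublocale TL: extension_tensor K R \<epsilon> M S i p q L by (rule extension_tensorI[OF L_module])

abbreviation "Z3 \<equiv> cocycles K A L \<mu> 3"
abbreviation "H3 \<equiv> cohomology K A L \<mu> 3"

lemmas R_structure = defR[unfolded deformation_iff[OF R_alg \<epsilon>_fun]]

lemma R_bilinear:
  "bilinear_map R (extend_scalars K R A) (extend_scalars K R A) (extend_scalars K R A) mR"
  "bilinear_map R (extend_scalars K R L) (extend_scalars K R A) (extend_scalars K R A) \<nu>R"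
  "bilinear_map R (extend_scalars K R L) (extend_scalars K R L) (extend_scalars K R L) bR"
  using R_structure by simp_all

sublocale RT: operation_triple K TA.TR TL.TR mR \<nu>R bR
  by (rule extension_tripleI(2)[OF R_alg A_module L_module R_bilinear])

text \<open>The candidates for a deformation with the given push-out: only the axioms of a Courant pair are left
  out.\<close>

definition is_lift where
  "is_lift m \<nu> b \<longleftrightarrow>
     bilinear_map S TA.ES TA.ES TA.ES m \<and> bilinear_map S TL.ES TA.ES TA.ES \<nu> \<and> bilinear_map S TL.ES TL.ES TL.ES b \<and>
     (\<forall>u\<in>carrier TA.TS. \<forall>v\<in>carrier TA.TS. TA.proj (m u v) = mR (TA.proj u) (TA.proj v)) \<and>
     (\<forall>y\<in>carrier TL.TS. \<forall>v\<in>carrier TA.TS. TA.proj (\<nu> y v) = \<nu>R (TL.proj y) (TA.proj v)) \<and>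
     (\<forall>y\<in>carrier TL.TS. \<forall>z\<in>carrier TL.TS. TL.proj (b y z) = bR (TL.proj y) (TL.proj z))"

lemma lift_bilinear:
  assumes "is_lift m \<nu> b"
  shows "bilinear_map S TA.ES TA.ES TA.ES m" "bilinear_map S TL.ES TA.ES TA.ES \<nu>" "bilinear_map S TL.ES TL.ES TL.ES b"
  using assms by (simp_all add: is_lift_def)

lemma lift_proj:
  assumes "is_lift m \<nu> b"
  shows "\<lbrakk>u \<in> carrier TA.TS; v \<in> carrier TA.TS\<rbrakk> \<Longrightarrow> TA.proj (m u v) = mR (TA.proj u) (TA.proj v)"
    "\<lbrakk>y \<in> carrier TL.TS; v \<in> carrier TA.TS\<rbrakk> \<Longrightarrow> TA.proj (\<nu> y v) = \<nu>R (TL.proj y) (TA.proj v)"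
    "\<lbrakk>y \<in> carrier TL.TS; z \<in> carrier TL.TS\<rbrakk> \<Longrightarrow> TL.proj (b y z) = bR (TL.proj y) (TL.proj z)"
  using assms by (simp_all add: is_lift_def)

lemma lift_triples:
  assumes "is_lift m \<nu> b"
  shows "operation_triple S TA.ES TL.ES m \<nu> b" "operation_triple K TA.TS TL.TS m \<nu> b"
  using extension_tripleI[OF S_alg A_module L_module lift_bilinear[OF assms]] by simp_all

lemma lift_aug:
  assumes l: "is_lift m \<nu> b"
  shows "\<lbrakk>u \<in> carrier TA.TS; v \<in> carrier TA.TS\<rbrakk>
      \<Longrightarrow> aug_map K S \<epsilon>S A (m u v) = aug_map K S \<epsilon>S A u \<otimes>\<^bsub>A\<^esub> aug_map K S \<epsilon>S A v"
    "\<lbrakk>y \<in> carrier TL.TS; v \<in> carrier TA.TS\<rbrakk>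
      \<Longrightarrow> aug_map K S \<epsilon>S A (\<nu> y v) = \<mu> (aug_map K S \<epsilon>S L y) (aug_map K S \<epsilon>S A v)"
    "\<lbrakk>y \<in> carrier TL.TS; z \<in> carrier TL.TS\<rbrakk>
      \<Longrightarrow> aug_map K S \<epsilon>S L (b y z) = aug_map K S \<epsilon>S L y \<otimes>\<^bsub>L\<^esub> aug_map K S \<epsilon>S L z"
proof -
  interpret operation_triple K TA.TS TL.TS m \<nu> b by (rule lift_triples(2)[OF l])
  show "\<lbrakk>u \<in> carrier TA.TS; v \<in> carrier TA.TS\<rbrakk>
      \<Longrightarrow> aug_map K S \<epsilon>S A (m u v) = aug_map K S \<epsilon>S A u \<otimes>\<^bsub>A\<^esub> aug_map K S \<epsilon>S A v"
    "\<lbrakk>y \<in> carrier TL.TS; v \<in> carrier TA.TS\<rbrakk>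
      \<Longrightarrow> aug_map K S \<epsilon>S A (\<nu> y v) = \<mu> (aug_map K S \<epsilon>S L y) (aug_map K S \<epsilon>S A v)"
    "\<lbrakk>y \<in> carrier TL.TS; z \<in> carrier TL.TS\<rbrakk>
      \<Longrightarrow> aug_map K S \<epsilon>S L (b y z) = aug_map K S \<epsilon>S L y \<otimes>\<^bsub>L\<^esub> aug_map K S \<epsilon>S L z"
    using R_structure by (simp_all add: TA.augR_proj[symmetric] TL.augR_proj[symmetric] lift_proj[OF l])
qed

text \<open>The projection maps the defects of the lift to those of the deformation over \<open>R\<close>, which vanish.\<close>

lemma lift_defects_in_kernel:
  assumes l: "is_lift m \<nu> b"
  shows "\<lbrakk>u \<in> carrier TA.TS; v \<in> carrier TA.TS; w \<in> carrier TA.TS\<rbrakk>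
      \<Longrightarrow> TA.proj (assoc_defect TA.TS m u v w) = \<zero>\<^bsub>TA.TR\<^esub>"
    "\<lbrakk>y \<in> carrier TL.TS; u \<in> carrier TA.TS; v \<in> carrier TA.TS\<rbrakk>
      \<Longrightarrow> TA.proj (derivation_defect TA.TS m \<nu> y u v) = \<zero>\<^bsub>TA.TR\<^esub>"
    "\<lbrakk>y \<in> carrier TL.TS; z \<in> carrier TL.TS; u \<in> carrier TA.TS\<rbrakk>
      \<Longrightarrow> TA.proj (action_defect TA.TS \<nu> b y z u) = \<zero>\<^bsub>TA.TR\<^esub>"
    "\<lbrakk>x \<in> carrier TL.TS; y \<in> carrier TL.TS; z \<in> carrier TL.TS\<rbrakk>
      \<Longrightarrow> TL.proj (leibniz_defect TL.TS b x y z) = \<zero>\<^bsub>TL.TR\<^esub>"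
proof -
  interpret operation_triple K TA.TS TL.TS m \<nu> b by (rule lift_triples(2)[OF l])
  have nd: "no_defects TA.TR TL.TR mR \<nu>R bR" using R_structure by simp
  note A = linear_map_add[OF TA.proj_lin] linear_map_diff[OF TA.proj_lin TA.TS_mod TA.TR_mod]
    linear_map_minus[OF TA.proj_lin TA.TS_mod TA.TR_mod]
  note L = linear_map_diff[OF TL.proj_lin TL.TS_mod TL.TR_mod] linear_map_minus[OF TL.proj_lin TL.TS_mod TL.TR_mod]
  note P = lift_proj[OF l]
  show "TA.proj (assoc_defect TA.TS m u v w) = \<zero>\<^bsub>TA.TR\<^esub>"
    if "u \<in> carrier TA.TS" "v \<in> carrier TA.TS" "w \<in> carrier TA.TS" for u v w
    using nd that unfolding no_defects_def assoc_defect_def by (simp add: A P)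
  show "TA.proj (derivation_defect TA.TS m \<nu> y u v) = \<zero>\<^bsub>TA.TR\<^esub>"
    if "y \<in> carrier TL.TS" "u \<in> carrier TA.TS" "v \<in> carrier TA.TS" for y u v
    using nd that unfolding no_defects_def derivation_defect_def by (simp add: A P)
  show "TA.proj (action_defect TA.TS \<nu> b y z u) = \<zero>\<^bsub>TA.TR\<^esub>"
    if "y \<in> carrier TL.TS" "z \<in> carrier TL.TS" "u \<in> carrier TA.TS" for y z u
    using nd that unfolding no_defects_def action_defect_def by (simp add: A P)
  show "TL.proj (leibniz_defect TL.TS b x y z) = \<zero>\<^bsub>TL.TR\<^esub>"
    if "x \<in> carrier TL.TS" "y \<in> carrier TL.TS" "z \<in> carrier TL.TS" for x y z
    using nd that unfolding no_defects_def leibniz_defect_def by (simp add: L P)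
qed

abbreviation "kerA \<equiv> {u \<in> carrier TA.TS. TA.proj u = \<zero>\<^bsub>TA.TR\<^esub>}"
abbreviation "kerL \<equiv> {y \<in> carrier TL.TS. TL.proj y = \<zero>\<^bsub>TL.TR\<^esub>}"
abbreviation "jA \<equiv> tens K S A \<one>\<^bsub>S\<^esub>"
abbreviation "jL \<equiv> tens K S L \<one>\<^bsub>S\<^esub>"

abbreviation "lift_theta f \<equiv> defect_cochain A L TA.TS TL.TS (aug_map K S (f \<circ> \<rho>) A) (aug_map K S (f \<circ> \<rho>) L) jA jL"

text \<open>The defects are \<open>S\<close>-trilinear with values in the kernel of the projection.\<close>

lemma lift_defects_reduce:
  assumes l: "is_lift m \<nu> b"
  shows "\<lbrakk>u \<in> carrier TA.TS; v \<in> carrier TA.TS; w \<in> carrier TA.TS\<rbrakk> \<Longrightarrow> assoc_defect TA.TS m u v w =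
      assoc_defect TA.TS m (jA (aug_map K S \<epsilon>S A u)) (jA (aug_map K S \<epsilon>S A v)) (jA (aug_map K S \<epsilon>S A w))"
    "\<lbrakk>y \<in> carrier TL.TS; u \<in> carrier TA.TS; v \<in> carrier TA.TS\<rbrakk> \<Longrightarrow> derivation_defect TA.TS m \<nu> y u v =
      derivation_defect TA.TS m \<nu> (jL (aug_map K S \<epsilon>S L y)) (jA (aug_map K S \<epsilon>S A u)) (jA (aug_map K S \<epsilon>S A v))"
    "\<lbrakk>y \<in> carrier TL.TS; z \<in> carrier TL.TS; u \<in> carrier TA.TS\<rbrakk> \<Longrightarrow> action_defect TA.TS \<nu> b y z u =
      action_defect TA.TS \<nu> b (jL (aug_map K S \<epsilon>S L y)) (jL (aug_map K S \<epsilon>S L z)) (jA (aug_map K S \<epsilon>S A u))"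
    "\<lbrakk>x \<in> carrier TL.TS; y \<in> carrier TL.TS; z \<in> carrier TL.TS\<rbrakk> \<Longrightarrow> leibniz_defect TL.TS b x y z =
      leibniz_defect TL.TS b (jL (aug_map K S \<epsilon>S L x)) (jL (aug_map K S \<epsilon>S L y)) (jL (aug_map K S \<epsilon>S L z))"
proof -
  interpret E: operation_triple S TA.ES TL.ES m \<nu> b by (rule lift_triples(1)[OF l])
  note tri = E.defect_trilinear[unfolded defect_extend_scalars] and ker = lift_defects_in_kernel[OF l]
    and red = kernel_trilinear_reduce
  show "\<lbrakk>u \<in> carrier TA.TS; v \<in> carrier TA.TS; w \<in> carrier TA.TS\<rbrakk> \<Longrightarrow> assoc_defect TA.TS m u v w =
      assoc_defect TA.TS m (jA (aug_map K S \<epsilon>S A u)) (jA (aug_map K S \<epsilon>S A v)) (jA (aug_map K S \<epsilon>S A w))"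
    by (rule red[OF A_module A_module A_module A_module tri(1) ker(1)])
  show "\<lbrakk>y \<in> carrier TL.TS; u \<in> carrier TA.TS; v \<in> carrier TA.TS\<rbrakk> \<Longrightarrow> derivation_defect TA.TS m \<nu> y u v =
      derivation_defect TA.TS m \<nu> (jL (aug_map K S \<epsilon>S L y)) (jA (aug_map K S \<epsilon>S A u)) (jA (aug_map K S \<epsilon>S A v))"
    by (rule red[OF L_module A_module A_module A_module tri(2) ker(2)])
  show "\<lbrakk>y \<in> carrier TL.TS; z \<in> carrier TL.TS; u \<in> carrier TA.TS\<rbrakk> \<Longrightarrow> action_defect TA.TS \<nu> b y z u =
      action_defect TA.TS \<nu> b (jL (aug_map K S \<epsilon>S L y)) (jL (aug_map K S \<epsilon>S L z)) (jA (aug_map K S \<epsilon>S A u))"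
    by (rule red[OF L_module L_module A_module A_module tri(3) ker(3)])
  show "\<lbrakk>x \<in> carrier TL.TS; y \<in> carrier TL.TS; z \<in> carrier TL.TS\<rbrakk> \<Longrightarrow> leibniz_defect TL.TS b x y z =
      leibniz_defect TL.TS b (jL (aug_map K S \<epsilon>S L x)) (jL (aug_map K S \<epsilon>S L y)) (jL (aug_map K S \<epsilon>S L z))"
    by (rule red[OF L_module L_module L_module L_module tri(4) ker(4)])
qed

text \<open>The functional \<open>f\<close> on \<open>M\<close>, extended by \<open>\<rho>\<close> to \<open>S\<close>, reads off one coordinate of the kernel.\<close>

lemma lift_first_order:
  assumes l: "is_lift m \<nu> b" and f: "functional K MK f"
  shows "first_order_lift K A L \<mu> TA.TS TL.TS (aug_map K S \<epsilon>S A) (aug_map K S \<epsilon>S L)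
    (aug_map K S (f \<circ> \<rho>) A) (aug_map K S (f \<circ> \<rho>) L) jA jL kerA kerL m \<nu> b"
proof -
  interpret operation_triple K TA.TS TL.TS m \<nu> b by (rule lift_triples(2)[OF l])
  note fr = functional_\<rho>[OF f]
  note ker = lift_defects_in_kernel[OF l] and aug = lift_aug[OF l] and bil = lift_bilinear[OF l]
  note onK1 = bilinear_on_kernel[OF A_module A_module A_module bil(1) mult_bilinear aug(1) f]
    and onK2 = bilinear_on_kernel[OF L_module A_module A_module bil(2) action_bilinear aug(2) f]
    and onK3 = bilinear_on_kernel[OF L_module L_module L_module bil(3) bracket_bilinear aug(3) f]
  show ?thesis
  proof (unfold_locales)
    show "linear_map K TA.TS A (aug_map K S \<epsilon>S A)" "linear_map K TL.TS L (aug_map K S \<epsilon>S L)"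
      by (rule TA.augS_lin TL.augS_lin)+
    show "linear_map K TA.TS A (aug_map K S (f \<circ> \<rho>) A)" "linear_map K TL.TS L (aug_map K S (f \<circ> \<rho>) L)"
      by (rule contraction_linear[OF S_mod _ fr] A_module L_module)+
    show "linear_map K A TA.TS jA" "linear_map K L TL.TS jL"
      by (rule bilinear_mapD(1)[OF TA.tensS] bilinear_mapD(1)[OF TL.tensS] S.one_closed)+
  next
    show "aug_map K S (f \<circ> \<rho>) A (assoc_defect TA.TS m u v w) = aug_map K S (f \<circ> \<rho>) A (assoc_defect TA.TS m
      (jA (aug_map K S \<epsilon>S A u)) (jA (aug_map K S \<epsilon>S A v)) (jA (aug_map K S \<epsilon>S A w)))"
      if "u \<in> carrier TA.TS" "v \<in> carrier TA.TS" "w \<in> carrier TA.TS" for u v w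
      using lift_defects_reduce(1)[OF l that] by simp
    show "aug_map K S (f \<circ> \<rho>) A (derivation_defect TA.TS m \<nu> y u v) = aug_map K S (f \<circ> \<rho>) A (derivation_defect TA.TS m \<nu>
      (jL (aug_map K S \<epsilon>S L y)) (jA (aug_map K S \<epsilon>S A u)) (jA (aug_map K S \<epsilon>S A v)))"
      if "y \<in> carrier TL.TS" "u \<in> carrier TA.TS" "v \<in> carrier TA.TS" for y u v
      using lift_defects_reduce(2)[OF l that] by simp
    show "aug_map K S (f \<circ> \<rho>) A (action_defect TA.TS \<nu> b y z u) = aug_map K S (f \<circ> \<rho>) A (action_defect TA.TS \<nu> b
      (jL (aug_map K S \<epsilon>S L y)) (jL (aug_map K S \<epsilon>S L z)) (jA (aug_map K S \<epsilon>S A u)))"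
      if "y \<in> carrier TL.TS" "z \<in> carrier TL.TS" "u \<in> carrier TA.TS" for y z u
      using lift_defects_reduce(3)[OF l that] by simp
    show "aug_map K S (f \<circ> \<rho>) L (leibniz_defect TL.TS b x y z) = aug_map K S (f \<circ> \<rho>) L (leibniz_defect TL.TS b
      (jL (aug_map K S \<epsilon>S L x)) (jL (aug_map K S \<epsilon>S L y)) (jL (aug_map K S \<epsilon>S L z)))"
      if "x \<in> carrier TL.TS" "y \<in> carrier TL.TS" "z \<in> carrier TL.TS" for x y z
      using lift_defects_reduce(4)[OF l that] by simp
  qed (simp_all add: ker aug onK1 onK2 onK3 TA.augS_tens TL.augS_tens p_one \<epsilon>_one)
qed

lemma lifts_first_order:
  assumes l: "is_lift m \<nu> b" and l': "is_lift m' \<nu>' b'" and f: "functional K MK f"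
  shows "first_order_lifts K A L \<mu> TA.TS TL.TS (aug_map K S \<epsilon>S A) (aug_map K S \<epsilon>S L)
    (aug_map K S (f \<circ> \<rho>) A) (aug_map K S (f \<circ> \<rho>) L) jA jL kerA kerL m \<nu> b m' \<nu>' b'"
proof -
  interpret l: operation_triple K TA.TS TL.TS m \<nu> b by (rule lift_triples(2)[OF l])
  interpret l': operation_triple K TA.TS TL.TS m' \<nu>' b' by (rule lift_triples(2)[OF l'])
  note P = lift_proj[OF l] lift_proj[OF l'] linear_map_diff[OF TA.proj_lin TA.TS_mod TA.TR_mod]
    linear_map_diff[OF TL.proj_lin TL.TS_mod TL.TR_mod] TA.TR.minus_eq_iff TL.TR.minus_eq_iff
  have k1: "TA.proj (m u v \<ominus>\<^bsub>TA.TS\<^esub> m' u v) = \<zero>\<^bsub>TA.TR\<^esub>"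
    if "u \<in> carrier TA.TS" "v \<in> carrier TA.TS" for u v using that by (simp add: P)
  have k2: "TA.proj (\<nu> y v \<ominus>\<^bsub>TA.TS\<^esub> \<nu>' y v) = \<zero>\<^bsub>TA.TR\<^esub>"
    if "y \<in> carrier TL.TS" "v \<in> carrier TA.TS" for y v using that by (simp add: P)
  have k3: "TL.proj (b y z \<ominus>\<^bsub>TL.TS\<^esub> b' y z) = \<zero>\<^bsub>TL.TR\<^esub>"
    if "y \<in> carrier TL.TS" "z \<in> carrier TL.TS" for y z using that by (simp add: P)
  note sub = bilinear_map_sub[OF lift_bilinear(1)[OF l] lift_bilinear(1)[OF l'] TA.ES_mod TA.ES_mod TA.ES_mod]
    bilinear_map_sub[OF lift_bilinear(2)[OF l] lift_bilinear(2)[OF l'] TL.ES_mod TA.ES_mod TA.ES_mod]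
    bilinear_map_sub[OF lift_bilinear(3)[OF l] lift_bilinear(3)[OF l'] TL.ES_mod TL.ES_mod TL.ES_mod]
  note sub = sub[unfolded extend_scalars_ops]
  show ?thesis
  proof (intro first_order_lifts.intro first_order_lifts_axioms.intro lift_first_order[OF l f] lift_first_order[OF l' f])
    show "aug_map K S (f \<circ> \<rho>) A (m u v \<ominus>\<^bsub>TA.TS\<^esub> m' u v) = aug_map K S (f \<circ> \<rho>) A
      (m (jA (aug_map K S \<epsilon>S A u)) (jA (aug_map K S \<epsilon>S A v)) \<ominus>\<^bsub>TA.TS\<^esub> m' (jA (aug_map K S \<epsilon>S A u)) (jA (aug_map K S \<epsilon>S A v)))"
      if "u \<in> carrier TA.TS" "v \<in> carrier TA.TS" for u v
      using kernel_bilinear_reduce[OF A_module A_module A_module sub(1) k1 that] by simp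
    show "aug_map K S (f \<circ> \<rho>) A (\<nu> y v \<ominus>\<^bsub>TA.TS\<^esub> \<nu>' y v) = aug_map K S (f \<circ> \<rho>) A
      (\<nu> (jL (aug_map K S \<epsilon>S L y)) (jA (aug_map K S \<epsilon>S A v)) \<ominus>\<^bsub>TA.TS\<^esub> \<nu>' (jL (aug_map K S \<epsilon>S L y)) (jA (aug_map K S \<epsilon>S A v)))"
      if "y \<in> carrier TL.TS" "v \<in> carrier TA.TS" for y v
      using kernel_bilinear_reduce[OF L_module A_module A_module sub(2) k2 that] by simp
    show "aug_map K S (f \<circ> \<rho>) L (b y z \<ominus>\<^bsub>TL.TS\<^esub> b' y z) = aug_map K S (f \<circ> \<rho>) L
      (b (jL (aug_map K S \<epsilon>S L y)) (jL (aug_map K S \<epsilon>S L z)) \<ominus>\<^bsub>TL.TS\<^esub> b' (jL (aug_map K S \<epsilon>S L y)) (jL (aug_map K S \<epsilon>S L z)))"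
      if "y \<in> carrier TL.TS" "z \<in> carrier TL.TS" for y z
      using kernel_bilinear_reduce[OF L_module L_module L_module sub(3) k3 that] by simp
  qed (simp_all add: k1 k2 k3)
qed

end

context courant
begin

lemma cocycle_is_cochain: "c \<in> carrier (cocycles K A L \<mu> 3) \<Longrightarrow> c \<in> carrier (cochains K A L 3)"
  by (simp add: cocycles_def)

lemma evaluation_linear:
  "z \<in> args1 A L 3 \<Longrightarrow> linear_map K (cocycles K A L \<mu> 3) A (\<lambda>c. snd c z)"
  "xs \<in> args0 L 3 \<Longrightarrow> linear_map K (cocycles K A L \<mu> 3) L (\<lambda>c. fst c xs)"
proof -
  show "linear_map K (cocycles K A L \<mu> 3) A (\<lambda>c. snd c z)" if "z \<in> args1 A L 3"
    using that cochain_closed(2)[OF cocycle_is_cochain] by (intro linear_mapI) (simp_all add: cocycles_def cochains_eval)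
  show "linear_map K (cocycles K A L \<mu> 3) L (\<lambda>c. fst c xs)" if "xs \<in> args0 L 3"
    using that cochain_closed(1)[OF cocycle_is_cochain] by (intro linear_mapI) (simp_all add: cocycles_def cochains_eval)
qed

end

context lifting_problem
begin

lemma Z3_mod: "module K Z3" and H3_mod: "module K H3"
  by (rule cocycles_module cohomology_module)+

text \<open>As \<open>\<rho>\<close> inverts \<open>i\<close>, it does not matter whether the factor in \<open>M\<close> is contracted before or after the
  cochain is evaluated.\<close>

lemma contraction_evaluation:
  assumes f: "functional K MK f" and \<Theta>: "\<Theta> \<in> carrier (tensor K MK Z3)"
  shows "z \<in> args1 A L 3 \<Longrightarrow> snd (aug_map K MK f Z3 \<Theta>) z =
      aug_map K S (f \<circ> \<rho>) A (tensor_map K MK Z3 S A i (\<lambda>c. snd c z) \<Theta>)"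
    and "xs \<in> args0 L 3 \<Longrightarrow> fst (aug_map K MK f Z3 \<Theta>) xs =
      aug_map K S (f \<circ> \<rho>) L (tensor_map K MK Z3 S L i (\<lambda>c. fst c xs) \<Theta>)"
proof -
  note cf = contraction_linear[OF MK_mod Z3_mod f]
  note fr = functional_\<rho>[OF f]
  have fc: "f x \<in> carrier K" if "x \<in> carrier M" for x using functionalD(1)[OF f] that by simp
  show "snd (aug_map K MK f Z3 \<Theta>) z = aug_map K S (f \<circ> \<rho>) A (tensor_map K MK Z3 S A i (\<lambda>c. snd c z) \<Theta>)"
    if z: "z \<in> args1 A L 3"
  proof (rule linear_map_tensor_eqI[OF MK_mod Z3_mod linear_map_comp[OF cf evaluation_linear(1)[OF z]]
        linear_map_comp[OF tensor_map_linear[OF MK_mod Z3_mod S_mod A_module i evaluation_linear(1)[OF z]]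
          contraction_linear[OF S_mod A_module fr]] _ \<Theta>])
    fix x c assume x: "x \<in> carrier MK" and c: "c \<in> carrier Z3"
    note e = linear_map_closed[OF evaluation_linear(1)[OF z] c]
    have "snd (aug_map K MK f Z3 (tens K MK Z3 x c)) z = f x \<odot>\<^bsub>A\<^esub> snd c z"
      using contraction_tens[OF MK_mod Z3_mod f x c] linear_map_smult[OF evaluation_linear(1)[OF z] _ c] fc x by simp
    then show "snd (aug_map K MK f Z3 (tens K MK Z3 x c)) z =
      aug_map K S (f \<circ> \<rho>) A (tensor_map K MK Z3 S A i (\<lambda>c. snd c z) (tens K MK Z3 x c))"
      using x c e by (simp add: tensor_map_tens[OF MK_mod Z3_mod S_mod A_module i evaluation_linear(1)[OF z]]
        contraction_tens[OF S_mod A_module fr] \<rho>_i)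
  qed
  show "fst (aug_map K MK f Z3 \<Theta>) xs = aug_map K S (f \<circ> \<rho>) L (tensor_map K MK Z3 S L i (\<lambda>c. fst c xs) \<Theta>)"
    if z: "xs \<in> args0 L 3"
  proof (rule linear_map_tensor_eqI[OF MK_mod Z3_mod linear_map_comp[OF cf evaluation_linear(2)[OF z]]
        linear_map_comp[OF tensor_map_linear[OF MK_mod Z3_mod S_mod L_module i evaluation_linear(2)[OF z]]
          contraction_linear[OF S_mod L_module fr]] _ \<Theta>])
    fix x c assume x: "x \<in> carrier MK" and c: "c \<in> carrier Z3"
    note e = linear_map_closed[OF evaluation_linear(2)[OF z] c]
    have "fst (aug_map K MK f Z3 (tens K MK Z3 x c)) xs = f x \<odot>\<^bsub>L\<^esub> fst c xs"
      using contraction_tens[OF MK_mod Z3_mod f x c] linear_map_smult[OF evaluation_linear(2)[OF z] _ c] fc x by simp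
    then show "fst (aug_map K MK f Z3 (tens K MK Z3 x c)) xs =
      aug_map K S (f \<circ> \<rho>) L (tensor_map K MK Z3 S L i (\<lambda>c. fst c xs) (tens K MK Z3 x c))"
      using x c e by (simp add: tensor_map_tens[OF MK_mod Z3_mod S_mod L_module i evaluation_linear(2)[OF z]]
        contraction_tens[OF S_mod L_module fr] \<rho>_i)
  qed
qed

lemma obstruction_contraction:
  assumes rep: "represents_obstruction K A L \<mu> MK S i (m, \<nu>, b) \<Theta>" and f: "functional K MK f"
  shows "aug_map K MK f Z3 \<Theta> = lift_theta f m \<nu> b"
proof (rule extensional_pair_eqI)
  have \<Theta>: "\<Theta> \<in> carrier (tensor K MK Z3)" using rep by (simp add: represents_obstruction_iff)
  have "aug_map K MK f Z3 \<Theta> \<in> carrier (cochains K A L 3)"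
    using cocycle_is_cochain linear_map_closed[OF contraction_linear[OF MK_mod Z3_mod f] \<Theta>] by blast
  then show "fst (aug_map K MK f Z3 \<Theta>) \<in> extensional (args0 L 3)" "snd (aug_map K MK f Z3 \<Theta>) \<in> extensional (args1 A L 3)"
    by (auto simp: cochains_carrier_iff PiE_def)
  show "fst (lift_theta f m \<nu> b) \<in> extensional (args0 L 3)" "snd (lift_theta f m \<nu> b) \<in> extensional (args1 A L 3)"
    by (simp_all add: defect_cochain_def cochain3_def)
  show "snd (aug_map K MK f Z3 \<Theta>) (xs, as) = snd (lift_theta f m \<nu> b) (xs, as)" if z: "(xs, as) \<in> args1 A L 3" for xs as
    using z rep unfolding contraction_evaluation(1)[OF f \<Theta> z] args_short_cases represents_obstruction_iff
    by (elim disjE exE conjE) (simp_all add: defect_cochain_values)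
  show "fst (aug_map K MK f Z3 \<Theta>) xs = fst (lift_theta f m \<nu> b) xs" if z: "xs \<in> args0 L 3" for xs
    using z rep unfolding contraction_evaluation(2)[OF f \<Theta> z] args_short_cases represents_obstruction_iff
    by (elim exE conjE) (simp add: defect_cochain_values)
qed

text \<open>An element of the kernel is the sum of its coordinates along \<open>eb\<close>. So a tensor whose cochains have
  these coordinates as values evaluates to the element itself.\<close>

lemma evaluate_coordinate_sum:
  fixes V :: "('k, 'v) module"
  assumes V: "module K V" and e: "linear_map K Z3 V e" and \<theta>: "\<And>j. j \<in> {1..d} \<Longrightarrow> \<theta> j \<in> carrier Z3"
    and X: "X \<in> carrier (tensor K S V)" "tensor_map K S V R V p (\<lambda>v. v) X = \<zero>\<^bsub>tensor K R V\<^esub>"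
    and v: "\<And>j. j \<in> {1..d} \<Longrightarrow> e (\<theta> j) = aug_map K S (\<phi> j \<circ> \<rho>) V X"
  shows "tensor_map K MK Z3 S V i e (\<Oplus>\<^bsub>tensor K MK Z3\<^esub>j\<in>{1..d}. tens K MK Z3 (eb j) (\<theta> j)) = X"
proof -
  interpret V: extension_tensor K R \<epsilon> M S i p q V by (rule extension_tensorI[OF V])
  note TZ = tensor_module[OF MK_mod Z3_mod]
  have tm: "tens K MK Z3 (eb j) (\<theta> j) \<in> carrier (tensor K MK Z3)" if "j \<in> {1..d}" for j
    using \<theta>[OF that] eb[OF that] MK_mod Z3_mod by simp
  have "tensor_map K MK Z3 S V i e (\<Oplus>\<^bsub>tensor K MK Z3\<^esub>j\<in>{1..d}. tens K MK Z3 (eb j) (\<theta> j)) =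
    (\<Oplus>\<^bsub>V.TS\<^esub>j\<in>{1..d}. tensor_map K MK Z3 S V i e (tens K MK Z3 (eb j) (\<theta> j)))"
    using tm by (intro linear_map_finsum[OF tensor_map_linear[OF MK_mod Z3_mod S_mod V i e] TZ V.TS_mod]) blast
  also have "\<dots> = (\<Oplus>\<^bsub>V.TS\<^esub>j\<in>{1..d}. tens K S V (i (eb j)) (aug_map K S (\<phi> j \<circ> \<rho>) V X))"
    using eb \<theta> v X(1) linear_map_closed[OF contraction_linear[OF S_mod V functional_\<rho>[OF \<phi>]]]
    by (intro V.TS.finsum_cong') (auto simp: tensor_map_tens[OF MK_mod Z3_mod S_mod V i e])
  also have "\<dots> = X" by (rule V.kernel_expansion[OF _ eb \<phi> expand X, symmetric]) auto
  finally show ?thesis .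
qed

text \<open>Each coordinate of the defects is a cocycle, so \<open>\<Theta>\<close> is the sum of these cocycles along the basis of
  \<open>M\<close>.\<close>

lemma obstruction_exists:
  assumes l: "is_lift m \<nu> b"
  shows "\<exists>\<Theta>. represents_obstruction K A L \<mu> MK S i (m, \<nu>, b) \<Theta>"
proof -
  interpret operation_triple K TA.TS TL.TS m \<nu> b by (rule lift_triples(2)[OF l])
  interpret TZ: module K "tensor K MK Z3" using MK_mod Z3_mod by simp
  let ?\<theta> = "\<lambda>j. lift_theta (\<phi> j) m \<nu> b"
  define \<Theta> where "\<Theta> = (\<Oplus>\<^bsub>tensor K MK Z3\<^esub>j\<in>{1..d}. tens K MK Z3 (eb j) (?\<theta> j))"
  have \<theta>: "?\<theta> j \<in> carrier Z3" if "j \<in> {1..d}" for j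
    using first_order_lift.theta_cocycle[OF lift_first_order[OF l \<phi>[OF that]]] .
  have \<Theta>: "\<Theta> \<in> carrier (tensor K MK Z3)"
    unfolding \<Theta>_def using \<theta> eb MK_mod Z3_mod by (intro TZ.finsum_closed) auto
  note ker = lift_defects_in_kernel[OF l]
  have evA: "tensor_map K MK Z3 S A i (\<lambda>c. snd c z) \<Theta> = X"
    if "z \<in> args1 A L 3" "X \<in> carrier TA.TS" "TA.proj X = \<zero>\<^bsub>TA.TR\<^esub>"
      "\<And>j. snd (?\<theta> j) z = aug_map K S (\<phi> j \<circ> \<rho>) A X" for z X
    unfolding \<Theta>_def
    by (rule evaluate_coordinate_sum[OF A_module evaluation_linear(1)[OF that(1)] \<theta> that(2,3)]) (simp_all add: that(4))
  have evL: "tensor_map K MK Z3 S L i (\<lambda>c. fst c xs) \<Theta> = X"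
    if "xs \<in> args0 L 3" "X \<in> carrier TL.TS" "TL.proj X = \<zero>\<^bsub>TL.TR\<^esub>"
      "\<And>j. fst (?\<theta> j) xs = aug_map K S (\<phi> j \<circ> \<rho>) L X" for xs X
    unfolding \<Theta>_def
    by (rule evaluate_coordinate_sum[OF L_module evaluation_linear(2)[OF that(1)] \<theta> that(2,3)]) (simp_all add: that(4))
  have "represents_obstruction K A L \<mu> MK S i (m, \<nu>, b) \<Theta>"
    unfolding represents_obstruction_iff
    by (intro conjI ballI \<Theta> evA evL) (simp_all add: short_args_mem ker defect_cochain_values)
  then show ?thesis by blast
qed

text \<open>The class of the defects of an arbitrary lift. Unlike \<^const>\<open>obstruction_class\<close>, it refers neither
  to bases nor to the components of the deformation.\<close>

definition is_obstruction_class where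
  "is_obstruction_class t \<longleftrightarrow> (\<exists>m \<nu> b \<Theta>. is_lift m \<nu> b \<and> represents_obstruction K A L \<mu> MK S i (m, \<nu>, b) \<Theta> \<and>
     t = tensor_map K MK Z3 MK H3 (\<lambda>x. x) (cohomology_class K A L \<mu> 3) \<Theta>)"

lemma class_coordinates:
  assumes t: "t \<in> carrier (tensor K MK H3)"
  shows "t = (\<Oplus>\<^bsub>tensor K MK H3\<^esub>j\<in>{1..d}. tens K MK H3 (eb j) (aug_map K MK (\<phi> j) H3 t))"
proof -
  have "tensor_map K MK H3 MK H3 (\<lambda>x. x) (\<lambda>x. x) t = t"
    by (rule linear_map_tensor_eqI[OF MK_mod H3_mod tensor_map_linear[OF MK_mod H3_mod MK_mod H3_mod linear_map_ident linear_map_ident]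
      linear_map_ident _ t]) (simp add: tensor_map_tens[OF MK_mod H3_mod MK_mod H3_mod linear_map_ident linear_map_ident])
  moreover have "tensor_map K MK H3 MK H3 (\<lambda>x. x) (\<lambda>x. x) t =
      (\<Oplus>\<^bsub>tensor K MK H3\<^esub>j\<in>{1..d}. tens K MK H3 (eb j) (aug_map K MK (\<phi> j) H3 t))"
    using eb \<phi> expand by (intro tensor_map_expansion[OF MK_mod MK_mod H3_mod linear_map_ident _ _ _ _ t]) auto
  ultimately show ?thesis by simp
qed

lemma class_contraction:
  assumes f: "functional K MK f" and \<Theta>: "\<Theta> \<in> carrier (tensor K MK Z3)"
  shows "aug_map K MK f H3 (tensor_map K MK Z3 MK H3 (\<lambda>x. x) (cohomology_class K A L \<mu> 3) \<Theta>) =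
    cohomology_class K A L \<mu> 3 (aug_map K MK f Z3 \<Theta>)"
proof (rule linear_map_tensor_eqI[OF MK_mod Z3_mod _ _ _ \<Theta>])
  note cl = cohomology_class_linear
  note tm = tensor_map_linear[OF MK_mod Z3_mod MK_mod H3_mod linear_map_ident cl]
    tensor_map_tens[OF MK_mod Z3_mod MK_mod H3_mod linear_map_ident cl]
  show "linear_map K (tensor K MK Z3) H3
     (\<lambda>\<Theta>. aug_map K MK f H3 (tensor_map K MK Z3 MK H3 (\<lambda>x. x) (cohomology_class K A L \<mu> 3) \<Theta>))"
    by (rule linear_map_comp[OF tm(1) contraction_linear[OF MK_mod H3_mod f]])
  show "linear_map K (tensor K MK Z3) H3 (\<lambda>\<Theta>. cohomology_class K A L \<mu> 3 (aug_map K MK f Z3 \<Theta>))"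
    by (rule linear_map_comp[OF contraction_linear[OF MK_mod Z3_mod f] cl])
  fix x c assume x: "x \<in> carrier MK" and c: "c \<in> carrier Z3"
  then show "aug_map K MK f H3 (tensor_map K MK Z3 MK H3 (\<lambda>x. x) (cohomology_class K A L \<mu> 3) (tens K MK Z3 x c)) =
      cohomology_class K A L \<mu> 3 (aug_map K MK f Z3 (tens K MK Z3 x c))"
    using functionalD(1)[OF f x] linear_map_closed[OF cl c]
    by (simp add: tm(2) contraction_tens[OF MK_mod H3_mod f] contraction_tens[OF MK_mod Z3_mod f] linear_map_smult[OF cl])
qed

lemma obstruction_class_closed:
  assumes "is_obstruction_class t"
  shows "t \<in> carrier (tensor K MK H3)"
proof -
  obtain m \<nu> b \<Theta> where "represents_obstruction K A L \<mu> MK S i (m, \<nu>, b) \<Theta>"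
    "t = tensor_map K MK Z3 MK H3 (\<lambda>x. x) (cohomology_class K A L \<mu> 3) \<Theta>"
    using assms unfolding is_obstruction_class_def by blast
  then show ?thesis
    using linear_map_closed[OF tensor_map_linear[OF MK_mod Z3_mod MK_mod H3_mod linear_map_ident cohomology_class_linear]]
    by (simp add: represents_obstruction_iff)
qed

text \<open>The defect cochains of two lifts differ by a coboundary, so the coordinates of the class can be
  computed from any lift.\<close>

lemma obstruction_class_coordinate:
  assumes t: "is_obstruction_class t" and l: "is_lift m \<nu> b" and f: "functional K MK f"
  shows "aug_map K MK f H3 t = cohomology_class K A L \<mu> 3 (lift_theta f m \<nu> b)"
proof -
  obtain m' \<nu>' b' \<Theta> where l': "is_lift m' \<nu>' b'" and rep: "represents_obstruction K A L \<mu> MK S i (m', \<nu>', b') \<Theta>"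
    and t: "t = tensor_map K MK Z3 MK H3 (\<lambda>x. x) (cohomology_class K A L \<mu> 3) \<Theta>"
    using t unfolding is_obstruction_class_def by blast
  have \<Theta>: "\<Theta> \<in> carrier (tensor K MK Z3)" using rep by (simp add: represents_obstruction_iff)
  interpret first_order_lifts K A L \<mu> TA.TS TL.TS "aug_map K S \<epsilon>S A" "aug_map K S \<epsilon>S L"
    "aug_map K S (f \<circ> \<rho>) A" "aug_map K S (f \<circ> \<rho>) L" jA jL kerA kerL m' \<nu>' b' m \<nu> b
    by (rule lifts_first_order[OF l' l f])
  have D: "total_cobdry A L \<mu> 2 difference \<in> carrier Z3" using d2_cocycle[OF difference_closed] .
  have DB: "total_cobdry A L \<mu> 2 difference \<in> coboundaries K A L \<mu> 3"
    using difference_closed by (simp add: coboundaries_def)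
  interpret H: module K H3 by (rule H3_mod)
  have "aug_map K MK f H3 t = cohomology_class K A L \<mu> 3 theta"
    unfolding t class_contraction[OF f \<Theta>] obstruction_contraction[OF rep f] ..
  also have "theta = l'.theta \<oplus>\<^bsub>Z3\<^esub> total_cobdry A L \<mu> 2 difference"
    using theta_difference by (simp add: cocycles_def)
  also have "cohomology_class K A L \<mu> 3 \<dots> = cohomology_class K A L \<mu> 3 l'.theta"
    using linear_map_add[OF cohomology_class_linear l'.theta_cocycle D] cohomology_class_zero_iff[OF D] DB
      linear_map_closed[OF cohomology_class_linear l'.theta_cocycle] by simp
  finally show ?thesis .
qed

lemma obstruction_class_unique:
  assumes t: "is_obstruction_class t" and t': "is_obstruction_class t'"
  shows "t = t'"
proof -
  obtain m \<nu> b where l: "is_lift m \<nu> b" using t unfolding is_obstruction_class_def by blast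
  interpret TH: module K "tensor K MK H3" using MK_mod H3_mod by simp
  have "aug_map K MK (\<phi> j) H3 t = aug_map K MK (\<phi> j) H3 t'" if "j \<in> {1..d}" for j
    using obstruction_class_coordinate[OF t l \<phi>[OF that]] obstruction_class_coordinate[OF t' l \<phi>[OF that]] by simp
  then have "(\<Oplus>\<^bsub>tensor K MK H3\<^esub>j\<in>{1..d}. tens K MK H3 (eb j) (aug_map K MK (\<phi> j) H3 t)) =
      (\<Oplus>\<^bsub>tensor K MK H3\<^esub>j\<in>{1..d}. tens K MK H3 (eb j) (aug_map K MK (\<phi> j) H3 t'))"
    using eb \<phi> MK_mod H3_mod linear_map_closed[OF contraction_linear[OF MK_mod H3_mod \<phi>] obstruction_class_closed[OF t']]
    by (intro TH.finsum_cong') auto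
  then show ?thesis
    using class_coordinates[OF obstruction_class_closed[OF t]] class_coordinates[OF obstruction_class_closed[OF t']] by simp
qed

text \<open>An element of \<open>M \<otimes> H\<^sup>3\<close> vanishes iff its coordinates along \<open>eb\<close> do.\<close>

lemma obstruction_class_zero_iff:
  assumes t: "is_obstruction_class t" and l: "is_lift m \<nu> b"
  shows "t = \<zero>\<^bsub>tensor K MK H3\<^esub> \<longleftrightarrow> (\<forall>j\<in>{1..d}. lift_theta (\<phi> j) m \<nu> b \<in> coboundaries K A L \<mu> 3)"
proof -
  interpret TH: module K "tensor K MK H3" using MK_mod H3_mod by simp
  have iff: "lift_theta (\<phi> j) m \<nu> b \<in> coboundaries K A L \<mu> 3 \<longleftrightarrow> aug_map K MK (\<phi> j) H3 t = \<zero>\<^bsub>H3\<^esub>" if "j \<in> {1..d}" for j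
    using obstruction_class_coordinate[OF t l \<phi>[OF that]]
      cohomology_class_zero_iff[OF first_order_lift.theta_cocycle[OF lift_first_order[OF l \<phi>[OF that]]]] by simp
  show ?thesis
  proof
    assume "t = \<zero>\<^bsub>tensor K MK H3\<^esub>"
    then show "\<forall>j\<in>{1..d}. lift_theta (\<phi> j) m \<nu> b \<in> coboundaries K A L \<mu> 3"
      using iff linear_map_zero[OF contraction_linear[OF MK_mod H3_mod \<phi>] TH.module_axioms H3_mod] by simp
  next
    assume "\<forall>j\<in>{1..d}. lift_theta (\<phi> j) m \<nu> b \<in> coboundaries K A L \<mu> 3"
    then have "(\<Oplus>\<^bsub>tensor K MK H3\<^esub>j\<in>{1..d}. tens K MK H3 (eb j) (aug_map K MK (\<phi> j) H3 t)) =
        (\<Oplus>\<^bsub>tensor K MK H3\<^esub>j\<in>{1..d}. \<zero>\<^bsub>tensor K MK H3\<^esub>)"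
      using iff eb bilinear_zero(2)[OF tens_bilinear[OF MK_mod H3_mod] MK_mod H3_mod TH.module_axioms]
      by (intro TH.finsum_cong') auto
    then show "t = \<zero>\<^bsub>tensor K MK H3\<^esub>"
      using class_coordinates[OF obstruction_class_closed[OF t]] by simp
  qed
qed

end

context square_zero_extension
begin

text \<open>Elements \<open>s\<close> of \<open>S\<close> act on \<open>i(x) \<otimes> w\<close> through \<open>\<epsilon>(p(s))\<close>.\<close>

lemma kernel_term_linear:
  fixes U :: "('k, 'u) module" and W :: "('k, 'w) module"
  assumes U: "module K U" and W: "module K W" and g: "linear_map K U W g" and x: "x \<in> carrier M"
  shows "linear_map S (extend_scalars K S U) (extend_scalars K S W) (\<lambda>X. tens K S W (i x) (g (aug_map K S \<epsilon>S U X)))"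
proof -
  interpret U: extension_tensor K R \<epsilon> M S i p q U by (rule extension_tensorI[OF U])
  interpret W: extension_tensor K R \<epsilon> M S i p q W by (rule extension_tensorI[OF W])
  have lin: "linear_map K U.TS W.TS (\<lambda>X. tens K S W (i x) (g (aug_map K S \<epsilon>S U X)))"
    using x by (intro linear_map_comp[OF linear_map_comp[OF U.augS_lin g] bilinear_mapD(1)[OF W.tensS]]) simp
  have aug: "aug_map K S \<epsilon>S U (s \<odot>\<^bsub>U.ES\<^esub> X) = \<epsilon>S s \<odot>\<^bsub>U\<^esub> aug_map K S \<epsilon>S U X"
    if s: "s \<in> carrier S" and X: "X \<in> carrier U.TS" for s X
  proof (rule linear_map_tensor_eqI[OF S_mod U linear_map_comp[OF U.smult_lin[OF s] U.augS_lin]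
        linear_map_scale[OF U.augS_lin U.TS_mod U] _ X])
    show "\<epsilon>S s \<in> carrier K" using s by simp
    fix s' u assume s': "s' \<in> carrier S" and u: "u \<in> carrier U"
    have "\<epsilon> (p s \<otimes>\<^bsub>R\<^esub> p s') = \<epsilon> (p s) \<otimes>\<^bsub>K\<^esub> \<epsilon> (p s')"
      using aug s s' by (simp add: augmentation_def ring_hom_def)
    then show "aug_map K S \<epsilon>S U (s \<odot>\<^bsub>U.ES\<^esub> tens K S U s' u) = \<epsilon>S s \<odot>\<^bsub>U\<^esub> aug_map K S \<epsilon>S U (tens K S U s' u)"
      using s s' u by (simp add: U.smult_tens U.augS_tens p_mult U.V.smult_assoc1)
  qed
  show ?thesis
  proof (rule linear_mapI)
    fix s X assume s: "s \<in> carrier S" and X: "X \<in> carrier U.ES"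
    let ?w = "g (aug_map K S \<epsilon>S U X)"
    have w: "?w \<in> carrier W" using linear_map_closed[OF g] X by simp
    have "tens K S W (i x) (g (aug_map K S \<epsilon>S U (s \<odot>\<^bsub>U.ES\<^esub> X))) = \<epsilon>S s \<odot>\<^bsub>W.TS\<^esub> tens K S W (i x) ?w"
      using s X x w by (simp add: aug linear_map_smult[OF g] bilinear_smult(2)[OF W.tensS])
    also have "\<dots> = s \<odot>\<^bsub>W.ES\<^esub> tens K S W (i x) ?w"
      using W.smult_incl[OF s, of "tens K MK W x ?w"] x w by (simp add: W.incl_tens)
    finally show "tens K S W (i x) (g (aug_map K S \<epsilon>S U (s \<odot>\<^bsub>U.ES\<^esub> X))) = s \<odot>\<^bsub>W.ES\<^esub> tens K S W (i x) ?w" .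
  qed (use linear_map_closed[OF lin] linear_map_add[OF lin] in simp_all)
qed

text \<open>An operation with values in the kernel that only depends on the reductions of its arguments: it
  changes a lift without changing the reduction to \<open>R\<close>.\<close>

definition correction ::
  "('k, 'u) module \<Rightarrow> ('k, 'v) module \<Rightarrow> ('k, 'w) module \<Rightarrow> nat set \<Rightarrow> (nat \<Rightarrow> 'm)
    \<Rightarrow> (nat \<Rightarrow> 'u \<Rightarrow> 'v \<Rightarrow> 'w) \<Rightarrow> ('s \<times> 'u \<Rightarrow> 'k) set \<Rightarrow> ('s \<times> 'v \<Rightarrow> 'k) set \<Rightarrow> ('s \<times> 'w \<Rightarrow> 'k) set" where
  "correction U V W J eb \<gamma> X Y = (\<Oplus>\<^bsub>tensor K S W\<^esub>j\<in>J.
     tens K S W (i (eb j)) (\<gamma> j (aug_map K S \<epsilon>S U X) (aug_map K S \<epsilon>S V Y)))"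

lemma correction:
  fixes U :: "('k, 'u) module" and V :: "('k, 'v) module" and W :: "('k, 'w) module"
  assumes U: "module K U" and V: "module K V" and W: "module K W"
    and eb: "\<And>j. j \<in> J \<Longrightarrow> eb j \<in> carrier M" and \<gamma>: "\<And>j. j \<in> J \<Longrightarrow> bilinear_map K U V W (\<gamma> j)"
  shows correction_bilinear:
      "bilinear_map S (extend_scalars K S U) (extend_scalars K S V) (extend_scalars K S W) (correction U V W J eb \<gamma>)"
    and correction_proj: "\<lbrakk>X \<in> carrier (tensor K S U); Y \<in> carrier (tensor K S V)\<rbrakk> \<Longrightarrow>
      tensor_map K S W R W p (\<lambda>v. v) (correction U V W J eb \<gamma> X Y) = \<zero>\<^bsub>tensor K R W\<^esub>"
    and correction_contraction: "\<lbrakk>functional K MK f; X \<in> carrier (tensor K S U); Y \<in> carrier (tensor K S V)\<rbrakk> \<Longrightarrow>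
      aug_map K S (f \<circ> \<rho>) W (correction U V W J eb \<gamma> X Y) =
      (\<Oplus>\<^bsub>W\<^esub>j\<in>J. f (eb j) \<odot>\<^bsub>W\<^esub> \<gamma> j (aug_map K S \<epsilon>S U X) (aug_map K S \<epsilon>S V Y))"
proof -
  interpret U: extension_tensor K R \<epsilon> M S i p q U by (rule extension_tensorI[OF U])
  interpret V: extension_tensor K R \<epsilon> M S i p q V by (rule extension_tensorI[OF V])
  interpret W: extension_tensor K R \<epsilon> M S i p q W by (rule extension_tensorI[OF W])
  show "bilinear_map S U.ES V.ES W.ES (correction U V W J eb \<gamma>)"
  proof (rule bilinear_mapI)
    fix X assume X: "X \<in> carrier U.ES"
    have "linear_map S V.ES W.ES (\<lambda>Y. \<Oplus>\<^bsub>W.ES\<^esub>j\<in>J. tens K S W (i (eb j)) (\<gamma> j (aug_map K S \<epsilon>S U X) (aug_map K S \<epsilon>S V Y)))"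
    proof (intro linear_map_fsum V.ES_mod W.ES_mod)
      fix j assume j: "j \<in> J"
      show "linear_map S V.ES W.ES (\<lambda>Y. tens K S W (i (eb j)) (\<gamma> j (aug_map K S \<epsilon>S U X) (aug_map K S \<epsilon>S V Y)))"
        using kernel_term_linear[OF V W bilinear_mapD(1)[OF \<gamma>[OF j], of "aug_map K S \<epsilon>S U X"] eb[OF j]] X by simp
    qed
    then show "linear_map S V.ES W.ES (correction U V W J eb \<gamma> X)"
      by (simp add: correction_def[abs_def])
  next
    fix Y assume Y: "Y \<in> carrier V.ES"
    have "linear_map S U.ES W.ES (\<lambda>X. \<Oplus>\<^bsub>W.ES\<^esub>j\<in>J. tens K S W (i (eb j)) (\<gamma> j (aug_map K S \<epsilon>S U X) (aug_map K S \<epsilon>S V Y)))"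
    proof (intro linear_map_fsum U.ES_mod W.ES_mod)
      fix j assume j: "j \<in> J"
      show "linear_map S U.ES W.ES (\<lambda>X. tens K S W (i (eb j)) (\<gamma> j (aug_map K S \<epsilon>S U X) (aug_map K S \<epsilon>S V Y)))"
        using kernel_term_linear[OF U W bilinear_mapD(2)[OF \<gamma>[OF j], of "aug_map K S \<epsilon>S V Y"] eb[OF j]] Y by simp
    qed
    then show "linear_map S U.ES W.ES (\<lambda>X. correction U V W J eb \<gamma> X Y)"
      by (simp add: correction_def)
  qed
  have cl: "\<gamma> j (aug_map K S \<epsilon>S U X) (aug_map K S \<epsilon>S V Y) \<in> carrier W"
    if "j \<in> J" "X \<in> carrier U.TS" "Y \<in> carrier V.TS" for j X Y
    using bilinear_closed[OF \<gamma>[OF that(1)]] that by simp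
  show "W.proj (correction U V W J eb \<gamma> X Y) = \<zero>\<^bsub>W.TR\<^esub>" if X: "X \<in> carrier U.TS" and Y: "Y \<in> carrier V.TS" for X Y
  proof -
    have "W.proj (correction U V W J eb \<gamma> X Y) =
      (\<Oplus>\<^bsub>W.TR\<^esub>j\<in>J. W.proj (tens K S W (i (eb j)) (\<gamma> j (aug_map K S \<epsilon>S U X) (aug_map K S \<epsilon>S V Y))))"
      unfolding correction_def using cl[OF _ X Y] eb by (intro linear_map_finsum[OF W.proj_lin W.TS_mod W.TR_mod]) auto
    also have "\<dots> = (\<Oplus>\<^bsub>W.TR\<^esub>j\<in>J. \<zero>\<^bsub>W.TR\<^esub>)"
      using cl[OF _ X Y] eb by (intro W.TR.finsum_cong') (auto simp: W.proj_tens bilinear_zero[OF W.tensR R_mod W W.TR_mod])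
    finally show ?thesis by simp
  qed
  show "aug_map K S (f \<circ> \<rho>) W (correction U V W J eb \<gamma> X Y) =
      (\<Oplus>\<^bsub>W\<^esub>j\<in>J. f (eb j) \<odot>\<^bsub>W\<^esub> \<gamma> j (aug_map K S \<epsilon>S U X) (aug_map K S \<epsilon>S V Y))"
    if f: "functional K MK f" and X: "X \<in> carrier U.TS" and Y: "Y \<in> carrier V.TS" for f X Y
  proof -
    note fr = functional_\<rho>[OF f]
    have fc: "f x \<in> carrier K" if "x \<in> carrier M" for x using functionalD(1)[OF f] that by simp
    have "aug_map K S (f \<circ> \<rho>) W (correction U V W J eb \<gamma> X Y) =
      (\<Oplus>\<^bsub>W\<^esub>j\<in>J. aug_map K S (f \<circ> \<rho>) W (tens K S W (i (eb j)) (\<gamma> j (aug_map K S \<epsilon>S U X) (aug_map K S \<epsilon>S V Y))))"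
      unfolding correction_def using cl[OF _ X Y] eb
      by (intro linear_map_finsum[OF contraction_linear[OF S_mod W fr] W.TS_mod W]) auto
    also have "\<dots> = (\<Oplus>\<^bsub>W\<^esub>j\<in>J. f (eb j) \<odot>\<^bsub>W\<^esub> \<gamma> j (aug_map K S \<epsilon>S U X) (aug_map K S \<epsilon>S V Y))"
      using cl[OF _ X Y] eb fc by (intro W.V.finsum_cong') (auto simp: contraction_tens[OF S_mod W fr] \<rho>_i)
    finally show ?thesis .
  qed
qed

end

context lifting_problem
begin

text \<open>The operations over \<open>R\<close> are \<open>R\<close>-bilinear, so the defining equations of the push-out amount to those
  with \<open>r = s = 1\<close>, which say that the operations over \<open>S\<close> reduce to those over \<open>R\<close>.\<close>

lemma deformation_push_out_iff:
  "deformation K S \<epsilon>S A L \<mu> (m, \<nu>, b) \<and> is_push_out K S R p A L (m, \<nu>, b) (mR, \<nu>R, bR) \<longleftrightarrow>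
   is_lift m \<nu> b \<and> no_defects TA.TS TL.TS m \<nu> b"
proof
  assume *: "deformation K S \<epsilon>S A L \<mu> (m, \<nu>, b) \<and> is_push_out K S R p A L (m, \<nu>, b) (mR, \<nu>R, bR)"
  note def = conjunct1[OF *, unfolded deformation_iff[OF S_alg \<epsilon>S_fun]]
  interpret operation_triple K TA.TS TL.TS m \<nu> b
    using def by (intro extension_tripleI(2)[OF S_alg A_module L_module]) simp_all
  interpret RA: module R "extend_scalars K R A" by (rule extend_scalars_module[OF R_alg A_module])
  interpret RL: module R "extend_scalars K R L" by (rule extend_scalars_module[OF R_alg L_module])
  have oneA: "\<one>\<^bsub>R\<^esub> \<odot>\<^bsub>extend_scalars K R A\<^esub> u = u" if "u \<in> carrier TA.TR" for u
    using RA.smult_one that by simp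
  have oneL: "\<one>\<^bsub>R\<^esub> \<odot>\<^bsub>extend_scalars K R L\<^esub> u = u" if "u \<in> carrier TL.TR" for u
    using RL.smult_one that by simp
  have "mR (TA.proj u) (TA.proj v) = TA.proj (m u v)" if "u \<in> carrier TA.TS" "v \<in> carrier TA.TS" for u v
  proof -
    have "mR (\<one>\<^bsub>R\<^esub> \<odot>\<^bsub>extend_scalars K R A\<^esub> TA.proj u) (\<one>\<^bsub>R\<^esub> \<odot>\<^bsub>extend_scalars K R A\<^esub> TA.proj v) =
      (\<one>\<^bsub>R\<^esub> \<otimes>\<^bsub>R\<^esub> \<one>\<^bsub>R\<^esub>) \<odot>\<^bsub>extend_scalars K R A\<^esub> TA.proj (m u v)"
      using conjunct2[OF *] that unfolding is_push_out_def prod.case Let_def by blast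
    then show ?thesis using that by (simp add: oneA)
  qed
  moreover have "\<nu>R (TL.proj u) (TA.proj v) = TA.proj (\<nu> u v)" if "u \<in> carrier TL.TS" "v \<in> carrier TA.TS" for u v
  proof -
    have "\<nu>R (\<one>\<^bsub>R\<^esub> \<odot>\<^bsub>extend_scalars K R L\<^esub> TL.proj u) (\<one>\<^bsub>R\<^esub> \<odot>\<^bsub>extend_scalars K R A\<^esub> TA.proj v) =
      (\<one>\<^bsub>R\<^esub> \<otimes>\<^bsub>R\<^esub> \<one>\<^bsub>R\<^esub>) \<odot>\<^bsub>extend_scalars K R A\<^esub> TA.proj (\<nu> u v)"
      using conjunct2[OF *] that unfolding is_push_out_def prod.case Let_def by blast
    then show ?thesis using that by (simp add: oneA oneL)
  qed
  moreover have "bR (TL.proj u) (TL.proj v) = TL.proj (b u v)" if "u \<in> carrier TL.TS" "v \<in> carrier TL.TS" for u v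
  proof -
    have "bR (\<one>\<^bsub>R\<^esub> \<odot>\<^bsub>extend_scalars K R L\<^esub> TL.proj u) (\<one>\<^bsub>R\<^esub> \<odot>\<^bsub>extend_scalars K R L\<^esub> TL.proj v) =
      (\<one>\<^bsub>R\<^esub> \<otimes>\<^bsub>R\<^esub> \<one>\<^bsub>R\<^esub>) \<odot>\<^bsub>extend_scalars K R L\<^esub> TL.proj (b u v)"
      using conjunct2[OF *] that unfolding is_push_out_def prod.case Let_def by blast
    then show ?thesis using that by (simp add: oneL)
  qed
  ultimately show "is_lift m \<nu> b \<and> no_defects TA.TS TL.TS m \<nu> b"
    using def by (simp add: is_lift_def)
next
  assume *: "is_lift m \<nu> b \<and> no_defects TA.TS TL.TS m \<nu> b"
  then have l: "is_lift m \<nu> b" and nd: "no_defects TA.TS TL.TS m \<nu> b" by simp_all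
  interpret operation_triple K TA.TS TL.TS m \<nu> b by (rule lift_triples(2)[OF l])
  interpret RA: module R "extend_scalars K R A" by (rule extend_scalars_module[OF R_alg A_module])
  interpret RL: module R "extend_scalars K R L" by (rule extend_scalars_module[OF R_alg L_module])
  have closed: "r \<odot>\<^bsub>extend_scalars K R A\<^esub> u \<in> carrier TA.TR" if "r \<in> carrier R" "u \<in> carrier TA.TR" for r u
    using RA.smult_closed that by simp
  have closedL: "r \<odot>\<^bsub>extend_scalars K R L\<^esub> u \<in> carrier TL.TR" if "r \<in> carrier R" "u \<in> carrier TL.TR" for r u
    using RL.smult_closed that by simp
  have assocA: "(r \<otimes>\<^bsub>R\<^esub> s) \<odot>\<^bsub>extend_scalars K R A\<^esub> u = s \<odot>\<^bsub>extend_scalars K R A\<^esub> (r \<odot>\<^bsub>extend_scalars K R A\<^esub> u)"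
    if "r \<in> carrier R" "s \<in> carrier R" "u \<in> carrier TA.TR" for r s u
    using RA.smult_assoc1[of s r u] that by (simp add: R.m_comm)
  have assocL: "(r \<otimes>\<^bsub>R\<^esub> s) \<odot>\<^bsub>extend_scalars K R L\<^esub> u = s \<odot>\<^bsub>extend_scalars K R L\<^esub> (r \<odot>\<^bsub>extend_scalars K R L\<^esub> u)"
    if "r \<in> carrier R" "s \<in> carrier R" "u \<in> carrier TL.TR" for r s u
    using RL.smult_assoc1[of s r u] that by (simp add: R.m_comm)
  have "deformation K S \<epsilon>S A L \<mu> (m, \<nu>, b)"
    unfolding deformation_iff[OF S_alg \<epsilon>S_fun] using lift_bilinear[OF l] nd lift_aug[OF l] by simp
  moreover have "is_push_out K S R p A L (m, \<nu>, b) (mR, \<nu>R, bR)"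
    unfolding is_push_out_def prod.case Let_def
    using bilinear_smult[OF R_bilinear(1)] bilinear_smult[OF R_bilinear(2)] bilinear_smult[OF R_bilinear(3)]
    by (simp add: lift_proj[OF l] closed closedL assocA assocL)
  ultimately show "deformation K S \<epsilon>S A L \<mu> (m, \<nu>, b) \<and> is_push_out K S R p A L (m, \<nu>, b) (mR, \<nu>R, bR)" ..
qed

lemma no_defects_theta:
  assumes l: "is_lift m \<nu> b" and nd: "no_defects TA.TS TL.TS m \<nu> b" and f: "functional K MK f"
  shows "lift_theta f m \<nu> b = \<zero>\<^bsub>cochains K A L 3\<^esub>"
proof (rule cochain_eqI)
  note fr = functional_\<rho>[OF f]
  show "lift_theta f m \<nu> b \<in> carrier (cochains K A L 3)"
    using first_order_lift.theta_closed[OF lift_first_order[OF l f]] .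
  interpret C: module K "cochains K A L 3" by (rule cochains_module[OF A_module L_module])
  show "\<zero>\<^bsub>cochains K A L 3\<^esub> \<in> carrier (cochains K A L 3)" by simp
  note zero = linear_map_zero[OF contraction_linear[OF S_mod A_module fr] TA.TS_mod A_module]
    linear_map_zero[OF contraction_linear[OF S_mod L_module fr] TL.TS_mod L_module]
  show "snd (lift_theta f m \<nu> b) z = snd \<zero>\<^bsub>cochains K A L 3\<^esub> z" if z: "z \<in> args1 A L 3" for z
    using z nd unfolding cochains_eval(6)[OF z] no_defects_def
    by (cases z) (auto simp: args_short_cases defect_cochain_values zero)
  show "fst (lift_theta f m \<nu> b) xs = fst \<zero>\<^bsub>cochains K A L 3\<^esub> xs" if z: "xs \<in> args0 L 3" for xs
    using z nd unfolding cochains_eval(5)[OF z] no_defects_def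
    by (auto simp: args_short_cases defect_cochain_values zero)
qed

lemma kernel_eq_zeroI:
  fixes V :: "('k, 'v) module"
  assumes V: "module K V" and X: "X \<in> carrier (tensor K S V)" "tensor_map K S V R V p (\<lambda>v. v) X = \<zero>\<^bsub>tensor K R V\<^esub>"
    and c: "\<And>j. j \<in> {1..d} \<Longrightarrow> aug_map K S (\<phi> j \<circ> \<rho>) V X = \<zero>\<^bsub>V\<^esub>"
  shows "X = \<zero>\<^bsub>tensor K S V\<^esub>"
proof -
  interpret V: extension_tensor K R \<epsilon> M S i p q V by (rule extension_tensorI[OF V])
  have "X = (\<Oplus>\<^bsub>V.TS\<^esub>j\<in>{1..d}. tens K S V (i (eb j)) (aug_map K S (\<phi> j \<circ> \<rho>) V X))"
    by (rule V.kernel_expansion[OF _ eb \<phi> expand X]) auto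
  also have "\<dots> = (\<Oplus>\<^bsub>V.TS\<^esub>j\<in>{1..d}. \<zero>\<^bsub>V.TS\<^esub>)"
    using c eb bilinear_zero(2)[OF V.tensS S_mod V V.TS_mod] by (intro V.TS.finsum_cong') auto
  finally show ?thesis by simp
qed

text \<open>The defects are determined by their values at constant arguments \<open>1 \<otimes> v\<close>, and these values by their
  coordinates along \<open>eb\<close>.\<close>

lemma theta_zero_no_defects:
  assumes l: "is_lift m \<nu> b" and z: "\<And>j. j \<in> {1..d} \<Longrightarrow> lift_theta (\<phi> j) m \<nu> b = \<zero>\<^bsub>cochains K A L 3\<^esub>"
  shows "no_defects TA.TS TL.TS m \<nu> b"
proof -
  interpret operation_triple K TA.TS TL.TS m \<nu> b by (rule lift_triples(2)[OF l])
  note ker = lift_defects_in_kernel[OF l]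
  note A = kernel_eq_zeroI[OF A_module] and L = kernel_eq_zeroI[OF L_module]
  have v: "snd (lift_theta (\<phi> j) m \<nu> b) z = \<zero>\<^bsub>A\<^esub>" if "j \<in> {1..d}" "z \<in> args1 A L 3" for j z
    using z[OF that(1)] cochains_eval(6)[OF that(2)] by metis
  have w: "fst (lift_theta (\<phi> j) m \<nu> b) xs = \<zero>\<^bsub>L\<^esub>" if "j \<in> {1..d}" "xs \<in> args0 L 3" for j xs
    using z[OF that(1)] cochains_eval(5)[OF that(2)] by metis
  show ?thesis
    unfolding no_defects_def
  proof (intro conjI ballI)
    show "assoc_defect TA.TS m u v w = \<zero>\<^bsub>TA.TS\<^esub>"
      if "u \<in> carrier TA.TS" "v \<in> carrier TA.TS" "w \<in> carrier TA.TS" for u v w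
      using that v[OF _ short_args_mem(4)] ker(1)
      by (subst lift_defects_reduce(1)[OF l]; (intro A)?) (simp_all add: defect_cochain_values)
    show "derivation_defect TA.TS m \<nu> y u v = \<zero>\<^bsub>TA.TS\<^esub>"
      if "y \<in> carrier TL.TS" "u \<in> carrier TA.TS" "v \<in> carrier TA.TS" for y u v
      using that v[OF _ short_args_mem(5)] ker(2)
      by (subst lift_defects_reduce(2)[OF l]; (intro A)?) (simp_all add: defect_cochain_values)
    show "action_defect TA.TS \<nu> b y z u = \<zero>\<^bsub>TA.TS\<^esub>"
      if "y \<in> carrier TL.TS" "z \<in> carrier TL.TS" "u \<in> carrier TA.TS" for y z u
      using that v[OF _ short_args_mem(6)] ker(3)
      by (subst lift_defects_reduce(3)[OF l]; (intro A)?) (simp_all add: defect_cochain_values)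
    show "leibniz_defect TL.TS b x y z = \<zero>\<^bsub>TL.TS\<^esub>"
      if "x \<in> carrier TL.TS" "y \<in> carrier TL.TS" "z \<in> carrier TL.TS" for x y z
      using that w[OF _ short_args_mem(7)] ker(4)
      by (subst lift_defects_reduce(4)[OF l]; (intro L)?) (simp_all add: defect_cochain_values)
  qed
qed

lemma dual_family_sum:
  fixes W :: "('k, 'w) module"
  assumes W: "module K W" and j: "j \<in> {1..d}" and g: "\<And>k. k \<in> {1..d} \<Longrightarrow> g k \<in> carrier W"
  shows "(\<Oplus>\<^bsub>W\<^esub>k\<in>{1..d}. \<phi> j (eb k) \<odot>\<^bsub>W\<^esub> g k) = g j"
proof -
  interpret W: module K W by fact
  have "(\<Oplus>\<^bsub>W\<^esub>k\<in>{1..d}. \<phi> j (eb k) \<odot>\<^bsub>W\<^esub> g k) = (\<Oplus>\<^bsub>W\<^esub>k\<in>{1..d}. if j = k then g k else \<zero>\<^bsub>W\<^esub>)"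
    using g j by (intro W.finsum_cong') (auto simp: \<phi>_eb)
  then show ?thesis using W.finsum_singleton[OF j, of g] g by auto
qed

text \<open>Subtracting \<open>\<Sum> i(e\<^sub>j) c\<^sub>j\<close> from the operations changes their coordinate with index \<open>j\<close> by \<open>c j\<close>, as
  the \<open>\<phi> j\<close> are dual to the basis.\<close>

lemma lift_change:
  assumes l: "is_lift m \<nu> b" and c: "\<And>j. j \<in> {1..d} \<Longrightarrow> c j \<in> carrier (cochains K A L 2)"
  shows "\<exists>m' \<nu>' b'. is_lift m' \<nu>' b' \<and> (\<forall>j\<in>{1..d}.
     lift_theta (\<phi> j) m \<nu> b = lift_theta (\<phi> j) m' \<nu>' b' \<oplus>\<^bsub>cochains K A L 3\<^esub> total_cobdry A L \<mu> 2 (c j))"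
proof -
  note comps = cochain2_comp_bilinear[OF A_module L_module c]
  let ?J = "{1..d}"
  let ?cm = "correction A A A ?J eb (\<lambda>j. comp_A2 (c j))" and ?cn = "correction L A A ?J eb (\<lambda>j. comp_LA (c j))"
    and ?cb = "correction L L L ?J eb (\<lambda>j. comp_L2 (c j))"
  have cm1: "bilinear_map S TA.ES TA.ES TA.ES ?cm"
    by (rule correction_bilinear[OF A_module A_module A_module]) (use eb comps(1) in auto)
  have cm2: "TA.proj (?cm u v) = \<zero>\<^bsub>TA.TR\<^esub>" if "u \<in> carrier TA.TS" "v \<in> carrier TA.TS" for u v
    by (rule correction_proj[OF A_module A_module A_module _ _ that]) (use eb comps(1) in auto)
  have cm3: "aug_map K S (f \<circ> \<rho>) A (?cm u v) =
      (\<Oplus>\<^bsub>A\<^esub>j\<in>?J. f (eb j) \<odot>\<^bsub>A\<^esub> comp_A2 (c j) (aug_map K S \<epsilon>S A u) (aug_map K S \<epsilon>S A v))"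
    if "functional K MK f" "u \<in> carrier TA.TS" "v \<in> carrier TA.TS" for f u v
    by (rule correction_contraction[OF A_module A_module A_module _ _ that]) (use eb comps(1) in auto)
  have cn1: "bilinear_map S TL.ES TA.ES TA.ES ?cn"
    by (rule correction_bilinear[OF L_module A_module A_module]) (use eb comps(2) in auto)
  have cn2: "TA.proj (?cn u v) = \<zero>\<^bsub>TA.TR\<^esub>" if "u \<in> carrier TL.TS" "v \<in> carrier TA.TS" for u v
    by (rule correction_proj[OF L_module A_module A_module _ _ that]) (use eb comps(2) in auto)
  have cn3: "aug_map K S (f \<circ> \<rho>) A (?cn u v) =
      (\<Oplus>\<^bsub>A\<^esub>j\<in>?J. f (eb j) \<odot>\<^bsub>A\<^esub> comp_LA (c j) (aug_map K S \<epsilon>S L u) (aug_map K S \<epsilon>S A v))"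
    if "functional K MK f" "u \<in> carrier TL.TS" "v \<in> carrier TA.TS" for f u v
    by (rule correction_contraction[OF L_module A_module A_module _ _ that]) (use eb comps(2) in auto)
  have cb1: "bilinear_map S TL.ES TL.ES TL.ES ?cb"
    by (rule correction_bilinear[OF L_module L_module L_module]) (use eb comps(3) in auto)
  have cb2: "TL.proj (?cb u v) = \<zero>\<^bsub>TL.TR\<^esub>" if "u \<in> carrier TL.TS" "v \<in> carrier TL.TS" for u v
    by (rule correction_proj[OF L_module L_module L_module _ _ that]) (use eb comps(3) in auto)
  have cb3: "aug_map K S (f \<circ> \<rho>) L (?cb u v) =
      (\<Oplus>\<^bsub>L\<^esub>j\<in>?J. f (eb j) \<odot>\<^bsub>L\<^esub> comp_L2 (c j) (aug_map K S \<epsilon>S L u) (aug_map K S \<epsilon>S L v))"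
    if "functional K MK f" "u \<in> carrier TL.TS" "v \<in> carrier TL.TS" for f u v
    by (rule correction_contraction[OF L_module L_module L_module _ _ that]) (use eb comps(3) in auto)
  let ?m = "\<lambda>u v. m u v \<ominus>\<^bsub>TA.TS\<^esub> ?cm u v" and ?n = "\<lambda>u v. \<nu> u v \<ominus>\<^bsub>TA.TS\<^esub> ?cn u v"
    and ?b = "\<lambda>u v. b u v \<ominus>\<^bsub>TL.TS\<^esub> ?cb u v"
  interpret operation_triple K TA.TS TL.TS m \<nu> b by (rule lift_triples(2)[OF l])
  interpret C: operation_triple K TA.TS TL.TS ?cm ?cn ?cb
    by (rule extension_tripleI(2)[OF S_alg A_module L_module cm1 cn1 cb1])
  note sub = bilinear_map_sub[OF lift_bilinear(1)[OF l] cm1 TA.ES_mod TA.ES_mod TA.ES_mod]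
    bilinear_map_sub[OF lift_bilinear(2)[OF l] cn1 TL.ES_mod TA.ES_mod TA.ES_mod]
    bilinear_map_sub[OF lift_bilinear(3)[OF l] cb1 TL.ES_mod TL.ES_mod TL.ES_mod]
  note P = lift_proj[OF l] linear_map_diff[OF TA.proj_lin TA.TS_mod TA.TR_mod]
    linear_map_diff[OF TL.proj_lin TL.TS_mod TL.TR_mod] TA.TR.minus_eq_iff TL.TR.minus_eq_iff
  have l': "is_lift ?m ?n ?b"
    unfolding is_lift_def using sub[unfolded extend_scalars_ops] by (simp add: P cm2 cn2 cb2 del: One_nat_def)
  moreover have "lift_theta (\<phi> j) m \<nu> b = lift_theta (\<phi> j) ?m ?n ?b \<oplus>\<^bsub>cochains K A L 3\<^esub> total_cobdry A L \<mu> 2 (c j)"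
    if j: "j \<in> ?J" for j
  proof -
    interpret D: first_order_lifts K A L \<mu> TA.TS TL.TS "aug_map K S \<epsilon>S A" "aug_map K S \<epsilon>S L"
      "aug_map K S (\<phi> j \<circ> \<rho>) A" "aug_map K S (\<phi> j \<circ> \<rho>) L" jA jL kerA kerL m \<nu> b ?m ?n ?b
      by (rule lifts_first_order[OF l l' \<phi>[OF j]])
    have canA: "u \<ominus>\<^bsub>TA.TS\<^esub> (u \<ominus>\<^bsub>TA.TS\<^esub> v) = v" if "u \<in> carrier TA.TS" "v \<in> carrier TA.TS" for u v
      using that by (simp add: TA.TS.signed_sum_simps)
    have canL: "u \<ominus>\<^bsub>TL.TS\<^esub> (u \<ominus>\<^bsub>TL.TS\<^esub> v) = v" if "u \<in> carrier TL.TS" "v \<in> carrier TL.TS" for u v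
      using that by (simp add: TL.TS.signed_sum_simps)
    note aug' = TA.augS_tens[OF S.one_closed] TL.augS_tens[OF S.one_closed]
    have sum1: "(\<Oplus>\<^bsub>A\<^esub>k\<in>?J. \<phi> j (eb k) \<odot>\<^bsub>A\<^esub> comp_A2 (c k) a a') = comp_A2 (c j) a a'"
      if "a \<in> carrier A" "a' \<in> carrier A" for a a'
      by (rule dual_family_sum[OF A_module j]) (use bilinear_closed[OF comps(1)] that in blast)
    have sum2: "(\<Oplus>\<^bsub>A\<^esub>k\<in>?J. \<phi> j (eb k) \<odot>\<^bsub>A\<^esub> comp_LA (c k) x a) = comp_LA (c j) x a"
      if "a \<in> carrier A" "x \<in> carrier L" for a x
      by (rule dual_family_sum[OF A_module j]) (use bilinear_closed[OF comps(2)] that in blast)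
    have sum3: "(\<Oplus>\<^bsub>L\<^esub>k\<in>?J. \<phi> j (eb k) \<odot>\<^bsub>L\<^esub> comp_L2 (c k) x y) = comp_L2 (c j) x y"
      if "x \<in> carrier L" "y \<in> carrier L" for x y
      by (rule dual_family_sum[OF L_module j]) (use bilinear_closed[OF comps(3)] that in blast)
    note rules = cochain2_values difference_cochain_def canA canL aug' p_one \<epsilon>_one
      cm3[OF \<phi>[OF j]] cn3[OF \<phi>[OF j]] cb3[OF \<phi>[OF j]] sum1 sum2 sum3
    have "D.difference = c j"
    proof (rule cochain_eqI[OF D.difference_closed c[OF j]])
      fix xs assume "xs \<in> args0 L 2"
      then show "fst D.difference xs = fst (c j) xs"
        by (auto simp: args_short_cases rules simp flip: comp_L2_def[of "c j"] simp del: One_nat_def)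
    next
      fix z assume "z \<in> args1 A L 2"
      then show "snd D.difference z = snd (c j) z"
        by (cases z) (auto simp: args_short_cases rules simp flip: comp_A2_def[of "c j"] comp_LA_def[of "c j"] simp del: One_nat_def)
    qed
    then show ?thesis using D.theta_difference by simp
  qed
  ultimately show ?thesis by blast
qed

text \<open>If the class vanishes, the coordinates of the defects of a lift are coboundaries, which a change of
  the lift removes. Conversely, a deformation over \<open>S\<close> with the given push-out is a lift without
  defects.\<close>

lemma obstruction_class_zero_iff_liftable:
  assumes t: "is_obstruction_class t"
  shows "t = \<zero>\<^bsub>tensor K MK H3\<^esub> \<longleftrightarrow>
    (\<exists>\<Lambda>'. deformation K S \<epsilon>S A L \<mu> \<Lambda>' \<and> is_push_out K S R p A L \<Lambda>' (mR, \<nu>R, bR))"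
proof
  interpret C: module K "cochains K A L 3" by (rule cochains_module[OF A_module L_module])
  assume z: "t = \<zero>\<^bsub>tensor K MK H3\<^esub>"
  obtain m \<nu> b where l: "is_lift m \<nu> b" using t unfolding is_obstruction_class_def by blast
  have "\<forall>j\<in>{1..d}. \<exists>c\<in>carrier (cochains K A L 2). lift_theta (\<phi> j) m \<nu> b = total_cobdry A L \<mu> 2 c"
    using obstruction_class_zero_iff[OF t l] z by (auto simp: coboundaries_def)
  then obtain c where c: "\<And>j. j \<in> {1..d} \<Longrightarrow> c j \<in> carrier (cochains K A L 2)"
    "\<And>j. j \<in> {1..d} \<Longrightarrow> lift_theta (\<phi> j) m \<nu> b = total_cobdry A L \<mu> 2 (c j)" by metis
  obtain m' \<nu>' b' where l': "is_lift m' \<nu>' b'" and ch: "\<And>j. j \<in> {1..d} \<Longrightarrow>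
     lift_theta (\<phi> j) m \<nu> b = lift_theta (\<phi> j) m' \<nu>' b' \<oplus>\<^bsub>cochains K A L 3\<^esub> total_cobdry A L \<mu> 2 (c j)"
    using lift_change[OF l, of c] c(1) by blast
  have "lift_theta (\<phi> j) m' \<nu>' b' = \<zero>\<^bsub>cochains K A L 3\<^esub>" if j: "j \<in> {1..d}" for j
    using ch[OF j] c(2)[OF j] first_order_lift.theta_closed[OF lift_first_order[OF l \<phi>[OF j]]]
      first_order_lift.theta_closed[OF lift_first_order[OF l' \<phi>[OF j]]]
    by (metis C.add.r_cancel_one')
  then have "no_defects TA.TS TL.TS m' \<nu>' b'" by (rule theta_zero_no_defects[OF l'])
  then show "\<exists>\<Lambda>'. deformation K S \<epsilon>S A L \<mu> \<Lambda>' \<and> is_push_out K S R p A L \<Lambda>' (mR, \<nu>R, bR)"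
    using l' deformation_push_out_iff by blast
next
  assume "\<exists>\<Lambda>'. deformation K S \<epsilon>S A L \<mu> \<Lambda>' \<and> is_push_out K S R p A L \<Lambda>' (mR, \<nu>R, bR)"
  then obtain m \<nu> b where l: "is_lift m \<nu> b" "no_defects TA.TS TL.TS m \<nu> b"
    using deformation_push_out_iff by (metis prod_cases3)
  have "\<zero>\<^bsub>cochains K A L 3\<^esub> \<in> coboundaries K A L \<mu> 3"
    using subgroup.one_closed[OF submodule.axioms(1)[OF coboundaries_submodule]] by (simp add: cocycles_def)
  then show "t = \<zero>\<^bsub>tensor K MK H3\<^esub>"
    using obstruction_class_zero_iff[OF t l(1)] no_defects_theta[OF l \<phi>] by simp
qed

end

section \<open>Perturbed operations are lifts\<close>

text \<open>The map is the \<open>S\<close>-bilinear extension of its values at \<open>(1 \<otimes> u, 1 \<otimes> v)\<close>. Its definition lifts one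
  argument at a time to the tensor product, and \<open>S\<close>-linearity is checked on pure tensors.\<close>

lemma perturbed_map:
  fixes U :: "('k, 'u) module" and V :: "('k, 'v) module" and W :: "('k, 'w) module"
  assumes S: "algebra K S" and U: "module K U" and V: "module K V" and W: "module K W"
    and \<beta>0: "bilinear_map K U V W \<beta>0" and \<beta>: "\<And>j. j \<in> {1..N} \<Longrightarrow> bilinear_map K U V W (\<beta> j)"
    and n: "\<And>j. j \<in> {1..N} \<Longrightarrow> n j \<in> carrier S"
  shows perturbed_map_bilinear:
      "bilinear_map S (extend_scalars K S U) (extend_scalars K S V) (extend_scalars K S W)
         (perturbed_map K S U V W N n \<beta>0 \<beta>)"
    and perturbed_map_tens: "\<lbrakk>s1 \<in> carrier S; u \<in> carrier U; s2 \<in> carrier S; v \<in> carrier V\<rbrakk> \<Longrightarrow>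
      perturbed_map K S U V W N n \<beta>0 \<beta> (tens K S U s1 u) (tens K S V s2 v) =
      (s1 \<otimes>\<^bsub>S\<^esub> s2) \<odot>\<^bsub>extend_scalars K S W\<^esub> (tens K S W \<one>\<^bsub>S\<^esub> (\<beta>0 u v) \<oplus>\<^bsub>tensor K S W\<^esub>
        (\<Oplus>\<^bsub>tensor K S W\<^esub>j\<in>{1..N}. tens K S W (n j) (\<beta> j u v)))"
proof -
  interpret S: algebra K S by fact
  interpret U: module K U by fact
  interpret V: module K V by fact
  interpret W: module K W by fact
  have Sm: "module K S" using S by (rule algebra_moduleD)
  let ?TU = "tensor K S U" and ?TV = "tensor K S V" and ?TW = "tensor K S W"
  let ?EU = "extend_scalars K S U" and ?EV = "extend_scalars K S V" and ?EW = "extend_scalars K S W"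
  have TU: "module K ?TU" and TV: "module K ?TV" and TW: "module K ?TW" using Sm U V W by simp_all
  interpret TW: module K ?TW by (rule TW)
  interpret EW: module S ?EW by (rule extend_scalars_module[OF S W])
  note tW = tens_bilinear[OF Sm W]
  note smW = extend_scalars_smult_tens[OF S W] and smWl = extend_scalars_smult_linear[OF S W]
  define B where "B = (\<lambda>u v. tens K S W \<one>\<^bsub>S\<^esub> (\<beta>0 u v) \<oplus>\<^bsub>?TW\<^esub>
        (\<Oplus>\<^bsub>?TW\<^esub>j\<in>{1..N}. tens K S W (n j) (\<beta> j u v)))"
  define h where "h = (\<lambda>s1 u s2 v. tens K S W (s1 \<otimes>\<^bsub>S\<^esub> s2) (\<beta>0 u v) \<oplus>\<^bsub>?TW\<^esub>
        (\<Oplus>\<^bsub>?TW\<^esub>j\<in>{1..N}. tens K S W (s1 \<otimes>\<^bsub>S\<^esub> s2 \<otimes>\<^bsub>S\<^esub> n j) (\<beta> j u v)))"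
  have Bbil: "bilinear_map K U V ?TW B"
    unfolding B_def
  proof (intro bilinear_mapI linear_map_plus linear_map_fsum U V TW)
    fix u j assume u: "u \<in> carrier U"
    show "linear_map K V ?TW (\<lambda>v. tens K S W \<one>\<^bsub>S\<^esub> (\<beta>0 u v))"
      by (rule linear_map_comp[OF bilinear_mapD(1)[OF \<beta>0 u] bilinear_mapD(1)[OF tW S.one_closed]])
    show "linear_map K V ?TW (\<lambda>v. tens K S W (n j) (\<beta> j u v))" if j: "j \<in> {1..N}"
      by (rule linear_map_comp[OF bilinear_mapD(1)[OF \<beta>[OF j] u] bilinear_mapD(1)[OF tW n[OF j]]])
  next
    fix v j assume v: "v \<in> carrier V"
    show "linear_map K U ?TW (\<lambda>u. tens K S W \<one>\<^bsub>S\<^esub> (\<beta>0 u v))"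
      by (rule linear_map_comp[OF bilinear_mapD(2)[OF \<beta>0 v] bilinear_mapD(1)[OF tW S.one_closed]])
    show "linear_map K U ?TW (\<lambda>u. tens K S W (n j) (\<beta> j u v))" if j: "j \<in> {1..N}"
      by (rule linear_map_comp[OF bilinear_mapD(2)[OF \<beta>[OF j] v] bilinear_mapD(1)[OF tW n[OF j]]])
  qed
  have Bc: "B u v \<in> carrier ?TW" if "u \<in> carrier U" "v \<in> carrier V" for u v
    using bilinear_closed[OF Bbil that] .
  have cl: "\<beta>0 u v \<in> carrier W" "j \<in> {1..N} \<Longrightarrow> \<beta> j u v \<in> carrier W" if "u \<in> carrier U" "v \<in> carrier V" for u v j
    using bilinear_closed[OF \<beta>0 that] bilinear_closed[OF \<beta> that] by auto
  have h: "h s1 u s2 v = (s1 \<otimes>\<^bsub>S\<^esub> s2) \<odot>\<^bsub>?EW\<^esub> B u v"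
    if "s1 \<in> carrier S" "u \<in> carrier U" "s2 \<in> carrier S" "v \<in> carrier V" for s1 u s2 v
  proof -
    let ?s = "s1 \<otimes>\<^bsub>S\<^esub> s2"
    have s: "?s \<in> carrier S" using that by simp
    have t: "tens K S W (n j) (\<beta> j u v) \<in> carrier ?TW" if "j \<in> {1..N}" for j
      using n[OF that] cl(2)[OF \<open>u \<in> carrier U\<close> \<open>v \<in> carrier V\<close> that] Sm W by simp
    have "?s \<odot>\<^bsub>?EW\<^esub> B u v = ?s \<odot>\<^bsub>?EW\<^esub> tens K S W \<one>\<^bsub>S\<^esub> (\<beta>0 u v) \<oplus>\<^bsub>?TW\<^esub>
      ?s \<odot>\<^bsub>?EW\<^esub> (\<Oplus>\<^bsub>?TW\<^esub>j\<in>{1..N}. tens K S W (n j) (\<beta> j u v))"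
      unfolding B_def using s t cl(1) that Sm W
      by (intro linear_map_add[OF smWl] TW.finsum_closed) auto
    also have "?s \<odot>\<^bsub>?EW\<^esub> (\<Oplus>\<^bsub>?TW\<^esub>j\<in>{1..N}. tens K S W (n j) (\<beta> j u v)) =
      (\<Oplus>\<^bsub>?TW\<^esub>j\<in>{1..N}. ?s \<odot>\<^bsub>?EW\<^esub> tens K S W (n j) (\<beta> j u v))"
      using t by (intro linear_map_finsum[OF smWl[OF s] TW TW]) blast
    also have "\<dots> = (\<Oplus>\<^bsub>?TW\<^esub>j\<in>{1..N}. tens K S W (?s \<otimes>\<^bsub>S\<^esub> n j) (\<beta> j u v))"
      using s n cl(2)[OF that(2,4)] Sm W by (intro TW.finsum_cong') (auto simp: smW)
    finally show ?thesis unfolding h_def using s cl(1)[OF that(2,4)] by (simp add: smW)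
  qed
  have sm_assoc: "(c \<odot>\<^bsub>S\<^esub> s) \<odot>\<^bsub>?EW\<^esub> X = c \<odot>\<^bsub>?TW\<^esub> (s \<odot>\<^bsub>?EW\<^esub> X)"
    if "c \<in> carrier K" "s \<in> carrier S" "X \<in> carrier ?TW" for c s X
    using smult_one_tensor[OF S W that(1), of "s \<odot>\<^bsub>?EW\<^esub> X"] EW.smult_assoc1[of "c \<odot>\<^bsub>S\<^esub> \<one>\<^bsub>S\<^esub>" s X] that
      linear_map_closed[OF smWl[OF that(2)]]
    by (simp add: S.smult_assoc2)
  have sm_c: "s \<odot>\<^bsub>?EW\<^esub> X \<in> carrier ?TW" if "s \<in> carrier S" "X \<in> carrier ?TW" for s X
    using linear_map_closed[OF smWl[OF that(1)] that(2)] .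
  have hbil: "bilinear_map K S V ?TW (h s1 u)" if s1: "s1 \<in> carrier S" and u: "u \<in> carrier U" for s1 u
  proof (intro bilinear_mapI linear_mapI)
    fix s2 c v assume "s2 \<in> carrier S" "c \<in> carrier K" "v \<in> carrier V"
    then show "h s1 u s2 (c \<odot>\<^bsub>V\<^esub> v) = c \<odot>\<^bsub>?TW\<^esub> h s1 u s2 v"
      using s1 u by (simp add: h bilinear_smult[OF Bbil] linear_map_smult[OF smWl] Bc)
    show "h s1 u (c \<odot>\<^bsub>S\<^esub> s2) v = c \<odot>\<^bsub>?TW\<^esub> h s1 u s2 v"
      using s1 u \<open>s2 \<in> carrier S\<close> \<open>c \<in> carrier K\<close> \<open>v \<in> carrier V\<close>
      by (simp add: h Bc bilinear_smult[OF algebra_mult_bilinear[OF S]] sm_assoc)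
  qed (use s1 u in \<open>simp_all add: h Bc sm_c S.r_distr bilinear_add[OF Bbil] linear_map_add[OF smWl]
      EW.smult_l_distr[simplified]\<close>)
  define G where "G = (\<lambda>s1 u. tensor_lift K S V ?TW (h s1 u))"
  have Gl: "linear_map K ?TV ?TW (G s1 u)" if "s1 \<in> carrier S" "u \<in> carrier U" for s1 u
    unfolding G_def by (rule tensor_lift_linear[OF Sm V TW hbil[OF that]])
  have Gt: "G s1 u (tens K S V s2 v) = (s1 \<otimes>\<^bsub>S\<^esub> s2) \<odot>\<^bsub>?EW\<^esub> B u v"
    if "s1 \<in> carrier S" "u \<in> carrier U" "s2 \<in> carrier S" "v \<in> carrier V" for s1 u s2 v
    unfolding G_def using tensor_lift_tens[OF Sm V TW hbil[OF that(1,2)] that(3,4)] h[OF that] by simp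
  have Gbil: "bilinear_map K S U ?TW (\<lambda>s1 u. G s1 u Y)" if Y: "Y \<in> carrier ?TV" for Y
  proof (intro bilinear_mapI linear_mapI)
    fix s1 u assume s1: "s1 \<in> carrier S" and u: "u \<in> carrier U"
    show "G s1 u Y \<in> carrier ?TW" using linear_map_closed[OF Gl[OF s1 u] Y] .
    then show "G s1 u Y \<in> carrier ?TW" .
    fix u' assume u': "u' \<in> carrier U"
    show "G s1 (u \<oplus>\<^bsub>U\<^esub> u') Y = G s1 u Y \<oplus>\<^bsub>?TW\<^esub> G s1 u' Y"
      by (rule linear_map_tensor_eqI[OF Sm V Gl linear_map_plus[OF Gl Gl TV TW] _ Y])
        (use s1 u u' in \<open>simp_all add: Gt bilinear_add[OF Bbil] linear_map_add[OF smWl] Bc\<close>)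
  next
    fix s1 u s1' assume s1: "s1 \<in> carrier S" and u: "u \<in> carrier U" and s1': "s1' \<in> carrier S"
    show "G (s1 \<oplus>\<^bsub>S\<^esub> s1') u Y = G s1 u Y \<oplus>\<^bsub>?TW\<^esub> G s1' u Y"
      by (rule linear_map_tensor_eqI[OF Sm V Gl linear_map_plus[OF Gl Gl TV TW] _ Y])
        (use s1 u s1' in \<open>simp_all add: Gt Bc S.l_distr EW.smult_l_distr[simplified]\<close>)
  next
    fix c s1 u assume c: "c \<in> carrier K" and s1: "s1 \<in> carrier S" and u: "u \<in> carrier U"
    show "G s1 (c \<odot>\<^bsub>U\<^esub> u) Y = c \<odot>\<^bsub>?TW\<^esub> G s1 u Y"
      by (rule linear_map_tensor_eqI[OF Sm V Gl linear_map_scale[OF Gl TV TW c] _ Y])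
        (use s1 u c in \<open>simp_all add: Gt Bc bilinear_smult[OF Bbil] linear_map_smult[OF smWl]\<close>)
    show "G (c \<odot>\<^bsub>S\<^esub> s1) u Y = c \<odot>\<^bsub>?TW\<^esub> G s1 u Y"
      by (rule linear_map_tensor_eqI[OF Sm V Gl linear_map_scale[OF Gl TV TW c] _ Y])
        (use s1 u c in \<open>simp_all add: Gt Bc S.smult_assoc2 sm_assoc\<close>)
  qed
  let ?P = "perturbed_map K S U V W N n \<beta>0 \<beta>"
  have P: "?P X Y = tensor_lift K S U ?TW (\<lambda>s1 u. G s1 u Y) X" for X Y
    by (simp add: perturbed_map_def G_def h_def)
  have Pl: "linear_map K ?TU ?TW (\<lambda>X. ?P X Y)" if "Y \<in> carrier ?TV" for Y
    unfolding P by (rule tensor_lift_linear[OF Sm U TW Gbil[OF that]])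
  have Pt: "?P (tens K S U s1 u) Y = G s1 u Y" if "s1 \<in> carrier S" "u \<in> carrier U" "Y \<in> carrier ?TV" for s1 u Y
    unfolding P by (rule tensor_lift_tens[OF Sm U TW Gbil[OF that(3)] that(1,2)])
  have Gs: "G (s \<otimes>\<^bsub>S\<^esub> s1) u Y = s \<odot>\<^bsub>?EW\<^esub> G s1 u Y"
    if s: "s \<in> carrier S" and s1: "s1 \<in> carrier S" and u: "u \<in> carrier U" and Y: "Y \<in> carrier ?TV" for s s1 u Y
    by (rule linear_map_tensor_eqI[OF Sm V Gl linear_map_comp[OF Gl smWl] _ Y])
      (use s s1 u in \<open>simp_all add: Gt Bc S.m_assoc EW.smult_assoc1[simplified]\<close>)
  have Gs': "G s1 u (s \<odot>\<^bsub>?EV\<^esub> Y) = s \<odot>\<^bsub>?EW\<^esub> G s1 u Y"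
    if s: "s \<in> carrier S" and s1: "s1 \<in> carrier S" and u: "u \<in> carrier U" and Y: "Y \<in> carrier ?TV" for s s1 u Y
    by (rule linear_map_tensor_eqI[OF Sm V linear_map_comp[OF extend_scalars_smult_linear[OF S V s] Gl]
        linear_map_comp[OF Gl smWl] _ Y])
      (use s s1 u in \<open>simp_all add: Gt Bc extend_scalars_smult_tens[OF S V] S.m_lcomm EW.smult_assoc1[simplified, symmetric]\<close>)
  note smUl = extend_scalars_smult_linear[OF S U] and smVl = extend_scalars_smult_linear[OF S V]
  have Pc: "?P X Y \<in> carrier ?TW" if "X \<in> carrier ?TU" "Y \<in> carrier ?TV" for X Y
    using linear_map_closed[OF Pl] that by simp
  show "bilinear_map S ?EU ?EV ?EW ?P"
  proof (intro bilinear_mapI linear_mapI)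
    fix X Y assume X: "X \<in> carrier ?EU" and Y: "Y \<in> carrier ?EV"
    show "?P X Y \<in> carrier ?EW" using Pc X Y by simp
    then show "?P X Y \<in> carrier ?EW" .
    show "?P X (Y \<oplus>\<^bsub>?EV\<^esub> Y') = ?P X Y \<oplus>\<^bsub>?EW\<^esub> ?P X Y'" if Y': "Y' \<in> carrier ?EV" for Y'
    proof -
      interpret TV: module K ?TV by (rule TV)
      have "?P X (Y \<oplus>\<^bsub>?TV\<^esub> Y') = ?P X Y \<oplus>\<^bsub>?TW\<^esub> ?P X Y'"
      proof (rule linear_map_tensor_eqI[OF Sm U Pl linear_map_plus[OF Pl Pl TU TW]])
        show "X \<in> carrier ?TU" "Y \<in> carrier ?TV" "Y' \<in> carrier ?TV" "Y \<oplus>\<^bsub>?TV\<^esub> Y' \<in> carrier ?TV" using X Y Y' by simp_all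
      qed (use Y Y' in \<open>simp add: Pt linear_map_add[OF Gl]\<close>)
      then show ?thesis by simp
    qed
    show "?P (X \<oplus>\<^bsub>?EU\<^esub> X') Y = ?P X Y \<oplus>\<^bsub>?EW\<^esub> ?P X' Y" if X': "X' \<in> carrier ?EU" for X'
      using linear_map_add[OF Pl] X X' Y by simp
  next
    fix s X Y assume s: "s \<in> carrier S" and X: "X \<in> carrier ?EU" and Y: "Y \<in> carrier ?EV"
    have sY: "s \<odot>\<^bsub>?EV\<^esub> Y \<in> carrier ?TV" using linear_map_closed[OF smVl[OF s]] Y by simp
    show "?P X (s \<odot>\<^bsub>?EV\<^esub> Y) = s \<odot>\<^bsub>?EW\<^esub> ?P X Y"
    proof (rule linear_map_tensor_eqI[OF Sm U Pl linear_map_comp[OF Pl smWl]])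
      show "X \<in> carrier ?TU" "Y \<in> carrier ?TV" "s \<odot>\<^bsub>?EV\<^esub> Y \<in> carrier ?TV" "s \<in> carrier S" using s X Y sY by simp_all
    qed (use s Y sY in \<open>simp add: Pt Gs'\<close>)
  next
    fix s X Y assume s: "s \<in> carrier S" and X: "X \<in> carrier ?EU" and Y: "Y \<in> carrier ?EV"
    show "?P (s \<odot>\<^bsub>?EU\<^esub> X) Y = s \<odot>\<^bsub>?EW\<^esub> ?P X Y"
    proof (rule linear_map_tensor_eqI[OF Sm U linear_map_comp[OF smUl Pl] linear_map_comp[OF Pl smWl]])
      show "X \<in> carrier ?TU" "Y \<in> carrier ?TV" "Y \<in> carrier ?TV" "s \<in> carrier S" "s \<in> carrier S" using s X Y by simp_all
    qed (use s Y in \<open>simp add: Pt Gs extend_scalars_smult_tens[OF S U]\<close>)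
  qed
  show "?P (tens K S U s1 u) (tens K S V s2 v) =
      (s1 \<otimes>\<^bsub>S\<^esub> s2) \<odot>\<^bsub>extend_scalars K S W\<^esub> (tens K S W \<one>\<^bsub>S\<^esub> (\<beta>0 u v) \<oplus>\<^bsub>tensor K S W\<^esub>
        (\<Oplus>\<^bsub>tensor K S W\<^esub>j\<in>{1..N}. tens K S W (n j) (\<beta> j u v)))"
    if "s1 \<in> carrier S" "u \<in> carrier U" "s2 \<in> carrier S" "v \<in> carrier V"
    using that Sm V by (simp add: Pt Gt) (simp add: B_def)
qed

text \<open>It suffices to compare pure tensors. There \<open>p\<close> annihilates the terms with index greater than \<open>n\<close>,
  and what remains are the components of \<open>\<beta>R\<close>, multiplied by \<open>p(s\<^sub>1 s\<^sub>2)\<close>.\<close>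

lemma (in square_zero_extension) perturbed_map_proj:
  fixes U :: "('k, 'u) module" and V :: "('k, 'v) module" and W :: "('k, 'w) module"
  assumes U: "module K U" and V: "module K V" and W: "module K W"
    and \<beta>0: "bilinear_map K U V W \<beta>0" and \<beta>: "\<And>j. j \<in> {1..n + d} \<Longrightarrow> bilinear_map K U V W (\<beta> j)"
    and nb: "\<And>j. j \<in> {1..n + d} \<Longrightarrow> nb j \<in> carrier S"
    and low: "\<And>j. j \<in> {1..n} \<Longrightarrow> p (nb j) = mb j" and high: "\<And>j. j \<in> {n+1..n + d} \<Longrightarrow> p (nb j) = \<zero>\<^bsub>R\<^esub>"
    and \<beta>R: "bilinear_map R (extend_scalars K R U) (extend_scalars K R V) (extend_scalars K R W) \<beta>R"
    and comp: "\<And>u v. \<lbrakk>u \<in> carrier U; v \<in> carrier V\<rbrakk> \<Longrightarrow>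
      \<beta>R (tens K R U \<one>\<^bsub>R\<^esub> u) (tens K R V \<one>\<^bsub>R\<^esub> v) = tens K R W \<one>\<^bsub>R\<^esub> (\<beta>0 u v) \<oplus>\<^bsub>tensor K R W\<^esub>
        (\<Oplus>\<^bsub>tensor K R W\<^esub>j\<in>{1..n}. tens K R W (mb j) (\<beta> j u v))"
    and X: "X \<in> carrier (tensor K S U)" and Y: "Y \<in> carrier (tensor K S V)"
  shows "tensor_map K S W R W p (\<lambda>w. w) (perturbed_map K S U V W (n + d) nb \<beta>0 \<beta> X Y) =
    \<beta>R (tensor_map K S U R U p (\<lambda>u. u) X) (tensor_map K S V R V p (\<lambda>v. v) Y)"
proof -
  interpret U: extension_tensor K R \<epsilon> M S i p q U by (rule extension_tensorI[OF U])
  interpret V: extension_tensor K R \<epsilon> M S i p q V by (rule extension_tensorI[OF V])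
  interpret W: extension_tensor K R \<epsilon> M S i p q W by (rule extension_tensorI[OF W])
  let ?P = "perturbed_map K S U V W (n + d) nb \<beta>0 \<beta>"
  note P = perturbed_map[OF S_alg U V W \<beta>0 \<beta> nb]
  have Pb: "bilinear_map S U.ES V.ES W.ES ?P" by (rule perturbed_map_bilinear[OF S_alg U V W \<beta>0 \<beta> nb])
  note PK = extend_bilinear_restrict[OF S_alg U V W Pb] and RK = extend_bilinear_restrict[OF R_alg U V W \<beta>R]
  have on_tens: "W.proj (?P (tens K S U s1 u) (tens K S V s2 v)) = \<beta>R (U.proj (tens K S U s1 u)) (V.proj (tens K S V s2 v))"
    if s1: "s1 \<in> carrier S" and u: "u \<in> carrier U" and s2: "s2 \<in> carrier S" and v: "v \<in> carrier V" for s1 u s2 v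
  proof -
    have cl: "\<beta>0 u v \<in> carrier W" "\<And>j. j \<in> {1..n + d} \<Longrightarrow> \<beta> j u v \<in> carrier W"
      using bilinear_closed[OF \<beta>0 u v] bilinear_closed[OF \<beta> u v] by auto
    let ?B = "tens K S W \<one>\<^bsub>S\<^esub> (\<beta>0 u v) \<oplus>\<^bsub>W.TS\<^esub> (\<Oplus>\<^bsub>W.TS\<^esub>j\<in>{1..n + d}. tens K S W (nb j) (\<beta> j u v))"
    have t: "tens K S W (nb j) (\<beta> j u v) \<in> carrier W.TS" if "j \<in> {1..n + d}" for j
      using nb[OF that] cl(2)[OF that] by simp
    have sc: "(\<Oplus>\<^bsub>W.TS\<^esub>j\<in>{1..n + d}. tens K S W (nb j) (\<beta> j u v)) \<in> carrier W.TS"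
      using t by (intro W.TS.finsum_closed) blast
    have "W.proj (\<Oplus>\<^bsub>W.TS\<^esub>j\<in>{1..n + d}. tens K S W (nb j) (\<beta> j u v)) =
        (\<Oplus>\<^bsub>W.TR\<^esub>j\<in>{1..n + d}. W.proj (tens K S W (nb j) (\<beta> j u v)))"
      using t by (intro linear_map_finsum[OF W.proj_lin W.TS_mod W.TR_mod]) blast
    also have "\<dots> = (\<Oplus>\<^bsub>W.TR\<^esub>j\<in>{1..n}. tens K R W (mb j) (\<beta> j u v))"
    proof (rule W.TR.add.finprod_mono_neutral_cong_right)
      fix j assume j: "j \<in> {1..n + d} - {1..n}"
      then have "p (nb j) = \<zero>\<^bsub>R\<^esub>" by (intro high) auto
      then show "W.proj (tens K S W (nb j) (\<beta> j u v)) = \<zero>\<^bsub>W.TR\<^esub>"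
        using j nb[of j] cl(2)[of j] by (simp add: W.proj_tens bilinear_zero[OF W.tensR R_mod W W.TR_mod])
    next
      show "W.proj (tens K S W (nb j) (\<beta> j u v)) = tens K R W (mb j) (\<beta> j u v)" if "j \<in> {1..n}" for j
        using that nb[of j] cl(2)[of j] low[of j] by (simp add: W.proj_tens)
    qed (use t in auto)
    finally have "W.proj ?B = \<beta>R (tens K R U \<one>\<^bsub>R\<^esub> u) (tens K R V \<one>\<^bsub>R\<^esub> v)"
      using cl(1) sc by (simp add: comp[OF u v] linear_map_add[OF W.proj_lin] W.proj_tens p_one)
    moreover have "?P (tens K S U s1 u) (tens K S V s2 v) = (s1 \<otimes>\<^bsub>S\<^esub> s2) \<odot>\<^bsub>W.ES\<^esub> ?B"
      by (rule perturbed_map_tens[OF S_alg U V W \<beta>0 \<beta> nb s1 u s2 v])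
    ultimately have "W.proj (?P (tens K S U s1 u) (tens K S V s2 v)) =
      (p s1 \<otimes>\<^bsub>R\<^esub> p s2) \<odot>\<^bsub>extend_scalars K R W\<^esub> \<beta>R (tens K R U \<one>\<^bsub>R\<^esub> u) (tens K R V \<one>\<^bsub>R\<^esub> v)"
      using s1 s2 sc cl(1) by (simp add: W.proj_smult p_mult)
    also have "\<dots> = \<beta>R (p s1 \<odot>\<^bsub>extend_scalars K R U\<^esub> tens K R U \<one>\<^bsub>R\<^esub> u) (p s2 \<odot>\<^bsub>extend_scalars K R V\<^esub> tens K R V \<one>\<^bsub>R\<^esub> v)"
      using s1 s2 u v module.smult_assoc1[OF extend_scalars_module[OF R_alg W], of "p s1" "p s2"]
        bilinear_closed[OF RK, of "tens K R U \<one>\<^bsub>R\<^esub> u" "tens K R V \<one>\<^bsub>R\<^esub> v"]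
        linear_map_closed[OF extend_scalars_smult_linear[OF R_alg V], of "p s2" "tens K R V \<one>\<^bsub>R\<^esub> v"]
      by (simp add: bilinear_smult[OF \<beta>R])
    also have "\<dots> = \<beta>R (U.proj (tens K S U s1 u)) (V.proj (tens K S V s2 v))"
      using s1 s2 u v by (simp add: extend_scalars_smult_tens[OF R_alg U] extend_scalars_smult_tens[OF R_alg V]
          U.proj_tens V.proj_tens)
    finally show ?thesis .
  qed
  show ?thesis
  proof (rule linear_map_tensor_eqI[OF S_mod U linear_map_comp[OF bilinear_mapD(2)[OF PK Y] W.proj_lin]
        linear_map_comp[OF U.proj_lin bilinear_mapD(2)[OF RK]] _ X])
    show "V.proj Y \<in> carrier V.TR" using Y by simp
    fix s1 u assume s1: "s1 \<in> carrier S" and u: "u \<in> carrier U"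
    show "W.proj (?P (tens K S U s1 u) Y) = \<beta>R (U.proj (tens K S U s1 u)) (V.proj Y)"
      by (rule linear_map_tensor_eqI[OF S_mod V linear_map_comp[OF bilinear_mapD(1)[OF PK] W.proj_lin]
        linear_map_comp[OF V.proj_lin bilinear_mapD(1)[OF RK]] _ Y])
       (use s1 u on_tens in simp_all)
  qed
qed

lemma (in lifting_problem) perturbed_is_lift:
  assumes q': "linear_map K R S q'" and pq': "\<And>r. r \<in> carrier R \<Longrightarrow> p (q' r) = r"
    and mb: "is_basis K (R\<lparr>carrier := a_kernel R K \<epsilon>\<rparr>) n mb" and eb': "is_basis K MK d' eb'"
    and \<Psi>: "\<And>j. j \<in> {1..n + d'} \<Longrightarrow> \<Psi> j \<in> carrier (cochains K A L 2)"
    and comp: "deformation_components K R A L \<mu> (mR, \<nu>R, bR) n mb \<Psi>"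
  defines "nb \<equiv> \<lambda>j. if j \<le> n then q' (mb j) else i (eb' (j - n))"
  shows "is_lift (perturbed_map K S A A A (n + d') nb (mult A) (\<lambda>j. comp_A2 (\<Psi> j)))
    (perturbed_map K S L A A (n + d') nb \<mu> (\<lambda>j. comp_LA (\<Psi> j)))
    (perturbed_map K S L L L (n + d') nb (mult L) (\<lambda>j. comp_L2 (\<Psi> j)))"
    (is "is_lift ?m ?n ?b")
proof -
  have mbc: "mb j \<in> carrier R" if "j \<in> {1..n}" for j
    using mb that by (auto simp: is_basis_def a_kernel_def')
  have ebc: "eb' j \<in> carrier M" if "j \<in> {1..d'}" for j
    using eb' that by (auto simp: is_basis_def)
  have nb: "nb j \<in> carrier S" if j: "j \<in> {1..n + d'}" for j
  proof (cases "j \<le> n")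
    case True
    then show ?thesis using j linear_map_closed[OF q' mbc[of j]] by (simp add: nb_def)
  next
    case False
    then have "j - n \<in> {1..d'}" using j by auto
    then show ?thesis using False ebc by (simp add: nb_def)
  qed
  have low: "p (nb j) = mb j" if "j \<in> {1..n}" for j
    using that mbc[OF that] by (simp add: nb_def pq')
  have high: "p (nb j) = \<zero>\<^bsub>R\<^esub>" if j: "j \<in> {n+1..n + d'}" for j
  proof -
    have "j - n \<in> {1..d'}" "\<not> j \<le> n" using j by auto
    then show ?thesis using ebc by (simp add: nb_def)
  qed
  note comps = cochain2_comp_bilinear[OF A_module L_module \<Psi>]
  have pA: "bilinear_map K A A A (comp_A2 (\<Psi> j))" "bilinear_map K L A A (comp_LA (\<Psi> j))" "bilinear_map K L L L (comp_L2 (\<Psi> j))"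
    if "j \<in> {1..n + d'}" for j
    using comps[OF that] by simp_all
  note cmp = comp[unfolded deformation_components_def prod.case Let_def]
  note cmpA = cmp[THEN conjunct1, rule_format] and cmpN = cmp[THEN conjunct2, THEN conjunct1, rule_format]
    and cmpL = cmp[THEN conjunct2, THEN conjunct2, rule_format]
  show ?thesis
    unfolding is_lift_def
  proof (intro conjI ballI)
    show "bilinear_map S TA.ES TA.ES TA.ES ?m"
      by (rule perturbed_map_bilinear[OF S_alg A_module A_module A_module mult_bilinear pA(1) nb])
    show "bilinear_map S TL.ES TA.ES TA.ES ?n"
      by (rule perturbed_map_bilinear[OF S_alg L_module A_module A_module action_bilinear pA(2) nb])
    show "bilinear_map S TL.ES TL.ES TL.ES ?b"
      by (rule perturbed_map_bilinear[OF S_alg L_module L_module L_module bracket_bilinear pA(3) nb])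
    show "TA.proj (?m u v) = mR (TA.proj u) (TA.proj v)" if "u \<in> carrier TA.TS" "v \<in> carrier TA.TS" for u v
      by (rule perturbed_map_proj[where mb = mb, OF A_module A_module A_module mult_bilinear pA(1) nb low high R_bilinear(1) _ that],
          (assumption | rule cmpA)+)
    show "TA.proj (?n u v) = \<nu>R (TL.proj u) (TA.proj v)" if "u \<in> carrier TL.TS" "v \<in> carrier TA.TS" for u v
      by (rule perturbed_map_proj[where mb = mb, OF L_module A_module A_module action_bilinear pA(2) nb low high R_bilinear(2) _ that],
          (assumption | rule cmpN)+)
    show "TL.proj (?b u v) = bR (TL.proj u) (TL.proj v)" if "u \<in> carrier TL.TS" "v \<in> carrier TL.TS" for u v
      by (rule perturbed_map_proj[where mb = mb, OF L_module L_module L_module bracket_bilinear pA(3) nb low high R_bilinear(3) _ that],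
          (assumption | rule cmpL)+)
  qed
qed

text \<open>Whatever bases, cochains and section are chosen, the perturbed operations form a lift. With
  \<open>obstruction_class_unique\<close>, this shows that all choices lead to the same class.\<close>

lemma (in lifting_problem) obstruction_class_is_obstruction_class:
  assumes t: "obstruction_class K A L \<mu> R \<epsilon> (mR, \<nu>R, bR) M S i q' t"
    and q': "linear_map K R S q'" and pq': "\<And>r. r \<in> carrier R \<Longrightarrow> p (q' r) = r"
  shows "is_obstruction_class t"
proof -
  obtain n mb d' eb' \<Psi> \<Theta> where mb: "is_basis K (R\<lparr>carrier := a_kernel R K \<epsilon>\<rparr>) n mb"
    and eb': "is_basis K MK d' eb'" and \<Psi>: "\<And>j. j \<in> {1..n + d'} \<Longrightarrow> \<Psi> j \<in> carrier (cochains K A L 2)"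
    and comp: "deformation_components K R A L \<mu> (mR, \<nu>R, bR) n mb \<Psi>"
    and rep: "let nb = (\<lambda>j. if j \<le> n then q' (mb j) else i (eb' (j - n)));
             ms = perturbed_map K S A A A (n + d') nb (mult A) (\<lambda>j. comp_A2 (\<Psi> j));
             \<nu>s = perturbed_map K S L A A (n + d') nb \<mu> (\<lambda>j. comp_LA (\<Psi> j));
             bs = perturbed_map K S L L L (n + d') nb (mult L) (\<lambda>j. comp_L2 (\<Psi> j))
         in represents_obstruction K A L \<mu> MK S i (ms, \<nu>s, bs) \<Theta>"
    and t: "t = tensor_map K MK Z3 MK H3 (\<lambda>m. m) (cohomology_class K A L \<mu> 3) \<Theta>"
    using t unfolding obstruction_class_def by blast
  from perturbed_is_lift[OF q' pq' mb eb' \<Psi> comp] rep[unfolded Let_def] t show ?thesis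
    unfolding is_obstruction_class_def by blast
qed

section \<open>Transport along homomorphisms of extensions\<close>

locale algebra_map = courant K A L \<mu>
  for K :: "('k, 'z) ring_scheme" and A :: "('k, 'a) module" and L :: "('k, 'l) module" and \<mu> +
  fixes S1 :: "('k, 's1) module" and S2 :: "('k, 's2) module" and \<Phi> :: "'s1 \<Rightarrow> 's2"
  assumes S1: "algebra K S1" and S2: "algebra K S2" and \<Phi>: "linear_map K S1 S2 \<Phi>"
    and \<Phi>_mult: "\<And>s t. \<lbrakk>s \<in> carrier S1; t \<in> carrier S1\<rbrakk> \<Longrightarrow> \<Phi> (s \<otimes>\<^bsub>S1\<^esub> t) = \<Phi> s \<otimes>\<^bsub>S2\<^esub> \<Phi> t"
    and \<Phi>_one: "\<Phi> \<one>\<^bsub>S1\<^esub> = \<one>\<^bsub>S2\<^esub>"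
begin

lemma S1_mod: "module K S1" and S2_mod: "module K S2"
  using S1 S2 by (simp_all add: algebra_moduleD)

sublocale S1: algebra K S1 by (rule S1)
sublocale S2: algebra K S2 by (rule S2)

lemma \<Phi>_closed [simp]: "s \<in> carrier S1 \<Longrightarrow> \<Phi> s \<in> carrier S2"
  by (rule linear_map_closed[OF \<Phi>])

abbreviation "push V \<equiv> tensor_map K S1 V S2 V \<Phi> (\<lambda>v. v)"

lemma push_lin: "module K V \<Longrightarrow> linear_map K (tensor K S1 V) (tensor K S2 V) (push V)"
  and push_tens: "\<lbrakk>module K V; s \<in> carrier S1; v \<in> carrier V\<rbrakk> \<Longrightarrow> push V (tens K S1 V s v) = tens K S2 V (\<Phi> s) v"
  by (rule tensor_map_linear[OF S1_mod _ S2_mod _ \<Phi> linear_map_ident]; assumption)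
    (rule tensor_map_tens[OF S1_mod _ S2_mod _ \<Phi> linear_map_ident]; assumption)

lemma push_smult:
  assumes V: "module K V" and s: "s \<in> carrier S1" and X: "X \<in> carrier (tensor K S1 V)"
  shows "push V (s \<odot>\<^bsub>extend_scalars K S1 V\<^esub> X) = \<Phi> s \<odot>\<^bsub>extend_scalars K S2 V\<^esub> push V X"
  by (rule tensor_map_smult[OF S1 S2 \<Phi> \<Phi>_mult V s X])

text \<open>Both sides are bilinear, and on pure tensors \<open>\<Phi>\<close> maps \<open>s\<^sub>1 s\<^sub>2 n\<^sub>j\<close> to the corresponding product
  in \<open>S2\<close>.\<close>

lemma push_perturbed:
  fixes U :: "('k, 'u) module" and V :: "('k, 'v) module" and W :: "('k, 'w) module"
  assumes U: "module K U" and V: "module K V" and W: "module K W"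
    and \<beta>0: "bilinear_map K U V W \<beta>0" and \<beta>: "\<And>j. j \<in> {1..N} \<Longrightarrow> bilinear_map K U V W (\<beta> j)"
    and n1: "\<And>j. j \<in> {1..N} \<Longrightarrow> n1 j \<in> carrier S1" and n2: "\<And>j. j \<in> {1..N} \<Longrightarrow> n2 j = \<Phi> (n1 j)"
    and X: "X \<in> carrier (tensor K S1 U)" and Y: "Y \<in> carrier (tensor K S1 V)"
  shows "push W (perturbed_map K S1 U V W N n1 \<beta>0 \<beta> X Y) = perturbed_map K S2 U V W N n2 \<beta>0 \<beta> (push U X) (push V Y)"
proof -
  have n2c: "n2 j \<in> carrier S2" if "j \<in> {1..N}" for j using n1[OF that] n2[OF that] by simp
  let ?P1 = "perturbed_map K S1 U V W N n1 \<beta>0 \<beta>" and ?P2 = "perturbed_map K S2 U V W N n2 \<beta>0 \<beta>"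
  have P1: "bilinear_map K (tensor K S1 U) (tensor K S1 V) (tensor K S1 W) ?P1"
    by (intro extend_bilinear_restrict[OF S1 U V W] perturbed_map_bilinear[OF S1 U V W \<beta>0 \<beta> n1])
  have P2: "bilinear_map K (tensor K S2 U) (tensor K S2 V) (tensor K S2 W) ?P2"
    by (intro extend_bilinear_restrict[OF S2 U V W] perturbed_map_bilinear[OF S2 U V W \<beta>0 \<beta> n2c])
  interpret W1: module K "tensor K S1 W" using S1_mod W by simp
  interpret W2: module K "tensor K S2 W" using S2_mod W by simp
  have on_tens: "push W (?P1 (tens K S1 U s u) (tens K S1 V s' v)) = ?P2 (push U (tens K S1 U s u)) (push V (tens K S1 V s' v))"
    if s: "s \<in> carrier S1" and u: "u \<in> carrier U" and s': "s' \<in> carrier S1" and v: "v \<in> carrier V" for s u s' v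
  proof -
    have cl: "\<beta>0 u v \<in> carrier W" "\<And>j. j \<in> {1..N} \<Longrightarrow> \<beta> j u v \<in> carrier W"
      using bilinear_closed[OF \<beta>0 u v] bilinear_closed[OF \<beta> u v] by auto
    have t: "tens K S1 W (n1 j) (\<beta> j u v) \<in> carrier (tensor K S1 W)" if "j \<in> {1..N}" for j
      using n1[OF that] cl(2)[OF that] S1_mod W by simp
    have sc: "(\<Oplus>\<^bsub>tensor K S1 W\<^esub>j\<in>{1..N}. tens K S1 W (n1 j) (\<beta> j u v)) \<in> carrier (tensor K S1 W)"
      using t by (intro W1.finsum_closed) blast
    have "push W (\<Oplus>\<^bsub>tensor K S1 W\<^esub>j\<in>{1..N}. tens K S1 W (n1 j) (\<beta> j u v)) =
      (\<Oplus>\<^bsub>tensor K S2 W\<^esub>j\<in>{1..N}. push W (tens K S1 W (n1 j) (\<beta> j u v)))"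
      using t by (intro linear_map_finsum[OF push_lin[OF W] W1.module_axioms W2.module_axioms]) blast
    also have "\<dots> = (\<Oplus>\<^bsub>tensor K S2 W\<^esub>j\<in>{1..N}. tens K S2 W (n2 j) (\<beta> j u v))"
      using n1 n2 n2c cl(2) S2_mod W by (intro W2.finsum_cong') (auto simp: push_tens[OF W])
    finally have sum: "push W (\<Oplus>\<^bsub>tensor K S1 W\<^esub>j\<in>{1..N}. tens K S1 W (n1 j) (\<beta> j u v)) =
      (\<Oplus>\<^bsub>tensor K S2 W\<^esub>j\<in>{1..N}. tens K S2 W (n2 j) (\<beta> j u v))" .
    have "push W (?P1 (tens K S1 U s u) (tens K S1 V s' v)) =
      push W ((s \<otimes>\<^bsub>S1\<^esub> s') \<odot>\<^bsub>extend_scalars K S1 W\<^esub> (tens K S1 W \<one>\<^bsub>S1\<^esub> (\<beta>0 u v) \<oplus>\<^bsub>tensor K S1 W\<^esub>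
        (\<Oplus>\<^bsub>tensor K S1 W\<^esub>j\<in>{1..N}. tens K S1 W (n1 j) (\<beta> j u v))))"
      by (subst perturbed_map_tens[OF S1 U V W \<beta>0 \<beta> n1 s u s' v]) auto
    also have "\<dots> = (\<Phi> s \<otimes>\<^bsub>S2\<^esub> \<Phi> s') \<odot>\<^bsub>extend_scalars K S2 W\<^esub> (tens K S2 W \<one>\<^bsub>S2\<^esub> (\<beta>0 u v) \<oplus>\<^bsub>tensor K S2 W\<^esub>
        (\<Oplus>\<^bsub>tensor K S2 W\<^esub>j\<in>{1..N}. tens K S2 W (n2 j) (\<beta> j u v)))"
      using s s' sc cl(1) S1_mod W
      by (simp add: push_smult[OF W] linear_map_add[OF push_lin[OF W]] sum push_tens[OF W] \<Phi>_mult \<Phi>_one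
          del: One_nat_def)
    also have "\<dots> = ?P2 (tens K S2 U (\<Phi> s) u) (tens K S2 V (\<Phi> s') v)"
      using s u s' v by (subst perturbed_map_tens[OF S2 U V W \<beta>0 \<beta> n2c]) auto
    finally show ?thesis using s u s' v by (simp add: push_tens[OF U] push_tens[OF V])
  qed
  show ?thesis
  proof (rule linear_map_tensor_eqI[OF S1_mod U linear_map_comp[OF bilinear_mapD(2)[OF P1 Y] push_lin[OF W]]
        linear_map_comp[OF push_lin[OF U] bilinear_mapD(2)[OF P2]] _ X])
    show "push V Y \<in> carrier (tensor K S2 V)" using linear_map_closed[OF push_lin[OF V] Y] .
    fix s u assume s: "s \<in> carrier S1" and u: "u \<in> carrier U"
    have c: "tens K S1 U s u \<in> carrier (tensor K S1 U)" using s u S1_mod U by simp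
    show "push W (?P1 (tens K S1 U s u) Y) = ?P2 (push U (tens K S1 U s u)) (push V Y)"
      by (rule linear_map_tensor_eqI[OF S1_mod V linear_map_comp[OF bilinear_mapD(1)[OF P1 c] push_lin[OF W]]
        linear_map_comp[OF push_lin[OF V] bilinear_mapD(1)[OF P2 linear_map_closed[OF push_lin[OF U] c]]] _ Y])
       (rule on_tens[OF s u])
  qed
qed

lemma push_tensor_map:
  assumes M: "module K M" and Z: "module K Z" and V: "module K V"
    and i1: "linear_map K M S1 i1" and i2: "linear_map K M S2 i2" and i: "\<And>x. x \<in> carrier M \<Longrightarrow> i2 x = \<Phi> (i1 x)"
    and g: "linear_map K Z V g" and \<Theta>: "\<Theta> \<in> carrier (tensor K M Z)"
  shows "tensor_map K M Z S2 V i2 g \<Theta> = push V (tensor_map K M Z S1 V i1 g \<Theta>)"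
  by (rule linear_map_tensor_eqI[OF M Z tensor_map_linear[OF M Z S2_mod V i2 g]
        linear_map_comp[OF tensor_map_linear[OF M Z S1_mod V i1 g] push_lin[OF V]] _ \<Theta>])
    (simp add: tensor_map_tens[OF M Z S2_mod V i2 g] tensor_map_tens[OF M Z S1_mod V i1 g] push_tens[OF V] i
      linear_map_closed[OF i1] linear_map_closed[OF g])

text \<open>The map \<open>\<Phi> \<otimes> id\<close> carries the perturbed operations over \<open>S1\<close>, hence their defects, to those over \<open>S2\<close>.
  So the same element \<open>\<Theta>\<close> of \<open>M \<otimes> Z\<^sup>3\<close> represents the obstruction on both sides.\<close>

lemma obstruction_class_transport:
  fixes R :: "('k, 'r) module" and M :: "('r, 'm) module"
  assumes R: "algebra K R" and M: "module R M"
    and i1: "linear_map K (restrict_scalars R M) S1 i1" and i2: "linear_map K (restrict_scalars R M) S2 i2"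
    and i: "\<And>x. x \<in> carrier M \<Longrightarrow> i2 x = \<Phi> (i1 x)"
    and q1: "\<And>r. r \<in> carrier R \<Longrightarrow> q1 r \<in> carrier S1" and q: "\<And>r. r \<in> carrier R \<Longrightarrow> q2 r = \<Phi> (q1 r)"
    and t: "obstruction_class K A L \<mu> R \<epsilon> \<Lambda> M S1 i1 q1 t"
  shows "obstruction_class K A L \<mu> R \<epsilon> \<Lambda> M S2 i2 q2 t"
proof -
  let ?MK = "restrict_scalars R M" and ?Z = "cocycles K A L \<mu> 3"
  have MK: "module K ?MK" using R M by (rule restrict_scalars_module)
  obtain n mb d eb \<Psi> \<Theta> where mb: "is_basis K (R\<lparr>carrier := a_kernel R K \<epsilon>\<rparr>) n mb"
    and eb: "is_basis K ?MK d eb" and \<Psi>: "\<And>j. j \<in> {1..n + d} \<Longrightarrow> \<Psi> j \<in> carrier (cochains K A L 2)"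
    and comp: "deformation_components K R A L \<mu> \<Lambda> n mb \<Psi>"
    and rep: "let nb = (\<lambda>j. if j \<le> n then q1 (mb j) else i1 (eb (j - n)));
             ms = perturbed_map K S1 A A A (n + d) nb (mult A) (\<lambda>j. comp_A2 (\<Psi> j));
             \<nu>s = perturbed_map K S1 L A A (n + d) nb \<mu> (\<lambda>j. comp_LA (\<Psi> j));
             bs = perturbed_map K S1 L L L (n + d) nb (mult L) (\<lambda>j. comp_L2 (\<Psi> j))
         in represents_obstruction K A L \<mu> ?MK S1 i1 (ms, \<nu>s, bs) \<Theta>"
    and t: "t = tensor_map K ?MK ?Z ?MK (cohomology K A L \<mu> 3) (\<lambda>m. m) (cohomology_class K A L \<mu> 3) \<Theta>"
    using t unfolding obstruction_class_def by blast
  define n1 where "n1 = (\<lambda>j. if j \<le> n then q1 (mb j) else i1 (eb (j - n)))"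
  define n2 where "n2 = (\<lambda>j. if j \<le> n then q2 (mb j) else i2 (eb (j - n)))"
  have mbc: "mb j \<in> carrier R" if "j \<in> {1..n}" for j
    using mb that by (auto simp: is_basis_def a_kernel_def')
  have ebc: "eb j \<in> carrier M" if "j \<in> {1..d}" for j
    using eb that by (auto simp: is_basis_def)
  have n1c: "n1 j \<in> carrier S1" and n12: "n2 j = \<Phi> (n1 j)" if j: "j \<in> {1..n + d}" for j
  proof -
    show "n1 j \<in> carrier S1"
    proof (cases "j \<le> n")
      case True
      then show ?thesis using j q1[OF mbc[of j]] by (simp add: n1_def)
    next
      case False
      then have "j - n \<in> {1..d}" using j by auto
      then show ?thesis using False ebc linear_map_closed[OF i1] by (simp add: n1_def)
    qed
    show "n2 j = \<Phi> (n1 j)"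
    proof (cases "j \<le> n")
      case True
      then show ?thesis using j q[OF mbc[of j]] by (simp add: n1_def n2_def)
    next
      case False
      then have "j - n \<in> {1..d}" using j by auto
      then show ?thesis using False i[OF ebc[of "j - n"]] by (simp add: n1_def n2_def)
    qed
  qed
  note comps = cochain2_comp_bilinear[OF A_module L_module \<Psi>]
  have pA: "bilinear_map K A A A (comp_A2 (\<Psi> j))" "bilinear_map K L A A (comp_LA (\<Psi> j))" "bilinear_map K L L L (comp_L2 (\<Psi> j))"
    if "j \<in> {1..n + d}" for j
    using comps[OF that] by simp_all
  have n2c: "n2 j \<in> carrier S2" if "j \<in> {1..n + d}" for j using n1c[OF that] n12[OF that] by simp
  have T1: "operation_triple K (tensor K S1 A) (tensor K S1 L) (perturbed_map K S1 A A A (n + d) n1 (mult A) (\<lambda>j. comp_A2 (\<Psi> j)))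
      (perturbed_map K S1 L A A (n + d) n1 \<mu> (\<lambda>j. comp_LA (\<Psi> j))) (perturbed_map K S1 L L L (n + d) n1 (mult L) (\<lambda>j. comp_L2 (\<Psi> j)))"
    by (intro extension_tripleI(2)[OF S1 A_module L_module] perturbed_map_bilinear[OF S1] A_module L_module
        mult_bilinear action_bilinear bracket_bilinear pA n1c)
  define m1 where "m1 = perturbed_map K S1 A A A (n + d) n1 (mult A) (\<lambda>j. comp_A2 (\<Psi> j))"
  define m2 where "m2 = perturbed_map K S2 A A A (n + d) n2 (mult A) (\<lambda>j. comp_A2 (\<Psi> j))"
  define \<nu>1 where "\<nu>1 = perturbed_map K S1 L A A (n + d) n1 \<mu> (\<lambda>j. comp_LA (\<Psi> j))"
  define \<nu>2 where "\<nu>2 = perturbed_map K S2 L A A (n + d) n2 \<mu> (\<lambda>j. comp_LA (\<Psi> j))"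
  define b1 where "b1 = perturbed_map K S1 L L L (n + d) n1 (mult L) (\<lambda>j. comp_L2 (\<Psi> j))"
  define b2 where "b2 = perturbed_map K S2 L L L (n + d) n2 (mult L) (\<lambda>j. comp_L2 (\<Psi> j))"
  have rep1: "represents_obstruction K A L \<mu> ?MK S1 i1 (m1, \<nu>1, b1) \<Theta>"
    using rep unfolding Let_def m1_def \<nu>1_def b1_def n1_def .
  interpret T1: operation_triple K "tensor K S1 A" "tensor K S1 L" m1 \<nu>1 b1
    using T1 unfolding m1_def \<nu>1_def b1_def .
  have tA2: "module K (tensor K S2 A)" and tL2: "module K (tensor K S2 L)" using S2_mod A_module L_module by simp_all
  have pm: "push A (m1 u v) = m2 (push A u) (push A v)"
    if "u \<in> carrier (tensor K S1 A)" "v \<in> carrier (tensor K S1 A)" for u v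
    unfolding m1_def m2_def
    by (rule push_perturbed[OF A_module A_module A_module mult_bilinear pA(1) n1c n12 that]; assumption)
  have pn: "push A (\<nu>1 u v) = \<nu>2 (push L u) (push A v)"
    if "u \<in> carrier (tensor K S1 L)" "v \<in> carrier (tensor K S1 A)" for u v
    unfolding \<nu>1_def \<nu>2_def
    by (rule push_perturbed[OF L_module A_module A_module action_bilinear pA(2) n1c n12 that]; assumption)
  have pb: "push L (b1 u v) = b2 (push L u) (push L v)"
    if "u \<in> carrier (tensor K S1 L)" "v \<in> carrier (tensor K S1 L)" for u v
    unfolding b1_def b2_def
    by (rule push_perturbed[OF L_module L_module L_module bracket_bilinear pA(3) n1c n12 that]; assumption)
  note pl = linear_map_add[OF push_lin[OF A_module]]
    linear_map_diff[OF push_lin[OF A_module] T1.X_module tA2] linear_map_minus[OF push_lin[OF A_module] T1.X_module tA2]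
    linear_map_diff[OF push_lin[OF L_module] T1.Y_module tL2] linear_map_minus[OF push_lin[OF L_module] T1.Y_module tL2]
  note rules = defect_defs pl pm pn pb push_tens[OF A_module] push_tens[OF L_module] \<Phi>_one S1_mod A_module L_module
  have \<Theta>: "\<Theta> \<in> carrier (tensor K ?MK ?Z)" using rep1 by (simp add: represents_obstruction_iff)
  have evA: "tensor_map K ?MK ?Z S2 A i2 (\<lambda>c. snd c z) \<Theta> = push A (tensor_map K ?MK ?Z S1 A i1 (\<lambda>c. snd c z) \<Theta>)"
    if "z \<in> args1 A L 3" for z
    using i by (intro push_tensor_map[OF MK cocycles_module A_module i1 i2 _ evaluation_linear(1)[OF that] \<Theta>]) simp
  have evL: "tensor_map K ?MK ?Z S2 L i2 (\<lambda>c. fst c xs) \<Theta> = push L (tensor_map K ?MK ?Z S1 L i1 (\<lambda>c. fst c xs) \<Theta>)"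
    if "xs \<in> args0 L 3" for xs
    using i by (intro push_tensor_map[OF MK cocycles_module L_module i1 i2 _ evaluation_linear(2)[OF that] \<Theta>]) simp
  have "represents_obstruction K A L \<mu> ?MK S2 i2 (m2, \<nu>2, b2) \<Theta>"
    using rep1 unfolding represents_obstruction_iff
    by (simp add: evA evL short_args_mem) (simp add: rules)
  then have "let nb = (\<lambda>j. if j \<le> n then q2 (mb j) else i2 (eb (j - n)));
             ms = perturbed_map K S2 A A A (n + d) nb (mult A) (\<lambda>j. comp_A2 (\<Psi> j));
             \<nu>s = perturbed_map K S2 L A A (n + d) nb \<mu> (\<lambda>j. comp_LA (\<Psi> j));
             bs = perturbed_map K S2 L L L (n + d) nb (mult L) (\<lambda>j. comp_L2 (\<Psi> j))
         in represents_obstruction K A L \<mu> ?MK S2 i2 (ms, \<nu>s, bs) \<Theta>"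
    unfolding Let_def m2_def \<nu>2_def b2_def n2_def .
  then show ?thesis
    unfolding obstruction_class_def using mb eb \<Psi> comp t by blast
qed

end

section \<open>A basis of the augmentation ideal\<close>

text \<open>Functionals are linear maps into \<open>K\<close>, regarded as a module over itself.\<close>

definition self_module :: "('k, 'z) ring_scheme \<Rightarrow> ('k, 'k) module" where
  "self_module K = \<lparr>carrier = carrier K, mult = mult K, one = one K, zero = zero K, add = add K, smult = mult K\<rparr>"

lemma self_module_simps [simp]:
  "carrier (self_module K) = carrier K" "zero (self_module K) = zero K" "add (self_module K) = add K"
  "smult (self_module K) = mult K" "a_minus (self_module K) = a_minus K" "finsum (self_module K) = finsum K"
  by (simp_all add: self_module_def fun_eq_iff a_minus_def a_inv_def m_inv_def finsum_def finprod_def)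

lemma self_module_module:
  assumes "cring K"
  shows "module K (self_module K)"
proof -
  interpret cring K by fact
  show ?thesis
  proof (rule moduleI)
    show "abelian_group (self_module K)"
      by (rule abelian_groupI) (auto simp: a_ac intro: add.inv_closed l_neg)
  qed (simp_all add: l_distr r_distr m_assoc is_cring)
qed

lemma functional_iff_linear: "functional K V f \<longleftrightarrow> linear_map K V (self_module K) f"
  by (simp add: functional_def linear_map_def)

lemma functional_diff:
  assumes "functional K V f" "module K V" "x \<in> carrier V" "y \<in> carrier V"
  shows "f (x \<ominus>\<^bsub>V\<^esub> y) = f x \<ominus>\<^bsub>K\<^esub> f y"
  using linear_map_diff[of K V "self_module K" f x y] assms self_module_module[of K]
  by (simp add: functional_iff_linear module_def)

lemma functional_finsum:
  assumes "functional K V f" "module K V" "g \<in> I \<rightarrow> carrier V"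
  shows "f (\<Oplus>\<^bsub>V\<^esub>i\<in>I. g i) = (\<Oplus>\<^bsub>K\<^esub>i\<in>I. f (g i))"
  using linear_map_finsum[of K V "self_module K" f g I] assms self_module_module[of K]
  by (simp add: functional_iff_linear module_def)

lemma is_basisI:
  assumes V: "module K V" and b: "\<And>j. j \<in> {1..n} \<Longrightarrow> b j \<in> carrier V"
    and \<psi>: "\<And>j. j \<in> {1..n} \<Longrightarrow> functional K V (\<psi> j)"
    and dual: "\<And>j k. \<lbrakk>j \<in> {1..n}; k \<in> {1..n}\<rbrakk> \<Longrightarrow> \<psi> j (b k) = (if j = k then \<one>\<^bsub>K\<^esub> else \<zero>\<^bsub>K\<^esub>)"
    and exp: "\<And>v. v \<in> carrier V \<Longrightarrow> v = (\<Oplus>\<^bsub>V\<^esub>j\<in>{1..n}. \<psi> j v \<odot>\<^bsub>V\<^esub> b j)"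
  shows "is_basis K V n b"
  unfolding is_basis_def
proof (intro conjI ballI ex_ex1I)
  interpret V: module K V by fact
  show "b \<in> {1..n} \<rightarrow> carrier V" using b by blast
  fix v assume v: "v \<in> carrier V"
  let ?c = "\<lambda>j\<in>{1..n}. \<psi> j v"
  have pv: "\<psi> j v \<in> carrier K" if "j \<in> {1..n}" for j using functionalD(1)[OF \<psi>[OF that] v] .
  have "(\<Oplus>\<^bsub>V\<^esub>j\<in>{1..n}. ?c j \<odot>\<^bsub>V\<^esub> b j) = (\<Oplus>\<^bsub>V\<^esub>j\<in>{1..n}. \<psi> j v \<odot>\<^bsub>V\<^esub> b j)"
    using pv b by (intro V.finsum_cong') auto
  then have "v = (\<Oplus>\<^bsub>V\<^esub>j\<in>{1..n}. ?c j \<odot>\<^bsub>V\<^esub> b j)" using exp[OF v] by simp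
  moreover have "?c \<in> {1..n} \<rightarrow>\<^sub>E carrier K" using pv by (intro restrict_PiE_iff[THEN iffD2] ballI)
  ultimately show "\<exists>c. c \<in> {1..n} \<rightarrow>\<^sub>E carrier K \<and> v = (\<Oplus>\<^bsub>V\<^esub>j\<in>{1..n}. c j \<odot>\<^bsub>V\<^esub> b j)" by blast
  have coord: "c l = \<psi> l v" if c: "c \<in> {1..n} \<rightarrow>\<^sub>E carrier K" and v': "v = (\<Oplus>\<^bsub>V\<^esub>j\<in>{1..n}. c j \<odot>\<^bsub>V\<^esub> b j)"
    and l: "l \<in> {1..n}" for c l
  proof -
    have cc: "c j \<in> carrier K" if "j \<in> {1..n}" for j using PiE_mem[OF c that] .
    have "\<psi> l v = (\<Oplus>\<^bsub>K\<^esub>j\<in>{1..n}. \<psi> l (c j \<odot>\<^bsub>V\<^esub> b j))"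
      unfolding v' using cc b by (intro functional_finsum[OF \<psi>[OF l] V]) auto
    also have "\<dots> = (\<Oplus>\<^bsub>K\<^esub>j\<in>{1..n}. if l = j then c j else \<zero>\<^bsub>K\<^esub>)"
      using cc b l by (intro V.R.finsum_cong') (auto simp: functionalD(3)[OF \<psi>[OF l]] dual)
    also have "\<dots> = c l" using V.R.finsum_singleton[OF l, of c] cc by auto
    finally show ?thesis by simp
  qed
  fix c c' assume *: "c \<in> {1..n} \<rightarrow>\<^sub>E carrier K \<and> v = (\<Oplus>\<^bsub>V\<^esub>j\<in>{1..n}. c j \<odot>\<^bsub>V\<^esub> b j)"
    "c' \<in> {1..n} \<rightarrow>\<^sub>E carrier K \<and> v = (\<Oplus>\<^bsub>V\<^esub>j\<in>{1..n}. c' j \<odot>\<^bsub>V\<^esub> b j)"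
  show "c = c'"
    using coord[OF conjunct1[OF *(1)] conjunct2[OF *(1)]] coord[OF conjunct1[OF *(2)] conjunct2[OF *(2)]]
    by (intro PiE_ext[OF conjunct1[OF *(1)] conjunct1[OF *(2)]]) metis
qed

text \<open>Some basis vector \<open>b k\<close> has \<open>\<epsilon>(b k) \<noteq> 0\<close>, as \<open>\<epsilon>(1) = 1\<close>. Subtracting suitable multiples of it from
  the other basis vectors moves them into the kernel of \<open>\<epsilon>\<close>, and does not affect their coordinate
  functionals.\<close>

lemma augmentation_ideal_basis:
  assumes K: "field K" and R: "algebra K R" and aug: "augmentation K R \<epsilon>" and b: "is_basis K R N b"
  obtains n mb \<psi> where "is_basis K (R\<lparr>carrier := a_kernel R K \<epsilon>\<rparr>) n mb"
    and "\<And>j. j \<in> {1..n} \<Longrightarrow> functional K R (\<psi> j)"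
    and "\<And>v. v \<in> a_kernel R K \<epsilon> \<Longrightarrow> v = (\<Oplus>\<^bsub>R\<^esub>j\<in>{1..n}. \<psi> j v \<odot>\<^bsub>R\<^esub> mb j)"
proof -
  interpret K: field K by fact
  interpret R: algebra K R by fact
  have Rm: "module K R" using R by (rule algebra_moduleD)
  note e = augmentation_functional[OF aug]
  obtain \<phi> where \<phi>: "\<And>j. j \<in> {1..N} \<Longrightarrow> functional K R (\<phi> j)"
    and exp: "\<And>v. v \<in> carrier R \<Longrightarrow> v = (\<Oplus>\<^bsub>R\<^esub>j\<in>{1..N}. \<phi> j v \<odot>\<^bsub>R\<^esub> b j)"
    and dual: "\<And>j k. \<lbrakk>j \<in> {1..N}; k \<in> {1..N}\<rbrakk> \<Longrightarrow> \<phi> j (b k) = (if j = k then \<one>\<^bsub>K\<^esub> else \<zero>\<^bsub>K\<^esub>)"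
    by (rule basis_dual[OF Rm b]) blast
  have bc: "b j \<in> carrier R" if "j \<in> {1..N}" for j using b that by (auto simp: is_basis_def)
  have pc: "\<phi> j v \<in> carrier K" if "j \<in> {1..N}" "v \<in> carrier R" for j v using functionalD(1)[OF \<phi>] that by simp
  have ec: "\<epsilon> v \<in> carrier K" if "v \<in> carrier R" for v using functionalD(1)[OF e that] .
  have esum: "\<epsilon> v = (\<Oplus>\<^bsub>K\<^esub>j\<in>{1..N}. \<phi> j v \<otimes>\<^bsub>K\<^esub> \<epsilon> (b j))" if v: "v \<in> carrier R" for v
  proof -
    have "\<epsilon> v = \<epsilon> (\<Oplus>\<^bsub>R\<^esub>j\<in>{1..N}. \<phi> j v \<odot>\<^bsub>R\<^esub> b j)" using exp[OF v] by simp
    also have "\<dots> = (\<Oplus>\<^bsub>K\<^esub>j\<in>{1..N}. \<epsilon> (\<phi> j v \<odot>\<^bsub>R\<^esub> b j))"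
      using pc bc v by (intro functional_finsum[OF e Rm]) auto
    also have "\<dots> = (\<Oplus>\<^bsub>K\<^esub>j\<in>{1..N}. \<phi> j v \<otimes>\<^bsub>K\<^esub> \<epsilon> (b j))"
      using pc bc ec v by (intro K.finsum_cong') (auto simp: functionalD(3)[OF e])
    finally show ?thesis .
  qed
  have "\<exists>k\<in>{1..N}. \<epsilon> (b k) \<noteq> \<zero>\<^bsub>K\<^esub>"
  proof (rule ccontr)
    assume "\<not> ?thesis"
    then have "(\<Oplus>\<^bsub>K\<^esub>j\<in>{1..N}. \<phi> j \<one>\<^bsub>R\<^esub> \<otimes>\<^bsub>K\<^esub> \<epsilon> (b j)) = (\<Oplus>\<^bsub>K\<^esub>j\<in>{1..N}. \<zero>\<^bsub>K\<^esub>)"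
      using pc by (intro K.finsum_cong') auto
    then have "\<epsilon> \<one>\<^bsub>R\<^esub> = \<zero>\<^bsub>K\<^esub>" using esum[OF R.one_closed] by simp
    moreover have "\<epsilon> \<one>\<^bsub>R\<^esub> = \<one>\<^bsub>K\<^esub>" using aug by (auto simp: augmentation_def ring_hom_def)
    ultimately show False by simp
  qed
  then obtain k where k: "k \<in> {1..N}" and ek: "\<epsilon> (b k) \<noteq> \<zero>\<^bsub>K\<^esub>" by blast
  have ekc: "\<epsilon> (b k) \<in> carrier K" using ec bc k by simp
  have eku: "\<epsilon> (b k) \<in> Units K" using ek ekc by (simp add: K.field_Units)
  \<comment> \<open>the indices different from \<open>k\<close>, renumbered\<close>
  define \<sigma> where "\<sigma> = (\<lambda>j. if j < k then j else j + 1)"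
  define n where "n = N - 1"
  have \<sigma>: "\<sigma> j \<in> {1..N}" "\<sigma> j \<noteq> k" if "j \<in> {1..n}" for j
    using that k by (auto simp: \<sigma>_def n_def)
  have \<sigma>_inj: "\<sigma> j = \<sigma> l \<longleftrightarrow> j = l" for j l by (auto simp: \<sigma>_def)
  have \<sigma>_surj: "\<exists>j\<in>{1..n}. l = \<sigma> j" if "l \<in> {1..N}" "l \<noteq> k" for l
  proof (cases "l < k")
    case True
    then show ?thesis using that k by (intro bexI[of _ l]) (auto simp: \<sigma>_def n_def)
  next
    case False
    then show ?thesis using that k by (intro bexI[of _ "l - 1"]) (auto simp: \<sigma>_def n_def)
  qed
  define f where "f = (\<lambda>j. \<epsilon> (b (\<sigma> j)) \<otimes>\<^bsub>K\<^esub> inv\<^bsub>K\<^esub> \<epsilon> (b k))"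
  define mb where "mb = (\<lambda>j. b (\<sigma> j) \<ominus>\<^bsub>R\<^esub> f j \<odot>\<^bsub>R\<^esub> b k)"
  define \<psi> where "\<psi> = (\<lambda>j. \<phi> (\<sigma> j))"
  let ?I = "a_kernel R K \<epsilon>"
  have I: "v \<in> ?I \<longleftrightarrow> v \<in> carrier R \<and> \<epsilon> v = \<zero>\<^bsub>K\<^esub>" for v by (simp add: a_kernel_def')
  have fc: "f j \<in> carrier K" if "j \<in> {1..n}" for j
    using \<sigma>(1)[OF that] bc ec eku by (simp add: f_def)
  have mbc: "mb j \<in> carrier R" if "j \<in> {1..n}" for j
    using \<sigma>(1)[OF that] bc[of "\<sigma> j"] bc[OF k] fc[OF that] by (simp add: mb_def)
  have mbI: "mb j \<in> ?I" if j: "j \<in> {1..n}" for j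
  proof -
    have "\<epsilon> (mb j) = \<epsilon> (b (\<sigma> j)) \<ominus>\<^bsub>K\<^esub> f j \<otimes>\<^bsub>K\<^esub> \<epsilon> (b k)"
      unfolding mb_def using \<sigma>(1)[OF j] bc[of "\<sigma> j"] bc[OF k] fc[OF j]
      by (simp add: functional_diff[OF e Rm] functionalD(3)[OF e])
    also have "f j \<otimes>\<^bsub>K\<^esub> \<epsilon> (b k) = \<epsilon> (b (\<sigma> j))"
      using ec[OF bc[OF \<sigma>(1)[OF j]]] eku ekc by (simp add: f_def K.m_assoc)
    finally show ?thesis using mbc[OF j] ec[OF bc[OF \<sigma>(1)[OF j]]] by (simp add: I K.minus_eq_iff)
  qed
  have \<psi>: "functional K R (\<psi> j)" if "j \<in> {1..n}" for j using \<phi>[OF \<sigma>(1)[OF that]] by (simp add: \<psi>_def)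
  have \<psi>_mb: "\<psi> j (mb l) = (if j = l then \<one>\<^bsub>K\<^esub> else \<zero>\<^bsub>K\<^esub>)" if j: "j \<in> {1..n}" and l: "l \<in> {1..n}" for j l
  proof -
    have "\<psi> j (mb l) = \<phi> (\<sigma> j) (b (\<sigma> l)) \<ominus>\<^bsub>K\<^esub> f l \<otimes>\<^bsub>K\<^esub> \<phi> (\<sigma> j) (b k)"
      unfolding mb_def \<psi>_def using bc[OF \<sigma>(1)[OF l]] bc[OF k] fc[OF l] \<phi>[OF \<sigma>(1)[OF j]]
      by (simp add: functional_diff[OF _ Rm] functionalD(3))
    then show ?thesis
      using dual[OF \<sigma>(1)[OF j] \<sigma>(1)[OF l]] dual[OF \<sigma>(1)[OF j] k] \<sigma>(2)[OF j] fc[OF l]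
      by (simp add: \<sigma>_inj K.minus_eq_iff)
  qed
  have expand: "v = (\<Oplus>\<^bsub>R\<^esub>j\<in>{1..n}. \<psi> j v \<odot>\<^bsub>R\<^esub> mb j)" if v: "v \<in> ?I" for v
  proof -
    have vc: "v \<in> carrier R" and ve: "\<epsilon> v = \<zero>\<^bsub>K\<^esub>" using v by (simp_all add: I)
    have pv: "\<psi> j v \<in> carrier K" if "j \<in> {1..n}" for j using functionalD(1)[OF \<psi>[OF that] vc] .
    define w where "w = (\<Oplus>\<^bsub>R\<^esub>j\<in>{1..n}. \<psi> j v \<odot>\<^bsub>R\<^esub> mb j)"
    have tc: "\<psi> j v \<odot>\<^bsub>R\<^esub> mb j \<in> carrier R" if "j \<in> {1..n}" for j using pv[OF that] mbc[OF that] by simp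
    have wc: "w \<in> carrier R" unfolding w_def using tc by (intro R.finsum_closed) blast
    have ew: "\<epsilon> w = \<zero>\<^bsub>K\<^esub>"
    proof -
      have "\<epsilon> w = (\<Oplus>\<^bsub>K\<^esub>j\<in>{1..n}. \<epsilon> (\<psi> j v \<odot>\<^bsub>R\<^esub> mb j))"
        unfolding w_def using tc by (intro functional_finsum[OF e Rm]) blast
      also have "\<dots> = (\<Oplus>\<^bsub>K\<^esub>j\<in>{1..n}. \<zero>\<^bsub>K\<^esub>)"
        using pv mbc mbI by (intro K.finsum_cong') (auto simp: functionalD(3)[OF e] I)
      finally show ?thesis by simp
    qed
    have pw: "\<psi> l w = \<psi> l v" if l: "l \<in> {1..n}" for l
    proof -
      have "\<psi> l w = (\<Oplus>\<^bsub>K\<^esub>j\<in>{1..n}. \<psi> l (\<psi> j v \<odot>\<^bsub>R\<^esub> mb j))"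
        unfolding w_def using tc by (intro functional_finsum[OF \<psi>[OF l] Rm]) blast
      also have "\<dots> = (\<Oplus>\<^bsub>K\<^esub>j\<in>{1..n}. if l = j then \<psi> j v else \<zero>\<^bsub>K\<^esub>)"
        using pv mbc l by (intro K.finsum_cong') (auto simp: functionalD(3)[OF \<psi>[OF l]] \<psi>_mb)
      also have "\<dots> = \<psi> l v" using K.finsum_singleton[OF l, of "\<lambda>j. \<psi> j v"] pv by auto
      finally show ?thesis .
    qed
    \<comment> \<open>All coordinates of \<open>v - w\<close> but the one with index \<open>k\<close> vanish by construction, and this one
      because \<open>\<epsilon>(v - w) = 0\<close> and \<open>\<epsilon>(b k) \<noteq> 0\<close>.\<close>
    let ?u = "v \<ominus>\<^bsub>R\<^esub> w"
    have u: "?u \<in> carrier R" using vc wc by simp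
    have pu: "\<phi> l ?u = \<zero>\<^bsub>K\<^esub>" if l: "l \<in> {1..N}" "l \<noteq> k" for l
    proof -
      obtain j where j: "j \<in> {1..n}" "l = \<sigma> j" using \<sigma>_surj[OF l] by blast
      have "\<phi> l ?u = \<psi> j v \<ominus>\<^bsub>K\<^esub> \<psi> j w"
        using functional_diff[OF \<psi>[OF j(1)] Rm vc wc] by (simp add: \<psi>_def j(2))
      then show ?thesis using pw[OF j(1)] pv[OF j(1)] by (simp add: K.minus_eq_iff)
    qed
    have "\<epsilon> ?u = \<zero>\<^bsub>K\<^esub>" using functional_diff[OF e Rm vc wc] ve ew by (simp add: K.minus_eq_iff)
    moreover have "\<epsilon> ?u = (\<Oplus>\<^bsub>K\<^esub>j\<in>{1..N}. if k = j then \<phi> j ?u \<otimes>\<^bsub>K\<^esub> \<epsilon> (b j) else \<zero>\<^bsub>K\<^esub>)"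
      unfolding esum[OF u] using pu pc[OF _ u] ec bc by (intro K.finsum_cong') auto
    moreover have "\<dots> = \<phi> k ?u \<otimes>\<^bsub>K\<^esub> \<epsilon> (b k)"
      using K.finsum_singleton[OF k, of "\<lambda>j. \<phi> j ?u \<otimes>\<^bsub>K\<^esub> \<epsilon> (b j)"] pc[OF _ u] ec bc by auto
    ultimately have "\<phi> k ?u \<otimes>\<^bsub>K\<^esub> \<epsilon> (b k) = \<zero>\<^bsub>K\<^esub>" by simp
    then have pk: "\<phi> k ?u = \<zero>\<^bsub>K\<^esub>" using K.integral[OF _ pc[OF k u] ekc] ek by blast
    have "\<phi> j ?u = \<zero>\<^bsub>K\<^esub>" if "j \<in> {1..N}" for j using pu[OF that] pk by blast
    then have "(\<Oplus>\<^bsub>R\<^esub>j\<in>{1..N}. \<phi> j ?u \<odot>\<^bsub>R\<^esub> b j) = (\<Oplus>\<^bsub>R\<^esub>j\<in>{1..N}. \<zero>\<^bsub>R\<^esub>)"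
      using bc by (intro R.finsum_cong') auto
    then have "?u = \<zero>\<^bsub>R\<^esub>" using exp[OF u] by simp
    then have "v = w" using vc wc by (simp add: R.minus_eq_iff)
    then show ?thesis unfolding w_def .
  qed
  have sub: "submodule ?I K R"
  proof (rule R.submoduleI)
    show "\<zero>\<^bsub>R\<^esub> \<in> ?I" using functionalD(3)[OF e K.zero_closed R.zero_closed] by (simp add: I ec)
    show "\<ominus>\<^bsub>R\<^esub> a \<in> ?I" if "a \<in> ?I" for a
      using functionalD(3)[OF e, of "\<ominus>\<^bsub>K\<^esub> \<one>\<^bsub>K\<^esub>" a] that by (simp add: I R.smult_l_minus)
  qed (auto simp: I functionalD[OF e])
  have Im: "module K (R\<lparr>carrier := ?I\<rparr>)" by (rule submodule.submodule_is_module[OF sub Rm])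
  have incl: "linear_map K (R\<lparr>carrier := ?I\<rparr>) R (\<lambda>v. v)" by (rule linear_mapI) (auto simp: I)
  have "is_basis K (R\<lparr>carrier := ?I\<rparr>) n mb"
  proof (rule is_basisI[OF Im _ _ \<psi>_mb])
    show "mb j \<in> carrier (R\<lparr>carrier := ?I\<rparr>)" if "j \<in> {1..n}" for j using mbI[OF that] by simp
    show "functional K (R\<lparr>carrier := ?I\<rparr>) (\<psi> j)" if "j \<in> {1..n}" for j
      using functional_comp[OF incl \<psi>[OF that]] .
    show "v = (\<Oplus>\<^bsub>R\<lparr>carrier := ?I\<rparr>\<^esub>j\<in>{1..n}. \<psi> j v \<odot>\<^bsub>R\<lparr>carrier := ?I\<rparr>\<^esub> mb j)"
      if v: "v \<in> carrier (R\<lparr>carrier := ?I\<rparr>)" for v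
    proof -
      have pv: "\<psi> j v \<in> carrier K" if "j \<in> {1..n}" for j using functionalD(1)[OF \<psi>[OF that]] v by (simp add: I)
      have tI: "(\<lambda>j. \<psi> j v \<odot>\<^bsub>R\<^esub> mb j) \<in> {1..n} \<rightarrow> carrier (R\<lparr>carrier := ?I\<rparr>)"
        using pv mbI submodule.smult_closed[OF sub] by auto
      have "v = (\<Oplus>\<^bsub>R\<^esub>j\<in>{1..n}. \<psi> j v \<odot>\<^bsub>R\<^esub> mb j)" using expand v by simp
      also have "\<dots> = (\<Oplus>\<^bsub>R\<lparr>carrier := ?I\<rparr>\<^esub>j\<in>{1..n}. \<psi> j v \<odot>\<^bsub>R\<^esub> mb j)"
        using linear_map_finsum[OF incl Im Rm tI] by simp
      finally show ?thesis by simp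
    qed
  qed
  then show thesis using that \<psi> expand by blast
qed

context lifting_problem
begin

text \<open>The components of the deformation are its contractions with the coordinate functionals of the
  augmentation ideal, extended by zero to the unit.\<close>

lemma deformation_components_exist:
  assumes mb: "is_basis K (R\<lparr>carrier := a_kernel R K \<epsilon>\<rparr>) n mb"
    and \<psi>: "\<And>j. j \<in> {1..n} \<Longrightarrow> functional K R (\<psi> j)"
    and exp: "\<And>v. v \<in> a_kernel R K \<epsilon> \<Longrightarrow> v = (\<Oplus>\<^bsub>R\<^esub>j\<in>{1..n}. \<psi> j v \<odot>\<^bsub>R\<^esub> mb j)"
  shows "\<exists>\<Psi>. (\<forall>j. \<Psi> j \<in> carrier (cochains K A L 2)) \<and> deformation_components K R A L \<mu> (mR, \<nu>R, bR) n mb \<Psi>"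
proof -
  \<comment> \<open>the projection of \<open>R\<close> onto the augmentation ideal along \<open>K 1\<close>\<close>
  define g where "g = (\<lambda>r. r \<ominus>\<^bsub>R\<^esub> \<epsilon> r \<odot>\<^bsub>R\<^esub> \<one>\<^bsub>R\<^esub>)"
  have e1: "linear_map K R R (\<lambda>r. \<epsilon> r \<odot>\<^bsub>R\<^esub> \<one>\<^bsub>R\<^esub>)"
    by (rule linear_mapI) (simp_all add: functionalD[OF \<epsilon>_fun] R.smult_l_distr R.smult_assoc1)
  have g: "linear_map K R R g" unfolding g_def by (rule linear_map_sub[OF linear_map_ident e1 R_mod R_mod])
  have g_ker: "g r \<in> a_kernel R K \<epsilon>" if r: "r \<in> carrier R" for r
  proof -
    have "\<epsilon> (g r) = \<epsilon> r \<ominus>\<^bsub>K\<^esub> \<epsilon> r"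
      unfolding g_def using r functional_diff[OF \<epsilon>_fun R_mod, of r "\<epsilon> r \<odot>\<^bsub>R\<^esub> \<one>\<^bsub>R\<^esub>"]
      by (simp add: functionalD(3)[OF \<epsilon>_fun] \<epsilon>_one)
    then show ?thesis using r linear_map_closed[OF g r] functionalD(1)[OF \<epsilon>_fun r]
      by (simp add: a_kernel_def' a_minus_def A.R.r_neg)
  qed
  have mbc: "mb j \<in> carrier R" if "j \<in> {1..n}" for j
    using mb that by (auto simp: is_basis_def a_kernel_def')
  define \<chi> where "\<chi> = (\<lambda>j r. \<psi> j (g r))"
  have \<chi>: "functional K R (\<chi> j)" if "j \<in> {1..n}" for j
    unfolding \<chi>_def by (rule functional_comp[OF g \<psi>[OF that]])
  define zero where "zero = \<zero>\<^bsub>cochains K A L 2\<^esub>"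
  define \<Psi> where "\<Psi> = (\<lambda>j. if j \<in> {1..n} then cochain2 A L
      (\<lambda>a a'. aug_map K R (\<chi> j) A (mR (tens K R A \<one>\<^bsub>R\<^esub> a) (tens K R A \<one>\<^bsub>R\<^esub> a')))
      (\<lambda>x a. aug_map K R (\<chi> j) A (\<nu>R (tens K R L \<one>\<^bsub>R\<^esub> x) (tens K R A \<one>\<^bsub>R\<^esub> a)))
      (\<lambda>x y. aug_map K R (\<chi> j) L (bR (tens K R L \<one>\<^bsub>R\<^esub> x) (tens K R L \<one>\<^bsub>R\<^esub> y))) else zero)"
  have "\<Psi> j \<in> carrier (cochains K A L 2)" for j
  proof (cases "j \<in> {1..n}")
    case True
    note j1 = bilinear_mapD(1)[OF TA.tensR R.one_closed] bilinear_mapD(1)[OF TL.tensR R.one_closed]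
    note c = contraction_linear[OF R_mod A_module \<chi>[OF True]] contraction_linear[OF R_mod L_module \<chi>[OF True]]
    show ?thesis
      unfolding \<Psi>_def if_P[OF True]
      by (intro cochain2_closed A_module L_module bilinear_comp[OF RT.m j1(1) j1(1) c(1)]
          bilinear_comp[OF RT.\<nu> j1(2) j1(1) c(1)] bilinear_comp[OF RT.b j1(2) j1(2) c(2)])
  next
    case False
    interpret C: module K "cochains K A L 2" by (rule cochains_module[OF A_module L_module])
    show ?thesis using False by (simp add: \<Psi>_def zero_def del: atLeastAtMost_iff)
  qed
  moreover have expA: "X = tens K R V \<one>\<^bsub>R\<^esub> (aug_map K R \<epsilon> V X) \<oplus>\<^bsub>tensor K R V\<^esub>
      (\<Oplus>\<^bsub>tensor K R V\<^esub>j\<in>{1..n}. tens K R V (mb j) (aug_map K R (\<chi> j) V X))"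
    if V: "module K V" and X: "X \<in> carrier (tensor K R V)" for V :: "('k, 'v) module" and X
  proof -
    interpret V: extension_tensor K R \<epsilon> M S i p q V by (rule extension_tensorI[OF V])
    note gl = tensor_map_linear[OF R_mod V R_mod V g linear_map_ident]
      and gt = tensor_map_tens[OF R_mod V R_mod V g linear_map_ident]
    have "tensor_map K R V R V g (\<lambda>v. v) X = (\<Oplus>\<^bsub>tensor K R V\<^esub>j\<in>{1..n}. tens K R V (mb j) (aug_map K R (\<chi> j) V X))"
      using mbc \<chi> exp[OF g_ker] by (intro tensor_map_expansion[OF R_mod R_mod V g _ _ _ _ X]) (auto simp: \<chi>_def)
    moreover have "X = tens K R V \<one>\<^bsub>R\<^esub> (aug_map K R \<epsilon> V X) \<oplus>\<^bsub>tensor K R V\<^esub> tensor_map K R V R V g (\<lambda>v. v) X"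
    proof (rule linear_map_tensor_eqI[OF R_mod V linear_map_ident linear_map_plus[OF linear_map_comp[OF V.augR_lin
              bilinear_mapD(1)[OF V.tensR R.one_closed]] gl V.TR_mod V.TR_mod] _ X])
      fix r v assume r: "r \<in> carrier R" and v: "v \<in> carrier V"
      have "tens K R V \<one>\<^bsub>R\<^esub> (\<epsilon> r \<odot>\<^bsub>V\<^esub> v) = tens K R V (\<epsilon> r \<odot>\<^bsub>R\<^esub> \<one>\<^bsub>R\<^esub>) v"
        using r v by (simp add: bilinear_smult[OF V.tensR])
      moreover have "\<epsilon> r \<odot>\<^bsub>R\<^esub> \<one>\<^bsub>R\<^esub> \<oplus>\<^bsub>R\<^esub> g r = r"
        using r R.a_lcomm[of "\<epsilon> r \<odot>\<^bsub>R\<^esub> \<one>\<^bsub>R\<^esub>" r "\<ominus>\<^bsub>R\<^esub> (\<epsilon> r \<odot>\<^bsub>R\<^esub> \<one>\<^bsub>R\<^esub>)"]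
        by (simp add: g_def a_minus_def R.r_neg)
      then have "tens K R V (\<epsilon> r \<odot>\<^bsub>R\<^esub> \<one>\<^bsub>R\<^esub>) v \<oplus>\<^bsub>tensor K R V\<^esub> tens K R V (g r) v = tens K R V r v"
        using r v linear_map_closed[OF g r] bilinear_add(1)[OF V.tensR, of "\<epsilon> r \<odot>\<^bsub>R\<^esub> \<one>\<^bsub>R\<^esub>" "g r" v] by simp
      ultimately show "tens K R V r v = tens K R V \<one>\<^bsub>R\<^esub> (aug_map K R \<epsilon> V (tens K R V r v)) \<oplus>\<^bsub>tensor K R V\<^esub>
          tensor_map K R V R V g (\<lambda>v. v) (tens K R V r v)"
        using r v by (simp add: V.augR_tens gt)
    qed
    ultimately show ?thesis by simp
  qed
  moreover have "deformation_components K R A L \<mu> (mR, \<nu>R, bR) n mb \<Psi>"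
    unfolding deformation_components_def prod.case Let_def
  proof (intro conjI ballI)
    have one: "aug_map K R \<epsilon> A (tens K R A \<one>\<^bsub>R\<^esub> a) = a" "aug_map K R \<epsilon> L (tens K R L \<one>\<^bsub>R\<^esub> x) = x"
      if "a \<in> carrier A" "x \<in> carrier L" for a x
      using that by (simp_all add: TA.augR_tens TL.augR_tens \<epsilon>_one)
    note one' = TA.augR_tens[OF R.one_closed] TL.augR_tens[OF R.one_closed]
    show "mR (tens K R A \<one>\<^bsub>R\<^esub> a) (tens K R A \<one>\<^bsub>R\<^esub> a') = tens K R A \<one>\<^bsub>R\<^esub> (a \<otimes>\<^bsub>A\<^esub> a') \<oplus>\<^bsub>tensor K R A\<^esub>
         (\<Oplus>\<^bsub>tensor K R A\<^esub>j\<in>{1..n}. tens K R A (mb j) (comp_A2 (\<Psi> j) a a'))"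
      if a: "a \<in> carrier A" and a': "a' \<in> carrier A" for a a'
    proof -
      let ?X = "mR (tens K R A \<one>\<^bsub>R\<^esub> a) (tens K R A \<one>\<^bsub>R\<^esub> a')"
      have X: "?X \<in> carrier TA.TR" using a a' by simp
      have "aug_map K R \<epsilon> A ?X = a \<otimes>\<^bsub>A\<^esub> a'" using R_structure a a' by (simp add: one' \<epsilon>_one)
      moreover have "(\<Oplus>\<^bsub>TA.TR\<^esub>j\<in>{1..n}. tens K R A (mb j) (aug_map K R (\<chi> j) A ?X)) =
          (\<Oplus>\<^bsub>TA.TR\<^esub>j\<in>{1..n}. tens K R A (mb j) (comp_A2 (\<Psi> j) a a'))"
        using a a' mbc X linear_map_closed[OF contraction_linear[OF R_mod A_module \<chi>]]
        by (intro TA.TR.finsum_cong') (auto simp: \<Psi>_def comp_A2_def cochain2_values)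
      ultimately show ?thesis using expA[OF A_module X] by simp
    qed
    show "\<nu>R (tens K R L \<one>\<^bsub>R\<^esub> x) (tens K R A \<one>\<^bsub>R\<^esub> a) = tens K R A \<one>\<^bsub>R\<^esub> (\<mu> x a) \<oplus>\<^bsub>tensor K R A\<^esub>
         (\<Oplus>\<^bsub>tensor K R A\<^esub>j\<in>{1..n}. tens K R A (mb j) (comp_LA (\<Psi> j) x a))"
      if a: "x \<in> carrier L" and a': "a \<in> carrier A" for x a
    proof -
      let ?X = "\<nu>R (tens K R L \<one>\<^bsub>R\<^esub> x) (tens K R A \<one>\<^bsub>R\<^esub> a)"
      have X: "?X \<in> carrier TA.TR" using a a' by simp
      have "aug_map K R \<epsilon> A ?X = \<mu> x a" using R_structure a a' by (simp add: one' \<epsilon>_one)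
      moreover have "(\<Oplus>\<^bsub>TA.TR\<^esub>j\<in>{1..n}. tens K R A (mb j) (aug_map K R (\<chi> j) A ?X)) =
          (\<Oplus>\<^bsub>TA.TR\<^esub>j\<in>{1..n}. tens K R A (mb j) (comp_LA (\<Psi> j) x a))"
        using a a' mbc X linear_map_closed[OF contraction_linear[OF R_mod A_module \<chi>]]
        by (intro TA.TR.finsum_cong') (auto simp: \<Psi>_def comp_LA_def cochain2_values)
      ultimately show ?thesis using expA[OF A_module X] by simp
    qed
    show "bR (tens K R L \<one>\<^bsub>R\<^esub> x) (tens K R L \<one>\<^bsub>R\<^esub> y) = tens K R L \<one>\<^bsub>R\<^esub> (x \<otimes>\<^bsub>L\<^esub> y) \<oplus>\<^bsub>tensor K R L\<^esub>
         (\<Oplus>\<^bsub>tensor K R L\<^esub>j\<in>{1..n}. tens K R L (mb j) (comp_L2 (\<Psi> j) x y))"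
      if a: "x \<in> carrier L" and a': "y \<in> carrier L" for x y
    proof -
      let ?X = "bR (tens K R L \<one>\<^bsub>R\<^esub> x) (tens K R L \<one>\<^bsub>R\<^esub> y)"
      have X: "?X \<in> carrier TL.TR" using a a' by simp
      have "aug_map K R \<epsilon> L ?X = x \<otimes>\<^bsub>L\<^esub> y" using R_structure a a' by (simp add: one' \<epsilon>_one)
      moreover have "(\<Oplus>\<^bsub>TL.TR\<^esub>j\<in>{1..n}. tens K R L (mb j) (aug_map K R (\<chi> j) L ?X)) =
          (\<Oplus>\<^bsub>TL.TR\<^esub>j\<in>{1..n}. tens K R L (mb j) (comp_L2 (\<Psi> j) x y))"
        using a a' mbc X linear_map_closed[OF contraction_linear[OF R_mod L_module \<chi>]]
        by (intro TL.TR.finsum_cong') (auto simp: \<Psi>_def comp_L2_def cochain2_values)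
      ultimately show ?thesis using expA[OF L_module X] by simp
    qed
  qed
  ultimately show ?thesis by blast
qed

text \<open>The components of the deformation, continued by arbitrary cochains, define perturbed operations. They
  form a lift, and every lift has an obstruction cochain.\<close>

lemma obstruction_class_exists:
  assumes K: "field K" and b: "is_basis K R N b" and eb': "is_basis K MK d' eb'"
    and q': "linear_map K R S q'" and pq': "\<And>r. r \<in> carrier R \<Longrightarrow> p (q' r) = r"
  shows "\<exists>t. obstruction_class K A L \<mu> R \<epsilon> (mR, \<nu>R, bR) M S i q' t"
proof -
  obtain n mb \<psi> where mb: "is_basis K (R\<lparr>carrier := a_kernel R K \<epsilon>\<rparr>) n mb"
    and \<psi>: "\<And>j. j \<in> {1..n} \<Longrightarrow> functional K R (\<psi> j)"
    and exp: "\<And>v. v \<in> a_kernel R K \<epsilon> \<Longrightarrow> v = (\<Oplus>\<^bsub>R\<^esub>j\<in>{1..n}. \<psi> j v \<odot>\<^bsub>R\<^esub> mb j)"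
    by (rule augmentation_ideal_basis[OF K R_alg aug b]) blast
  obtain \<Psi> where \<Psi>: "\<And>j. \<Psi> j \<in> carrier (cochains K A L 2)"
    and comp: "deformation_components K R A L \<mu> (mR, \<nu>R, bR) n mb \<Psi>"
    using deformation_components_exist[OF mb \<psi> exp] by blast
  from obstruction_exists[OF perturbed_is_lift[OF q' pq' mb eb' \<Psi> comp]]
  show ?thesis unfolding obstruction_class_def Let_def using mb eb' \<Psi> comp by blast
qed

end

section \<open>The standard extension of a Harrison class\<close>

text \<open>Each axiom is an equation whose two sides have the same image under the injective map \<open>f\<close>.\<close>

lemma algebra_transfer:
  fixes S :: "('k, 's) module" and T :: "('k, 't) module"
  assumes S: "algebra K S"
    and f: "\<And>x. x \<in> carrier T \<Longrightarrow> f x \<in> carrier S" and g: "\<And>s. s \<in> carrier S \<Longrightarrow> g s \<in> carrier T"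
    and fg: "\<And>s. s \<in> carrier S \<Longrightarrow> f (g s) = s" and gf: "\<And>x. x \<in> carrier T \<Longrightarrow> g (f x) = x"
    and cl: "\<And>x y. \<lbrakk>x \<in> carrier T; y \<in> carrier T\<rbrakk> \<Longrightarrow> x \<oplus>\<^bsub>T\<^esub> y \<in> carrier T \<and> x \<otimes>\<^bsub>T\<^esub> y \<in> carrier T"
      "\<zero>\<^bsub>T\<^esub> \<in> carrier T" "\<one>\<^bsub>T\<^esub> \<in> carrier T" "\<And>c x. \<lbrakk>c \<in> carrier K; x \<in> carrier T\<rbrakk> \<Longrightarrow> c \<odot>\<^bsub>T\<^esub> x \<in> carrier T"
    and add: "\<And>x y. \<lbrakk>x \<in> carrier T; y \<in> carrier T\<rbrakk> \<Longrightarrow> f (x \<oplus>\<^bsub>T\<^esub> y) = f x \<oplus>\<^bsub>S\<^esub> f y"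
    and mult: "\<And>x y. \<lbrakk>x \<in> carrier T; y \<in> carrier T\<rbrakk> \<Longrightarrow> f (x \<otimes>\<^bsub>T\<^esub> y) = f x \<otimes>\<^bsub>S\<^esub> f y"
    and zero: "f \<zero>\<^bsub>T\<^esub> = \<zero>\<^bsub>S\<^esub>" and one: "f \<one>\<^bsub>T\<^esub> = \<one>\<^bsub>S\<^esub>"
    and smult: "\<And>c x. \<lbrakk>c \<in> carrier K; x \<in> carrier T\<rbrakk> \<Longrightarrow> f (c \<odot>\<^bsub>T\<^esub> x) = c \<odot>\<^bsub>S\<^esub> f x"
  shows "algebra K T"
proof -
  interpret S: algebra K S by fact
  have eq: "x = y" if "f x = f y" "x \<in> carrier T" "y \<in> carrier T" for x y
    using that gf by metis
  note rules = f g cl add mult zero one smult S.a_ac S.m_ac S.l_distr S.r_distr S.smult_l_distr S.smult_r_distr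
    S.smult_assoc1 S.smult_assoc2 bilinear_smult[OF algebra_mult_bilinear[OF S]] fg
  have ag: "abelian_group T"
  proof (rule abelian_groupI)
    show "\<exists>y\<in>carrier T. y \<oplus>\<^bsub>T\<^esub> x = \<zero>\<^bsub>T\<^esub>" if "x \<in> carrier T" for x
      using that by (intro bexI[of _ "g (\<ominus>\<^bsub>S\<^esub> f x)"] eq) (simp_all add: rules S.r_neg)
  qed (auto intro!: eq simp: rules)
  moreover have "comm_monoid T"
    by (rule comm_monoidI) (auto intro!: eq simp: rules)
  ultimately have "cring T"
    by (intro cringI) (auto intro!: eq simp: rules)
  then show ?thesis using S.R.is_cring ag
    by (intro algebraI) (auto intro!: eq simp: rules)
qed

text \<open>The section \<open>q\<close> has cocycle \<open>\<psi>\<close>, so \<open>(r, m) \<mapsto> q(r) + i(m)\<close> is an isomorphism of extensions.\<close>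

locale standard_extension = square_zero_extension K R \<epsilon> M S i p q
  for K :: "('k, 'z) ring_scheme" and R :: "('k, 'r) module" and \<epsilon> :: "'r \<Rightarrow> 'k"
    and M :: "('r, 'm) module" and S :: "('k, 's) module" and i :: "'m \<Rightarrow> 's" and p :: "'s \<Rightarrow> 'r"
    and q :: "'r \<Rightarrow> 's" +
  fixes \<psi> :: "'r \<times> 'r \<Rightarrow> 'm"
  assumes \<psi>: "\<And>r s. \<lbrakk>r \<in> carrier R; s \<in> carrier R\<rbrakk> \<Longrightarrow> \<psi> (r, s) \<in> carrier M"
    and q_mult: "\<And>r s. \<lbrakk>r \<in> carrier R; s \<in> carrier R\<rbrakk> \<Longrightarrow> q r \<otimes>\<^bsub>S\<^esub> q s = q (r \<otimes>\<^bsub>R\<^esub> s) \<oplus>\<^bsub>S\<^esub> i (\<psi> (r, s))"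
begin

abbreviation "E \<equiv> std_extension R M \<psi>"

definition from_std :: "'r \<times> 'm \<Rightarrow> 's" where
  "from_std = (\<lambda>(r, m). q r \<oplus>\<^bsub>S\<^esub> i m)"

definition to_std :: "'s \<Rightarrow> 'r \<times> 'm" where
  "to_std s = (p s, \<rho> s)"

lemma from_std_pair: "from_std (r, m) = q r \<oplus>\<^bsub>S\<^esub> i m"
  by (simp add: from_std_def)

lemma E_simps:
  "carrier E = carrier R \<times> carrier M" "(r, m) \<otimes>\<^bsub>E\<^esub> (s, n) = (r \<otimes>\<^bsub>R\<^esub> s, r \<odot>\<^bsub>M\<^esub> n \<oplus>\<^bsub>M\<^esub> s \<odot>\<^bsub>M\<^esub> m \<oplus>\<^bsub>M\<^esub> \<psi> (r, s))"
  "\<one>\<^bsub>E\<^esub> = (\<one>\<^bsub>R\<^esub>, \<ominus>\<^bsub>M\<^esub> \<psi> (\<one>\<^bsub>R\<^esub>, \<one>\<^bsub>R\<^esub>))" "\<zero>\<^bsub>E\<^esub> = (\<zero>\<^bsub>R\<^esub>, \<zero>\<^bsub>M\<^esub>)"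
  "(r, m) \<oplus>\<^bsub>E\<^esub> (s, n) = (r \<oplus>\<^bsub>R\<^esub> s, m \<oplus>\<^bsub>M\<^esub> n)" "c \<odot>\<^bsub>E\<^esub> (r, m) = (c \<odot>\<^bsub>R\<^esub> r, c \<odot>\<^bsub>MK\<^esub> m)"
  by (simp_all add: std_extension_def)

lemma i_add: "\<lbrakk>x \<in> carrier M; y \<in> carrier M\<rbrakk> \<Longrightarrow> i (x \<oplus>\<^bsub>M\<^esub> y) = i x \<oplus>\<^bsub>S\<^esub> i y"
  using linear_map_add[OF i] by simp

lemma i_zero [simp]: "i \<zero>\<^bsub>M\<^esub> = \<zero>\<^bsub>S\<^esub>" and q_zero [simp]: "q \<zero>\<^bsub>R\<^esub> = \<zero>\<^bsub>S\<^esub>"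
  using linear_map_zero[OF i MK_mod S_mod] linear_map_zero[OF q R_mod S_mod] by simp_all

lemma from_std_inverse: "s \<in> carrier S \<Longrightarrow> from_std (to_std s) = s"
  by (simp add: from_std_def to_std_def i_\<rho> S.signed_sum_simps)

lemma \<rho>_q: "r \<in> carrier R \<Longrightarrow> \<rho> (q r) = \<zero>\<^bsub>M\<^esub>"
  using i_\<rho>[of "q r"] by (intro inj_onD[OF i_inj]) (simp_all add: pq S.minus_eq_iff)

lemma to_std_inverse: "x \<in> carrier E \<Longrightarrow> to_std (from_std x) = x"
  by (auto simp: E_simps from_std_def to_std_def linear_map_add[OF p] linear_map_add[OF \<rho>_linear] pq \<rho>_i \<rho>_q)

text \<open>If \<open>1 = q(1) + i(m)\<close>, then multiplying by \<open>q(1)\<close> gives \<open>q(1) = q(1) + i(\<psi>(1, 1)) + i(m)\<close>.\<close>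

lemma from_std_one: "from_std \<one>\<^bsub>E\<^esub> = \<one>\<^bsub>S\<^esub>"
proof -
  define m where "m = \<rho> \<one>\<^bsub>S\<^esub>"
  have m: "m \<in> carrier M" by (simp add: m_def)
  have psi: "\<psi> (\<one>\<^bsub>R\<^esub>, \<one>\<^bsub>R\<^esub>) \<in> carrier M" by (rule \<psi>) simp_all
  have one: "q \<one>\<^bsub>R\<^esub> \<oplus>\<^bsub>S\<^esub> i m = \<one>\<^bsub>S\<^esub>"
    using from_std_inverse[OF S.one_closed] by (simp add: from_std_def to_std_def m_def p_one)
  have "q \<one>\<^bsub>R\<^esub> = q \<one>\<^bsub>R\<^esub> \<otimes>\<^bsub>S\<^esub> (q \<one>\<^bsub>R\<^esub> \<oplus>\<^bsub>S\<^esub> i m)" unfolding one by simp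
  also have "\<dots> = q \<one>\<^bsub>R\<^esub> \<oplus>\<^bsub>S\<^esub> i (\<psi> (\<one>\<^bsub>R\<^esub>, \<one>\<^bsub>R\<^esub>) \<oplus>\<^bsub>M\<^esub> m)"
    using m psi by (simp add: S.r_distr q_mult mult_i pq i_add S.a_ac)
  finally have "i (\<psi> (\<one>\<^bsub>R\<^esub>, \<one>\<^bsub>R\<^esub>) \<oplus>\<^bsub>M\<^esub> m) = i \<zero>\<^bsub>M\<^esub>"
    using m psi by (metis S.add.l_cancel_one' M.add.m_closed R.one_closed i_zero map_closed(2,3))
  then have "\<psi> (\<one>\<^bsub>R\<^esub>, \<one>\<^bsub>R\<^esub>) \<oplus>\<^bsub>M\<^esub> m = \<zero>\<^bsub>M\<^esub>" using inj_onD[OF i_inj] m psi by simp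
  then have "m = \<ominus>\<^bsub>M\<^esub> \<psi> (\<one>\<^bsub>R\<^esub>, \<one>\<^bsub>R\<^esub>)" using m psi by (metis M.a_comm M.minus_equality M.minus_minus)
  then show ?thesis using one by (simp add: E_simps from_std_pair)
qed

lemma from_std_ops:
  assumes "x \<in> carrier E"
  shows from_std_closed: "from_std x \<in> carrier S"
    and from_std_add: "y \<in> carrier E \<Longrightarrow> from_std (x \<oplus>\<^bsub>E\<^esub> y) = from_std x \<oplus>\<^bsub>S\<^esub> from_std y"
    and from_std_mult: "y \<in> carrier E \<Longrightarrow> from_std (x \<otimes>\<^bsub>E\<^esub> y) = from_std x \<otimes>\<^bsub>S\<^esub> from_std y"
    and from_std_smult: "c \<in> carrier K \<Longrightarrow> from_std (c \<odot>\<^bsub>E\<^esub> x) = c \<odot>\<^bsub>S\<^esub> from_std x"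
proof -
  obtain r m where x: "x = (r, m)" "r \<in> carrier R" "m \<in> carrier M" using assms by (auto simp: E_simps)
  show "from_std x \<in> carrier S" using x by (simp add: from_std_pair)
  show "from_std (c \<odot>\<^bsub>E\<^esub> x) = c \<odot>\<^bsub>S\<^esub> from_std x" if "c \<in> carrier K"
    using x that linear_map_smult[OF i that, of m] linear_map_smult[OF q that x(2)]
    by (simp add: E_simps from_std_pair S.smult_r_distr del: restrict_scalars_simps(4))
  assume "y \<in> carrier E"
  then obtain s n where y: "y = (s, n)" "s \<in> carrier R" "n \<in> carrier M" by (auto simp: E_simps)
  show "from_std (x \<oplus>\<^bsub>E\<^esub> y) = from_std x \<oplus>\<^bsub>S\<^esub> from_std y"
    using x y by (simp add: E_simps from_std_pair i_add linear_map_add[OF q] S.a_ac)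
  have "i m \<otimes>\<^bsub>S\<^esub> q s = i (s \<odot>\<^bsub>M\<^esub> m)" using x y by (simp add: S.m_comm[of "i m"] mult_i pq)
  moreover have "i m \<otimes>\<^bsub>S\<^esub> i n = \<zero>\<^bsub>S\<^esub>" using x y by (simp add: mult_i)
  ultimately show "from_std (x \<otimes>\<^bsub>E\<^esub> y) = from_std x \<otimes>\<^bsub>S\<^esub> from_std y"
    using x y \<psi>[OF x(2) y(2)]
    by (simp add: E_simps from_std_pair S.l_distr S.r_distr q_mult mult_i pq linear_map_add[OF p] i_add S.a_ac)
qed

lemma E_closed:
  assumes "x \<in> carrier E"
  shows "y \<in> carrier E \<Longrightarrow> x \<oplus>\<^bsub>E\<^esub> y \<in> carrier E" "y \<in> carrier E \<Longrightarrow> x \<otimes>\<^bsub>E\<^esub> y \<in> carrier E" "c \<in> carrier K \<Longrightarrow> c \<odot>\<^bsub>E\<^esub> x \<in> carrier E"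
  using assms \<psi> by (auto simp: E_simps)

lemma to_std_closed: "s \<in> carrier S \<Longrightarrow> to_std s \<in> carrier E"
  by (simp add: to_std_def E_simps)

lemma E_zero_one: "\<zero>\<^bsub>E\<^esub> \<in> carrier E" "\<one>\<^bsub>E\<^esub> \<in> carrier E" "from_std \<zero>\<^bsub>E\<^esub> = \<zero>\<^bsub>S\<^esub>"
  using \<psi> by (simp_all add: E_simps from_std_pair)

lemma E_algebra: "algebra K E"
  by (rule algebra_transfer[OF S_alg from_std_closed to_std_closed from_std_inverse to_std_inverse])
    (simp_all add: E_closed E_zero_one from_std_add from_std_mult from_std_smult from_std_one)

lemma from_std_linear: "linear_map K E S from_std"
  by (rule linear_mapI) (simp_all add: from_std_closed from_std_add from_std_smult)

lemma from_std_eqD: "\<lbrakk>from_std x = from_std y; x \<in> carrier E; y \<in> carrier E\<rbrakk> \<Longrightarrow> x = y"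
  by (metis to_std_inverse)

lemma to_std_linear: "linear_map K S E to_std"
  by (rule linear_mapI; (rule from_std_eqD)?)
    (simp_all add: to_std_closed E_closed from_std_add from_std_smult from_std_inverse)

lemma to_std_mult: "\<lbrakk>s \<in> carrier S; t \<in> carrier S\<rbrakk> \<Longrightarrow> to_std (s \<otimes>\<^bsub>S\<^esub> t) = to_std s \<otimes>\<^bsub>E\<^esub> to_std t"
  and to_std_one: "to_std \<one>\<^bsub>S\<^esub> = \<one>\<^bsub>E\<^esub>"
  by (rule from_std_eqD; simp add: to_std_closed E_closed E_zero_one from_std_mult from_std_one from_std_inverse)+

lemma std_inclusion_linear: "linear_map K MK E (\<lambda>m. (\<zero>\<^bsub>R\<^esub>, m))"
  by (rule linear_mapI) (simp_all add: E_simps)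

end

text \<open>The isomorphism of the standard extension with \<open>S\<close> and its inverse both transport obstruction
  classes.\<close>

lemma (in lifting_problem) std_obstruction_class_iff:
  assumes q': "linear_map K R S q'" and pq': "\<And>r. r \<in> carrier R \<Longrightarrow> p (q' r) = r"
    and \<psi>: "\<And>r s. \<lbrakk>r \<in> carrier R; s \<in> carrier R\<rbrakk> \<Longrightarrow> \<psi> (r, s) \<in> carrier M"
    and q'_mult: "\<And>r s. \<lbrakk>r \<in> carrier R; s \<in> carrier R\<rbrakk> \<Longrightarrow> q' r \<otimes>\<^bsub>S\<^esub> q' s = q' (r \<otimes>\<^bsub>R\<^esub> s) \<oplus>\<^bsub>S\<^esub> i (\<psi> (r, s))"
  shows "obstruction_class K A L \<mu> R \<epsilon> \<Lambda> M (std_extension R M \<psi>) (\<lambda>m. (\<zero>\<^bsub>R\<^esub>, m)) (\<lambda>r. (r, \<zero>\<^bsub>M\<^esub>)) t \<longleftrightarrow>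
    obstruction_class K A L \<mu> R \<epsilon> \<Lambda> M S i q' t"
proof -
  interpret E: standard_extension K R \<epsilon> M S i p q' \<psi>
    by unfold_locales (use R_alg aug M_mod kill ext q' pq' \<psi> q'_mult in auto)
  interpret F: algebra_map K A L \<mu> E.E S E.from_std
    by (intro algebra_map.intro courant_axioms algebra_map_axioms.intro E.E_algebra S_alg E.from_std_linear
        E.from_std_mult E.from_std_one)
  interpret G: algebra_map K A L \<mu> S E.E E.to_std
    by (intro algebra_map.intro courant_axioms algebra_map_axioms.intro E.E_algebra S_alg E.to_std_linear
        E.to_std_mult E.to_std_one)
  have c: "m \<in> carrier M \<Longrightarrow> (\<zero>\<^bsub>R\<^esub>, m) \<in> carrier E.E" "r \<in> carrier R \<Longrightarrow> (r, \<zero>\<^bsub>M\<^esub>) \<in> carrier E.E" for m r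
    by (simp_all add: E.E_simps)
  have i: "i m = E.from_std (\<zero>\<^bsub>R\<^esub>, m)" if "m \<in> carrier M" for m using that by (simp add: E.from_std_pair)
  have r: "q' r = E.from_std (r, \<zero>\<^bsub>M\<^esub>)" if "r \<in> carrier R" for r
    using that linear_map_closed[OF q' that] by (simp add: E.from_std_pair)
  show ?thesis
  proof
    show "obstruction_class K A L \<mu> R \<epsilon> \<Lambda> M S i q' t"
      if "obstruction_class K A L \<mu> R \<epsilon> \<Lambda> M E.E (\<lambda>m. (\<zero>\<^bsub>R\<^esub>, m)) (\<lambda>r. (r, \<zero>\<^bsub>M\<^esub>)) t"
      by (rule F.obstruction_class_transport[OF R_alg M_mod E.std_inclusion_linear E.i _ _ _ that])
        (simp_all add: i r c)
    show "obstruction_class K A L \<mu> R \<epsilon> \<Lambda> M E.E (\<lambda>m. (\<zero>\<^bsub>R\<^esub>, m)) (\<lambda>r. (r, \<zero>\<^bsub>M\<^esub>)) t"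
      if "obstruction_class K A L \<mu> R \<epsilon> \<Lambda> M S i q' t"
      by (rule G.obstruction_class_transport[OF R_alg M_mod E.i E.std_inclusion_linear _ _ _ that])
        (simp_all add: i r c E.to_std_inverse linear_map_closed[OF q'])
  qed
qed

lemma harrison_class_iff:
  "\<psi> \<in> harrison_class K R M \<psi>0 \<longleftrightarrow> (\<exists>g. linear_map K R (restrict_scalars R M) g \<and>
     \<psi> = (\<lambda>(r, s)\<in>carrier R \<times> carrier R. (r \<odot>\<^bsub>M\<^esub> g s \<ominus>\<^bsub>M\<^esub> g (r \<otimes>\<^bsub>R\<^esub> s) \<oplus>\<^bsub>M\<^esub> s \<odot>\<^bsub>M\<^esub> g r) \<oplus>\<^bsub>M\<^esub> \<psi>0 (r, s)))"
  (is "_ \<longleftrightarrow> ?rhs")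
proof -
  have eq: "(\<lambda>z\<in>carrier R \<times> carrier R. (\<lambda>(r, s)\<in>carrier R \<times> carrier R. f r s) z \<oplus>\<^bsub>M\<^esub> \<psi>0 z)
    = (\<lambda>(r, s)\<in>carrier R \<times> carrier R. f r s \<oplus>\<^bsub>M\<^esub> \<psi>0 (r, s))" for f
    by (auto simp: fun_eq_iff)
  have "\<psi> \<in> harrison_class K R M \<psi>0 \<longleftrightarrow>
      (\<exists>h\<in>harrison_coboundaries K R M. \<psi> = (\<lambda>z\<in>carrier R \<times> carrier R. h z \<oplus>\<^bsub>M\<^esub> \<psi>0 z))"
    unfolding harrison_class_def a_r_coset_def r_coset_def by (simp add: harrison_cocycles_def)
  then show ?thesis unfolding harrison_coboundaries_def using eq by fastforce
qed

lemma restrict_scalars_minus: "x \<ominus>\<^bsub>restrict_scalars R M\<^esub> y = x \<ominus>\<^bsub>M\<^esub> y"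
  by (simp add: a_minus_def a_inv_def m_inv_def)

context square_zero_extension
begin

text \<open>Adding \<open>i \<circ> g\<close> to the section adds the coboundary of \<open>g\<close> to its cocycle, so every cocycle in the
  class of the extension comes from a section.\<close>

lemma section_of_cocycle:
  assumes q_mult: "\<And>r s. \<lbrakk>r \<in> carrier R; s \<in> carrier R\<rbrakk> \<Longrightarrow> q r \<otimes>\<^bsub>S\<^esub> q s = q (r \<otimes>\<^bsub>R\<^esub> s) \<oplus>\<^bsub>S\<^esub> i (\<psi>0 (r, s))"
    and \<psi>0: "\<And>r s. \<lbrakk>r \<in> carrier R; s \<in> carrier R\<rbrakk> \<Longrightarrow> \<psi>0 (r, s) \<in> carrier M"
    and \<psi>: "\<psi> \<in> harrison_class K R M \<psi>0"
  obtains q' where "linear_map K R S q'" and "\<And>r. r \<in> carrier R \<Longrightarrow> p (q' r) = r"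
    and "\<And>r s. \<lbrakk>r \<in> carrier R; s \<in> carrier R\<rbrakk> \<Longrightarrow> \<psi> (r, s) \<in> carrier M"
    and "\<And>r s. \<lbrakk>r \<in> carrier R; s \<in> carrier R\<rbrakk> \<Longrightarrow> q' r \<otimes>\<^bsub>S\<^esub> q' s = q' (r \<otimes>\<^bsub>R\<^esub> s) \<oplus>\<^bsub>S\<^esub> i (\<psi> (r, s))"
proof -
  obtain g where g: "linear_map K R MK g" and \<psi>_eq:
    "\<psi> = (\<lambda>(r, s)\<in>carrier R \<times> carrier R. (r \<odot>\<^bsub>M\<^esub> g s \<ominus>\<^bsub>M\<^esub> g (r \<otimes>\<^bsub>R\<^esub> s) \<oplus>\<^bsub>M\<^esub> s \<odot>\<^bsub>M\<^esub> g r) \<oplus>\<^bsub>M\<^esub> \<psi>0 (r, s))"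
    using \<psi> unfolding harrison_class_iff by blast
  have gc: "g r \<in> carrier M" if "r \<in> carrier R" for r using linear_map_closed[OF g that] by simp
  have i_add: "i (x \<oplus>\<^bsub>M\<^esub> y) = i x \<oplus>\<^bsub>S\<^esub> i y" if "x \<in> carrier M" "y \<in> carrier M" for x y
    using linear_map_add[OF i, of x y] that by simp
  have i_diff: "i (x \<ominus>\<^bsub>M\<^esub> y) = i x \<ominus>\<^bsub>S\<^esub> i y" if "x \<in> carrier M" "y \<in> carrier M" for x y
    using linear_map_diff[OF i MK_mod S_mod, of x y] that by (simp add: restrict_scalars_minus)
  have i_zero: "i \<zero>\<^bsub>M\<^esub> = \<zero>\<^bsub>S\<^esub>" using linear_map_zero[OF i MK_mod S_mod] by simp
  define q' where "q' = (\<lambda>r. q r \<oplus>\<^bsub>S\<^esub> i (g r))"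
  show thesis
  proof
    show "linear_map K R S q'"
      unfolding q'_def by (intro linear_map_plus q linear_map_comp[OF g i] R_mod S_mod)
    show "p (q' r) = r" if "r \<in> carrier R" for r
      using that gc[OF that] by (simp add: q'_def linear_map_add[OF p] pq)
    fix r s assume r: "r \<in> carrier R" and s: "s \<in> carrier R"
    note cl = r s gc[OF r] gc[OF s] gc[OF R.m_closed[OF r s]] \<psi>0[OF r s]
    show "\<psi> (r, s) \<in> carrier M" using cl by (simp add: \<psi>_eq)
    have "i (g r) \<otimes>\<^bsub>S\<^esub> q s = i (s \<odot>\<^bsub>M\<^esub> g r)" using cl by (simp add: S.m_comm[of "i (g r)"] mult_i pq)
    moreover have "i (g r) \<otimes>\<^bsub>S\<^esub> i (g s) = \<zero>\<^bsub>S\<^esub>" using cl by (simp add: mult_i i_zero)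
    ultimately have "q' r \<otimes>\<^bsub>S\<^esub> q' s = q (r \<otimes>\<^bsub>R\<^esub> s) \<oplus>\<^bsub>S\<^esub> i (\<psi>0 (r, s)) \<oplus>\<^bsub>S\<^esub> i (r \<odot>\<^bsub>M\<^esub> g s) \<oplus>\<^bsub>S\<^esub> i (s \<odot>\<^bsub>M\<^esub> g r)"
      using cl by (simp add: q'_def S.l_distr S.r_distr q_mult mult_i pq linear_map_add[OF p] S.a_ac)
    then show "q' r \<otimes>\<^bsub>S\<^esub> q' s = q' (r \<otimes>\<^bsub>R\<^esub> s) \<oplus>\<^bsub>S\<^esub> i (\<psi> (r, s))"
      using cl by (simp add: q'_def \<psi>_eq i_add i_diff S.signed_sum_simps)
  qed
qed

end

lemma harrison_class_self:
  assumes "algebra K R" "module R M" "\<psi> \<in> carrier (harrison_cocycles K R M)"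
  shows "\<psi> \<in> harrison_class K R M \<psi>"
proof -
  interpret R: algebra K R by fact
  interpret M: module R M by fact
  have R: "module K R" and MK: "module K (restrict_scalars R M)"
    using assms by (simp_all add: algebra_moduleD restrict_scalars_module)
  interpret MK: module K "restrict_scalars R M" by fact
  have "linear_map K R (restrict_scalars R M) (\<lambda>_. \<zero>\<^bsub>M\<^esub>)"
    using MK.smult_r_null by (intro linear_mapI) simp_all
  moreover have "\<psi> = (\<lambda>(r, s)\<in>carrier R \<times> carrier R. (r \<odot>\<^bsub>M\<^esub> \<zero>\<^bsub>M\<^esub> \<ominus>\<^bsub>M\<^esub> \<zero>\<^bsub>M\<^esub> \<oplus>\<^bsub>M\<^esub> s \<odot>\<^bsub>M\<^esub> \<zero>\<^bsub>M\<^esub>) \<oplus>\<^bsub>M\<^esub> \<psi> (r, s))"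
  proof (rule ext)
    fix z
    have "\<psi> \<in> carrier R \<times> carrier R \<rightarrow>\<^sub>E carrier M" using assms(3) by (simp add: harrison_cocycles_def)
    then have psi: "w \<in> carrier R \<times> carrier R \<Longrightarrow> \<psi> w \<in> carrier M" "w \<notin> carrier R \<times> carrier R \<Longrightarrow> \<psi> w = undefined" for w
      by (auto dest: PiE_mem PiE_arb)
    show "\<psi> z = (\<lambda>(r, s)\<in>carrier R \<times> carrier R. (r \<odot>\<^bsub>M\<^esub> \<zero>\<^bsub>M\<^esub> \<ominus>\<^bsub>M\<^esub> \<zero>\<^bsub>M\<^esub> \<oplus>\<^bsub>M\<^esub> s \<odot>\<^bsub>M\<^esub> \<zero>\<^bsub>M\<^esub>) \<oplus>\<^bsub>M\<^esub> \<psi> (r, s)) z"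
      by (cases "z \<in> carrier R \<times> carrier R") (auto simp: a_minus_def psi)
  qed
  ultimately show ?thesis unfolding harrison_class_iff by blast
qed

section \<open>The obstruction theorem\<close>

theorem theorem3p14:
  fixes K :: "'k ring"
    and A :: "('k, 'a) module" and L :: "('k, 'l) module" and \<mu> :: "'l \<Rightarrow> 'a \<Rightarrow> 'a"
    and R :: "('k, 'r) module" and \<epsilon> :: "'r \<Rightarrow> 'k"
    and \<Lambda> :: "('k, 'r, 'a, 'l) deformation"
    and M :: "('r, 'm) module"
    and S :: "('k, 's) module" and i :: "'m \<Rightarrow> 's" and p :: "'s \<Rightarrow> 'r"
    and c :: "('r \<times> 'r \<Rightarrow> 'm) set"
  assumes "field K" and "\<forall>n::nat. n > 0 \<longrightarrow> [n] \<cdot>\<^bsub>K\<^esub> \<one>\<^bsub>K\<^esub> \<noteq> \<zero>\<^bsub>K\<^esub>"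
    and "courant_pair K A L \<mu>"
    and "local_algebra K R \<epsilon>" and "finite_dim K R"
    and "deformation K R \<epsilon> A L \<mu> \<Lambda>"
    and "module R M" and "finite_dim K (restrict_scalars R M)"
    and "\<forall>r\<in>a_kernel R K \<epsilon>. \<forall>m\<in>carrier M. r \<odot>\<^bsub>M\<^esub> m = \<zero>\<^bsub>M\<^esub>"
    and "algebra_extension K R M S i p"
    and "c \<in> carrier (harrison_H2 K R M)" and "corresponds_to K R M S i p c"
  shows "(\<exists>\<Lambda>'. deformation K S (\<epsilon> \<circ> p) A L \<mu> \<Lambda>' \<and> is_push_out K S R p A L \<Lambda>' \<Lambda>) \<longleftrightarrow>
         obstruction_map K A L \<mu> R \<epsilon> \<Lambda> M c
           = \<zero>\<^bsub>tensor K (restrict_scalars R M) (cohomology K A L \<mu> 3)\<^esub>"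
proof -
  obtain mR \<nu>R bR where \<Lambda>: "\<Lambda> = (mR, \<nu>R, bR)" by (cases \<Lambda>)
  obtain N b where b: "is_basis K R N b" using assms(5) by (auto simp: finite_dim_def)
  obtain d eb where eb_basis: "is_basis K (restrict_scalars R M) d eb" using assms(8) by (auto simp: finite_dim_def)
  have R: "algebra K R" and aug: "augmentation K R \<epsilon>" using assms(4) by (simp_all add: local_algebra_def)
  have MK: "module K (restrict_scalars R M)" using R assms(7) by (rule restrict_scalars_module)
  obtain \<phi> where \<phi>: "\<And>j. j \<in> {1..d} \<Longrightarrow> functional K (restrict_scalars R M) (\<phi> j)"
    and expand: "\<And>v. v \<in> carrier (restrict_scalars R M) \<Longrightarrow>
      v = (\<Oplus>\<^bsub>restrict_scalars R M\<^esub>j\<in>{1..d}. \<phi> j v \<odot>\<^bsub>restrict_scalars R M\<^esub> eb j)"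
    and dual: "\<And>j k. \<lbrakk>j \<in> {1..d}; k \<in> {1..d}\<rbrakk> \<Longrightarrow> \<phi> j (eb k) = (if j = k then \<one>\<^bsub>K\<^esub> else \<zero>\<^bsub>K\<^esub>)"
    by (rule basis_dual[OF MK eb_basis]) blast
  obtain q \<psi>0 where q: "linear_map K R S q" and pq: "\<And>r. r \<in> carrier R \<Longrightarrow> p (q r) = r"
    and \<psi>0: "\<psi>0 \<in> carrier (harrison_cocycles K R M)" and c: "c = harrison_class K R M \<psi>0"
    and q_mult: "\<And>r s. \<lbrakk>r \<in> carrier R; s \<in> carrier R\<rbrakk> \<Longrightarrow>
      q r \<otimes>\<^bsub>S\<^esub> q s = q (r \<otimes>\<^bsub>R\<^esub> s) \<oplus>\<^bsub>S\<^esub> i (\<psi>0 (r, s))"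
    using assms(12) unfolding corresponds_to_def by blast
  have \<psi>0_closed: "\<psi>0 (r, s) \<in> carrier M" if "r \<in> carrier R" "s \<in> carrier R" for r s
    using \<psi>0 that by (auto simp: harrison_cocycles_def)
  interpret square_zero_extension K R \<epsilon> M S i p q
    by (rule square_zero_extension.intro) (use R aug assms(7,9,10) q pq in auto)
  have "courant K A L \<mu>" using assms(3) by (rule courant.intro)
  then interpret lifting_problem K A L \<mu> R \<epsilon> M S i p q mR \<nu>R bR d eb \<phi>
    using assms(6) \<phi> expand dual eb_basis
    by (intro lifting_problem.intro square_zero_extension_axioms lifting_problem_axioms.intro)
      (auto simp: \<Lambda> is_basis_def)
  let ?std = "\<lambda>\<psi> t. obstruction_class K A L \<mu> R \<epsilon> \<Lambda> M (std_extension R M \<psi>) (\<lambda>m. (\<zero>\<^bsub>R\<^esub>, m)) (\<lambda>r. (r, \<zero>\<^bsub>M\<^esub>)) t"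
  \<comment> \<open>Every class that the definition of the obstruction map admits is the class of a lift over \<open>S\<close>.\<close>
  have std: "is_obstruction_class t" if \<psi>: "\<psi> \<in> c" and t: "?std \<psi> t" for \<psi> t
  proof -
    obtain q' where q': "linear_map K R S q'" "\<And>r. r \<in> carrier R \<Longrightarrow> p (q' r) = r"
      "\<And>r s. \<lbrakk>r \<in> carrier R; s \<in> carrier R\<rbrakk> \<Longrightarrow> \<psi> (r, s) \<in> carrier M"
      "\<And>r s. \<lbrakk>r \<in> carrier R; s \<in> carrier R\<rbrakk> \<Longrightarrow> q' r \<otimes>\<^bsub>S\<^esub> q' s = q' (r \<otimes>\<^bsub>R\<^esub> s) \<oplus>\<^bsub>S\<^esub> i (\<psi> (r, s))"
      by (rule section_of_cocycle[OF q_mult \<psi>0_closed \<psi>[unfolded c]]) blast+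
    have "obstruction_class K A L \<mu> R \<epsilon> \<Lambda> M S i q' t"
      by (rule iffD1[OF std_obstruction_class_iff[OF q'] t])
    then show ?thesis unfolding \<Lambda> using q'(1,2) by (rule obstruction_class_is_obstruction_class)
  qed
  obtain t where "obstruction_class K A L \<mu> R \<epsilon> \<Lambda> M S i q t"
    using obstruction_class_exists[OF assms(1) b eb_basis q pq] unfolding \<Lambda> by blast
  note t = iffD2[OF std_obstruction_class_iff[where \<psi> = \<psi>0, OF q pq \<psi>0_closed q_mult] this]
  have \<psi>0_c: "\<psi>0 \<in> c" unfolding c by (rule harrison_class_self[OF R assms(7) \<psi>0])
  have "obstruction_map K A L \<mu> R \<epsilon> \<Lambda> M c = t"
    unfolding obstruction_map_def
  proof (rule the_equality)
    show "\<exists>\<psi>\<in>c. ?std \<psi> t" using \<psi>0_c t by blast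
    show "t' = t" if "\<exists>\<psi>\<in>c. ?std \<psi> t'" for t'
      using that std[OF _ _] obstruction_class_unique[OF _ std[OF \<psi>0_c t]] by blast
  qed
  then show ?thesis
    using obstruction_class_zero_iff_liftable[OF std[OF \<psi>0_c t]] unfolding \<Lambda> by simp
qed

end
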